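(* Let $M$ be a complex manifold and let $A$ be a complex abelian Lie algebra acting holomorphically on $M$ with a dense open orbit and preserving a holomorphic affine connection on $M$. Then $A$ also preserves a flat torsion-free holomorphic affine connection on $M$.
   Context: A holomorphic action of a complex Lie algebra $A$ on $M$ is a complex-linear Lie algebra homomorphism from $A$ to the Lie algebra of holomorphic vector fields on $M$ (the vector fields need not be complete). The action has a dense open orbit if the set of points $m\in M$ at which the vector fields coming from $A$ span $T_mM$ is dense in $M$ (equivalently, there is an open orbit on every connected component of $M$). A holomorphic affine connection on $M$ is a holomorphic connection on the holomorphic tangent bundle $TM$. The Lie algebra preserves a connection if the local flows of all the vector fields coming from $A$ are local automorphisms of the connection. A connection is flat if its curvature vanishes, and torsion-free if its torsion vanishes. *)

theory Defs
  imports "HOL-Analysis.Analysis" "HOL-Library.Function_Algebras"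
begin

section \<open>Holomorphic maps between open subsets of complex coordinate spaces\<close>

text \<open>Both notions are meant for open \<open>S\<close>. The derivative \<open>h \<mapsto> \<Sum>i. a$i * h$i\<close> is complex
  linear, so this is complex Frechet differentiability at every point of \<open>S\<close>.\<close>

definition scalar_holomorphic_on :: "(complex^'n \<Rightarrow> complex) \<Rightarrow> (complex^'n) set \<Rightarrow> bool" where
  "scalar_holomorphic_on f S \<longleftrightarrow>
     (\<forall>x\<in>S. \<exists>a::complex^'n. (f has_derivative (\<lambda>h. \<Sum>i\<in>UNIV. a $ i * h $ i)) (at x))"

definition vector_holomorphic_on :: "(complex^'n \<Rightarrow> complex^'m) \<Rightarrow> (complex^'n) set \<Rightarrow> bool" where
  "vector_holomorphic_on F S \<longleftrightarrow> (\<forall>i. scalar_holomorphic_on (\<lambda>x. F x $ i) S)"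


section \<open>Complex manifolds\<close>

text \<open>A chart is a pair of its domain and its coordinate map. Only the values of the coordinate map
  on the domain matter.\<close>

type_synonym ('a, 'n) chart = "'a set \<times> ('a \<Rightarrow> complex^'n)"

abbreviation chart_dom :: "('a, 'n::finite) chart \<Rightarrow> 'a set" where
  "chart_dom c \<equiv> fst c"

abbreviation coord :: "('a, 'n::finite) chart \<Rightarrow> 'a \<Rightarrow> complex^'n" where
  "coord c \<equiv> snd c"

definition chart_inv :: "('a, 'n::finite) chart \<Rightarrow> complex^'n \<Rightarrow> 'a" where
  "chart_inv c = inv_into (chart_dom c) (coord c)"

definition is_chart :: "'a topology \<Rightarrow> ('a, 'n::finite) chart \<Rightarrow> bool" where
  "is_chart M c \<longleftrightarrow> openin M (chart_dom c) \<and> open (coord c ` chart_dom c) \<and>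
     homeomorphic_map (subtopology M (chart_dom c)) (top_of_set (coord c ` chart_dom c)) (coord c)"

definition transition :: "('a, 'n::finite) chart \<Rightarrow> ('a, 'n) chart \<Rightarrow> complex^'n \<Rightarrow> complex^'n" where
  "transition c d = coord d \<circ> chart_inv c"

text \<open>The manifold is of pure dimension \<open>CARD('n)\<close>. The atlas \<open>A\<close> need not be maximal.\<close>

definition complex_manifold :: "'a topology \<Rightarrow> ('a, 'n::finite) chart set \<Rightarrow> bool" where
  "complex_manifold M A \<longleftrightarrow>
     Hausdorff_space M \<and> second_countable M \<and>
     (\<forall>c\<in>A. is_chart M c) \<and> topspace M = (\<Union>c\<in>A. chart_dom c) \<and>
     (\<forall>c\<in>A. \<forall>d\<in>A.
        vector_holomorphic_on (transition c d) (coord c ` (chart_dom c \<inter> chart_dom d)))"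

definition holomorphic_function_on ::
    "('a, 'n::finite) chart set \<Rightarrow> 'a set \<Rightarrow> ('a \<Rightarrow> complex) \<Rightarrow> bool" where
  "holomorphic_function_on A U f \<longleftrightarrow>
     (\<forall>c\<in>A. scalar_holomorphic_on (f \<circ> chart_inv c) (coord c ` (U \<inter> chart_dom c)))"

definition holomorphic_map_on ::
    "'a topology \<Rightarrow> ('a, 'n::finite) chart set \<Rightarrow> 'a set \<Rightarrow> ('a \<Rightarrow> 'a) \<Rightarrow> bool" where
  "holomorphic_map_on M A U f \<longleftrightarrow>
     continuous_map (subtopology M U) M f \<and>
     (\<forall>c\<in>A. \<forall>d\<in>A. vector_holomorphic_on (coord d \<circ> f \<circ> chart_inv c)
        (coord c ` {p \<in> U \<inter> chart_dom c. f p \<in> chart_dom d}))"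


section \<open>Holomorphic vector fields\<close>

text \<open>A tangent vector at \<open>p\<close> is the family of its coordinate vectors in all charts of the atlas
  around \<open>p\<close>, related by the derivatives of the transition maps. The entries at all other charts
  are set to zero, so that equality of tangent vectors is equality of functions, and the tangent
  space is a linear subspace for the pointwise operations of \<open>Function_Algebras\<close>.\<close>

type_synonym ('a, 'n) tangent = "('a, 'n) chart \<Rightarrow> complex^'n"

definition tangent_scale :: "complex \<Rightarrow> ('a, 'n::finite) tangent \<Rightarrow> ('a, 'n) tangent" where
  "tangent_scale z v = (\<lambda>c. z *s v c)"

definition tangent_space :: "('a, 'n::finite) chart set \<Rightarrow> 'a \<Rightarrow> ('a, 'n) tangent set" where
  "tangent_space A p = {v.
     (\<forall>c. \<not> (c \<in> A \<and> p \<in> chart_dom c) \<longrightarrow> v c = 0) \<and>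
     (\<forall>c\<in>A. \<forall>d\<in>A. p \<in> chart_dom c \<inter> chart_dom d \<longrightarrow>
        v d = frechet_derivative (transition c d) (at (coord c p)) (v c))}"

type_synonym ('a, 'n) vfield = "'a \<Rightarrow> ('a, 'n) tangent"

definition local_rep :: "('a, 'n::finite) chart \<Rightarrow> ('a, 'n) vfield \<Rightarrow> complex^'n \<Rightarrow> complex^'n" where
  "local_rep c X = (\<lambda>x. X (chart_inv c x) c)"

text \<open>Vector fields on \<open>U\<close> are extended by zero outside \<open>U\<close>, again to make equality literal.\<close>

definition holomorphic_vfields ::
    "('a, 'n::finite) chart set \<Rightarrow> 'a set \<Rightarrow> ('a, 'n) vfield set" where
  "holomorphic_vfields A U = {X.
     (\<forall>p\<in>U. X p \<in> tangent_space A p) \<and> (\<forall>p. p \<notin> U \<longrightarrow> X p = 0) \<and>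
     (\<forall>c\<in>A. vector_holomorphic_on (local_rep c X) (coord c ` (U \<inter> chart_dom c)))}"

definition fun_scale :: "('a \<Rightarrow> complex) \<Rightarrow> ('a, 'n::finite) vfield \<Rightarrow> ('a, 'n) vfield" where
  "fun_scale f X = (\<lambda>p. tangent_scale (f p) (X p))"

definition restrict_vfield :: "'a set \<Rightarrow> ('a, 'n::finite) vfield \<Rightarrow> ('a, 'n) vfield" where
  "restrict_vfield V X = (\<lambda>p. if p \<in> V then X p else 0)"

definition lie_bracket ::
    "('a, 'n::finite) chart set \<Rightarrow> 'a set \<Rightarrow> ('a, 'n) vfield \<Rightarrow> ('a, 'n) vfield \<Rightarrow> ('a, 'n) vfield" where
  "lie_bracket A U X Y = (\<lambda>p c.
     if c \<in> A \<and> p \<in> U \<inter> chart_dom c then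
       frechet_derivative (local_rep c Y) (at (coord c p)) (X p c)
       - frechet_derivative (local_rep c X) (at (coord c p)) (Y p c)
     else 0)"


section \<open>Holomorphic actions of complex Lie algebras\<close>

locale complex_lie_algebra = vector_space smul
  for smul :: "complex \<Rightarrow> 'g::ab_group_add \<Rightarrow> 'g" +
  fixes bracket :: "'g \<Rightarrow> 'g \<Rightarrow> 'g"
  assumes bracket_add_left: "bracket (a + b) c = bracket a c + bracket b c"
    and bracket_add_right: "bracket a (b + c) = bracket a b + bracket a c"
    and bracket_scale_left: "bracket (smul z a) b = smul z (bracket a b)"
    and bracket_scale_right: "bracket a (smul z b) = smul z (bracket a b)"
    and bracket_self: "bracket a a = 0"
    and jacobi: "bracket a (bracket b c) + bracket b (bracket c a) + bracket c (bracket a b) = 0"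

locale abelian_complex_lie_algebra = complex_lie_algebra +
  assumes abelian: "bracket a b = 0"

definition holomorphic_action ::
    "'a topology \<Rightarrow> ('a, 'n::finite) chart set \<Rightarrow> (complex \<Rightarrow> 'g::ab_group_add \<Rightarrow> 'g) \<Rightarrow>
     ('g \<Rightarrow> 'g \<Rightarrow> 'g) \<Rightarrow> ('g \<Rightarrow> ('a, 'n) vfield) \<Rightarrow> bool" where
  "holomorphic_action M A smul bracket \<rho> \<longleftrightarrow>
     (\<forall>a. \<rho> a \<in> holomorphic_vfields A (topspace M)) \<and>
     (\<forall>a b. \<rho> (a + b) = \<rho> a + \<rho> b) \<and>
     (\<forall>z a. \<rho> (smul z a) = fun_scale (\<lambda>_. z) (\<rho> a)) \<and>
     (\<forall>a b. \<rho> (bracket a b) = lie_bracket A (topspace M) (\<rho> a) (\<rho> b))"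

definition dense_open_orbit ::
    "'a topology \<Rightarrow> ('a, 'n::finite) chart set \<Rightarrow> ('g \<Rightarrow> ('a, 'n) vfield) \<Rightarrow> bool" where
  "dense_open_orbit M A \<rho> \<longleftrightarrow>
     M closure_of {p \<in> topspace M.
       module.span tangent_scale (range (\<lambda>a. \<rho> a p)) = tangent_space A p} = topspace M"


section \<open>Holomorphic affine connections\<close>

text \<open>Holomorphic vector fields on open sets need not extend to \<open>M\<close>, so a connection is an operator
  \<open>N U X Y\<close> (the covariant derivative of \<open>Y\<close> along \<open>X\<close>) on the holomorphic vector fields over each
  open \<open>U\<close>, compatible with restriction. The values of \<open>N\<close> at other arguments are irrelevant. In the
  Leibniz rule, the Frechet derivative is the derivative of \<open>f\<close> along \<open>X\<close>, computed in the chart \<open>c\<close>.\<close>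

type_synonym ('a, 'n) connection =
  "'a set \<Rightarrow> ('a, 'n) vfield \<Rightarrow> ('a, 'n) vfield \<Rightarrow> ('a, 'n) vfield"

definition holomorphic_connection ::
    "'a topology \<Rightarrow> ('a, 'n::finite) chart set \<Rightarrow> ('a, 'n) connection \<Rightarrow> bool" where
  "holomorphic_connection M A N \<longleftrightarrow>
     (\<forall>U. openin M U \<longrightarrow>
       (\<forall>X\<in>holomorphic_vfields A U. \<forall>Y\<in>holomorphic_vfields A U.
          N U X Y \<in> holomorphic_vfields A U) \<and>
       (\<forall>X\<in>holomorphic_vfields A U. \<forall>X'\<in>holomorphic_vfields A U. \<forall>Y\<in>holomorphic_vfields A U.
          N U (X + X') Y = N U X Y + N U X' Y) \<and>
       (\<forall>X\<in>holomorphic_vfields A U. \<forall>Y\<in>holomorphic_vfields A U. \<forall>Y'\<in>holomorphic_vfields A U.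
          N U X (Y + Y') = N U X Y + N U X Y') \<and>
       (\<forall>f. holomorphic_function_on A U f \<longrightarrow>
         (\<forall>X\<in>holomorphic_vfields A U. \<forall>Y\<in>holomorphic_vfields A U.
            N U (fun_scale f X) Y = fun_scale f (N U X Y) \<and>
            (\<forall>c\<in>A. \<forall>p\<in>U \<inter> chart_dom c.
               N U X (fun_scale f Y) p c =
                 f p *s N U X Y p c
                 + frechet_derivative (f \<circ> chart_inv c) (at (coord c p)) (X p c) *s Y p c))) \<and>
       (\<forall>V. openin M V \<and> V \<subseteq> U \<longrightarrow>
         (\<forall>X\<in>holomorphic_vfields A U. \<forall>Y\<in>holomorphic_vfields A U.
            N V (restrict_vfield V X) (restrict_vfield V Y) = restrict_vfield V (N U X Y))))"

definition torsion ::
    "('a, 'n::finite) chart set \<Rightarrow> ('a, 'n) connection \<Rightarrow> 'a set \<Rightarrow>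
     ('a, 'n) vfield \<Rightarrow> ('a, 'n) vfield \<Rightarrow> ('a, 'n) vfield" where
  "torsion A N U X Y = N U X Y - N U Y X - lie_bracket A U X Y"

definition curvature ::
    "('a, 'n::finite) chart set \<Rightarrow> ('a, 'n) connection \<Rightarrow> 'a set \<Rightarrow>
     ('a, 'n) vfield \<Rightarrow> ('a, 'n) vfield \<Rightarrow> ('a, 'n) vfield \<Rightarrow> ('a, 'n) vfield" where
  "curvature A N U X Y Z =
     N U X (N U Y Z) - N U Y (N U X Z) - N U (lie_bracket A U X Y) Z"

definition torsion_free ::
    "'a topology \<Rightarrow> ('a, 'n::finite) chart set \<Rightarrow> ('a, 'n) connection \<Rightarrow> bool" where
  "torsion_free M A N \<longleftrightarrow>
     (\<forall>U. openin M U \<longrightarrow>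
       (\<forall>X\<in>holomorphic_vfields A U. \<forall>Y\<in>holomorphic_vfields A U. torsion A N U X Y = 0))"

definition flat_connection ::
    "'a topology \<Rightarrow> ('a, 'n::finite) chart set \<Rightarrow> ('a, 'n) connection \<Rightarrow> bool" where
  "flat_connection M A N \<longleftrightarrow>
     (\<forall>U. openin M U \<longrightarrow>
       (\<forall>X\<in>holomorphic_vfields A U. \<forall>Y\<in>holomorphic_vfields A U. \<forall>Z\<in>holomorphic_vfields A U.
          curvature A N U X Y Z = 0))"


section \<open>Local flows and local automorphisms\<close>

text \<open>Vector fields \<open>Y\<close> on \<open>U\<close> and \<open>Y'\<close> on \<open>f ` U\<close> are related if the derivative of \<open>f\<close> maps \<open>Y\<close>
  to \<open>Y'\<close>.\<close>

definition related_on ::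
    "('a, 'n::finite) chart set \<Rightarrow> ('a \<Rightarrow> 'a) \<Rightarrow> 'a set \<Rightarrow>
     ('a, 'n) vfield \<Rightarrow> ('a, 'n) vfield \<Rightarrow> bool" where
  "related_on A f U Y Y' \<longleftrightarrow>
     (\<forall>p\<in>U. \<forall>c\<in>A. \<forall>d\<in>A. p \<in> chart_dom c \<and> f p \<in> chart_dom d \<longrightarrow>
        Y' (f p) d =
          frechet_derivative (coord d \<circ> f \<circ> chart_inv c) (at (coord c p)) (Y p c))"

definition biholomorphism_on ::
    "'a topology \<Rightarrow> ('a, 'n::finite) chart set \<Rightarrow> 'a set \<Rightarrow> ('a \<Rightarrow> 'a) \<Rightarrow> bool" where
  "biholomorphism_on M A U f \<longleftrightarrow>
     openin M U \<and> openin M (f ` U) \<and> inj_on f U \<and>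
     holomorphic_map_on M A U f \<and> holomorphic_map_on M A (f ` U) (inv_into U f)"

definition local_automorphism ::
    "'a topology \<Rightarrow> ('a, 'n::finite) chart set \<Rightarrow> ('a, 'n) connection \<Rightarrow>
     'a set \<Rightarrow> ('a \<Rightarrow> 'a) \<Rightarrow> bool" where
  "local_automorphism M A N U f \<longleftrightarrow>
     biholomorphism_on M A U f \<and>
     (\<forall>V. openin M V \<and> V \<subseteq> U \<longrightarrow>
       (\<forall>Y\<in>holomorphic_vfields A V. \<forall>Z\<in>holomorphic_vfields A V.
        \<forall>Y'\<in>holomorphic_vfields A (f ` V). \<forall>Z'\<in>holomorphic_vfields A (f ` V).
          related_on A f V Y Y' \<and> related_on A f V Z Z' \<longrightarrow>
          related_on A f V (N V Y Z) (N (f ` V) Y' Z')))"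

text \<open>A local flow of \<open>X\<close>, with complex time in the disc of radius \<open>\<epsilon>\<close> and initial points in \<open>W\<close>.
  The derivative condition says that \<open>\<Phi>\<close> is holomorphic jointly in time and initial point, and that
  its derivative in the time direction is given by \<open>X\<close>.\<close>

definition local_flow ::
    "'a topology \<Rightarrow> ('a, 'n::finite) chart set \<Rightarrow> ('a, 'n) vfield \<Rightarrow>
     real \<Rightarrow> 'a set \<Rightarrow> (complex \<Rightarrow> 'a \<Rightarrow> 'a) \<Rightarrow> bool" where
  "local_flow M A X \<epsilon> W \<Phi> \<longleftrightarrow>
     \<epsilon> > 0 \<and> openin M W \<and> (\<forall>p\<in>W. \<Phi> 0 p = p) \<and>
     continuous_map (prod_topology (top_of_set (ball 0 \<epsilon>)) (subtopology M W)) M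
       (\<lambda>(t, p). \<Phi> t p) \<and>
     (\<forall>t\<in>ball 0 \<epsilon>. \<forall>p\<in>W. \<forall>c\<in>A. \<forall>d\<in>A.
        p \<in> chart_dom c \<and> \<Phi> t p \<in> chart_dom d \<longrightarrow>
        (\<exists>J::complex^'n^'n.
           ((\<lambda>(s, x). coord d (\<Phi> s (chart_inv c x)))
             has_derivative (\<lambda>(s, h). s *s X (\<Phi> t p) d + J *v h)) (at (t, coord c p))))"

definition preserves_connection ::
    "'a topology \<Rightarrow> ('a, 'n::finite) chart set \<Rightarrow> ('g \<Rightarrow> ('a, 'n) vfield) \<Rightarrow>
     ('a, 'n) connection \<Rightarrow> bool" where
  "preserves_connection M A \<rho> N \<longleftrightarrow>
     (\<forall>a \<epsilon> W \<Phi>. local_flow M A (\<rho> a) \<epsilon> W \<Phi> \<longrightarrow>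
        (\<forall>t\<in>ball 0 \<epsilon>. local_automorphism M A N W (\<Phi> t)))"

end

theory Submission
  imports Defs "HOL-Complex_Analysis.Complex_Analysis"
begin

text \<open>On a component of \<open>M\<close> choose fields \<open>X\<^sub>j\<close> of the action which are a basis at a point of the open orbit.
  The flows preserve \<open>N\<close>, so the symmetrized connection has constant coefficients in this frame, that is, it is
  given by a commutative product \<open>\<mu>\<close> on \<open>\<complex>\<^sup>n\<close>, and it is flat if and only if \<open>\<mu>\<close> is associative. On the dense open set
  every other product also defines an invariant connection, but that need not extend to the points where
  the \<open>X\<^sub>j\<close> degenerate.

  Let \<open>U\<close> be the sum of all ideals of \<open>\<mu>\<close> on which the multiplication operators commute, let \<open>T\<close> be a
  projector with kernel \<open>U\<close> and \<open>P = 1 - T\<close>. Then the product \<open>\<mu> (P v) (P w)\<close> is commutative and associative.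
  If \<open>S\<close> is the matrix of the frame in a chart, the Christoffel symbols of this product are polynomial in those of
  \<open>\<mu>\<close>, in \<open>S\<close>, its derivatives and \<open>T S\<^sup>-\<^sup>1\<close>, so it suffices that \<open>T S\<^sup>-\<^sup>1\<close> extends. Along a line in a direction
  whose derivative of \<open>S\<close> kills no vector of the kernel of \<open>S\<close>, the residues of the polar combinations \<open>\<lambda>\<close> of frame fields
  with \<open>S \<lambda>\<close> bounded form an ideal contained in \<open>U\<close>. Hence \<open>T S\<^sup>-\<^sup>1\<close> is bounded on the line, and Cauchy's
  formula on circles in such lines gives the extension. Finally, the local flows of the action preserve the frame
  and every component, hence every connection that is constant in the frame.\<close>

section \<open>Holomorphic functions of several variables\<close>

text \<open>The extension rests on two facts. Good directions exist because the fields of the action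
  are affine: along a geodesic a combination of them solves the Jacobi equation, so if its value at
  \<open>p\<close> and its derivative along \<open>y\<close> vanish, it vanishes on the whole
  geodesic. This is impossible if a cone around \<open>y\<close> contains no zeros of
  \<open>det S\<close>. The residues form an ideal of the required kind because covariant
  differentiation along the line acts on the polar combinations. The coefficient of
  \<open>t\<^sup>-\<^sup>2\<close> shows that the residue of \<open>S\<^sup>-\<^sup>1 y\<close>
  multiplies the kernel of \<open>S\<close> as the identity, hence acts unipotently on all
  coefficients. A combination with lowest term \<open>t\<^sup>-\<^sup>m\<^sup>-\<^sup>1\<close>,
  \<open>m \<ge> 1\<close>, would produce the eigenvalue \<open>m + 1\<close>, so residue 0 forces
  the combination to be 0. The commutator defect of two combinations starts at
  \<open>t\<^sup>-\<^sup>2\<close> and therefore vanishes; since every residue is a product of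
  residues, all multiplications commute on them. The projector kills the whole of \<open>U\<close>,
  not only the residues at one point, so that one product serves all degenerate points of a
  component.\<close>

abbreviation fd :: "('a::real_normed_vector \<Rightarrow> 'b::real_normed_vector) \<Rightarrow> 'a \<Rightarrow> 'a \<Rightarrow> 'b" where
  "fd f x \<equiv> frechet_derivative f (at x)"

lemma frechet_derivative_at': "(f has_derivative f') (at x) \<Longrightarrow> fd f x = f'"
  using frechet_derivative_at by metis

lemma norm_smult: "norm (z *s (h::complex^'n)) = cmod z * norm h"
  by (simp add: norm_vec_def L2_set_right_distrib norm_mult)

lemma scaleR_eq_smult: "c *\<^sub>R (h::complex^'n) = of_real c *s h"
  by (simp only: vec_eq_iff vector_scaleR_component vector_smult_component) (simp add: scaleR_conv_of_real)

lemma bounded_linear_smult_left: "bounded_linear (\<lambda>z. z *s (h::complex^'n))"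
  by (rule bounded_linear_intro[where K="norm h"])
     (simp_all add: vector_sadd_rdistrib norm_smult scaleR_eq_smult vector_smult_assoc scaleR_conv_of_real)

lemma bounded_linear_smult_right: "bounded_linear (\<lambda>h. z *s (h::complex^'n))"
  by (rule bounded_linear_intro[where K="norm z"])
     (simp_all add: vector_add_ldistrib norm_smult scaleR_eq_smult vector_smult_assoc mult.commute)

lemma complex_linear_expand:
  fixes D :: "complex^'n \<Rightarrow> complex"
  assumes "linear D" and "\<And>z h. D (z *s h) = z * D h"
  shows "D h = (\<Sum>i\<in>UNIV. D (axis i 1) * h $ i)"
proof -
  have "D h = D (\<Sum>i\<in>UNIV. (h $ i) *s axis i 1)"
    by (simp add: basis_expansion)
  also have "\<dots> = (\<Sum>i\<in>UNIV. D (axis i 1) * h $ i)"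
    by (simp add: linear_sum[OF assms(1)] assms(2) mult.commute)
  finally show ?thesis .
qed

text \<open>A derivative is real linear, so only complex homogeneity has to be checked to obtain the
  coefficient vector of the definition.\<close>

lemma scalar_holI:
  assumes "\<And>x. x \<in> S \<Longrightarrow> \<exists>D. (f has_derivative D) (at x) \<and> (\<forall>z h. D (z *s h) = z * D h)"
  shows "scalar_holomorphic_on f S"
  unfolding scalar_holomorphic_on_def
proof
  fix x assume "x \<in> S"
  then obtain D where D: "(f has_derivative D) (at x)" "\<And>z h. D (z *s h) = z * D h"
    using assms by blast
  have "D = (\<lambda>h. \<Sum>i\<in>UNIV. (\<chi> i. D (axis i 1)) $ i * h $ i)"
    unfolding vec_lambda_beta by (intro ext complex_linear_expand[OF has_derivative_linear[OF D(1)] D(2)])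
  with D(1) show "\<exists>a. (f has_derivative (\<lambda>h. \<Sum>i\<in>UNIV. a $ i * h $ i)) (at x)"
    by metis
qed

lemma scalar_holD:
  assumes "scalar_holomorphic_on f S" "x \<in> S"
  shows "(f has_derivative fd f x) (at x)" and "fd f x (z *s h) = z * fd f x h"
proof -
  obtain a where a: "(f has_derivative (\<lambda>h. \<Sum>i\<in>UNIV. a $ i * h $ i)) (at x)"
    using assms unfolding scalar_holomorphic_on_def by blast
  then have eq: "fd f x = (\<lambda>h. \<Sum>i\<in>UNIV. a $ i * h $ i)"
    by (rule frechet_derivative_at')
  show "(f has_derivative fd f x) (at x)" using a eq by simp
  show "fd f x (z *s h) = z * fd f x h"
    by (simp add: eq sum_distrib_left mult_ac)
qed

lemma scalar_hol_fd_linear: "scalar_holomorphic_on f S \<Longrightarrow> x \<in> S \<Longrightarrow> linear (fd f x)"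
  using has_derivative_linear scalar_holD(1) by blast

lemma scalar_hol_subset: "scalar_holomorphic_on f S \<Longrightarrow> T \<subseteq> S \<Longrightarrow> scalar_holomorphic_on f T"
  unfolding scalar_holomorphic_on_def by blast

lemma scalar_hol_local:
  assumes "\<And>x. x \<in> S \<Longrightarrow> \<exists>T. x \<in> T \<and> scalar_holomorphic_on f T"
  shows "scalar_holomorphic_on f S"
  using assms unfolding scalar_holomorphic_on_def by blast

lemma scalar_hol_continuous_on: "scalar_holomorphic_on f S \<Longrightarrow> continuous_on S f"
  by (meson continuous_at_imp_continuous_on has_derivative_continuous scalar_holD(1))

lemma scalar_hol_cong:
  assumes "open S" "\<And>x. x \<in> S \<Longrightarrow> f x = g x" "scalar_holomorphic_on f S"
  shows "scalar_holomorphic_on g S"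
  using assms unfolding scalar_holomorphic_on_def
  by (meson has_derivative_transform_within_open)

lemma fd_cong_open:
  assumes "open S" "x \<in> S" "\<And>y. y \<in> S \<Longrightarrow> f y = g y"
  shows "fd f x = fd g x"
proof -
  have "(f has_derivative D) (at x) \<longleftrightarrow> (g has_derivative D) (at x)" for D
    using assms has_derivative_transform_within_open[of f D x UNIV S g]
      has_derivative_transform_within_open[of g D x UNIV S f] by auto
  then show ?thesis by (simp add: frechet_derivative_def)
qed

lemma scalar_hol_const [simp]: "scalar_holomorphic_on (\<lambda>x. c) S"
  by (rule scalar_holI) (auto intro!: exI[where x="\<lambda>h. 0"])

lemma scalar_hol_add:
  assumes "scalar_holomorphic_on f S" "scalar_holomorphic_on g S"
  shows "scalar_holomorphic_on (\<lambda>x. f x + g x) S"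
proof (rule scalar_holI)
  fix x assume "x \<in> S"
  note f = scalar_holD[OF assms(1) this] and g = scalar_holD[OF assms(2) this]
  show "\<exists>D. ((\<lambda>x. f x + g x) has_derivative D) (at x) \<and> (\<forall>z h. D (z *s h) = z * D h)"
    by (intro exI conjI, rule has_derivative_add[OF f(1) g(1)]) (simp add: f g algebra_simps)
qed

lemma scalar_hol_mult:
  assumes "scalar_holomorphic_on f S" "scalar_holomorphic_on g S"
  shows "scalar_holomorphic_on (\<lambda>x. f x * g x) S"
proof (rule scalar_holI)
  fix x assume "x \<in> S"
  note f = scalar_holD[OF assms(1) this] and g = scalar_holD[OF assms(2) this]
  show "\<exists>D. ((\<lambda>x. f x * g x) has_derivative D) (at x) \<and> (\<forall>z h. D (z *s h) = z * D h)"
    by (intro exI conjI, rule has_derivative_mult[OF f(1) g(1)]) (simp add: f g algebra_simps)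
qed

lemma scalar_hol_inverse:
  assumes "scalar_holomorphic_on f S" "\<And>x. x \<in> S \<Longrightarrow> f x \<noteq> 0"
  shows "scalar_holomorphic_on (\<lambda>x. inverse (f x)) S"
proof (rule scalar_holI)
  fix x assume "x \<in> S"
  note f = scalar_holD[OF assms(1) this]
  show "\<exists>D. ((\<lambda>x. inverse (f x)) has_derivative D) (at x) \<and> (\<forall>z h. D (z *s h) = z * D h)"
    by (intro exI conjI, rule Deriv.has_derivative_inverse[OF assms(2)[OF \<open>x \<in> S\<close>] f(1)]) (simp add: f algebra_simps)
qed

lemma scalar_hol_divide:
  "scalar_holomorphic_on f S \<Longrightarrow> scalar_holomorphic_on g S \<Longrightarrow> (\<And>x. x \<in> S \<Longrightarrow> g x \<noteq> 0) \<Longrightarrow>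
   scalar_holomorphic_on (\<lambda>x. f x / g x) S"
  unfolding divide_inverse by (intro scalar_hol_mult scalar_hol_inverse)

lemma scalar_hol_minus: "scalar_holomorphic_on f S \<Longrightarrow> scalar_holomorphic_on (\<lambda>x. - f x) S"
  using scalar_hol_mult[OF scalar_hol_const, of f S "-1"] by simp

lemma scalar_hol_diff:
  "scalar_holomorphic_on f S \<Longrightarrow> scalar_holomorphic_on g S \<Longrightarrow> scalar_holomorphic_on (\<lambda>x. f x - g x) S"
  using scalar_hol_add[OF _ scalar_hol_minus, of f S g] by simp

lemma scalar_hol_sum:
  "(\<And>i. i \<in> I \<Longrightarrow> scalar_holomorphic_on (f i) S) \<Longrightarrow> scalar_holomorphic_on (\<lambda>x. \<Sum>i\<in>I. f i x) S"
  by (induction I rule: infinite_finite_induct) (simp_all add: scalar_hol_add)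

lemma scalar_hol_prod:
  "(\<And>i. i \<in> I \<Longrightarrow> scalar_holomorphic_on (f i) S) \<Longrightarrow> scalar_holomorphic_on (\<lambda>x. \<Prod>i\<in>I. f i x) S"
  by (induction I rule: infinite_finite_induct) (simp_all add: scalar_hol_mult)

lemma has_derivative_vec:
  fixes F :: "'a::real_normed_vector \<Rightarrow> complex^'m"
  assumes "\<And>i. ((\<lambda>x. F x $ i) has_derivative (\<lambda>h. D h $ i)) (at x)"
  shows "(F has_derivative D) (at x)"
proof -
  have "((\<lambda>x. \<Sum>i\<in>UNIV. F x $ i *s axis i 1) has_derivative (\<lambda>h. \<Sum>i\<in>UNIV. D h $ i *s axis i 1)) (at x)"
    by (intro has_derivative_sum bounded_linear.has_derivative[OF bounded_linear_smult_left] assms)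
  then show ?thesis by (simp only: basis_expansion)
qed

lemma vector_holD:
  assumes "vector_holomorphic_on F S" "x \<in> S"
  shows "(F has_derivative fd F x) (at x)" and "fd F x (z *s h) = z *s fd F x h"
    and "fd F x h $ i = fd (\<lambda>y. F y $ i) x h"
proof -
  have h: "scalar_holomorphic_on (\<lambda>y. F y $ i) S" for i
    using assms(1) by (simp add: vector_holomorphic_on_def)
  have "(F has_derivative (\<lambda>h. \<chi> i. fd (\<lambda>y. F y $ i) x h)) (at x)"
    by (rule has_derivative_vec) (use scalar_holD(1)[OF h assms(2)] in simp)
  then have eq: "fd F x = (\<lambda>h. \<chi> i. fd (\<lambda>y. F y $ i) x h)" and D: "(F has_derivative fd F x) (at x)"
    using frechet_derivative_at' by metis+
  show "(F has_derivative fd F x) (at x)" by (rule D)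
  show "fd F x (z *s h) = z *s fd F x h"
    by (simp add: eq vec_eq_iff scalar_holD(2)[OF h assms(2)])
  show "fd F x h $ i = fd (\<lambda>y. F y $ i) x h" by (simp add: eq)
qed

lemma vector_holI:
  assumes "\<And>x. x \<in> S \<Longrightarrow> \<exists>D. (F has_derivative D) (at x) \<and> (\<forall>z h. D (z *s h) = z *s D h)"
  shows "vector_holomorphic_on F S"
  unfolding vector_holomorphic_on_def
proof (intro allI scalar_holI)
  fix x i assume "x \<in> S"
  then obtain D where D: "(F has_derivative D) (at x)" "\<And>z h. D (z *s h) = z *s D h"
    using assms by blast
  then show "\<exists>D. ((\<lambda>y. F y $ i) has_derivative D) (at x) \<and> (\<forall>z h. D (z *s h) = z * D h)"
    by (intro exI[where x="\<lambda>h. D h $ i"]) (auto intro: bounded_linear.has_derivative[OF bounded_linear_vec_nth])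
qed

lemma vector_hol_fd_linear: "vector_holomorphic_on F S \<Longrightarrow> x \<in> S \<Longrightarrow> linear (fd F x)"
  using has_derivative_linear vector_holD(1) by blast

lemma vector_hol_fd_add: "vector_holomorphic_on F S \<Longrightarrow> x \<in> S \<Longrightarrow> fd F x (h + k) = fd F x h + fd F x k"
  using vector_hol_fd_linear linear_add by blast

lemma vector_hol_subset: "vector_holomorphic_on f S \<Longrightarrow> T \<subseteq> S \<Longrightarrow> vector_holomorphic_on f T"
  unfolding vector_holomorphic_on_def using scalar_hol_subset by blast

lemma vector_hol_local:
  assumes "\<And>x. x \<in> S \<Longrightarrow> \<exists>T. x \<in> T \<and> vector_holomorphic_on f T"
  shows "vector_holomorphic_on f S"
  using assms unfolding vector_holomorphic_on_def by (meson scalar_hol_local)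

lemma vector_hol_continuous_on: "vector_holomorphic_on f S \<Longrightarrow> continuous_on S f"
  by (meson continuous_at_imp_continuous_on has_derivative_continuous vector_holD(1))

lemma vector_hol_cong:
  assumes "open S" "\<And>x. x \<in> S \<Longrightarrow> f x = g x" "vector_holomorphic_on f S"
  shows "vector_holomorphic_on g S"
  using assms unfolding vector_holomorphic_on_def by (metis (no_types, lifting) scalar_hol_cong)

lemma vector_hol_const [simp]: "vector_holomorphic_on (\<lambda>x. c) S"
  by (simp add: vector_holomorphic_on_def)

lemma vector_hol_add:
  "vector_holomorphic_on f S \<Longrightarrow> vector_holomorphic_on g S \<Longrightarrow> vector_holomorphic_on (\<lambda>x. f x + g x) S"
  by (simp add: vector_holomorphic_on_def scalar_hol_add)

lemma vector_hol_diff: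
  "vector_holomorphic_on f S \<Longrightarrow> vector_holomorphic_on g S \<Longrightarrow> vector_holomorphic_on (\<lambda>x. f x - g x) S"
  by (simp add: vector_holomorphic_on_def scalar_hol_diff)

lemma vector_hol_smult:
  "scalar_holomorphic_on f S \<Longrightarrow> vector_holomorphic_on g S \<Longrightarrow> vector_holomorphic_on (\<lambda>x. f x *s g x) S"
  by (simp add: vector_holomorphic_on_def scalar_hol_mult)

lemma vector_hol_sum:
  "(\<And>i. i \<in> I \<Longrightarrow> vector_holomorphic_on (f i) S) \<Longrightarrow> vector_holomorphic_on (\<lambda>x. \<Sum>i\<in>I. f i x) S"
  by (simp add: vector_holomorphic_on_def sum_component scalar_hol_sum)

lemma scalar_hol_compose:
  assumes "scalar_holomorphic_on f T" "vector_holomorphic_on g S" "\<And>x. x \<in> S \<Longrightarrow> g x \<in> T"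
  shows "scalar_holomorphic_on (\<lambda>x. f (g x)) S"
proof (rule scalar_holI)
  fix x assume x: "x \<in> S"
  note g = vector_holD[OF assms(2) x] and f = scalar_holD[OF assms(1) assms(3)[OF x]]
  show "\<exists>D. ((\<lambda>x. f (g x)) has_derivative D) (at x) \<and> (\<forall>z h. D (z *s h) = z * D h)"
    using has_derivative_compose[OF g(1) f(1)] g(2) f(2) by fastforce
qed

lemma vector_hol_compose:
  assumes "vector_holomorphic_on f T" "vector_holomorphic_on g S" "\<And>x. x \<in> S \<Longrightarrow> g x \<in> T"
  shows "vector_holomorphic_on (\<lambda>x. f (g x)) S"
  using assms scalar_hol_compose unfolding vector_holomorphic_on_def[of f] vector_holomorphic_on_def[of "\<lambda>x. f (g x)"] by blast

text \<open>Restriction to complex lines is the way in which the one-variable theory enters.\<close>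

lemma line_field_derivative:
  assumes "scalar_holomorphic_on f S" "x + t *s h \<in> S"
  shows "((\<lambda>t. f (x + t *s h)) has_field_derivative fd f (x + t *s h) h) (at t)"
proof -
  have 1: "((\<lambda>t. x + t *s h) has_derivative (\<lambda>s. s *s h)) (at t)"
    using has_derivative_add[OF has_derivative_const bounded_linear_imp_has_derivative[OF bounded_linear_smult_left], of x]
    by simp
  have "((\<lambda>t. f (x + t *s h)) has_derivative (\<lambda>s. fd f (x + t *s h) (s *s h))) (at t)"
    using has_derivative_compose[OF 1 scalar_holD(1)[OF assms]] .
  moreover have "(\<lambda>s. fd f (x + t *s h) (s *s h)) = (*) (fd f (x + t *s h) h)"
    by (simp add: fun_eq_iff scalar_holD(2)[OF assms] mult.commute)
  ultimately show ?thesis by (simp add: has_field_derivative_def)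
qed

lemma line_holomorphic:
  assumes "scalar_holomorphic_on f S" "\<And>t. t \<in> T \<Longrightarrow> x + t *s h \<in> S"
  shows "(\<lambda>t. f (x + t *s h)) holomorphic_on T"
  using line_field_derivative[OF assms(1) assms(2)]
  by (meson field_differentiable_at_within field_differentiable_def holomorphic_on_def)

text \<open>On the line \<open>x + t h\<close> this is the first order Taylor remainder at
  \<open>t = 1\<close>, with Cauchy's inequality for the second derivative. The constant depends
  only on a bound of \<open>f\<close>; this uniformity in \<open>x\<close> yields continuity of the
  derivative and differentiation under the integral sign.\<close>

lemma quadratic_bound:
  assumes f: "scalar_holomorphic_on f (ball x r)" and B: "\<And>y. y \<in> ball x r \<Longrightarrow> cmod (f y) \<le> B" and r: "r > 0"
    and h: "norm h \<le> r / 4"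
  shows "cmod (f (x + h) - f x - fd f x h) \<le> 8 * B * (norm h)\<^sup>2 / r\<^sup>2"
proof (cases "h = 0")
  case True
  then show ?thesis using scalar_holD(2)[OF f, of x 0 0] r by simp
next
  case False
  \<comment> \<open>The line stays in the ball for parameters of modulus below \<open>R\<close>.
    Since \<open>R \<ge> 4\<close>, circles of radius \<open>R/2\<close> around points of the unit
    disc still fit.\<close>
  define R where "R = r / norm h"
  have R: "R \<ge> 4" using False r h by (simp add: R_def field_simps)
  have inb: "x + t *s h \<in> ball x r" if "t \<in> ball 0 R" for t
  proof -
    have "cmod t * norm h < R * norm h" using that False by simp
    also have "\<dots> = r" using False by (simp add: R_def)
    finally show ?thesis by (simp add: dist_norm norm_smult)
  qed
  let ?g = "\<lambda>t. f (x + t *s h)"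
  have hol: "?g holomorphic_on ball 0 R" by (rule line_holomorphic[OF f inb])
  have d2: "cmod ((deriv ^^ 2) ?g t) \<le> 8 * B / R\<^sup>2" if t: "t \<in> cball 0 1" for t
  proof -
    have sub: "cball t (R/2) \<subseteq> ball 0 R"
    proof
      fix s assume "s \<in> cball t (R/2)"
      then have "cmod s \<le> 1 + R/2" using t norm_triangle_sub[of s t] by (simp add: dist_norm norm_minus_commute)
      then show "s \<in> ball 0 R" using R by simp
    qed
    have "cmod ((deriv ^^ 2) ?g t) \<le> fact 2 * B / (R/2) ^ 2"
    proof (rule Cauchy_inequality)
      show "?g holomorphic_on ball t (R/2)" using holomorphic_on_subset[OF hol] sub ball_subset_cball by blast
      show "continuous_on (cball t (R/2)) ?g"
        using holomorphic_on_imp_continuous_on[OF hol] sub continuous_on_subset by blast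
      show "0 < R/2" using R by simp
      fix s assume "cmod (t - s) = R/2"
      then have "s \<in> cball t (R/2)" by (simp add: dist_norm)
      then show "cmod (?g s) \<le> B" using sub inb B by blast
    qed
    then show ?thesis by (simp add: field_simps power2_eq_square)
  qed
  have "cmod ((deriv ^^ 0) ?g 1 - (\<Sum>i\<le>1. (deriv ^^ i) ?g 0 * (1 - 0) ^ i / fact i)) \<le> (8 * B / R\<^sup>2) * cmod (1 - 0) ^ Suc 1 / fact 1"
  proof (rule complex_Taylor[where S="cball 0 1"])
    fix i t assume "t \<in> cball (0::complex) 1"
    then have "t \<in> ball 0 R" using R by simp
    have "((deriv ^^ i) ?g has_field_derivative deriv ((deriv ^^ i) ?g) t) (at t)"
      using holomorphic_derivI[OF holomorphic_higher_deriv[OF hol open_ball] open_ball \<open>t \<in> ball 0 R\<close>] .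
    then show "((deriv ^^ i) ?g has_field_derivative (deriv ^^ Suc i) ?g t) (at t within cball 0 1)"
      by (simp add: has_field_derivative_at_within)
  next
    show "cmod ((deriv ^^ Suc 1) ?g t) \<le> 8 * B / R\<^sup>2" if "t \<in> cball 0 1" for t
      using d2[OF that] by (simp add: numeral_2_eq_2)
  qed auto
  moreover have "deriv ?g 0 = fd f x h"
    using line_field_derivative[OF f, of x 0 h] r by (simp add: DERIV_imp_deriv)
  ultimately show ?thesis by (simp add: R_def power_divide algebra_simps)
qed


section \<open>Differentiation under the integral sign\<close>

lemma ball_margin:
  fixes f :: "complex^'n \<Rightarrow> complex"
  assumes "scalar_holomorphic_on f S" "open S" "compact T" "T \<subseteq> S"
  obtains r B where "r > 0" "B \<ge> 0" "\<And>x y. x \<in> T \<Longrightarrow> dist x y \<le> r \<Longrightarrow> y \<in> S \<and> cmod (f y) \<le> B"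
proof -
  obtain e where e: "e > 0" "(\<Union>x\<in>T. cball x e) \<subseteq> S"
    using compact_subset_open_imp_cball_epsilon_subset[OF assms(3,2,4)] by blast
  have "compact (\<Union>x\<in>T. cball x e)"
    using compact_minkowski_sum_cball[OF assms(3)] by blast
  then have "compact (f ` (\<Union>x\<in>T. cball x e))"
    by (intro compact_continuous_image continuous_on_subset[OF scalar_hol_continuous_on[OF assms(1)] e(2)])
  then obtain B where "\<And>y. y \<in> (\<Union>x\<in>T. cball x e) \<Longrightarrow> cmod (f y) \<le> B"
    by (meson bounded_iff compact_imp_bounded imageI)
  then show thesis
    using e by (intro that[of e "max 0 B"] conjI subsetD[OF e(2)]) (auto intro!: max.coboundedI2)
qed

text \<open>Difference quotients with step \<open>1 / n\<close> are continuous and, by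
  \<open>quadratic_bound\<close>, converge uniformly near each point.\<close>

lemma fd_continuous_on:
  assumes f: "scalar_holomorphic_on f S" and S: "open S"
  shows "continuous_on S (\<lambda>x. fd f x h)"
proof -
  have "isCont (\<lambda>x. fd f x h) x0" if x0: "x0 \<in> S" for x0
  proof -
    obtain r B where r: "r > 0" "B \<ge> 0" and rB: "\<And>y. dist x0 y \<le> r \<Longrightarrow> y \<in> S \<and> cmod (f y) \<le> B"
      by (rule ball_margin[OF f S, of "{x0}"]) (use x0 in auto)
    define q where "q n x = of_nat n * (f (x + (1 / of_nat n) *s h) - f x)" for n :: nat and x
    \<comment> \<open>\<open>r / 8\<close> is a quarter of the radius \<open>r / 2\<close> for which
      \<open>quadratic_bound\<close> is applied.\<close>
    obtain M :: nat where M: "M \<ge> 1" "norm h / real M \<le> r / 8"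
    proof -
      obtain M0 :: nat where "real M0 > 8 * norm h / r" using reals_Archimedean2 by blast
      then show thesis using r by (intro that[of "Suc M0"]) (auto simp: field_simps)
    qed
    have small: "norm ((1 / of_nat n) *s h) \<le> r / 8" if "n \<ge> M" for n
    proof -
      have "norm ((1 / of_nat n) *s h) = norm h / real n" by (simp add: norm_smult norm_divide)
      also have "\<dots> \<le> norm h / real M" using that M(1) by (intro divide_left_mono) auto
      finally show ?thesis using M by linarith
    qed
    have inball: "y \<in> S \<and> cmod (f y) \<le> B" if "x \<in> ball x0 (r/2)" "y \<in> ball x (r/2)" for x y
      using rB[of y] dist_triangle[of x0 y x] that by (auto simp: dist_commute)
    have "uniform_limit (ball x0 (r/2)) q (\<lambda>x. fd f x h) sequentially"
    proof (rule uniform_limitI)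
      fix e :: real assume e: "e > 0"
      define C where "C = 8 * B * (norm h)\<^sup>2 / (r/2)\<^sup>2"
      have C: "C \<ge> 0" using r by (simp add: C_def)
      obtain M1 :: nat where M1: "real M1 > C / e" using reals_Archimedean2 by blast
      show "\<forall>\<^sub>F n in sequentially. \<forall>x\<in>ball x0 (r/2). dist (q n x) (fd f x h) < e"
        unfolding eventually_sequentially
      proof (intro exI[where x="M + M1"] allI impI ballI)
        fix n x assume n: "n \<ge> M + M1" and x: "x \<in> ball x0 (r/2)"
        have fx: "scalar_holomorphic_on f (ball x (r/2))" using inball[OF x] scalar_hol_subset[OF f] by blast
        let ?k = "(1 / of_nat n) *s h"
        have n0: "n > 0" using n M by simp
        have "cmod (f (x + ?k) - f x - fd f x ?k) \<le> 8 * B * (norm ?k)\<^sup>2 / (r/2)\<^sup>2"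
          using small[of n] n r by (intro quadratic_bound[OF fx]) (use inball[OF x] in auto)
        also have "\<dots> = C / (real n)\<^sup>2" by (simp add: C_def norm_smult norm_divide power_divide)
        finally have 1: "cmod (f (x + ?k) - f x - fd f x ?k) \<le> C / (real n)\<^sup>2" .
        have x': "x \<in> ball x (r/2)" using r by simp
        have "q n x - fd f x h = of_nat n * (f (x + ?k) - f x - fd f x ?k)"
          using n0 by (simp add: q_def scalar_holD(2)[OF fx x'] algebra_simps)
        then have "dist (q n x) (fd f x h) = real n * cmod (f (x + ?k) - f x - fd f x ?k)"
          by (simp add: dist_norm norm_mult)
        also have "\<dots> \<le> real n * (C / (real n)\<^sup>2)" using 1 by (intro mult_left_mono) auto
        also have "\<dots> = C / real n" using n0 by (simp add: power2_eq_square)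
        also have "\<dots> < e"
        proof -
          have "C / e < real n" using M1 n by simp
          then show ?thesis using e n0 by (simp add: field_simps)
        qed
        finally show "dist (q n x) (fd f x h) < e" .
      qed
    qed
    moreover have "\<forall>\<^sub>F n in sequentially. continuous_on (ball x0 (r/2)) (q n)"
      unfolding eventually_sequentially
    proof (intro exI[where x=M] allI impI)
      fix n assume n: "n \<ge> M"
      have 1: "x + (1 / of_nat n) *s h \<in> S" if "x \<in> ball x0 (r/2)" for x
        using inball[OF that, of "x + (1 / of_nat n) *s h"] small[OF n] r by (simp add: dist_norm)
      have 2: "ball x0 (r/2) \<subseteq> S" using rB r by (intro subsetI) (simp add: dist_norm)
      show "continuous_on (ball x0 (r/2)) (q n)"
        unfolding q_def
        by (intro continuous_intros continuous_on_compose2[OF scalar_hol_continuous_on[OF f]])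
           (use 1 2 in auto)
    qed
    ultimately have "continuous_on (ball x0 (r/2)) (\<lambda>x. fd f x h)"
      by (intro uniform_limit_theorem[where f=q and F=sequentially]) auto
    then show ?thesis using r by (simp add: continuous_on_eq_continuous_at)
  qed
  then show ?thesis by (simp add: continuous_at_imp_continuous_on)
qed

lemma has_derivative_quadratic:
  fixes G :: "'a::real_normed_vector \<Rightarrow> 'b::real_normed_vector"
  assumes "bounded_linear D" "d > 0" "\<And>h. norm h < d \<Longrightarrow> norm (G (x + h) - G x - D h) \<le> C * (norm h)\<^sup>2"
  shows "(G has_derivative D) (at x)"
  unfolding has_derivative_at
proof (intro conjI assms(1))
  have 1: "\<forall>\<^sub>F h in at 0. norm (G (x + h) - G x - D h) / norm h \<le> C * norm h"
    unfolding eventually_at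
    by (rule exI[where x=d]) (use assms(2,3) in \<open>auto simp: divide_simps power2_eq_square mult_ac\<close>)
  have 2: "((\<lambda>h. C * norm h) \<longlongrightarrow> 0) (at (0::'a))"
    by (auto intro!: tendsto_eq_intros)
  show "(\<lambda>h. norm (G (x + h) - G x - D h) / norm h) \<midarrow>0\<rightarrow> 0"
    by (rule tendsto_sandwich[OF _ 1 tendsto_const 2]) simp
qed

text \<open>\<open>quadratic_bound\<close> makes the remainder uniform in \<open>t\<close>. The
  weight \<open>w\<close> admits both Cauchy formulas: it is 1 for values and the inverse of the
  circle parameter for derivatives.\<close>

lemma hol_param_integral:
  fixes f :: "complex^'n \<Rightarrow> complex" and K :: "real \<Rightarrow> complex^'n"
  assumes f: "scalar_holomorphic_on f S" and S: "open S"
    and K: "continuous_on {0..1} K" and w: "continuous_on {0..1} w"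
    and inS: "\<And>t. t \<in> {0..1} \<Longrightarrow> x0 + K t \<in> S"
  obtains d where "d > 0"
    and "\<And>x t. x \<in> ball x0 d \<Longrightarrow> t \<in> {0..1} \<Longrightarrow> x + K t \<in> S"
    and "\<And>x. x \<in> ball x0 d \<Longrightarrow> ((\<lambda>x. integral {0..1} (\<lambda>t. w t * f (x + K t))) has_derivative
            (\<lambda>h. integral {0..1} (\<lambda>t. w t * fd f (x + K t) h))) (at x)"
    and "scalar_holomorphic_on (\<lambda>x. integral {0..1} (\<lambda>t. w t * f (x + K t))) (ball x0 d)"
proof -
  define T where "T = (\<lambda>t. x0 + K t) ` {0..1}"
  have "compact T" unfolding T_def by (intro compact_continuous_image continuous_intros K) auto
  moreover have "T \<subseteq> S" using inS by (auto simp: T_def)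
  ultimately obtain r B where r: "r > 0" "B \<ge> 0"
    and rB: "\<And>z y. z \<in> T \<Longrightarrow> dist z y \<le> r \<Longrightarrow> y \<in> S \<and> cmod (f y) \<le> B"
    using ball_margin[OF f S] by metis
  \<comment> \<open>Half of the margin is for the centre \<open>x\<close>, half for the increment
    \<open>h\<close>.\<close>
  define d where "d = r / 2"
  have d: "d > 0" using r by (simp add: d_def)
  obtain W where W: "\<And>t. t \<in> {0..1} \<Longrightarrow> cmod (w t) \<le> W"
  proof -
    have "compact (w ` {0..1})" by (intro compact_continuous_image w) auto
    then show thesis using that by (meson bounded_iff compact_imp_bounded imageI)
  qed
  have W0: "W \<ge> 0" using order_trans[OF norm_ge_zero W[of 0]] by simp
  have near: "y \<in> S \<and> cmod (f y) \<le> B" if "x \<in> ball x0 d" "t \<in> {0..1}" "y \<in> ball (x + K t) d" for x t y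
  proof -
    have "dist (x0 + K t) y \<le> dist (x0 + K t) (x + K t) + dist (x + K t) y" by (rule dist_triangle)
    also have "\<dots> \<le> r" using that by (simp add: d_def dist_norm)
    finally show ?thesis using that(2) by (intro rB[of "x0 + K t"]) (auto simp: T_def)
  qed
  have mem: "x + K t \<in> S" if "x \<in> ball x0 d" "t \<in> {0..1}" for x t
    using near[OF that, of "x + K t"] d by simp
  have inti: "(\<lambda>t. w t * f (x + K t)) integrable_on {0..1}" if x: "x \<in> ball x0 d" for x
    by (intro integrable_continuous_real continuous_intros w
        continuous_on_compose2[OF scalar_hol_continuous_on[OF f]] K) (use mem[OF x] in auto)
  have intd: "(\<lambda>t. w t * fd f (x + K t) h) integrable_on {0..1}" if x: "x \<in> ball x0 d" for x h
    by (intro integrable_continuous_real continuous_intros w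
        continuous_on_compose2[OF fd_continuous_on[OF f S]] K) (use mem[OF x] in auto)
  have der: "((\<lambda>x. integral {0..1} (\<lambda>t. w t * f (x + K t))) has_derivative
            (\<lambda>h. integral {0..1} (\<lambda>t. w t * fd f (x + K t) h))) (at x)" if x: "x \<in> ball x0 d" for x
  proof (rule has_derivative_quadratic[where d="min (d/4) (d - dist x0 x)" and C="W * (8 * B / d\<^sup>2)"])
    have lin: "linear (fd f (x + K t))" if "t \<in> {0..1}" for t
      using scalar_hol_fd_linear[OF f mem[OF x that]] .
    show "bounded_linear (\<lambda>h. integral {0..1} (\<lambda>t. w t * fd f (x + K t) h))"
    proof (rule linear_conv_bounded_linear[THEN iffD1], rule linearI)
      fix a b
      have "integral {0..1} (\<lambda>t. w t * fd f (x + K t) (a + b)) =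
            integral {0..1} (\<lambda>t. w t * fd f (x + K t) a + w t * fd f (x + K t) b)"
        by (rule integral_cong) (simp add: linear_add[OF lin] algebra_simps)
      then show "integral {0..1} (\<lambda>t. w t * fd f (x + K t) (a + b)) =
            integral {0..1} (\<lambda>t. w t * fd f (x + K t) a) + integral {0..1} (\<lambda>t. w t * fd f (x + K t) b)"
        by (simp add: integral_add intd[OF x])
    next
      fix c :: real and a
      have "integral {0..1} (\<lambda>t. w t * fd f (x + K t) (c *\<^sub>R a)) =
            integral {0..1} (\<lambda>t. c *\<^sub>R (w t * fd f (x + K t) a))"
        by (rule integral_cong) (simp add: linear_scale[OF lin] algebra_simps)
      then show "integral {0..1} (\<lambda>t. w t * fd f (x + K t) (c *\<^sub>R a)) =
            c *\<^sub>R integral {0..1} (\<lambda>t. w t * fd f (x + K t) a)" by simp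
    qed
    show "0 < min (d/4) (d - dist x0 x)" using x d by simp
    fix h :: "complex^'n" assume h: "norm h < min (d/4) (d - dist x0 x)"
    have xh: "x + h \<in> ball x0 d"
      using h dist_triangle[of x0 "x + h" x] by (simp add: dist_norm)
    have "norm (integral {0..1} (\<lambda>t. w t * (f (x + h + K t) - f (x + K t) - fd f (x + K t) h)))
          \<le> integral {0..1} (\<lambda>t::real. W * (8 * B / d\<^sup>2) * (norm h)\<^sup>2)"
    proof (rule integral_norm_bound_integral)
      have "(\<lambda>t. w t * f (x + h + K t) - w t * f (x + K t) - w t * fd f (x + K t) h) integrable_on {0..1}"
        by (intro integrable_diff inti intd x xh)
      then show "(\<lambda>t. w t * (f (x + h + K t) - f (x + K t) - fd f (x + K t) h)) integrable_on {0..1}"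
        by (simp add: algebra_simps)
      fix t :: real assume t: "t \<in> {0..1}"
      have "cmod (f ((x + K t) + h) - f (x + K t) - fd f (x + K t) h) \<le> 8 * B * (norm h)\<^sup>2 / d\<^sup>2"
      proof (rule quadratic_bound)
        show "scalar_holomorphic_on f (ball (x + K t) d)"
          using near[OF x t] scalar_hol_subset[OF f] by blast
      qed (use near[OF x t] d h in auto)
      then have "cmod (w t) * cmod (f (x + h + K t) - f (x + K t) - fd f (x + K t) h)
          \<le> W * (8 * B * (norm h)\<^sup>2 / d\<^sup>2)"
        using W[OF t] W0 by (intro mult_mono) (auto simp: add_ac)
      then show "norm (w t * (f (x + h + K t) - f (x + K t) - fd f (x + K t) h)) \<le> W * (8 * B / d\<^sup>2) * (norm h)\<^sup>2"
        by (simp add: norm_mult)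
    qed auto
    moreover have "integral {0..1} (\<lambda>t. w t * (f (x + h + K t) - f (x + K t) - fd f (x + K t) h)) =
       integral {0..1} (\<lambda>t. w t * f (x + h + K t)) - integral {0..1} (\<lambda>t. w t * f (x + K t))
       - integral {0..1} (\<lambda>t. w t * fd f (x + K t) h)"
      by (simp add: right_diff_distrib integral_diff integrable_diff inti[OF x] inti[OF xh] intd[OF x])
    ultimately show "norm (integral {0..1} (\<lambda>t. w t * f (x + h + K t)) - integral {0..1} (\<lambda>t. w t * f (x + K t))
       - integral {0..1} (\<lambda>t. w t * fd f (x + K t) h)) \<le> W * (8 * B / d\<^sup>2) * (norm h)\<^sup>2"
      by simp
  qed
  show thesis
  proof (rule that[OF d mem der])
    show "scalar_holomorphic_on (\<lambda>x. integral {0..1} (\<lambda>t. w t * f (x + K t))) (ball x0 d)"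
    proof (rule scalar_holI, intro exI conjI allI, erule der)
      fix x z h assume x: "x \<in> ball x0 d"
      have "integral {0..1} (\<lambda>t. w t * fd f (x + K t) (z *s h)) = integral {0..1} (\<lambda>t. z * (w t * fd f (x + K t) h))"
        by (rule integral_cong) (simp add: scalar_holD(2)[OF f mem[OF x]])
      then show "integral {0..1} (\<lambda>t. w t * fd f (x + K t) (z *s h)) = z * integral {0..1} (\<lambda>t. w t * fd f (x + K t) h)"
        by simp
    qed
  qed
qed

text \<open>The substitution \<open>u = \<rho> exp (2 \<pi> i t)\<close> turns the contour integrals of Cauchy's formulas
  into integrals over \<open>[0,1]\<close>, to which the previous lemma applies.\<close>

definition circ :: "real \<Rightarrow> real \<Rightarrow> complex" where
  "circ \<rho> t = of_real \<rho> * exp (2 * of_real pi * \<i> * of_real t)"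

lemma continuous_on_circ [continuous_intros]: "continuous_on T (circ \<rho>)"
  unfolding circ_def by (intro continuous_intros)

lemma norm_circ: "\<rho> > 0 \<Longrightarrow> cmod (circ \<rho> t) = \<rho>"
  by (simp add: circ_def norm_mult)

lemma circ_nonzero: "\<rho> > 0 \<Longrightarrow> circ \<rho> t \<noteq> 0"
  using norm_circ[of \<rho> t] by force

text \<open>The derivative of the circle path is \<open>2 \<pi> i\<close> times
  \<open>circ \<rho>\<close>, and this constant cancels.\<close>

lemma contour_integral_circ:
  assumes "\<rho> > 0" "(f has_contour_integral (2 * of_real pi * \<i> * c)) (circlepath 0 \<rho>)"
  shows "c = integral {0..1} (\<lambda>t. circ \<rho> t * f (circ \<rho> t))"
proof -
  have "((\<lambda>t. f (circlepath 0 \<rho> t) * vector_derivative (circlepath 0 \<rho>) (at t within {0..1})) has_integral (2 * of_real pi * \<i> * c)) {0..1}"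
    using assms(2) by (simp add: has_contour_integral_def)
  then have "((\<lambda>t. (2 * of_real pi * \<i>) * (circ \<rho> t * f (circ \<rho> t))) has_integral (2 * of_real pi * \<i> * c)) {0..1}"
    by (rule has_integral_eq[rotated], subst vector_derivative_circlepath01) (auto simp: circlepath circ_def mult_ac)
  from has_integral_mult_right[OF this, of "inverse (2 * of_real pi * \<i>)"]
  have "((\<lambda>t. circ \<rho> t * f (circ \<rho> t)) has_integral c) {0..1}"
    by (simp add: field_simps)
  then show ?thesis by (simp add: integral_unique)
qed

lemma cauchy_mean_value:
  assumes "\<phi> holomorphic_on ball 0 R" "0 < \<rho>" "\<rho> < R"
  shows "\<phi> 0 = integral {0..1} (\<lambda>t. \<phi> (circ \<rho> t))"
    and "deriv \<phi> 0 = integral {0..1} (\<lambda>t. inverse (circ \<rho> t) * \<phi> (circ \<rho> t))"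
proof -
  have sub: "cball 0 \<rho> \<subseteq> ball 0 R" using assms by auto
  have c: "continuous_on (cball 0 \<rho>) \<phi>" and h: "\<phi> holomorphic_on ball 0 \<rho>"
    using sub assms holomorphic_on_subset[OF assms(1)]
    by (auto simp: subset_ball intro: holomorphic_on_imp_continuous_on)
  have "((\<lambda>u. \<phi> u / (u - 0)) has_contour_integral (2 * of_real pi * \<i> * \<phi> 0)) (circlepath 0 \<rho>)"
    by (rule Cauchy_integral_circlepath[OF c h]) (use assms in auto)
  from contour_integral_circ[OF assms(2) this]
  show "\<phi> 0 = integral {0..1} (\<lambda>t. \<phi> (circ \<rho> t))"
    by (simp add: circ_nonzero assms)
  have "((\<lambda>u. \<phi> u / (u - 0) ^ (Suc 1)) has_contour_integral ((2 * pi * \<i>) / (fact 1) * (deriv ^^ 1) \<phi> 0)) (circlepath 0 \<rho>)"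
    by (rule Cauchy_has_contour_integral_higher_derivative_circlepath[OF c h]) (use assms in auto)
  then have "((\<lambda>u. \<phi> u / (u * u)) has_contour_integral (2 * of_real pi * \<i> * deriv \<phi> 0)) (circlepath 0 \<rho>)"
    by (simp add: power2_eq_square)
  from contour_integral_circ[OF assms(2) this]
  show "deriv \<phi> 0 = integral {0..1} (\<lambda>t. inverse (circ \<rho> t) * \<phi> (circ \<rho> t))"
    by (simp add: circ_nonzero assms field_simps)
qed

text \<open>One radius serves all \<open>x\<close> near \<open>x0\<close> and all holomorphic
  \<open>g\<close> on \<open>S\<close>, so the right-hand side is a parameter integral in
  \<open>x\<close>, and the formula can be used for \<open>f\<close> and for its derivatives
  alike.\<close>

lemma fd_cauchy_integral:
  assumes f: "scalar_holomorphic_on f S" and S: "open S" and x0: "x0 \<in> S"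
  obtains d \<rho> where "d > 0" "\<rho> > 0" "ball x0 d \<subseteq> S"
    "\<And>x t. x \<in> ball x0 d \<Longrightarrow> x + circ \<rho> t *s h \<in> S"
    "\<And>x g. x \<in> ball x0 d \<Longrightarrow> scalar_holomorphic_on g S \<Longrightarrow>
       fd g x h = integral {0..1} (\<lambda>t. inverse (circ \<rho> t) * g (x + circ \<rho> t *s h))"
proof -
  obtain r where r: "r > 0" "ball x0 r \<subseteq> S" using S x0 open_contains_ball by blast
  \<comment> \<open>\<open>norm h + 1\<close> instead of \<open>norm h\<close> covers
    \<open>h = 0\<close>.\<close>
  define \<rho> where "\<rho> = r / (4 * (norm h + 1))"
  have hp: "0 < norm h + 1" using norm_ge_zero[of h] by linarith
  have \<rho>: "\<rho> > 0" using r(1) hp by (simp add: \<rho>_def)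
  have small: "2 * \<rho> * norm h \<le> r / 2"
  proof -
    have "2 * \<rho> * norm h = (r/2) * (norm h / (norm h + 1))" using hp by (simp add: \<rho>_def divide_simps)
    also have "\<dots> \<le> (r/2) * 1" using r(1) hp by (intro mult_left_mono) (auto simp: field_simps)
    finally show ?thesis by simp
  qed
  have inS: "x + t *s h \<in> S" if x: "x \<in> ball x0 (r/2)" and "cmod t < 2 * \<rho>" for x t
  proof -
    have "dist x0 (x + t *s h) \<le> dist x0 x + cmod t * norm h"
      using norm_triangle_ineq[of "x0 - x" "- (t *s h)"] by (simp add: dist_norm norm_smult algebra_simps)
    also have "\<dots> \<le> dist x0 x + 2 * \<rho> * norm h" using that by (intro add_left_mono mult_right_mono) auto
    also have "\<dots> < r" using small x by simp
    finally show ?thesis using r(2) by auto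
  qed
  have form: "fd g x h = integral {0..1} (\<lambda>t. inverse (circ \<rho> t) * g (x + circ \<rho> t *s h))"
    if x: "x \<in> ball x0 (r/2)" and g: "scalar_holomorphic_on g S" for x g
  proof -
    have "(\<lambda>t. g (x + t *s h)) holomorphic_on ball 0 (2 * \<rho>)"
      by (rule line_holomorphic[OF g]) (use inS[OF x] in auto)
    moreover have "deriv (\<lambda>t. g (x + t *s h)) 0 = fd g x h"
      using line_field_derivative[OF g, of x 0 h] inS[OF x, of 0] \<rho> by (simp add: DERIV_imp_deriv)
    ultimately show ?thesis
      using cauchy_mean_value(2)[of "\<lambda>t. g (x + t *s h)" "2 * \<rho>" \<rho>] \<rho> by simp
  qed
  show thesis
    by (rule that[of "r/2" \<rho>]) (use r \<rho> inS norm_circ[OF \<rho>] form in \<open>auto simp: subset_eq\<close>)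
qed

text \<open>Near a point the derivative along \<open>h\<close> is a Cauchy integral of
  \<open>f\<close>, which can be differentiated under the integral sign. Its derivative along
  \<open>k\<close> is the Cauchy integral of the derivative of \<open>f\<close> along
  \<open>k\<close>, that is, the mixed derivative in the other order.\<close>

lemma scalar_hol_fd:
  assumes f: "scalar_holomorphic_on f S" and S: "open S"
  shows "scalar_holomorphic_on (\<lambda>x. fd f x h) S"
    and "x \<in> S \<Longrightarrow> fd (\<lambda>y. fd f y h) x k = fd (\<lambda>y. fd f y k) x h"
proof -
  \<comment> \<open>The symmetry is conditional here: Cauchy's formula for the derivative along
    \<open>k\<close> needs that derivative to be holomorphic, and this is known only once the first
    half is available for every direction.\<close>
  have main: "\<exists>d>0. ball x0 d \<subseteq> S \<and> scalar_holomorphic_on (\<lambda>x. fd f x h) (ball x0 d) \<and>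
    (\<forall>k. scalar_holomorphic_on (\<lambda>x. fd f x k) S \<longrightarrow> fd (\<lambda>y. fd f y h) x0 k = fd (\<lambda>y. fd f y k) x0 h)"
    if x0: "x0 \<in> S" for x0 h
  proof -
    obtain d \<rho> where d: "d > 0" "\<rho> > 0" "ball x0 d \<subseteq> S"
      and inS: "\<And>x t. x \<in> ball x0 d \<Longrightarrow> x + circ \<rho> t *s h \<in> S"
      and form: "\<And>x g. x \<in> ball x0 d \<Longrightarrow> scalar_holomorphic_on g S \<Longrightarrow>
         fd g x h = integral {0..1} (\<lambda>t. inverse (circ \<rho> t) * g (x + circ \<rho> t *s h))"
      by (rule fd_cauchy_integral[OF f S x0]) (rule that)
    have cK: "continuous_on {0..1} (\<lambda>t. circ \<rho> t *s h)"
      by (intro bounded_linear.continuous_on[OF bounded_linear_smult_left] continuous_intros)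
    have cw: "continuous_on {0..1} (\<lambda>t. inverse (circ \<rho> t))"
      by (intro continuous_intros) (simp add: circ_nonzero d)
    define G where "G x = integral {0..1} (\<lambda>t. inverse (circ \<rho> t) * f (x + circ \<rho> t *s h))" for x
    obtain e where e: "e > 0"
      and der: "\<And>x. x \<in> ball x0 e \<Longrightarrow> (G has_derivative (\<lambda>k. integral {0..1} (\<lambda>t. inverse (circ \<rho> t) * fd f (x + circ \<rho> t *s h) k))) (at x)"
      and hol: "scalar_holomorphic_on G (ball x0 e)"
    proof (rule hol_param_integral[OF f S cK cw, of x0])
      show "x0 + circ \<rho> t *s h \<in> S" for t using inS[of x0 t] d by simp
    qed (rule that[unfolded G_def])
    define m where "m = min d e"
    have m: "m > 0" "ball x0 m \<subseteq> ball x0 d" "ball x0 m \<subseteq> ball x0 e" using d e by (auto simp: m_def)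
    have eq: "G x = fd f x h" if "x \<in> ball x0 m" for x
      using form[of x f] f that m by (auto simp: G_def)
    have "scalar_holomorphic_on (\<lambda>x. fd f x h) (ball x0 m)"
      by (rule scalar_hol_cong[OF open_ball eq scalar_hol_subset[OF hol m(3)]])
    moreover have "fd (\<lambda>y. fd f y h) x0 k = fd (\<lambda>y. fd f y k) x0 h"
      if k: "scalar_holomorphic_on (\<lambda>x. fd f x k) S" for k
    proof -
      have "fd (\<lambda>y. fd f y h) x0 = fd G x0"
        by (rule fd_cong_open[OF open_ball, of x0 x0 m]) (use m eq in auto)
      also have "\<dots> = (\<lambda>k. integral {0..1} (\<lambda>t. inverse (circ \<rho> t) * fd f (x0 + circ \<rho> t *s h) k))"
        by (rule frechet_derivative_at'[OF der]) (use e in auto)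
      finally show ?thesis using form[OF _ k, of x0] d by simp
    qed
    ultimately show ?thesis using m d by (intro exI[where x=m]) auto
  qed
  show hol: "scalar_holomorphic_on (\<lambda>x. fd f x h) S" for h
    by (rule scalar_hol_local) (use main in \<open>metis centre_in_ball\<close>)
  show "fd (\<lambda>y. fd f y h) x k = fd (\<lambda>y. fd f y k) x h" if "x \<in> S"
    using main[OF that] hol by blast
qed

lemma vector_hol_fd:
  assumes f: "vector_holomorphic_on f S" and S: "open S"
  shows "vector_holomorphic_on (\<lambda>x. fd f x h) S"
    and "x \<in> S \<Longrightarrow> fd (\<lambda>y. fd f y h) x k = fd (\<lambda>y. fd f y k) x h"
proof -
  have fi: "scalar_holomorphic_on (\<lambda>y. f y $ i) S" for i using f by (simp add: vector_holomorphic_on_def)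
  have eq: "fd (\<lambda>y. f y $ i) x h = fd f x h $ i" if "x \<in> S" for x i h
    using vector_holD(3)[OF f that] by simp
  show hol: "vector_holomorphic_on (\<lambda>x. fd f x h) S" for h
    unfolding vector_holomorphic_on_def
    by (intro allI scalar_hol_cong[OF S eq scalar_hol_fd(1)[OF fi S]])
  assume x: "x \<in> S"
  have "fd (\<lambda>y. fd f y h) x k $ i = fd (\<lambda>y. fd (\<lambda>y. f y $ i) y h) x k" for i h k
    using vector_holD(3)[OF hol x] fd_cong_open[OF S x, of "\<lambda>y. fd (\<lambda>y. f y $ i) y h" "\<lambda>y. fd f y h $ i"] eq by simp
  then show "fd (\<lambda>y. fd f y h) x k = fd (\<lambda>y. fd f y k) x h"
    by (simp add: vec_eq_iff scalar_hol_fd(2)[OF fi S x])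
qed

text \<open>The complex line through \<open>y\<close> and \<open>z\<close> meets the ball in a
  convex, hence connected, set of parameters, where the one-variable identity theorem
  applies.\<close>

lemma scalar_hol_identity:
  assumes f: "scalar_holomorphic_on f (ball x r)" and y: "y \<in> ball x r" "s > 0"
    and zero: "\<And>z. z \<in> ball x r \<Longrightarrow> z \<in> ball y s \<Longrightarrow> f z = 0" and z: "z \<in> ball x r"
  shows "f z = 0"
proof -
  define T where "T = (\<lambda>t. y + t *s (z - y)) -` ball x r"
  have cl: "continuous_on UNIV (\<lambda>t. y + t *s (z - y))"
    by (intro continuous_intros bounded_linear.continuous_on[OF bounded_linear_smult_left])
  have "open T" unfolding T_def by (rule open_vimage[OF open_ball cl])
  have "convex T"
  proof (rule convexI)
    fix a b and u v :: real assume ab: "a \<in> T" "b \<in> T" and uv: "0 \<le> u" "0 \<le> v" "u + v = 1"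
    have "u *\<^sub>R (y + a *s (z - y)) + v *\<^sub>R (y + b *s (z - y)) \<in> ball x r"
      using ab uv by (intro convexD[OF convex_ball]) (auto simp: T_def)
    moreover have "u *\<^sub>R (y + a *s (z - y)) + v *\<^sub>R (y + b *s (z - y)) = y + (u *\<^sub>R a + v *\<^sub>R b) *s (z - y)"
    proof -
      have "u *\<^sub>R (y + a *s (z - y)) + v *\<^sub>R (y + b *s (z - y)) = (u + v) *\<^sub>R y + (u *\<^sub>R a + v *\<^sub>R b) *s (z - y)"
        by (simp add: scaleR_eq_smult scaleR_conv_of_real vec_eq_iff algebra_simps)
      then show ?thesis using uv by simp
    qed
    ultimately show "u *\<^sub>R a + v *\<^sub>R b \<in> T" by (simp add: T_def)
  qed
  define V where "V = T \<inter> (\<lambda>t. y + t *s (z - y)) -` ball y s"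
  have oV: "open V" unfolding V_def by (intro open_Int \<open>open T\<close> open_vimage[OF open_ball cl])
  have "0 \<in> V" using y by (simp add: V_def T_def)
  then have "V \<noteq> {}" by blast
  have hol: "(\<lambda>t. f (y + t *s (z - y))) holomorphic_on T"
    by (rule line_holomorphic[OF f]) (auto simp: T_def)
  have "f (y + 1 *s (z - y)) = 0"
    by (rule analytic_continuation_open[of V T "\<lambda>t. f (y + t *s (z - y))" "\<lambda>t. 0"])
       (use oV \<open>open T\<close> convex_connected[OF \<open>convex T\<close>] \<open>V \<noteq> {}\<close> hol zero z in \<open>auto simp: V_def T_def simp del: vector_ssub_ldistrib\<close>)
  then show ?thesis by simp
qed

section \<open>Holomorphic families of linear and bilinear maps\<close>

text \<open>Linearity over the complex numbers, whereas \<open>linear\<close> means linearity over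
  the reals.\<close>

definition clin :: "(complex^'n \<Rightarrow> complex^'m) \<Rightarrow> bool" where
  "clin T \<longleftrightarrow> (\<forall>x y. T (x + y) = T x + T y) \<and> (\<forall>z x. T (z *s x) = z *s T x)"

definition cbil :: "(complex^'n \<Rightarrow> complex^'m \<Rightarrow> complex^'k) \<Rightarrow> bool" where
  "cbil B \<longleftrightarrow> (\<forall>x. clin (B x)) \<and> (\<forall>y. clin (\<lambda>x. B x y))"

definition lin_hol :: "(complex^'n \<Rightarrow> complex^'m \<Rightarrow> complex^'k) \<Rightarrow> (complex^'n) set \<Rightarrow> bool" where
  "lin_hol T S \<longleftrightarrow> (\<forall>x\<in>S. clin (T x)) \<and> (\<forall>v. vector_holomorphic_on (\<lambda>x. T x v) S)"

definition bil_hol :: "(complex^'n \<Rightarrow> complex^'m \<Rightarrow> complex^'l \<Rightarrow> complex^'k) \<Rightarrow> (complex^'n) set \<Rightarrow> bool" where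
  "bil_hol B S \<longleftrightarrow> (\<forall>x\<in>S. cbil (B x)) \<and> (\<forall>v w. vector_holomorphic_on (\<lambda>x. B x v w) S)"

lemma clinI: "(\<And>x y. T (x + y) = T x + T y) \<Longrightarrow> (\<And>z x. T (z *s x) = z *s T x) \<Longrightarrow> clin T"
  by (simp add: clin_def)

lemma clin_add: "clin T \<Longrightarrow> T (x + y) = T x + T y"
  and clin_scale: "clin T \<Longrightarrow> T (z *s x) = z *s T x"
  by (simp_all add: clin_def)

lemma clin_zero: "clin T \<Longrightarrow> T 0 = 0"
  using clin_scale[of T 0 0] by simp

lemma clin_minus: "clin T \<Longrightarrow> T (- x) = - T x"
  using clin_scale[of T "-1" x] by simp

lemma clin_diff: "clin T \<Longrightarrow> T (x - y) = T x - T y"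
  using clin_add[of T x "- y"] by (simp add: clin_minus)

lemma clin_sum: "clin T \<Longrightarrow> T (\<Sum>i\<in>I. f i) = (\<Sum>i\<in>I. T (f i))"
  by (induction I rule: infinite_finite_induct) (simp_all add: clin_zero clin_add)

lemma clin_expand: "clin T \<Longrightarrow> T v = (\<Sum>i\<in>UNIV. v $ i *s T (axis i 1))"
  using clin_sum[of T "\<lambda>i. v $ i *s axis i 1" UNIV] by (simp add: basis_expansion clin_scale)

lemma clin_linear: "clin T \<Longrightarrow> linear T"
  by (rule linearI) (simp_all add: clin_add clin_scale scaleR_eq_smult)

lemma clin_compose: "clin S \<Longrightarrow> clin T \<Longrightarrow> clin (\<lambda>x. S (T x))"
  by (simp add: clin_def)

lemma clin_ident [simp]: "clin (\<lambda>x. x)"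
  by (simp add: clin_def)

lemma clin_add_map: "clin S \<Longrightarrow> clin T \<Longrightarrow> clin (\<lambda>x. S x + T x)"
  by (simp add: clin_def)

lemma clin_diff_map: "clin S \<Longrightarrow> clin T \<Longrightarrow> clin (\<lambda>x. S x - T x)"
  by (simp add: clin_def)

lemma clin_smult_map: "clin S \<Longrightarrow> clin (\<lambda>x. z *s S x)"
  by (simp add: clin_def mult_ac)

lemma clin_matrix [simp]: "clin ((*v) A)"
  by (simp add: clin_def matrix_vector_right_distrib vector_scalar_commute)

lemma clin_norm_bound: "clin T \<Longrightarrow> norm (T v) \<le> (\<Sum>i\<in>UNIV. norm (T (axis i 1))) * norm v"
  for T :: "complex^'n \<Rightarrow> complex^'m"
proof -
  assume T: "clin T"
  have "norm (T v) \<le> (\<Sum>i\<in>UNIV. norm (v $ i *s T (axis i 1)))"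
    by (subst clin_expand[OF T]) (rule norm_sum)
  also have "\<dots> \<le> (\<Sum>i\<in>UNIV. norm (T (axis i 1)) * norm v)"
    by (intro sum_mono) (simp add: norm_smult mult.commute[of "norm (v $ _)"] mult_left_mono Finite_Cartesian_Product.norm_nth_le)
  finally show ?thesis by (simp add: sum_distrib_right)
qed

lemma cbilD: "cbil B \<Longrightarrow> clin (B x)" "cbil B \<Longrightarrow> clin (\<lambda>x. B x y)"
  by (simp_all add: cbil_def)

lemma vector_hol_fd_clin: "vector_holomorphic_on f S \<Longrightarrow> x \<in> S \<Longrightarrow> clin (fd f x)"
  by (rule clinI) (simp_all add: vector_hol_fd_add vector_holD(2))

lemma lin_holD: "lin_hol T S \<Longrightarrow> x \<in> S \<Longrightarrow> clin (T x)" "lin_hol T S \<Longrightarrow> vector_holomorphic_on (\<lambda>x. T x v) S"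
  by (simp_all add: lin_hol_def)

lemma bil_holD: "bil_hol T S \<Longrightarrow> x \<in> S \<Longrightarrow> cbil (T x)" "bil_hol T S \<Longrightarrow> vector_holomorphic_on (\<lambda>x. T x v w) S"
  by (simp_all add: bil_hol_def)

lemma bil_hol_lin1: "bil_hol T S \<Longrightarrow> lin_hol (\<lambda>x. T x v) S"
  by (simp add: bil_hol_def lin_hol_def cbil_def)

lemma bil_hol_lin2: "bil_hol T S \<Longrightarrow> lin_hol (\<lambda>x w. T x w v) S"
  by (simp add: bil_hol_def lin_hol_def cbil_def)

lemma lin_hol_subset: "lin_hol T S \<Longrightarrow> S' \<subseteq> S \<Longrightarrow> lin_hol T S'"
  unfolding lin_hol_def using vector_hol_subset by blast

lemma bil_hol_subset: "bil_hol T S \<Longrightarrow> S' \<subseteq> S \<Longrightarrow> bil_hol T S'"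
  unfolding bil_hol_def using vector_hol_subset by blast

lemma lin_hol_apply:
  assumes "open S" "lin_hol T S" "vector_holomorphic_on v S"
  shows "vector_holomorphic_on (\<lambda>x. T x (v x)) S"
proof (rule vector_hol_cong[OF assms(1)])
  show "(\<Sum>i\<in>UNIV. v x $ i *s T x (axis i 1)) = T x (v x)" if "x \<in> S" for x
    using clin_expand[OF lin_holD(1)[OF assms(2) that]] by metis
  show "vector_holomorphic_on (\<lambda>x. \<Sum>i\<in>UNIV. v x $ i *s T x (axis i 1)) S"
    using assms(3) lin_holD(2)[OF assms(2)]
    by (intro vector_hol_sum vector_hol_smult) (simp_all add: vector_holomorphic_on_def[of v])
qed

lemma bil_hol_apply1:
  assumes "open S" "bil_hol B S" "vector_holomorphic_on v S"
  shows "lin_hol (\<lambda>x. B x (v x)) S"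
  using lin_hol_apply[OF assms(1) bil_hol_lin2[OF assms(2)] assms(3)] bil_holD(1)[OF assms(2)]
  by (simp add: lin_hol_def cbil_def)

lemma bil_hol_apply:
  assumes "open S" "bil_hol B S" "vector_holomorphic_on v S" "vector_holomorphic_on w S"
  shows "vector_holomorphic_on (\<lambda>x. B x (v x) (w x)) S"
  using lin_hol_apply[OF assms(1) bil_hol_apply1[OF assms(1-3)] assms(4)] .

lemma fd_clin_in_parameter:
  assumes S: "open S" and T: "lin_hol T S" and x: "x \<in> S"
  shows "clin (\<lambda>v. fd (\<lambda>y. T y v) x h)"
proof (rule clinI)
  note h = vector_holD(1)[OF lin_holD(2)[OF T] x]
  fix v w
  have "fd (\<lambda>y. T y (v + w)) x = fd (\<lambda>y. T y v + T y w) x"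
    by (rule fd_cong_open[OF S x]) (simp add: clin_add[OF lin_holD(1)[OF T]])
  also have "\<dots> = (\<lambda>h. fd (\<lambda>y. T y v) x h + fd (\<lambda>y. T y w) x h)"
    by (intro frechet_derivative_at' has_derivative_add h)
  finally show "fd (\<lambda>y. T y (v + w)) x h = fd (\<lambda>y. T y v) x h + fd (\<lambda>y. T y w) x h" by simp
next
  note h = vector_holD(1)[OF lin_holD(2)[OF T] x]
  fix z v
  have "fd (\<lambda>y. T y (z *s v)) x = fd (\<lambda>y. z *s T y v) x"
    by (rule fd_cong_open[OF S x]) (simp add: clin_scale[OF lin_holD(1)[OF T]])
  also have "\<dots> = (\<lambda>h. z *s fd (\<lambda>y. T y v) x h)"
    by (intro frechet_derivative_at' bounded_linear.has_derivative[OF bounded_linear_smult_right] h)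
  finally show "fd (\<lambda>y. T y (z *s v)) x h = z *s fd (\<lambda>y. T y v) x h" by simp
qed

lemma lin_hol_fd:
  assumes S: "open S" and T: "lin_hol T S"
  shows "bil_hol (\<lambda>x h v. fd (\<lambda>y. T y v) x h) S"
  unfolding bil_hol_def cbil_def
  by (auto intro: fd_clin_in_parameter[OF S T] vector_hol_fd_clin[OF lin_holD(2)[OF T]] vector_hol_fd(1)[OF lin_holD(2)[OF T] S])

text \<open>The product rule after expansion in a basis. The filter \<open>at t within X\<close>
  serves curves on real intervals as well as maps on open sets.\<close>

lemma has_derivative_lin_hol:
  assumes S: "open S" and T: "lin_hol T S"
    and g: "(g has_derivative g') (at t within X)" "g t \<in> S"
    and v: "(v has_derivative v') (at t within X)" and t: "t \<in> X"
  shows "((\<lambda>s. T (g s) (v s)) has_derivative (\<lambda>h. fd (\<lambda>y. T y (v t)) (g t) (g' h) + T (g t) (v' h))) (at t within X)"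
proof -
  have cont: "continuous (at t within X) g" using g(1) by (rule has_derivative_continuous)
  have ev: "\<forall>\<^sub>F s in at t within X. g s \<in> S"
    using topological_tendstoD[OF cont[unfolded continuous_within] S g(2)] .
  have "((\<lambda>s. \<Sum>i\<in>UNIV. v s $ i *s T (g s) (axis i 1)) has_derivative
     (\<lambda>h. \<Sum>i\<in>UNIV. v t $ i *s fd (\<lambda>y. T y (axis i 1)) (g t) (g' h) + v' h $ i *s T (g t) (axis i 1))) (at t within X)"
  proof (intro has_derivative_sum)
    fix i :: 'b
    have 1: "((\<lambda>s. T (g s) (axis i 1)) has_derivative (\<lambda>h. fd (\<lambda>y. T y (axis i 1)) (g t) (g' h))) (at t within X)"
      using has_derivative_compose[OF g(1) has_derivative_at_withinI, of "\<lambda>y. T y (axis i 1)"]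
        has_derivative_compose[OF g(1) vector_holD(1)[OF lin_holD(2)[OF T] g(2), of "axis i 1"]] by simp
    have 2: "((\<lambda>s. v s $ i) has_derivative (\<lambda>h. v' h $ i)) (at t within X)"
      by (rule bounded_linear.has_derivative[OF bounded_linear_vec_nth v])
    have bb: "bounded_bilinear (\<lambda>z (x::complex^'c). z *s x)"
      by (rule bounded_bilinear.intro)
         (auto simp: scaleR_eq_smult mult_ac norm_smult scaleR_conv_of_real intro!: exI[where x=1])
    show "((\<lambda>s. v s $ i *s T (g s) (axis i 1)) has_derivative
     (\<lambda>h. v t $ i *s fd (\<lambda>y. T y (axis i 1)) (g t) (g' h) + v' h $ i *s T (g t) (axis i 1))) (at t within X)"
      by (rule bounded_bilinear.FDERIV[OF bb 2 1])
  qed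
  moreover have "(\<Sum>i\<in>UNIV. v t $ i *s fd (\<lambda>y. T y (axis i 1)) (g t) (g' h) + v' h $ i *s T (g t) (axis i 1)) =
      fd (\<lambda>y. T y (v t)) (g t) (g' h) + T (g t) (v' h)" for h
    using clin_expand[OF fd_clin_in_parameter[OF S T g(2)], of "v t" "g' h"] clin_expand[OF lin_holD(1)[OF T g(2)], of "v' h"]
    by (simp add: sum.distrib)
  ultimately have D: "((\<lambda>s. \<Sum>i\<in>UNIV. v s $ i *s T (g s) (axis i 1)) has_derivative
     (\<lambda>h. fd (\<lambda>y. T y (v t)) (g t) (g' h) + T (g t) (v' h))) (at t within X)" by simp
  \<comment> \<open>\<open>T (g s)\<close> is known to be linear only where
    \<open>g s \<in> S\<close>, so the expansion holds eventually and not everywhere.\<close>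
  have ev': "\<forall>\<^sub>F s in at t within X. (\<Sum>i\<in>UNIV. v s $ i *s T (g s) (axis i 1)) = T (g s) (v s)"
    using ev by eventually_elim (use clin_expand[OF lin_holD(1)[OF T]] in metis)
  show ?thesis
    by (rule has_derivative_transform_eventually[OF D ev' _ t])
       (use clin_expand[OF lin_holD(1)[OF T g(2)]] in metis)
qed

lemma has_derivative_bil_hol:
  assumes S: "open S" and B: "bil_hol B S"
    and g: "(g has_derivative g') (at t within X)" "g t \<in> S"
    and v: "(v has_derivative v') (at t within X)"
    and w: "(w has_derivative w') (at t within X)" and t: "t \<in> X"
  shows "((\<lambda>s. B (g s) (v s) (w s)) has_derivative
     (\<lambda>h. fd (\<lambda>y. B y (v t) (w t)) (g t) (g' h) + B (g t) (v' h) (w t) + B (g t) (v t) (w' h))) (at t within X)"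
proof -
  have cont: "continuous (at t within X) g" using g(1) by (rule has_derivative_continuous)
  have ev: "\<forall>\<^sub>F s in at t within X. g s \<in> S"
    using topological_tendstoD[OF cont[unfolded continuous_within] S g(2)] .
  note cl = cbilD(2)[OF bil_holD(1)[OF B]]
  have "((\<lambda>s. \<Sum>i\<in>UNIV. v s $ i *s B (g s) (axis i 1) (w s)) has_derivative
     (\<lambda>h. \<Sum>i\<in>UNIV. v t $ i *s (fd (\<lambda>y. B y (axis i 1) (w t)) (g t) (g' h) + B (g t) (axis i 1) (w' h)) + v' h $ i *s B (g t) (axis i 1) (w t))) (at t within X)"
  proof (intro has_derivative_sum)
    fix i :: 'b
    note 1 = has_derivative_lin_hol[OF S bil_hol_lin1[OF B, of "axis i 1"] g w t]
    have 2: "((\<lambda>s. v s $ i) has_derivative (\<lambda>h. v' h $ i)) (at t within X)"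
      by (rule bounded_linear.has_derivative[OF bounded_linear_vec_nth v])
    have bb: "bounded_bilinear (\<lambda>z (x::complex^'d). z *s x)"
      by (rule bounded_bilinear.intro)
         (auto simp: scaleR_eq_smult mult_ac norm_smult scaleR_conv_of_real intro!: exI[where x=1])
    show "((\<lambda>s. v s $ i *s B (g s) (axis i 1) (w s)) has_derivative
     (\<lambda>h. v t $ i *s (fd (\<lambda>y. B y (axis i 1) (w t)) (g t) (g' h) + B (g t) (axis i 1) (w' h)) + v' h $ i *s B (g t) (axis i 1) (w t))) (at t within X)"
      by (rule bounded_bilinear.FDERIV[OF bb 2 1])
  qed
  moreover have "(\<Sum>i\<in>UNIV. v t $ i *s (fd (\<lambda>y. B y (axis i 1) (w t)) (g t) (g' h) + B (g t) (axis i 1) (w' h)) + v' h $ i *s B (g t) (axis i 1) (w t)) =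
      fd (\<lambda>y. B y (v t) (w t)) (g t) (g' h) + B (g t) (v' h) (w t) + B (g t) (v t) (w' h)" for h
    using clin_expand[OF fd_clin_in_parameter[OF S bil_hol_lin2[OF B] g(2)], of "v t" "w t" "g' h"]
      clin_expand[OF cl[OF g(2)], of "v t" "w' h"] clin_expand[OF cl[OF g(2)], of "v' h" "w t"]
    by (simp add: sum.distrib)
  ultimately have D: "((\<lambda>s. \<Sum>i\<in>UNIV. v s $ i *s B (g s) (axis i 1) (w s)) has_derivative
     (\<lambda>h. fd (\<lambda>y. B y (v t) (w t)) (g t) (g' h) + B (g t) (v' h) (w t) + B (g t) (v t) (w' h))) (at t within X)" by simp
  have ev': "\<forall>\<^sub>F s in at t within X. (\<Sum>i\<in>UNIV. v s $ i *s B (g s) (axis i 1) (w s)) = B (g s) (v s) (w s)"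
    using ev by eventually_elim (use clin_expand[OF cl] in metis)
  show ?thesis
    by (rule has_derivative_transform_eventually[OF D ev' _ t])
       (use clin_expand[OF cl[OF g(2)]] in metis)
qed

lemma fd_lin_hol:
  assumes "open S" "lin_hol T S" "x \<in> S" "vector_holomorphic_on v S"
  shows "fd (\<lambda>y. T y (v y)) x h = fd (\<lambda>y. T y (v x)) x h + T x (fd v x h)"
  using frechet_derivative_at'[OF has_derivative_lin_hol[OF assms(1,2) has_derivative_ident assms(3) vector_holD(1)[OF assms(4,3)]]]
  by simp

lemma fd_bil_hol:
  assumes "open S" "bil_hol B S" "x \<in> S" "vector_holomorphic_on v S" "vector_holomorphic_on w S"
  shows "fd (\<lambda>y. B y (v y) (w y)) x h = fd (\<lambda>y. B y (v x) (w x)) x h + B x (fd v x h) (w x) + B x (v x) (fd w x h)"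
  using frechet_derivative_at'[OF has_derivative_bil_hol[OF assms(1,2) has_derivative_ident assms(3) vector_holD(1)[OF assms(4,3)] vector_holD(1)[OF assms(5,3)]]]
  by simp

lemma lin_hol_bounded:
  fixes T :: "complex^'n \<Rightarrow> complex^'m \<Rightarrow> complex^'k"
  assumes "lin_hol T S" "compact C" "C \<subseteq> S"
  obtains K where "K \<ge> 0" "\<And>x v. x \<in> C \<Longrightarrow> norm (T x v) \<le> K * norm v"
proof -
  have "\<exists>k. \<forall>x\<in>C. norm (T x (axis i 1)) \<le> k" for i
  proof -
    have "compact ((\<lambda>x. T x (axis i 1)) ` C)"
      by (intro compact_continuous_image continuous_on_subset[OF vector_hol_continuous_on[OF lin_holD(2)[OF assms(1)]] assms(3)] assms(2))
    then show ?thesis by (meson bounded_iff compact_imp_bounded imageI)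
  qed
  then obtain k where k: "\<And>i x. x \<in> C \<Longrightarrow> norm (T x (axis i 1)) \<le> k i" by metis
  show thesis
  proof (rule that[of "max 0 (\<Sum>i\<in>UNIV. k i)"])
    fix x v assume x: "x \<in> C"
    have "norm (T x v) \<le> (\<Sum>i\<in>UNIV. norm (T x (axis i 1))) * norm v"
      using clin_norm_bound lin_holD(1)[OF assms(1)] x assms(3) by blast
    also have "\<dots> \<le> max 0 (\<Sum>i\<in>UNIV. k i) * norm v"
      by (intro mult_right_mono max.coboundedI2 sum_mono k x) auto
    finally show "norm (T x v) \<le> max 0 (\<Sum>i\<in>UNIV. k i) * norm v" .
  qed simp
qed

lemma bil_hol_bounded:
  fixes T :: "complex^'n \<Rightarrow> complex^'m \<Rightarrow> complex^'l \<Rightarrow> complex^'k"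
  assumes "bil_hol T S" "compact C" "C \<subseteq> S"
  obtains K where "K \<ge> 0" "\<And>x v w. x \<in> C \<Longrightarrow> norm (T x v w) \<le> K * norm v * norm w"
proof -
  have "\<exists>k\<ge>0. \<forall>x\<in>C. \<forall>w. norm (T x (axis i 1) w) \<le> k * norm w" for i
    using lin_hol_bounded[OF bil_hol_lin1[OF assms(1)] assms(2,3)] by metis
  then obtain k where k: "\<And>i. k i \<ge> 0" "\<And>i x w. x \<in> C \<Longrightarrow> norm (T x (axis i 1) w) \<le> k i * norm w" by metis
  show thesis
  proof (rule that[of "\<Sum>i\<in>UNIV. k i"])
    fix x v w assume x: "x \<in> C"
    have "norm (T x v w) \<le> (\<Sum>i\<in>UNIV. norm (T x (axis i 1) w)) * norm v"
      using clin_norm_bound[OF cbilD(2)[OF bil_holD(1)[OF assms(1)]]] x assms(3) by blast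
    also have "\<dots> \<le> (\<Sum>i\<in>UNIV. k i * norm w) * norm v"
      by (intro mult_right_mono sum_mono k x) auto
    finally show "norm (T x v w) \<le> (\<Sum>i\<in>UNIV. k i) * norm v * norm w"
      by (simp add: sum_distrib_right sum_distrib_left mult_ac)
  qed (simp add: k sum_nonneg)
qed

section \<open>Determinants and inverses of holomorphic matrices\<close>

lemma lin_hol_matrix_entries:
  fixes A :: "complex^'n \<Rightarrow> complex^'k^'m"
  assumes "lin_hol (\<lambda>x. (*v) (A x)) S"
  shows "scalar_holomorphic_on (\<lambda>x. A x $ i $ j) S"
proof -
  have "(A x *v axis j 1) $ i = A x $ i $ j" for x
    by (simp add: matrix_vector_mult_def axis_def if_distrib cong: if_cong)
  moreover have "scalar_holomorphic_on (\<lambda>x. (A x *v axis j 1) $ i) S"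
    using lin_holD(2)[OF assms, of "axis j 1"] unfolding vector_holomorphic_on_def by (rule spec)
  ultimately show ?thesis by simp
qed

lemma scalar_hol_det:
  fixes A :: "complex^'n \<Rightarrow> complex^'k^'k"
  assumes "\<And>i j. scalar_holomorphic_on (\<lambda>x. A x $ i $ j) S"
  shows "scalar_holomorphic_on (\<lambda>x. det (A x)) S"
  unfolding det_def by (intro scalar_hol_sum scalar_hol_mult scalar_hol_prod scalar_hol_const assms)

lemma open_det_nonzero:
  fixes A :: "complex^'n \<Rightarrow> complex^'k^'k"
  assumes "open S" "lin_hol (\<lambda>x. (*v) (A x)) S"
  shows "open {x \<in> S. det (A x) \<noteq> 0}"
proof -
  have "{x \<in> S. det (A x) \<noteq> 0} = S \<inter> (\<lambda>x. det (A x)) -` (- {0})" by auto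
  then show ?thesis
    using continuous_open_preimage[OF scalar_hol_continuous_on[OF scalar_hol_det[OF lin_hol_matrix_entries[OF assms(2)]]] assms(1), of "- {0}"]
    by (simp add: open_Compl)
qed

lemma matrix_inv_cancel:
  fixes A :: "complex^'n^'n"
  assumes "det A \<noteq> 0"
  shows "A *v (matrix_inv A *v v) = v" "matrix_inv A *v (A *v v) = v"
proof -
  have "A ** matrix_inv A = mat 1 \<and> matrix_inv A ** A = mat 1"
    using assms unfolding invertible_det_nz[symmetric] invertible_def matrix_inv_def by (rule someI_ex)
  then show "A *v (matrix_inv A *v v) = v" "matrix_inv A *v (A *v v) = v"
    by (simp_all add: matrix_vector_mul_assoc)
qed

lemma matrix_inv_cramer:
  fixes A :: "complex^'n^'n"
  assumes "det A \<noteq> 0"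
  shows "matrix_inv A *v v = (\<chi> k. det (\<chi> i j. if j = k then v $ i else A $ i $ j) / det A)"
  using cramer[OF assms, of "matrix_inv A *v v" v] matrix_inv_cancel(1)[OF assms] by simp

lemma lin_hol_matrix_inv:
  fixes A :: "complex^'n \<Rightarrow> complex^'k^'k"
  assumes A: "lin_hol (\<lambda>x. (*v) (A x)) S" and S: "open S" and nz: "\<And>x. x \<in> S \<Longrightarrow> det (A x) \<noteq> 0"
  shows "lin_hol (\<lambda>x. (*v) (matrix_inv (A x))) S"
proof -
  note e = lin_hol_matrix_entries[OF A]
  have "vector_holomorphic_on (\<lambda>x. matrix_inv (A x) *v v) S" for v
  proof (rule vector_hol_cong[OF S])
    show "(\<chi> k. det (\<chi> i j. if j = k then v $ i else A x $ i $ j) / det (A x)) = matrix_inv (A x) *v v" if "x \<in> S" for x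
      using matrix_inv_cramer[OF nz[OF that]] by simp
    have "scalar_holomorphic_on (\<lambda>x. (\<chi> i j. if j = k then v $ i else A x $ i $ j) $ i $ j) S" for i j k
      by (cases "j = k") (simp_all add: e)
    then show "vector_holomorphic_on (\<lambda>x. \<chi> k. det (\<chi> i j. if j = k then v $ i else A x $ i $ j) / det (A x)) S"
      unfolding vector_holomorphic_on_def by (auto intro!: scalar_hol_divide scalar_hol_det e nz)
  qed
  then show ?thesis by (simp add: lin_hol_def)
qed

section \<open>Multiplicity of a zero along lines\<close>

text \<open>The maximum principle for \<open>\<psi>\<close>: on the circle the factor
  \<open>t ^ d\<close> has constant modulus.\<close>

lemma max_modulus_quotient:
  assumes "\<psi> holomorphic_on ball 0 R" "0 < \<rho>" "\<rho> < R"
    and "\<And>t. cmod t = \<rho> \<Longrightarrow> cmod (t ^ d * \<psi> t) \<le> B" and "cmod t \<le> \<rho>"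
  shows "cmod (\<psi> t) \<le> B / \<rho> ^ d"
proof (rule maximum_modulus_frontier[of \<psi> "cball 0 \<rho>"])
  have "cball (0::complex) \<rho> \<subseteq> ball 0 R" using assms by auto
  then show "\<psi> holomorphic_on interior (cball 0 \<rho>)" "continuous_on (closure (cball 0 \<rho>)) \<psi>"
    using assms(1) holomorphic_on_subset holomorphic_on_imp_continuous_on continuous_on_subset interior_subset
    by (metis subset_trans, metis closed_cball closure_closed)
  show "cmod (\<psi> z) \<le> B / \<rho> ^ d" if "z \<in> frontier (cball 0 \<rho>)" for z
    using assms(4)[of z] that assms(2) by (simp add: field_simps norm_mult norm_power)
qed (use assms in auto)

text \<open>Let \<open>d\<close> be the largest number such that \<open>f\<close> vanishes at
  \<open>p\<close> to order at least \<open>d\<close> along all lines, and \<open>y\<close> a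
  direction where the order is exactly \<open>d\<close>. For directions near \<open>y\<close> the
  quotients by \<open>t ^ d\<close> are uniformly close to that of \<open>y\<close>, which is not 0
  at \<open>t = 0\<close>. So one radius without zeros serves a whole cone of directions.\<close>

lemma multiplicity_direction:
  fixes f :: "complex^'n \<Rightarrow> complex"
  assumes f: "scalar_holomorphic_on f (ball p R)" and R: "R > 0" and nz: "x \<in> ball p R" "f x \<noteq> 0"
  obtains y e r where "e > 0" "r > 0"
    "\<And>z t. norm (z - y) < e \<Longrightarrow> t \<noteq> 0 \<Longrightarrow> cmod t < r \<Longrightarrow> p + t *s z \<in> ball p R \<and> f (p + t *s z) \<noteq> 0"
proof -
  define P where "P d \<longleftrightarrow> (\<forall>z\<in>ball 0 1. \<exists>\<psi>. \<psi> holomorphic_on ball 0 R \<and> (\<forall>t\<in>ball 0 R. f (p + t *s z) = t ^ d * \<psi> t))" for d :: nat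
  have inb: "p + t *s z \<in> ball p R" if "cmod t < R" "norm z \<le> 1" for t z
  proof -
    have "cmod t * norm z \<le> cmod t * 1" using that by (intro mult_left_mono) auto
    then show ?thesis using that by (simp add: dist_norm norm_smult)
  qed
  have hol: "(\<lambda>t. f (p + t *s z)) holomorphic_on ball 0 R" if "norm z < 1" for z
    by (rule line_holomorphic[OF f]) (use inb that in auto)
  have P0: "P 0" unfolding P_def
  proof
    fix z :: "complex^'n" assume "z \<in> ball 0 1"
    then show "\<exists>\<psi>. \<psi> holomorphic_on ball 0 R \<and> (\<forall>t\<in>ball 0 R. f (p + t *s z) = t ^ 0 * \<psi> t)"
      by (intro exI[where x="\<lambda>t. f (p + t *s z)"]) (simp add: hol)
  qed
  have step: "P (Suc d)" if Pd: "P d" and z0: "\<And>z \<psi>. z \<in> ball 0 1 \<Longrightarrow> \<psi> holomorphic_on ball 0 R \<Longrightarrow>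
      \<forall>t\<in>ball 0 R. f (p + t *s z) = t ^ d * \<psi> t \<Longrightarrow> \<psi> 0 = 0" for d
    unfolding P_def
  proof
    fix z :: "complex^'n" assume z: "z \<in> ball 0 1"
    then obtain \<psi> where \<psi>: "\<psi> holomorphic_on ball 0 R" "\<forall>t\<in>ball 0 R. f (p + t *s z) = t ^ d * \<psi> t"
      using Pd unfolding P_def by blast
    have "\<psi> 0 = 0" using z0[OF z \<psi>] .
    then show "\<exists>\<psi>. \<psi> holomorphic_on ball 0 R \<and> (\<forall>t\<in>ball 0 R. f (p + t *s z) = t ^ Suc d * \<psi> t)"
      using pole_lemma_open[OF \<psi>(1) open_ball, of 0] \<psi>(2) R
      by (intro exI[where x="\<lambda>u. if u = 0 then deriv \<psi> 0 else (\<psi> u - \<psi> 0) / (u - 0)"]) (auto simp: \<psi>(2))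
  qed
  have "\<exists>d z \<psi>. P d \<and> z \<in> ball 0 1 \<and> \<psi> holomorphic_on ball 0 R \<and> (\<forall>t\<in>ball 0 R. f (p + t *s z) = t ^ d * \<psi> t) \<and> \<psi> 0 \<noteq> 0"
  proof (rule ccontr)
    assume contra: "\<not> ?thesis"
    \<comment> \<open>If no order is the last one, the maximum principle bounds \<open>f x\<close>
      by a constant times the \<open>d\<close>-th power of \<open>cmod t / \<rho> < 1\<close>, for
      every \<open>d\<close>.\<close>
    have all: "P d" for d
      by (induction d) (use P0 step contra in blast)+
    have "x \<noteq> p \<or> x = p" by simp
    \<comment> \<open>\<open>P\<close> speaks of directions of norm below 1, so \<open>x - p\<close>
      is scaled by \<open>s\<close>; the parameter \<open>1 / s\<close> of the point
      \<open>x\<close> then has to be below \<open>R\<close>.\<close>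
    obtain s :: real where s: "1 / R < s" "s * norm (x - p) < 1"
    proof (cases "x = p")
      case True
      then show thesis using that[of "1/R + 1"] by simp
    next
      case False
      then have "norm (x - p) > 0" by simp
      then have "1 / R < 1 / norm (x - p)" using nz(1) R by (intro divide_strict_left_mono mult_pos_pos) (auto simp: dist_norm norm_minus_commute)
      then obtain s where "1/R < s" "s < 1 / norm (x - p)" using dense by blast
      then show thesis using that[of s] \<open>norm (x - p) > 0\<close> by (simp add: field_simps)
    qed
    have s0: "s > 0" using s(1) R using divide_pos_pos[of 1 R] by linarith
    define z where "z = of_real s *s (x - p)"
    define t where "t = (1 / of_real s :: complex)"
    have z: "norm z < 1" using s s0 by (simp add: z_def norm_smult del: vector_ssub_ldistrib)
    have t: "cmod t < R" using s s0 R by (simp add: t_def norm_divide field_simps)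
    have x: "x = p + t *s z" using s0 by (simp add: z_def t_def vec_eq_iff)
    obtain \<rho> where \<rho>: "cmod t < \<rho>" "\<rho> < R" using t dense by blast
    have \<rho>0: "\<rho> > 0" using \<rho> norm_ge_zero[of t] by linarith
    have "compact ((\<lambda>t. f (p + t *s z)) ` sphere 0 \<rho>)"
      using \<rho> by (intro compact_continuous_image continuous_on_subset[OF holomorphic_on_imp_continuous_on[OF hol[OF z]]]) auto
    then obtain B where B: "\<And>t. cmod t = \<rho> \<Longrightarrow> cmod (f (p + t *s z)) \<le> B"
      by (force dest: compact_imp_bounded simp: bounded_iff)
    have "cmod (f x) \<le> B * (cmod t / \<rho>) ^ d" for d
    proof -
      obtain \<psi> where \<psi>: "\<psi> holomorphic_on ball 0 R" "\<forall>t\<in>ball 0 R. f (p + t *s z) = t ^ d * \<psi> t"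
        using bspec[OF all[of d, unfolded P_def], of z] z by auto
      have "cmod (\<psi> t) \<le> B / \<rho> ^ d"
        by (rule max_modulus_quotient[OF \<psi>(1) \<rho>0 \<rho>(2)]) (use \<psi>(2) \<rho> B in auto)
      then have "cmod (t ^ d) * cmod (\<psi> t) \<le> cmod (t ^ d) * (B / \<rho> ^ d)" by (intro mult_left_mono) auto
      then show ?thesis using \<psi>(2) t x by (simp add: norm_mult norm_power power_divide mult.commute)
    qed
    moreover have "(\<lambda>d. B * (cmod t / \<rho>) ^ d) \<longlonglongrightarrow> B * 0"
      using \<rho> \<rho>0 by (intro tendsto_mult tendsto_const LIMSEQ_power_zero) simp
    ultimately have "cmod (f x) \<le> 0"
      using LIMSEQ_le_const[of "\<lambda>d. B * (cmod t / \<rho>) ^ d" 0 "cmod (f x)"] by auto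
    then show False using nz by simp
  qed
  then obtain d y \<psi> where Pd: "P d" and y: "norm y < 1" and \<psi>: "\<psi> holomorphic_on ball 0 R"
    "\<And>t. t\<in>ball 0 R \<Longrightarrow> f (p + t *s y) = t ^ d * \<psi> t" and \<psi>0: "\<psi> 0 \<noteq> 0" by auto
  define \<rho> where "\<rho> = R / 2"
  have \<rho>: "\<rho> > 0" "\<rho> < R" using R by (auto simp: \<rho>_def)
  \<comment> \<open>Two errors of size \<open>\<eta>\<close>, from the change of direction and from
    moving away from \<open>t = 0\<close>, cannot cancel \<open>\<psi> 0\<close>.\<close>
  define \<eta> where "\<eta> = cmod (\<psi> 0) / 4"
  have \<eta>: "\<eta> > 0" using \<psi>0 by (simp add: \<eta>_def)
  have "uniformly_continuous_on (cball p \<rho>) f"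
    using \<rho> by (intro compact_uniformly_continuous continuous_on_subset[OF scalar_hol_continuous_on[OF f]]) auto
  \<comment> \<open>The factor \<open>\<rho> ^ d\<close> is lost again when the bound on the circle
    is divided by \<open>t ^ d\<close>.\<close>
  then obtain e1 where e1: "e1 > 0" "\<And>a b. a \<in> cball p \<rho> \<Longrightarrow> b \<in> cball p \<rho> \<Longrightarrow> dist a b < e1 \<Longrightarrow> dist (f a) (f b) < \<eta> * \<rho> ^ d"
    using \<eta> \<rho> unfolding uniformly_continuous_on_def by (metis dist_commute mult_pos_pos zero_less_power)
  have "isCont \<psi> 0" using \<psi>(1) R holomorphic_on_imp_continuous_on continuous_on_eq_continuous_at
    by (metis centre_in_ball open_ball)
  then obtain r1 where r1: "r1 > 0" "\<And>t. cmod t < r1 \<Longrightarrow> cmod (\<psi> t - \<psi> 0) < \<eta>"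
    using \<eta> unfolding continuous_at_eps_delta by (metis diff_zero dist_norm)
  show thesis
  proof (rule that[of "min (e1 / \<rho>) (1 - norm y)" "min r1 \<rho>" y])
    show "min (e1 / \<rho>) (1 - norm y) > 0" using e1 y \<rho> by simp
    show "min r1 \<rho> > 0" using r1 \<rho> by simp
    fix z t assume zy: "norm (z - y) < min (e1 / \<rho>) (1 - norm y)" and t: "t \<noteq> 0" "cmod t < min r1 \<rho>"
    have z: "norm z < 1" using zy norm_triangle_ineq[of "z - y" y] by simp
    obtain \<theta> where \<theta>: "\<theta> holomorphic_on ball 0 R" "\<forall>t\<in>ball 0 R. f (p + t *s z) = t ^ d * \<theta> t"
      using bspec[OF Pd[unfolded P_def], of z] z by auto
    have "cmod (\<theta> t - \<psi> t) \<le> (\<eta> * \<rho> ^ d) / \<rho> ^ d"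
    proof (rule max_modulus_quotient[where R=R and \<psi>="\<lambda>t. \<theta> t - \<psi> t"])
      show "(\<lambda>t. \<theta> t - \<psi> t) holomorphic_on ball 0 R" by (intro holomorphic_on_diff \<theta> \<psi>)
      fix s assume s: "cmod s = \<rho>"
      have "dist (p + s *s z) (p + s *s y) = \<rho> * norm (z - y)"
        using norm_smult[of s "z - y"] s by (simp add: dist_norm)
      also have "\<dots> < e1" using zy \<rho> by (simp add: field_simps)
      finally have "dist (p + s *s z) (p + s *s y) < e1" .
      moreover have "p + s *s w \<in> cball p \<rho>" if "norm w < 1" for w
        using that s \<rho> mult_left_mono[of "norm w" 1 \<rho>] by (simp add: dist_norm norm_smult)
      ultimately have "dist (f (p + s *s z)) (f (p + s *s y)) < \<eta> * \<rho> ^ d" using e1(2) y z by blast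
      then show "cmod (s ^ d * (\<theta> s - \<psi> s)) \<le> \<eta> * \<rho> ^ d"
        using \<theta>(2) \<psi>(2) s \<rho> by (simp add: dist_norm right_diff_distrib)
    qed (use \<rho> t in auto)
    then have 1: "cmod (\<theta> t - \<psi> t) \<le> \<eta>" using \<rho> by simp
    have "\<theta> t \<noteq> 0"
    proof
      assume "\<theta> t = 0"
      then have "cmod (\<psi> t) \<le> \<eta>" using 1 by simp
      moreover have "cmod (\<psi> 0) \<le> cmod (\<psi> t - \<psi> 0) + cmod (\<psi> t)"
        using norm_triangle_sub[of "\<psi> 0" "\<psi> t"] by (simp add: norm_minus_commute)
      ultimately show False using r1(2)[of t] t \<eta> unfolding \<eta>_def by linarith
    qed
    then show "p + t *s z \<in> ball p R \<and> f (p + t *s z) \<noteq> 0"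
      using \<theta>(2) t \<rho> inb[of t z] z by auto
  qed
qed

section \<open>Ordinary differential equations\<close>

text \<open>Picard's operator on the bounded continuous functions on the whole real line, with
  Banach's fixed point theorem. The closest point projection \<open>cp\<close> makes the right-hand
  side globally Lipschitz and bounded, and the clamped time \<open>cl\<close> extends functions by
  constants outside the interval.\<close>

lemma ode_local_existence:
  fixes F :: "'a::euclidean_space \<Rightarrow> 'a"
  assumes R: "R > 0" and L: "\<And>x y. x \<in> cball u0 R \<Longrightarrow> y \<in> cball u0 R \<Longrightarrow> norm (F x - F y) \<le> L * norm (x - y)"
  obtains e u where "e > 0" "u 0 = u0" "\<And>t. t \<in> {0..e} \<Longrightarrow> u t \<in> cball u0 R"
    "\<And>t. t \<in> {0..e} \<Longrightarrow> (u has_vector_derivative F (u t)) (at t within {0..e})"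
proof -
  define L' where "L' = max L 1"
  define cp where "cp = closest_point (cball u0 R)"
  define G where "G x = F (cp x)" for x
  have cp: "cp x \<in> cball u0 R" for x unfolding cp_def using R by (intro closest_point_in_set) auto
  have GL: "norm (G x - G y) \<le> L' * norm (x - y)" for x y
  proof -
    have "norm (G x - G y) \<le> L * norm (cp x - cp y)" unfolding G_def by (intro L cp)
    also have "\<dots> \<le> L' * norm (cp x - cp y)" by (intro mult_right_mono) (auto simp: L'_def)
    also have "\<dots> \<le> L' * norm (x - y)"
      using closest_point_lipschitz[of "cball u0 R" x y] R
      by (intro mult_left_mono) (auto simp: L'_def cp_def dist_norm)
    finally show ?thesis .
  qed
  have contG: "continuous_on UNIV G"
    unfolding continuous_on_iff
  proof (intro ballI allI impI)
    fix x and e :: real assume "e > 0"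
    then show "\<exists>d>0. \<forall>y\<in>UNIV. dist y x < d \<longrightarrow> dist (G y) (G x) < e"
      using GL by (intro exI[where x="e / L'"])
        (auto simp: dist_norm L'_def field_simps intro: le_less_trans)
  qed
  define B where "B = norm (F u0) + L' * R"
  have B: "norm (G x) \<le> B" for x
  proof -
    have "norm (G x - G u0) \<le> L' * norm (cp x - u0)"
    proof -
      have "cp u0 = u0" unfolding cp_def using R by (intro closest_point_self) auto
      moreover have "cp (cp x) = cp x" using cp unfolding cp_def by (intro closest_point_self)
      ultimately show ?thesis using GL[of "cp x" u0] by (simp add: G_def)
    qed
    also have "\<dots> \<le> L' * R" using cp[of x] by (intro mult_left_mono) (auto simp: L'_def dist_norm norm_minus_commute)
    finally have "norm (G x - G u0) \<le> L' * R" .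
    moreover have "G u0 = F u0" unfolding G_def cp_def using R by (subst closest_point_self) auto
    ultimately show ?thesis using norm_triangle_sub[of "G x" "G u0"] by (simp add: B_def)
  qed
  have B0: "B \<ge> 0" using B norm_ge_zero order_trans by blast
  \<comment> \<open>The first bound makes the operator contract by the factor 1/2, the second keeps
    its values in the ball; \<open>B + 1\<close> avoids a division by 0.\<close>
  define e where "e = min (1 / (2 * L')) (R / (B + 1))"
  have e: "e > 0" "e * L' \<le> 1/2" "e * B \<le> R"
  proof -
    show "e > 0" using R B0 by (simp add: e_def L'_def)
    have "e * L' \<le> 1 / (2 * L') * L'" unfolding e_def by (intro mult_right_mono) (auto simp: L'_def)
    then show "e * L' \<le> 1/2" by (simp add: L'_def)
    have "e * B \<le> (R / (B + 1)) * B" unfolding e_def using B0 by (intro mult_right_mono) auto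
    also have "\<dots> \<le> R" using R B0 by (simp add: field_simps)
    finally show "e * B \<le> R" .
  qed
  define cl where "cl t = max 0 (min e t)" for t
  have cl: "cl t \<in> {0..e}" for t using e by (auto simp: cl_def)
  have cl_id: "cl t = t" if "t \<in> {0..e}" for t using that by (auto simp: cl_def)
  define T where "T u t = u0 + integral {0..cl t} (\<lambda>s. G (apply_bcontfun u s))" for u :: "real \<Rightarrow>\<^sub>C 'a" and t
  have cG: "continuous_on X (\<lambda>s. G (apply_bcontfun u s))" for u :: "real \<Rightarrow>\<^sub>C 'a" and X
    by (rule continuous_on_compose2[OF contG]) auto
  have int: "(\<lambda>s. G (apply_bcontfun u s)) integrable_on {0..a}" for u :: "real \<Rightarrow>\<^sub>C 'a" and a
    by (rule integrable_continuous_real[OF cG])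
  have Tbound: "norm (T u t - u0) \<le> R" for u t
  proof -
    have "norm (integral {0..cl t} (\<lambda>s. G (apply_bcontfun u s))) \<le> B * (cl t - 0)"
      using cl[of t] by (intro integral_bound cG B) auto
    also have "\<dots> \<le> B * e" using cl[of t] B0 by (intro mult_left_mono) auto
    also have "\<dots> \<le> R" using e by (simp add: mult.commute)
    finally show ?thesis by (simp add: T_def)
  qed
  have Tder: "(T u has_vector_derivative G (apply_bcontfun u t)) (at t within {0..e})" if t: "t \<in> {0..e}" for u t
  proof -
    have "((\<lambda>t. u0 + integral {0..t} (\<lambda>s. G (apply_bcontfun u s))) has_vector_derivative 0 + G (apply_bcontfun u t)) (at t within {0..e})"
      by (intro has_vector_derivative_add has_vector_derivative_const integral_has_vector_derivative cG t)
    then show ?thesis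
      using has_vector_derivative_transform[OF t, of "T u" "\<lambda>t. u0 + integral {0..t} (\<lambda>s. G (apply_bcontfun u s))"]
      by (simp add: T_def cl_id)
  qed
  have Tcont: "T u \<in> bcontfun" for u
  proof -
    have "continuous_on {0..e} (T u)"
      by (rule continuous_on_vector_derivative[OF Tder])
    moreover have "continuous_on UNIV cl" unfolding cl_def by (intro continuous_intros)
    ultimately have "continuous_on UNIV (\<lambda>t. T u (cl t))"
      by (rule continuous_on_compose2) (use cl in auto)
    moreover have "T u (cl t) = T u t" for t using cl_id[OF cl, of t] by (simp add: T_def)
    ultimately have "continuous_on UNIV (T u)" by simp
    moreover have "norm (T u t) \<le> norm u0 + R" for t
      using Tbound[of u t] norm_triangle_sub[of "T u t" u0] by simp
    ultimately show ?thesis by (rule bcontfun_normI)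
  qed
  define TT where "TT u = Bcontfun (T u)" for u
  have TT: "apply_bcontfun (TT u) = T u" for u unfolding TT_def by (rule Bcontfun_inverse[OF Tcont])
  have "\<forall>u v. dist (TT u) (TT v) \<le> (1/2) * dist u v"
  proof (intro allI dist_bound)
    fix u v t
    have "T u t - T v t = integral {0..cl t} (\<lambda>s. G (apply_bcontfun u s) - G (apply_bcontfun v s))"
      by (simp add: T_def integral_diff int)
    also have "norm \<dots> \<le> (L' * dist u v) * (cl t - 0)"
    proof (rule integral_bound)
      fix s
      have "norm (G (apply_bcontfun u s) - G (apply_bcontfun v s)) \<le> L' * norm (apply_bcontfun u s - apply_bcontfun v s)" by (rule GL)
      also have "\<dots> \<le> L' * dist u v" using dist_bounded[of u s v] by (intro mult_left_mono) (auto simp: dist_norm L'_def)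
      finally show "norm (G (apply_bcontfun u s) - G (apply_bcontfun v s)) \<le> L' * dist u v" .
    qed (use cl[of t] in \<open>auto intro!: continuous_intros cG\<close>)
    also have "\<dots> \<le> (L' * dist u v) * e" using cl[of t] by (intro mult_left_mono) (auto simp: L'_def)
    also have "\<dots> = (e * L') * dist u v" by simp
    also have "\<dots> \<le> (1/2) * dist u v" using e by (intro mult_right_mono) auto
    finally show "dist (apply_bcontfun (TT u) t) (apply_bcontfun (TT v) t) \<le> (1/2) * dist u v"
      by (simp add: TT dist_norm)
  qed
  then obtain u where u: "TT u = u" using banach_fix_type[of "1/2" TT] by auto
  then have ut: "apply_bcontfun u = T u" using TT by metis
  have ball: "apply_bcontfun u t \<in> cball u0 R" for t using Tbound[of u t] ut by (simp add: dist_norm norm_minus_commute)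
  show thesis
  proof (rule that[of e "apply_bcontfun u"])
    show "e > 0" by (rule e)
    have "T u 0 = u0" using cl_id[of 0] e by (simp add: T_def)
    then show "apply_bcontfun u 0 = u0" using ut by metis
    show "apply_bcontfun u t \<in> cball u0 R" for t by (rule ball)
    show "(apply_bcontfun u has_vector_derivative F (apply_bcontfun u t)) (at t within {0..e})" if "t \<in> {0..e}" for t
    proof -
      have "G (apply_bcontfun u t) = F (apply_bcontfun u t)"
        unfolding G_def cp_def by (subst closest_point_self[OF ball]) simp
      then show ?thesis using Tder[OF that, of u] ut by metis
    qed
  qed
qed

text \<open>Gronwall's argument: the squared norm of \<open>w t\<close> multiplied by
  \<open>exp (- 2 K t)\<close> does not increase.\<close>

lemma ode_zero_unique:
  fixes w :: "real \<Rightarrow> 'a::real_inner"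
  assumes d: "\<And>t. t \<in> {0..e} \<Longrightarrow> (w has_vector_derivative w' t) (at t within {0..e})"
    and K: "\<And>t. t \<in> {0..e} \<Longrightarrow> norm (w' t) \<le> K * norm (w t)" and 0: "w 0 = 0" and t: "t \<in> {0..e}"
  shows "w t = 0"
proof -
  define \<phi> where "\<phi> t = (w t \<bullet> w t) * exp (- (2 * K * t))" for t
  have cw: "continuous_on {0..e} w" using d continuous_on_vector_derivative by blast
  have "\<phi> t \<le> \<phi> 0"
  proof (rule DERIV_nonpos_imp_decreasing_open[of 0 t \<phi>])
    show "0 \<le> t" using t by simp
    show "continuous_on {0..t} \<phi>" unfolding \<phi>_def
      by (intro continuous_intros continuous_on_subset[OF cw]) (use t in auto)
    fix s assume s: "0 < s" "s < t"
    have "(w has_vector_derivative w' s) (at s)"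
      using d[of s] s t at_within_interior[of s "{0..e}"] by auto
    then have "((\<lambda>t. w t \<bullet> w t) has_derivative (\<lambda>h. w s \<bullet> (h *\<^sub>R w' s) + (h *\<^sub>R w' s) \<bullet> w s)) (at s)"
      unfolding has_vector_derivative_def by (intro has_derivative_inner)
    then have "((\<lambda>t. w t \<bullet> w t) has_real_derivative (2 * (w s \<bullet> w' s))) (at s)"
      unfolding has_field_derivative_def by (simp add: inner_commute algebra_simps mult_commute_abs)
    then have "(\<phi> has_real_derivative (2 * (w s \<bullet> w' s)) * exp (- (2 * K * s)) + (w s \<bullet> w s) * (exp (- (2 * K * s)) * (- (2 * K)))) (at s)"
      unfolding \<phi>_def by (auto intro!: derivative_eq_intros)
    moreover have "w s \<bullet> w' s \<le> K * (w s \<bullet> w s)"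
    proof -
      have "w s \<bullet> w' s \<le> norm (w s) * norm (w' s)" by (rule norm_cauchy_schwarz)
      also have "\<dots> \<le> norm (w s) * (K * norm (w s))" using K[of s] s t by (intro mult_left_mono) auto
      finally show ?thesis by (simp add: power2_norm_eq_inner[symmetric] power2_eq_square mult_ac)
    qed
    then have "(2 * (w s \<bullet> w' s)) * exp (- (2 * K * s)) + (w s \<bullet> w s) * (exp (- (2 * K * s)) * (- (2 * K))) \<le> 0"
      using mult_right_mono[of "w s \<bullet> w' s" "K * (w s \<bullet> w s)" "exp (- (2 * K * s))"] by (simp add: algebra_simps)
    ultimately show "\<exists>y. (\<phi> has_real_derivative y) (at s) \<and> y \<le> 0" by blast
  qed
  then have "(w t \<bullet> w t) * exp (- (2 * K * t)) \<le> 0" using 0 by (simp add: \<phi>_def)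
  moreover have "w t \<bullet> w t \<ge> 0" "exp (- (2 * K * t)) > 0" by simp_all
  ultimately have "w t \<bullet> w t = 0" by (metis antisym mult_le_0_iff not_less)
  then show ?thesis by simp
qed

section \<open>Meromorphic frames along a complex line\<close>

text \<open>For a commutative product the last condition says that all associators with the element
  of \<open>J\<close> in the middle vanish.\<close>

definition comm_ideal :: "(complex^'n \<Rightarrow> complex^'n \<Rightarrow> complex^'n) \<Rightarrow> (complex^'n) set \<Rightarrow> bool" where
  "comm_ideal \<mu> J \<longleftrightarrow> 0 \<in> J \<and> (\<forall>x\<in>J. \<forall>y\<in>J. x + y \<in> J) \<and> (\<forall>z. \<forall>x\<in>J. z *s x \<in> J) \<and>
     (\<forall>b. \<forall>x\<in>J. \<mu> b x \<in> J) \<and> (\<forall>b c. \<forall>x\<in>J. \<mu> b (\<mu> c x) = \<mu> c (\<mu> b x))"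

section \<open>Functions bounded near an isolated singularity\<close>

definition bdd0 :: "(complex \<Rightarrow> 'a::real_normed_vector) \<Rightarrow> bool" where
  "bdd0 f \<longleftrightarrow> (\<exists>K. \<forall>\<^sub>F t in at 0. norm (f t) \<le> K)"

lemma bdd0I: "\<forall>\<^sub>F t in at 0. norm (f t) \<le> K \<Longrightarrow> bdd0 f"
  unfolding bdd0_def by blast

lemma bdd0_cong: "bdd0 f \<Longrightarrow> \<forall>\<^sub>F t in at 0. f t = g t \<Longrightarrow> bdd0 g"
  unfolding bdd0_def by (elim exE, rule exI) (auto elim: eventually_elim2)

lemma bdd0_mono: "bdd0 f \<Longrightarrow> \<forall>\<^sub>F t in at 0. norm (g t) \<le> K * norm (f t) \<Longrightarrow> bdd0 g"
  unfolding bdd0_def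
proof (elim exE)
  fix B assume "\<forall>\<^sub>F t in at 0. norm (g t) \<le> K * norm (f t)" "\<forall>\<^sub>F t in at 0. norm (f t) \<le> B"
  then have "\<forall>\<^sub>F t in at 0. norm (g t) \<le> \<bar>K\<bar> * B"
  proof eventually_elim
    case (elim t)
    have "K * norm (f t) \<le> \<bar>K\<bar> * norm (f t)" by (intro mult_right_mono) auto
    also have "\<dots> \<le> \<bar>K\<bar> * B" using elim by (intro mult_left_mono) auto
    finally show ?case using elim by linarith
  qed
  then show "\<exists>B. \<forall>\<^sub>F t in at 0. norm (g t) \<le> B" by blast
qed

lemma bdd0_add: "bdd0 f \<Longrightarrow> bdd0 g \<Longrightarrow> bdd0 (\<lambda>t. f t + g t)"
  unfolding bdd0_def
proof (elim exE)
  fix A B assume "\<forall>\<^sub>F t in at 0. norm (f t) \<le> A" "\<forall>\<^sub>F t in at 0. norm (g t) \<le> B"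
  then have "\<forall>\<^sub>F t in at 0. norm (f t + g t) \<le> A + B"
    by eventually_elim (rule norm_triangle_mono)
  then show "\<exists>B. \<forall>\<^sub>F t in at 0. norm (f t + g t) \<le> B" by blast
qed

lemma bdd0_const [simp]: "bdd0 (\<lambda>t. c)"
  by (rule bdd0I[of _ "norm c"]) simp

lemma bdd0_sum: "(\<And>i. i \<in> I \<Longrightarrow> bdd0 (f i)) \<Longrightarrow> bdd0 (\<lambda>t. \<Sum>i\<in>I. f i t)"
  by (induction I rule: infinite_finite_induct) (simp_all add: bdd0_add)

lemma bdd0_minus: "bdd0 f \<Longrightarrow> bdd0 (\<lambda>t. - f t)"
  by (simp add: bdd0_def)

lemma bdd0_diff: "bdd0 f \<Longrightarrow> bdd0 g \<Longrightarrow> bdd0 (\<lambda>t. f t - g t)"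
  using bdd0_add[OF _ bdd0_minus, of f g] by simp

lemma bdd0_smult:
  fixes g :: "complex \<Rightarrow> complex^'n"
  shows "bdd0 f \<Longrightarrow> bdd0 g \<Longrightarrow> bdd0 (\<lambda>t. f t *s g t)"
  unfolding bdd0_def
proof (elim exE)
  fix A B assume "\<forall>\<^sub>F t in at 0. norm (f t) \<le> A" "\<forall>\<^sub>F t in at 0. norm (g t) \<le> B"
  then have "\<forall>\<^sub>F t in at 0. norm (f t *s g t) \<le> \<bar>A\<bar> * \<bar>B\<bar>"
    by eventually_elim (auto simp: norm_smult intro!: mult_mono)
  then show "\<exists>B. \<forall>\<^sub>F t in at 0. norm (f t *s g t) \<le> B" by blast
qed

lemma bdd0_isCont:
  fixes f :: "complex \<Rightarrow> 'a::real_normed_vector"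
  assumes "isCont f 0" shows "bdd0 f"
proof -
  have "((\<lambda>t. norm (f t)) \<longlongrightarrow> norm (f 0)) (at 0)"
    using assms by (intro tendsto_norm) (simp add: continuous_at)
  then have "\<forall>\<^sub>F t in at 0. norm (f t) < norm (f 0) + 1" by (rule order_tendstoD) simp
  then show ?thesis by (intro bdd0I[of _ "norm (f 0) + 1"]) (auto elim: eventually_mono)
qed

lemma bdd0_holomorphic:
  assumes "f holomorphic_on ball 0 r" "r > 0" shows "bdd0 f"
proof -
  have "\<forall>x\<in>ball 0 r. isCont f x"
    using holomorphic_on_imp_continuous_on[OF assms(1)] by (simp add: continuous_on_eq_continuous_at)
  then show ?thesis using assms(2) by (intro bdd0_isCont) simp
qed

lemma bdd0_ident: "bdd0 (\<lambda>t. t)"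
  by (rule bdd0_isCont) (intro continuous_intros)

lemma bdd0_component: "bdd0 f \<Longrightarrow> bdd0 (\<lambda>t. f t $ i)" for f :: "complex \<Rightarrow> complex^'n"
  by (rule bdd0_mono[where K=1]) (auto simp: Finite_Cartesian_Product.norm_nth_le)

lemma bdd0_vec:
  fixes f :: "complex \<Rightarrow> complex^'n"
  assumes "\<And>i. bdd0 (\<lambda>t. f t $ i)" shows "bdd0 f"
proof -
  have "bdd0 (\<lambda>t. \<Sum>i\<in>UNIV. f t $ i *s axis i 1)" by (intro bdd0_sum bdd0_smult assms) simp
  then show ?thesis by (simp only: basis_expansion)
qed

lemma bdd0_tendsto_zero:
  fixes f :: "complex \<Rightarrow> complex^'n"
  assumes "bdd0 f" "m \<ge> (1::nat)"
  shows "((\<lambda>t. t ^ m *s f t) \<longlongrightarrow> 0) (at 0)"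
proof -
  obtain K where K: "\<forall>\<^sub>F t in at 0. norm (f t) \<le> K" using assms(1) unfolding bdd0_def by blast
  have "((\<lambda>t. cmod t ^ m * K) \<longlongrightarrow> cmod 0 ^ m * K) (at 0)" by (intro tendsto_intros)
  then have 0: "((\<lambda>t. cmod t ^ m * K) \<longlongrightarrow> 0) (at 0)" using assms(2) by (simp add: zero_power)
  show ?thesis
    by (rule Lim_null_comparison[OF _ 0])
       (use K in \<open>auto elim!: eventually_mono simp: norm_smult norm_power intro!: mult_left_mono\<close>)
qed

text \<open>A bounded function extends holomorphically over 0, and the derivative of the extension
  is bounded there.\<close>

lemma bdd0_deriv:
  assumes "F holomorphic_on ball 0 r - {0}" "r > 0" "bdd0 F"
  shows "bdd0 (deriv F)"
proof -
  obtain K where "\<forall>\<^sub>F t in at 0. norm (F t) \<le> K" using assms(3) unfolding bdd0_def by blast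
  then obtain H where H: "H holomorphic_on ball 0 r" "\<And>z. z \<in> ball 0 r - {0} \<Longrightarrow> H z = F z"
    using holomorphic_on_extend_bounded[OF assms(1)] assms(2) by (auto simp: interior_open)
  have "deriv H holomorphic_on ball 0 r" using H(1) by (rule holomorphic_deriv) simp
  then have "bdd0 (deriv H)"
    using assms(2) by (rule bdd0_holomorphic)
  moreover have "\<forall>\<^sub>F t in at 0. deriv H t = deriv F t"
  proof -
    have "\<forall>\<^sub>F t in at 0. t \<in> ball 0 r - {0}"
      using assms(2) unfolding eventually_at by (intro exI[where x=r]) (auto simp: dist_commute)
    then show ?thesis
    proof eventually_elim
      case (elim t)
      have "open (ball 0 r - {0::complex})" by auto
      then show ?case using H(2) elim by (intro complex_derivative_transform_within_open[OF holomorphic_on_subset[OF H(1)] assms(1)]) auto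
    qed
  qed
  ultimately show ?thesis by (rule bdd0_cong)
qed

text \<open>The highest coefficient is the value at 0 of the extension of
  \<open>t ^ Suc d * f t\<close>; subtracting its term lowers the pole order by 1.\<close>

lemma principal_part:
  assumes "f holomorphic_on ball 0 r - {0}" "r > 0" "bdd0 (\<lambda>t. t ^ d * f t)"
  shows "\<exists>c :: nat \<Rightarrow> complex. bdd0 (\<lambda>t. f t - (\<Sum>j<d. inverse t ^ Suc j * c j))"
  using assms(1,3)
proof (induction d arbitrary: f)
  case 0
  then show ?case by simp
next
  case (Suc d)
  have "(\<lambda>t. t ^ Suc d * f t) holomorphic_on ball 0 r - {0}"
    by (intro holomorphic_intros Suc.prems)
  moreover obtain K where "\<forall>\<^sub>F t in at 0. norm (t ^ Suc d * f t) \<le> K" using Suc.prems(2) unfolding bdd0_def by blast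
  ultimately obtain H where H: "H holomorphic_on ball 0 r" "\<And>z. z \<in> ball 0 r - {0} \<Longrightarrow> H z = z ^ Suc d * f z"
    using holomorphic_on_extend_bounded[of "\<lambda>t. t ^ Suc d * f t" "ball 0 r" 0] assms(2) by (auto simp: interior_open)
  define f' where "f' t = f t - inverse t ^ Suc d * H 0" for t
  have "f' holomorphic_on ball 0 r - {0}" unfolding f'_def by (intro holomorphic_intros Suc.prems) auto
  moreover have "bdd0 (\<lambda>t. t ^ d * f' t)"
  proof -
    have "(\<lambda>z. if z = 0 then deriv H 0 else (H z - H 0) / (z - 0)) holomorphic_on ball 0 r"
      by (rule pole_lemma_open[OF H(1) open_ball])
    then have "bdd0 (\<lambda>z. if z = 0 then deriv H 0 else (H z - H 0) / (z - 0))"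
      using assms(2) by (rule bdd0_holomorphic)
    then show ?thesis
    proof (rule bdd0_cong)
      have "\<forall>\<^sub>F t in at 0. t \<in> ball 0 r - {0}"
        using assms(2) unfolding eventually_at by (intro exI[where x=r]) (auto simp: dist_commute)
      then show "\<forall>\<^sub>F t in at 0. (if t = 0 then deriv H 0 else (H t - H 0) / (t - 0)) = t ^ d * f' t"
        by eventually_elim (use H(2) in \<open>auto simp: f'_def field_simps\<close>)
    qed
  qed
  ultimately obtain c where c: "bdd0 (\<lambda>t. f' t - (\<Sum>j<d. inverse t ^ Suc j * c j))" using Suc.IH by blast
  show ?case
    by (rule exI[where x="c(d := H 0)"], rule bdd0_cong[OF c]) (simp add: f'_def algebra_simps)
qed

text \<open>\<open>\<gamma> j\<close> is the coefficient of
  \<open>t\<^sup>-\<^sup>j\<^sup>-\<^sup>1\<close>, so \<open>\<gamma> 0\<close> is the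
  residue.\<close>

definition pp :: "nat \<Rightarrow> (nat \<Rightarrow> complex^'n) \<Rightarrow> complex \<Rightarrow> complex^'n" where
  "pp N \<gamma> t = (\<Sum>j<N. inverse t ^ Suc j *s \<gamma> j)"

section \<open>Arithmetic of polar parts\<close>

lemma pp_extend:
  assumes "\<And>j. j \<ge> N \<Longrightarrow> \<gamma> j = 0" "N \<le> M"
  shows "pp M \<gamma> t = pp N \<gamma> t"
  unfolding pp_def using assms by (intro sum.mono_neutral_right) auto

lemma pp_clin: "clin T \<Longrightarrow> T (pp N \<gamma> t) = pp N (\<lambda>j. T (\<gamma> j)) t"
  by (simp add: pp_def clin_sum clin_scale)

text \<open>Because of the index shift, the terms with indices \<open>i\<close> and \<open>j\<close>
  contribute to the index \<open>i + j + 1\<close>. So the product has residue 0, which is what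
  makes \<open>Lm_zero_residue\<close> applicable in \<open>U_curv\<close>.\<close>

lemma pp_product:
  assumes B: "cbil B" and z: "\<And>j. j \<ge> N \<Longrightarrow> \<alpha> j = 0" "\<And>j. j \<ge> M \<Longrightarrow> \<beta> j = 0"
  shows "B (pp N \<alpha> t) (pp M \<beta> t) = pp (Suc (N + M)) (\<lambda>k. case k of 0 \<Rightarrow> 0 | Suc k \<Rightarrow> \<Sum>i\<le>k. B (\<alpha> i) (\<beta> (k - i))) t"
proof -
  let ?z = "inverse t"
  define g where "g i j = ?z ^ Suc (Suc (i + j)) *s B (\<alpha> i) (\<beta> j)" for i j
  have B0: "B 0 y = 0" "B x 0 = 0" for x y
    using clin_zero[OF cbilD(1)[OF B]] clin_zero[OF cbilD(2)[OF B]] by auto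
  have "B (pp N \<alpha> t) (pp M \<beta> t) = (\<Sum>i<N. \<Sum>j<M. g i j)"
    by (simp add: pp_def clin_sum[OF cbilD(1)[OF B]] clin_sum[OF cbilD(2)[OF B]]
        clin_scale[OF cbilD(1)[OF B]] clin_scale[OF cbilD(2)[OF B]] g_def vec.scale_sum_right power_add mult_ac)
       (subst sum.swap, simp add: mult_ac)
  also have "\<dots> = (\<Sum>(i,j)\<in>{..<N} \<times> {..<M}. g i j)" by (simp add: sum.cartesian_product)
  also have "\<dots> = (\<Sum>(i,j)\<in>{(i,j). i + j \<le> N + M}. g i j)"
  proof (rule sum.mono_neutral_left)
    show "finite {(i, j). i + j \<le> N + M}"
      by (rule finite_subset[of _ "{..N+M} \<times> {..N+M}"]) auto
    show "\<forall>p\<in>{(i, j). i + j \<le> N + M} - {..<N} \<times> {..<M}. (case p of (i, j) \<Rightarrow> g i j) = 0"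
    proof
      fix p assume p: "p \<in> {(i, j). i + j \<le> N + M} - {..<N} \<times> {..<M}"
      obtain i j where ij: "p = (i, j)" by (cases p)
      then show "(case p of (i, j) \<Rightarrow> g i j) = 0" using p z(1)[of i] z(2)[of j] B0 by (cases "i < N") (auto simp: g_def)
    qed
  qed auto
  also have "\<dots> = (\<Sum>k\<le>N+M. \<Sum>i\<le>k. g i (k - i))" by (rule sum.triangle_reindex_eq)
  also have "\<dots> = (\<Sum>k<Suc (N+M). ?z ^ Suc (Suc k) *s (\<Sum>i\<le>k. B (\<alpha> i) (\<beta> (k - i))))"
    by (simp add: g_def vec.scale_sum_right lessThan_Suc_atMost)
  also have "\<dots> = pp (Suc (Suc (N + M))) (\<lambda>k. case k of 0 \<Rightarrow> 0 | Suc k \<Rightarrow> \<Sum>i\<le>k. B (\<alpha> i) (\<beta> (k - i))) t"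
    unfolding pp_def by (subst sum.lessThan_Suc_shift) simp
  also have "\<dots> = pp (Suc (N + M)) (\<lambda>k. case k of 0 \<Rightarrow> 0 | Suc k \<Rightarrow> \<Sum>i\<le>k. B (\<alpha> i) (\<beta> (k - i))) t"
  proof (rule pp_extend)
    fix k assume k: "Suc (N + M) \<le> k"
    then obtain l where l: "k = Suc l" "N + M \<le> l" by (cases k) auto
    have "B (\<alpha> i) (\<beta> (l - i)) = 0" if "i \<le> l" for i
      using z(1)[of i] z(2)[of "l - i"] B0 l that by (cases "i \<ge> N") auto
    then show "(case k of 0 \<Rightarrow> 0 | Suc k \<Rightarrow> \<Sum>i\<le>k. B (\<alpha> i) (\<beta> (k - i))) = 0" using l by simp
  qed simp
  finally show ?thesis .
qed

lemma inverse_power_derivative: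
  "(t::complex) \<noteq> 0 \<Longrightarrow> ((\<lambda>t. inverse t ^ Suc j) has_field_derivative - of_nat (Suc j) * inverse t ^ Suc (Suc j)) (at t)"
  using DERIV_power[OF DERIV_inverse[of t], of "Suc j"] by (simp add: algebra_simps)

lemma pp_top: "((\<lambda>t. t ^ Suc m *s pp (Suc m) \<gamma> t) \<longlongrightarrow> \<gamma> m) (at 0)"
proof (rule Lim_transform_eventually)
  show "\<forall>\<^sub>F t in at 0. (\<Sum>j<Suc m. t ^ (m - j) *s \<gamma> j) = t ^ Suc m *s pp (Suc m) \<gamma> t"
    unfolding eventually_at
  proof (intro exI[where x=1] conjI ballI impI)
    fix t :: complex assume "t \<noteq> 0 \<and> dist t 0 < 1"
    then have "t ^ Suc m * inverse t ^ Suc j = t ^ (m - j)" if "j < Suc m" for j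
      using that by (simp add: power_diff field_simps)
    then show "(\<Sum>j<Suc m. t ^ (m - j) *s \<gamma> j) = t ^ Suc m *s pp (Suc m) \<gamma> t"
      unfolding pp_def vec.scale_sum_right vector_smult_assoc by (intro sum.cong) auto
  qed simp
  have "((\<lambda>t. \<Sum>j<Suc m. t ^ (m - j) *s \<gamma> j) \<longlongrightarrow> (\<Sum>j<Suc m. 0 ^ (m - j) *s \<gamma> j)) (at (0::complex))"
    by (intro tendsto_sum bounded_linear.tendsto[OF bounded_linear_smult_left] tendsto_intros)
  moreover have "(\<Sum>j<m. (0::complex) ^ (m - j) *s \<gamma> j) = 0"
    by (rule sum.neutral) (auto simp: zero_power)
  ultimately show "((\<lambda>t. \<Sum>j<Suc m. t ^ (m - j) *s \<gamma> j) \<longlongrightarrow> \<gamma> m) (at 0)" by simp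
qed

lemma pp_add: "pp N (\<lambda>j. \<alpha> j + \<beta> j) t = pp N \<alpha> t + pp N \<beta> t"
  by (simp add: pp_def sum.distrib)

lemma pp_shift: "t \<noteq> 0 \<Longrightarrow> t *s pp (Suc N) \<gamma> t = \<gamma> 0 + pp N (\<lambda>j. \<gamma> (Suc j)) t"
  unfolding pp_def by (subst sum.lessThan_Suc_shift) (simp add: vec.scale_sum_right mult.assoc[symmetric])

text \<open>\<open>G t\<close> is the matrix of a frame at the points of a line in direction \<open>y\<close>, degenerate at \<open>t = 0\<close>
  only. The boundedness conditions express that the constant tensors \<open>x \<mapsto> \<mu> w x\<close> and
  \<open>(x, z) \<mapsto> \<mu> x (\<mu> b z) - \<mu> b (\<mu> x z)\<close> in this frame come from tensors holomorphic at \<open>t = 0\<close>;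
  \<open>cov\<close> says that \<open>\<mu>\<close> describes a holomorphic connection.\<close>

locale line_frame =
  fixes G G' :: "complex \<Rightarrow> complex^'n^'n" and r :: real and y :: "complex^'n"
    and \<mu> :: "complex^'n \<Rightarrow> complex^'n \<Rightarrow> complex^'n"
  assumes r: "r > 0"
    and der: "\<And>t i j. cmod t < r \<Longrightarrow> ((\<lambda>t. G t $ i $ j) has_field_derivative G' t $ i $ j) (at t)"
    and nz: "\<And>t. t \<noteq> 0 \<Longrightarrow> cmod t < r \<Longrightarrow> det (G t) \<noteq> 0"
    and bil: "cbil \<mu>" and sym: "\<And>v w. \<mu> v w = \<mu> w v"
    and mult: "\<And>w. \<exists>K. \<forall>v t. cmod t < r \<longrightarrow> norm (G t *v \<mu> w v) \<le> K * norm (G t *v v)"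
    and curv: "\<And>b. \<exists>K. \<forall>x z t. cmod t < r \<longrightarrow>
        norm (G t *v (\<mu> x (\<mu> b z) - \<mu> b (\<mu> x z))) \<le> K * norm (G t *v x) * norm (G t *v z)"
    and cov: "\<exists>K. \<forall>v t. t \<noteq> 0 \<and> cmod t < r \<longrightarrow>
        norm (G' t *v v - G t *v \<mu> (matrix_inv (G t) *v y) v) \<le> K * norm (G t *v v)"
    and good: "\<And>v. G 0 *v v = 0 \<Longrightarrow> G' 0 *v v = 0 \<Longrightarrow> v = 0"
begin

lemmas \<mu>_add = clin_add[OF cbilD(1)[OF bil]] clin_add[OF cbilD(2)[OF bil]]
lemmas \<mu>_scale = clin_scale[OF cbilD(1)[OF bil]] clin_scale[OF cbilD(2)[OF bil]]
lemmas \<mu>_diff = clin_diff[OF cbilD(1)[OF bil]] clin_diff[OF cbilD(2)[OF bil]]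
lemmas \<mu>_zero = clin_zero[OF cbilD(1)[OF bil]] clin_zero[OF cbilD(2)[OF bil]]

lemma near0: "\<forall>\<^sub>F t in at 0. t \<noteq> 0 \<and> cmod t < r"
  unfolding eventually_at using r by (intro exI[where x=r]) (auto simp: dist_commute)

lemma entries_hol: "(\<lambda>t. G t $ i $ j) holomorphic_on ball 0 r"
  unfolding holomorphic_on_def field_differentiable_def
  by (intro ballI exI) (rule has_field_derivative_at_within[OF der], simp)

lemma entry_cont: "isCont (\<lambda>t. G t $ i $ j) 0"
  by (rule DERIV_isCont[OF der]) (use r in simp)

lemma G_apply: "(G t *v v) $ i = (\<Sum>j\<in>UNIV. G t $ i $ j * v $ j)"
  by (simp add: matrix_vector_mult_def)

lemma G_tendsto: "(f \<longlongrightarrow> v) (at 0) \<Longrightarrow> ((\<lambda>t. G t *v f t) \<longlongrightarrow> G 0 *v v) (at 0)"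
  by (rule vec_tendstoI, unfold G_apply)
     (intro tendsto_sum tendsto_mult tendsto_vec_nth isContD[OF entry_cont])

lemma det_hol:
  fixes H :: "complex \<Rightarrow> complex^'k^'k"
  assumes "\<And>i j. (\<lambda>t. H t $ i $ j) holomorphic_on S"
  shows "(\<lambda>t. det (H t)) holomorphic_on S"
  unfolding det_def by (intro holomorphic_intros assms)

section \<open>Poles of the inverse frame matrix\<close>

lemma inverse_hol: "(\<lambda>t. (matrix_inv (G t) *v X) $ k) holomorphic_on ball 0 r - {0}"
proof (rule holomorphic_transform)
  have e: "(\<lambda>t. (\<chi> i j. if j = k then X $ i else G t $ i $ j) $ i $ j) holomorphic_on ball 0 r" for i j
    by (cases "j = k") (auto intro: entries_hol)
  show "(\<lambda>t. det (\<chi> i j. if j = k then X $ i else G t $ i $ j) / det (G t)) holomorphic_on ball 0 r - {0}"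
    by (intro holomorphic_on_divide holomorphic_on_subset[OF det_hol[OF e]] holomorphic_on_subset[OF det_hol[OF entries_hol]])
       (use nz in auto)
  show "det (\<chi> i j. if j = k then X $ i else G t $ i $ j) / det (G t) = (matrix_inv (G t) *v X) $ k"
    if "t \<in> ball 0 r - {0}" for t
    using nz[of t] that by (simp add: matrix_inv_cramer)
qed

text \<open>By Cramer's rule the only denominator is \<open>det (G t)\<close>, which vanishes at 0
  to a finite order that does not depend on \<open>X\<close>.\<close>

lemma inverse_pole: "\<exists>d. \<forall>X. bdd0 (\<lambda>t. t ^ d *s (matrix_inv (G t) *v X))"
proof -
  \<comment> \<open>The factor \<open>t\<close> gives a function that is 0 at 0 and not constant,
    also if \<open>det (G 0) \<noteq> 0\<close>; so the lower bound for differences of values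
    becomes one for the determinant.\<close>
  have "(\<lambda>t. t * det (G t)) holomorphic_on ball 0 r"
    by (intro holomorphic_intros det_hol entries_hol)
  note hol = this
  have ne: "of_real (r/2) * det (G (of_real (r/2))) \<noteq> 0 * det (G 0)" using nz[of "of_real (r/2)"] r by simp
  obtain k n s where k: "0 < k" "0 < s" "ball 0 s \<subseteq> ball (0::complex) r"
    "\<And>w. w \<in> ball 0 s \<Longrightarrow> k * norm (w - 0) ^ n \<le> norm (w * det (G w) - 0 * det (G 0))"
  proof (rule holomorphic_lower_bound_difference[OF hol open_ball connected_ball _ _ ne])
    show "0 \<in> ball (0::complex) r" "of_real (r/2) \<in> ball (0::complex) r" using r by auto
  qed (rule that)
  have "bdd0 (\<lambda>t. t ^ n *s (matrix_inv (G t) *v X))" for X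
  proof (rule bdd0_vec)
    fix i
    have e: "(\<lambda>t. (\<chi> a b. if b = i then X $ a else G t $ a $ b) $ a $ b) holomorphic_on ball 0 r" for a b
      by (cases "b = i") (auto intro: entries_hol)
    have "bdd0 (\<lambda>t. det (\<chi> a b. if b = i then X $ a else G t $ a $ b))"
      by (rule bdd0_holomorphic[OF det_hol[OF e] r])
    then show "bdd0 (\<lambda>t. (t ^ n *s (matrix_inv (G t) *v X)) $ i)"
    proof (rule bdd0_mono[where K="1 / k"])
      have "\<forall>\<^sub>F t in at 0. t \<noteq> 0 \<and> cmod t < min s 1"
        unfolding eventually_at using k(2) by (intro exI[where x="min s 1"]) auto
      with near0 show "\<forall>\<^sub>F t in at 0. norm ((t ^ n *s (matrix_inv (G t) *v X)) $ i)
           \<le> 1 / k * norm (det (\<chi> a b. if b = i then X $ a else G t $ a $ b))"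
      proof eventually_elim
        case (elim t)
        let ?D = "det (\<chi> a b. if b = i then X $ a else G t $ a $ b)"
        have d: "det (G t) \<noteq> 0" using nz elim by blast
        have "k * cmod t ^ n \<le> cmod t * cmod (det (G t))" using k(4)[of t] elim by (simp add: norm_mult)
        also have "\<dots> \<le> 1 * cmod (det (G t))" using elim by (intro mult_right_mono) auto
        finally have "k * cmod t ^ n \<le> cmod (det (G t))" by simp
        then have "cmod t ^ n / cmod (det (G t)) \<le> 1 / k" using d k(1) by (simp add: field_simps)
        then have "cmod t ^ n / cmod (det (G t)) * cmod ?D \<le> 1 / k * cmod ?D" by (rule mult_right_mono) simp
        then show ?case using d by (simp add: matrix_inv_cramer norm_mult norm_divide norm_power)
      qed
    qed
  qed
  then show ?thesis by blast
qed

definition pdeg :: nat where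
  "pdeg = (SOME d. \<forall>X. bdd0 (\<lambda>t. t ^ d *s (matrix_inv (G t) *v X)))"

lemma pdeg: "bdd0 (\<lambda>t. t ^ pdeg *s (matrix_inv (G t) *v X))"
  unfolding pdeg_def using someI_ex[OF inverse_pole] by blast

lemma inverse_principal_part:
  "\<exists>\<gamma>. (\<forall>j\<ge>pdeg. \<gamma> j = 0) \<and> bdd0 (\<lambda>t. matrix_inv (G t) *v X - pp pdeg \<gamma> t)"
proof -
  have "\<exists>c :: nat \<Rightarrow> complex. bdd0 (\<lambda>t. (matrix_inv (G t) *v X) $ i - (\<Sum>j<pdeg. inverse t ^ Suc j * c j))" for i
    by (rule principal_part[OF inverse_hol r]) (use bdd0_component[OF pdeg[of X], of i] in simp)
  then have "\<exists>c. \<forall>i. bdd0 (\<lambda>t. (matrix_inv (G t) *v X) $ i - (\<Sum>j<pdeg. inverse t ^ Suc j * c i j))"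
    by (intro choice allI)
  then obtain c where c: "\<And>i. bdd0 (\<lambda>t. (matrix_inv (G t) *v X) $ i - (\<Sum>j<pdeg. inverse t ^ Suc j * c i j))" by blast
  show ?thesis
    by (rule exI[where x="\<lambda>j. if j < pdeg then \<chi> i. c i j else 0"]) (use c in \<open>auto intro!: bdd0_vec simp: pp_def sum_component simp del: power_Suc\<close>)
qed

text \<open>The polar combinations of the frame fields that have bounded values. By
  \<open>LmD\<close> every bound of the support may be taken for \<open>N\<close>, and by
  \<open>Lm_support\<close> the number \<open>pdeg\<close> is one for all members.\<close>

definition Lm :: "(nat \<Rightarrow> complex^'n) set" where
  "Lm = {\<gamma>. \<exists>N. (\<forall>j\<ge>N. \<gamma> j = 0) \<and> bdd0 (\<lambda>t. G t *v pp N \<gamma> t)}"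

section \<open>Operations on polar combinations with bounded values\<close>

lemma LmI: "(\<And>j. j \<ge> N \<Longrightarrow> \<gamma> j = 0) \<Longrightarrow> bdd0 (\<lambda>t. G t *v pp N \<gamma> t) \<Longrightarrow> \<gamma> \<in> Lm"
  unfolding Lm_def by blast

lemma pp_cong_support:
  assumes "\<And>j. j \<ge> N \<Longrightarrow> \<gamma> j = 0" "\<And>j. j \<ge> M \<Longrightarrow> \<gamma> j = 0"
  shows "pp M \<gamma> t = pp N \<gamma> t"
  using pp_extend[of N \<gamma> "max N M" t] pp_extend[of M \<gamma> "max N M" t] assms by simp

lemma LmD:
  assumes "\<gamma> \<in> Lm" "\<And>j. j \<ge> M \<Longrightarrow> \<gamma> j = 0"
  shows "bdd0 (\<lambda>t. G t *v pp M \<gamma> t)"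
proof -
  obtain N where N: "\<forall>j\<ge>N. \<gamma> j = 0" "bdd0 (\<lambda>t. G t *v pp N \<gamma> t)" using assms(1) unfolding Lm_def by blast
  then show ?thesis using pp_cong_support[of N \<gamma> M] assms(2) by simp
qed

lemma G_bounded: "bdd0 f \<Longrightarrow> bdd0 (\<lambda>t. G t *v f t)"
proof (rule bdd0_vec, unfold G_apply, rule bdd0_sum)
  fix i j assume f: "bdd0 f"
  have "bdd0 (\<lambda>t. G t $ i $ j *s (\<chi> _::unit. f t $ j))"
    by (rule bdd0_smult[OF bdd0_isCont[OF entry_cont]], rule bdd0_vec) (simp add: bdd0_component[OF f])
  from bdd0_component[OF this, of "()"] show "bdd0 (\<lambda>t. G t $ i $ j * f t $ j)" by simp
qed

text \<open>A polar combination is the inverse matrix applied to its bounded value, so its pole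
  order is at most that of the inverse.\<close>

lemma Lm_support:
  assumes "\<gamma> \<in> Lm" "j \<ge> pdeg" shows "\<gamma> j = 0"
proof (rule ccontr)
  assume nzj: "\<gamma> j \<noteq> 0"
  obtain N where N: "\<forall>j\<ge>N. \<gamma> j = 0" "bdd0 (\<lambda>t. G t *v pp N \<gamma> t)" using assms(1) unfolding Lm_def by blast
  have fin: "finite {j. \<gamma> j \<noteq> 0}" by (rule finite_subset[of _ "{..<N}"]) (use N(1) in \<open>auto simp: not_le[symmetric]\<close>)
  define m where "m = Max {j. \<gamma> j \<noteq> 0}"
  have m: "\<gamma> m \<noteq> 0" "j \<le> m" using Max_in[OF fin] Max_ge[OF fin] nzj by (auto simp: m_def)
  have sup: "\<gamma> i = 0" if "i \<ge> Suc m" for i using Max_ge[OF fin, of i] that by (force simp: m_def)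
  have b: "bdd0 (\<lambda>t. G t *v pp (Suc m) \<gamma> t)" by (rule LmD[OF assms(1) sup])
  have "bdd0 (\<lambda>t. \<Sum>k\<in>UNIV. (G t *v pp (Suc m) \<gamma> t) $ k *s (t ^ pdeg *s (matrix_inv (G t) *v axis k 1)))"
    by (intro bdd0_sum bdd0_smult bdd0_component[OF b] pdeg)
  then have "bdd0 (\<lambda>t. t ^ pdeg *s pp (Suc m) \<gamma> t)"
  proof (rule bdd0_cong)
    show "\<forall>\<^sub>F t in at 0. (\<Sum>k\<in>UNIV. (G t *v pp (Suc m) \<gamma> t) $ k *s (t ^ pdeg *s (matrix_inv (G t) *v axis k 1))) = t ^ pdeg *s pp (Suc m) \<gamma> t"
      using near0
    proof eventually_elim
      case (elim t)
      have "pp (Suc m) \<gamma> t = (\<Sum>k\<in>UNIV. (G t *v pp (Suc m) \<gamma> t) $ k *s (matrix_inv (G t) *v axis k 1))"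
        using clin_expand[OF clin_matrix, of "matrix_inv (G t)" "G t *v pp (Suc m) \<gamma> t"] matrix_inv_cancel(2)[OF nz] elim by simp
      then have "t ^ pdeg *s pp (Suc m) \<gamma> t = t ^ pdeg *s (\<Sum>k\<in>UNIV. (G t *v pp (Suc m) \<gamma> t) $ k *s (matrix_inv (G t) *v axis k 1))" by simp
      then show ?case by (simp add: vec.scale_sum_right mult.commute)
    qed
  qed
  then have "((\<lambda>t. t ^ Suc (m - pdeg) *s (t ^ pdeg *s pp (Suc m) \<gamma> t)) \<longlongrightarrow> 0) (at 0)"
    by (rule bdd0_tendsto_zero) simp
  moreover have "t ^ Suc (m - pdeg) *s (t ^ pdeg *s v) = t ^ Suc m *s v" for t :: complex and v :: "complex^'n"
    using assms(2) m(2) by (simp add: power_add[symmetric])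
  ultimately have "((\<lambda>t. t ^ Suc m *s pp (Suc m) \<gamma> t) \<longlongrightarrow> 0) (at 0)" by (simp only:)
  then show False using pp_top[of m \<gamma>] m(1) LIM_unique by blast
qed

lemma Lm_bdd: "\<gamma> \<in> Lm \<Longrightarrow> bdd0 (\<lambda>t. G t *v pp pdeg \<gamma> t)"
  by (rule LmD) (simp_all add: Lm_support)

lemma Lm_add: "\<alpha> \<in> Lm \<Longrightarrow> \<beta> \<in> Lm \<Longrightarrow> (\<lambda>j. \<alpha> j + \<beta> j) \<in> Lm"
  by (rule LmI[where N=pdeg])
     (simp_all add: Lm_support pp_add matrix_vector_right_distrib bdd0_add Lm_bdd)

lemma Lm_map:
  assumes "\<gamma> \<in> Lm" "clin T" "\<And>f. bdd0 (\<lambda>t. G t *v f t) \<Longrightarrow> bdd0 (\<lambda>t. G t *v T (f t))"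
  shows "(\<lambda>j. T (\<gamma> j)) \<in> Lm"
  using assms(3)[OF Lm_bdd[OF assms(1)]]
  by (intro LmI[where N=pdeg]) (simp_all add: Lm_support[OF assms(1)] clin_zero[OF assms(2)] pp_clin[OF assms(2)])

lemma mult_bdd:
  assumes "bdd0 (\<lambda>t. G t *v f t)" shows "bdd0 (\<lambda>t. G t *v \<mu> w (f t))"
proof -
  obtain K where K: "\<And>v t. cmod t < r \<Longrightarrow> norm (G t *v \<mu> w v) \<le> K * norm (G t *v v)" using mult by blast
  show ?thesis
    by (rule bdd0_mono[OF assms, of _ K]) (use near0 K in \<open>auto elim: eventually_mono\<close>)
qed

lemma Lm_mult: "\<gamma> \<in> Lm \<Longrightarrow> (\<lambda>j. \<mu> w (\<gamma> j)) \<in> Lm"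
  by (rule Lm_map) (auto intro: cbilD(1)[OF bil] mult_bdd)

lemma Lm_scale: "\<gamma> \<in> Lm \<Longrightarrow> (\<lambda>j. z *s \<gamma> j) \<in> Lm"
  by (rule Lm_map[of _ "\<lambda>v. z *s v"]) (auto intro!: clin_smult_map bdd0_smult simp: vector_scalar_commute)

lemma Lm_shift: assumes "\<gamma> \<in> Lm" shows "(\<lambda>j. \<gamma> (Suc j)) \<in> Lm"
proof (rule LmI)
  show "\<gamma> (Suc j) = 0" if "j \<ge> pdeg" for j using Lm_support[OF assms] that by simp
  have "bdd0 (\<lambda>t. G t *v pp (Suc pdeg) \<gamma> t)" by (rule LmD[OF assms]) (simp add: Lm_support[OF assms])
  then have "bdd0 (\<lambda>t. t *s (G t *v pp (Suc pdeg) \<gamma> t) - G t *v \<gamma> 0)"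
    by (rule bdd0_diff[OF bdd0_smult[OF bdd0_ident] G_bounded[OF bdd0_const]])
  then show "bdd0 (\<lambda>t. G t *v pp pdeg (\<lambda>j. \<gamma> (Suc j)) t)"
  proof (rule bdd0_cong)
    show "\<forall>\<^sub>F t in at 0. t *s (G t *v pp (Suc pdeg) \<gamma> t) - G t *v \<gamma> 0 = G t *v pp pdeg (\<lambda>j. \<gamma> (Suc j)) t"
      using near0
    proof eventually_elim
      case (elim t)
      have "t *s (G t *v pp (Suc pdeg) \<gamma> t) = G t *v (\<gamma> 0 + pp pdeg (\<lambda>j. \<gamma> (Suc j)) t)"
        using elim by (simp add: pp_shift vector_scalar_commute[symmetric])
      then show ?case by (simp add: matrix_vector_right_distrib)
    qed
  qed
qed

text \<open>The polar part of the coefficients of the direction \<open>y\<close> in the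
  frame.\<close>

definition gg :: "nat \<Rightarrow> complex^'n" where
  "gg = (SOME \<gamma>. (\<forall>j\<ge>pdeg. \<gamma> j = 0) \<and> bdd0 (\<lambda>t. matrix_inv (G t) *v y - pp pdeg \<gamma> t))"

lemma gg: "j \<ge> pdeg \<Longrightarrow> gg j = 0" "bdd0 (\<lambda>t. matrix_inv (G t) *v y - pp pdeg gg t)"
  using someI_ex[OF inverse_principal_part[of y]] unfolding gg_def[symmetric] by auto

text \<open>\<open>G\<close> maps the inverse applied to \<open>X\<close> to the constant
  \<open>X\<close>, and the difference from the polar part to a bounded function.\<close>

lemma principal_part_Lm:
  assumes "\<And>j. j \<ge> pdeg \<Longrightarrow> \<gamma> j = 0" "bdd0 (\<lambda>t. matrix_inv (G t) *v X - pp pdeg \<gamma> t)"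
  shows "\<gamma> \<in> Lm"
proof (rule LmI[OF assms(1)])
  have "bdd0 (\<lambda>t. X - G t *v (matrix_inv (G t) *v X - pp pdeg \<gamma> t))"
    by (intro bdd0_diff bdd0_const G_bounded assms(2))
  then show "bdd0 (\<lambda>t. G t *v pp pdeg \<gamma> t)"
    by (rule bdd0_cong)
       (use near0 in \<open>auto elim!: eventually_mono simp: matrix_vector_mult_diff_distrib matrix_inv_cancel(1)[OF nz]\<close>)
qed simp

text \<open>The polar covariant derivative along the line,
  \<open>P' + \<mu> (pp pdeg gg t) P\<close>. Differentiation and the product both raise the index
  by 1, hence the value 0 at index 0.\<close>

definition \<delta> :: "(nat \<Rightarrow> complex^'n) \<Rightarrow> nat \<Rightarrow> complex^'n" where
  "\<delta> \<gamma> k = (case k of 0 \<Rightarrow> 0 | Suc k \<Rightarrow> - of_nat (Suc k) *s \<gamma> k + (\<Sum>i\<le>k. \<mu> (gg i) (\<gamma> (k - i))))"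

text \<open>\<open>G P\<close> is bounded, and so is its derivative \<open>G' P + G P'\<close>. By
  \<open>cov\<close>, \<open>G' P\<close> may be replaced by
  \<open>G (\<mu> (G\<^sup>-\<^sup>1 y) P)\<close>, and by \<open>mult\<close> the bounded part of
  \<open>G\<^sup>-\<^sup>1 y\<close> contributes a bounded term only.\<close>

lemma Lm_delta: assumes \<gamma>: "\<gamma> \<in> Lm" shows "\<delta> \<gamma> \<in> Lm"
proof (rule LmI[where N="Suc (pdeg + pdeg)"])
  note sup = Lm_support[OF \<gamma>]
  show "\<delta> \<gamma> k = 0" if k: "k \<ge> Suc (pdeg + pdeg)" for k
  proof -
    obtain l where l: "k = Suc l" "pdeg + pdeg \<le> l" using k by (cases k) auto
    have "\<mu> (gg i) (\<gamma> (l - i)) = 0" if "i \<le> l" for i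
      using gg(1)[of i] sup[of "l - i"] l that by (cases "i \<ge> pdeg") (auto simp: \<mu>_zero)
    then show ?thesis using l sup by (simp add: \<delta>_def)
  qed
  define N where "N = pdeg"
  define P where "P = pp N \<gamma>"
  define D where "D t = (\<Sum>j<N. (- of_nat (Suc j) * inverse t ^ Suc (Suc j)) *s \<gamma> j)" for t :: complex
  have bP: "bdd0 (\<lambda>t. G t *v P t)" unfolding P_def N_def by (rule Lm_bdd[OF \<gamma>])
  have dP: "((\<lambda>t. P t $ j) has_field_derivative D t $ j) (at t)" if "t \<noteq> 0" for t j
    unfolding P_def pp_def D_def sum_component vector_smult_component
    by (intro DERIV_sum DERIV_cmult_right inverse_power_derivative that)
  have dF: "((\<lambda>t. (G t *v P t) $ i) has_field_derivative (G' t *v P t + G t *v D t) $ i) (at t)"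
    if "t \<noteq> 0" "cmod t < r" for t i
  proof -
    have "((\<lambda>t. \<Sum>j\<in>UNIV. G t $ i $ j * P t $ j) has_field_derivative
        (\<Sum>j\<in>UNIV. G' t $ i $ j * P t $ j + D t $ j * G t $ i $ j)) (at t)"
      by (intro DERIV_sum DERIV_mult der dP that)
    then show ?thesis unfolding G_apply
      by (simp add: matrix_vector_mult_def sum.distrib mult.commute)
  qed
  have "bdd0 (\<lambda>t. G' t *v P t + G t *v D t)"
  proof (rule bdd0_vec)
    fix i
    have "(\<lambda>t. (G t *v P t) $ i) holomorphic_on ball 0 r - {0}"
      unfolding holomorphic_on_def field_differentiable_def
      by (intro ballI exI) (rule has_field_derivative_at_within[OF dF], auto)
    from bdd0_deriv[OF this r bdd0_component[OF bP]]
    show "bdd0 (\<lambda>t. (G' t *v P t + G t *v D t) $ i)"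
      by (rule bdd0_cong, intro eventually_mono[OF near0] DERIV_imp_deriv dF) auto
  qed
  moreover obtain K where K: "\<And>v t. t \<noteq> 0 \<Longrightarrow> cmod t < r \<Longrightarrow>
        norm (G' t *v v - G t *v \<mu> (matrix_inv (G t) *v y) v) \<le> K * norm (G t *v v)" using cov by blast
  have "bdd0 (\<lambda>t. G' t *v P t - G t *v \<mu> (matrix_inv (G t) *v y) (P t))"
    by (rule bdd0_mono[OF bP, of _ K]) (use near0 K in \<open>auto elim: eventually_mono\<close>)
  moreover have "bdd0 (\<lambda>t. G t *v \<mu> (matrix_inv (G t) *v y - pp pdeg gg t) (P t))"
  proof -
    have "G t *v \<mu> h v = (\<Sum>k\<in>UNIV. h $ k *s (G t *v \<mu> (axis k 1) v))" for t h v
      using clin_expand[OF clin_compose[OF clin_matrix cbilD(2)[OF bil]]] by blast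
    then have eq: "(\<lambda>t. G t *v \<mu> (matrix_inv (G t) *v y - pp pdeg gg t) (P t)) =
        (\<lambda>t. \<Sum>k\<in>UNIV. (matrix_inv (G t) *v y - pp pdeg gg t) $ k *s (G t *v \<mu> (axis k 1) (P t)))"
      by (intro ext)
    show ?thesis
      unfolding eq by (intro bdd0_sum bdd0_smult bdd0_component[OF gg(2)] mult_bdd bP)
  qed
  ultimately have "bdd0 (\<lambda>t. (G' t *v P t + G t *v D t) - (G' t *v P t - G t *v \<mu> (matrix_inv (G t) *v y) (P t))
     - G t *v \<mu> (matrix_inv (G t) *v y - pp pdeg gg t) (P t))" by - (rule bdd0_diff[OF bdd0_diff])
  then have "bdd0 (\<lambda>t. G t *v (D t + \<mu> (pp pdeg gg t) (P t)))"
    by (simp add: \<mu>_diff matrix_vector_right_distrib matrix_vector_mult_diff_distrib algebra_simps)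
  moreover have "D t + \<mu> (pp pdeg gg t) (P t) = pp (Suc (pdeg + pdeg)) (\<delta> \<gamma>) t" for t
  proof -
    have "D t = pp (Suc N) (\<lambda>k. case k of 0 \<Rightarrow> 0 | Suc k \<Rightarrow> - of_nat (Suc k) *s \<gamma> k) t"
      unfolding pp_def D_def by (subst sum.lessThan_Suc_shift) (simp add: vector_smult_assoc mult_ac del: of_nat_Suc vector_sub_rdistrib vector_sadd_rdistrib)
    also have "\<dots> = pp (Suc (pdeg + pdeg)) (\<lambda>k. case k of 0 \<Rightarrow> 0 | Suc k \<Rightarrow> - of_nat (Suc k) *s \<gamma> k) t"
      by (rule pp_extend[symmetric]) (auto simp: N_def sup split: nat.split)
    finally have 1: "D t = \<dots>" .
    have 2: "\<mu> (pp pdeg gg t) (P t) = pp (Suc (pdeg + pdeg)) (\<lambda>k. case k of 0 \<Rightarrow> 0 | Suc k \<Rightarrow> \<Sum>i\<le>k. \<mu> (gg i) (\<gamma> (k - i))) t"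
      unfolding P_def N_def by (rule pp_product[OF bil gg(1) sup])
    show ?thesis unfolding 1 2 pp_add[symmetric]
      by (rule arg_cong[where f="\<lambda>\<gamma>. pp _ \<gamma> t"]) (auto simp: \<delta>_def fun_eq_iff split: nat.split)
  qed
  ultimately show "bdd0 (\<lambda>t. G t *v pp (Suc (pdeg + pdeg)) (\<delta> \<gamma>) t)" by simp
qed

section \<open>The residue of the direction acts unipotently\<close>

lemma Lm_top:
  assumes "\<gamma> \<in> Lm" "\<And>j. j \<ge> Suc m \<Longrightarrow> \<gamma> j = 0" shows "G 0 *v \<gamma> m = 0"
proof -
  have "((\<lambda>t. t ^ Suc m *s (G t *v pp (Suc m) \<gamma> t)) \<longlongrightarrow> 0) (at 0)"
    by (rule bdd0_tendsto_zero[OF LmD[OF assms]]) simp_all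
  moreover have "((\<lambda>t. G t *v (t ^ Suc m *s pp (Suc m) \<gamma> t)) \<longlongrightarrow> G 0 *v \<gamma> m) (at 0)"
    by (rule G_tendsto[OF pp_top])
  ultimately show ?thesis using LIM_unique by (simp add: vector_scalar_commute) blast
qed

lemma kernel_ideal: assumes "G 0 *v v = 0" shows "G 0 *v \<mu> w v = 0"
proof -
  obtain K where "norm (G 0 *v \<mu> w v) \<le> K * norm (G 0 *v v)" using mult[of w] r by force
  then show ?thesis using assms by simp
qed

lemma kernel_quotient:
  assumes "G 0 *v v = 0" shows "((\<lambda>t. inverse t *s (G t *v v)) \<longlongrightarrow> G' 0 *v v) (at 0)"
proof (rule vec_tendstoI)
  fix i
  have "((\<lambda>t. (G t *v v) $ i) has_field_derivative (G' 0 *v v) $ i) (at 0)"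
  proof -
    have "((\<lambda>t. \<Sum>j\<in>UNIV. G t $ i $ j * v $ j) has_field_derivative (\<Sum>j\<in>UNIV. G' 0 $ i $ j * v $ j)) (at 0)"
      by (intro DERIV_sum DERIV_cmult_right der) (use r in simp)
    then show ?thesis unfolding G_apply by (simp add: matrix_vector_mult_def)
  qed
  then have "((\<lambda>t. ((G t *v v) $ i - (G 0 *v v) $ i) / (t - 0)) \<longlongrightarrow> (G' 0 *v v) $ i) (at 0)"
    by (simp only: has_field_derivative_iff)
  then show "((\<lambda>t. (inverse t *s (G t *v v)) $ i) \<longlongrightarrow> (G' 0 *v v) $ i) (at 0)"
    using assms by (simp add: field_simps)
qed

text \<open>The values \<open>G t *v v\<close> divided by \<open>t\<close> converge to
  \<open>G' 0 *v v\<close>.\<close>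

lemma kernel_Lm: assumes "G 0 *v v = 0" shows "(\<lambda>j. if j = 0 then v else 0) \<in> Lm"
proof (rule LmI[where N=1])
  have "((\<lambda>t. norm (inverse t *s (G t *v v))) \<longlongrightarrow> norm (G' 0 *v v)) (at 0)"
    by (intro tendsto_norm kernel_quotient assms)
  then have "\<forall>\<^sub>F t in at 0. norm (inverse t *s (G t *v v)) < norm (G' 0 *v v) + 1" by (rule order_tendstoD) simp
  then have "bdd0 (\<lambda>t. inverse t *s (G t *v v))"
    by (intro bdd0I[of _ "norm (G' 0 *v v) + 1"]) (auto elim: eventually_mono)
  then show "bdd0 (\<lambda>t. G t *v pp 1 (\<lambda>j. if j = 0 then v else 0) t)"
    by (simp add: pp_def vector_scalar_commute)
qed simp

text \<open>For a pole of order \<open>m + 1 \<ge> 2\<close> the value multiplied by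
  \<open>t ^ m\<close> tends to 0, but also to \<open>G' 0 *v \<gamma> m\<close>. Then
  \<open>good\<close> excludes \<open>\<gamma> m \<noteq> 0\<close>; this is where the choice of the
  direction enters.\<close>

lemma kernel_valued_Lm:
  assumes "\<gamma> \<in> Lm" "\<And>j. G 0 *v \<gamma> j = 0" "k \<ge> 1" shows "\<gamma> k = 0"
proof (rule ccontr)
  assume nzk: "\<gamma> k \<noteq> 0"
  have fin: "finite {j. \<gamma> j \<noteq> 0}"
    by (rule finite_subset[of _ "{..<pdeg}"]) (use Lm_support[OF assms(1)] in \<open>auto simp: not_le[symmetric]\<close>)
  define m where "m = Max {j. \<gamma> j \<noteq> 0}"
  have m: "\<gamma> m \<noteq> 0" "k \<le> m" using Max_in[OF fin] Max_ge[OF fin] nzk by (auto simp: m_def)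
  have sup: "\<gamma> i = 0" if "i \<ge> Suc m" for i using Max_ge[OF fin, of i] that by (force simp: m_def)
  have b: "bdd0 (\<lambda>t. G t *v pp (Suc m) \<gamma> t)" by (rule LmD[OF assms(1) sup])
  have "((\<lambda>t. t ^ m *s (G t *v pp (Suc m) \<gamma> t)) \<longlongrightarrow> 0) (at 0)"
    by (rule bdd0_tendsto_zero[OF b]) (use assms(3) m in simp)
  moreover have "((\<lambda>t. t ^ m *s (G t *v pp (Suc m) \<gamma> t)) \<longlongrightarrow> G' 0 *v \<gamma> m) (at 0)"
  proof (rule Lim_transform_eventually)
    have "((\<lambda>t. \<Sum>j<Suc m. t ^ (m - j) *s (inverse t *s (G t *v \<gamma> j))) \<longlongrightarrow> (\<Sum>j<Suc m. 0 ^ (m - j) *s (G' 0 *v \<gamma> j))) (at 0)"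
    proof (rule tendsto_sum)
      fix j
      show "((\<lambda>t. t ^ (m - j) *s (inverse t *s (G t *v \<gamma> j))) \<longlongrightarrow> 0 ^ (m - j) *s (G' 0 *v \<gamma> j)) (at 0)"
        by (rule vec_tendstoI, unfold vector_smult_component[of "_ ^ _"])
           (intro tendsto_mult tendsto_power tendsto_ident_at tendsto_vec_nth kernel_quotient assms(2))
    qed
    moreover have "(\<Sum>j<m. (0::complex) ^ (m - j) *s (G' 0 *v \<gamma> j)) = 0"
      by (rule sum.neutral) (auto simp: zero_power)
    ultimately show "((\<lambda>t. \<Sum>j<Suc m. t ^ (m - j) *s (inverse t *s (G t *v \<gamma> j))) \<longlongrightarrow> G' 0 *v \<gamma> m) (at 0)" by simp
    show "\<forall>\<^sub>F t in at 0. (\<Sum>j<Suc m. t ^ (m - j) *s (inverse t *s (G t *v \<gamma> j))) = t ^ m *s (G t *v pp (Suc m) \<gamma> t)"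
      using near0
    proof eventually_elim
      case (elim t)
      then have "t ^ m * inverse t ^ Suc j = t ^ (m - j) * inverse t" if "j < Suc m" for j
        using that by (simp add: power_diff field_simps)
      then show ?case unfolding pp_def clin_sum[OF clin_matrix] clin_scale[OF clin_matrix] vec.scale_sum_right vector_smult_assoc
        by (intro sum.cong) auto
    qed
  qed
  ultimately have "G' 0 *v \<gamma> m = 0" using LIM_unique by blast
  then show False using good assms(2) m(1) by blast
qed

text \<open>Differentiate \<open>v / t\<close>: the coefficient of \<open>t\<^sup>-\<^sup>2\<close>
  is \<open>\<mu> (gg 0) v - v\<close>. The kernel of \<open>G 0\<close> is an ideal, so all
  coefficients of the derivative lie in it, and \<open>kernel_valued_Lm\<close> leaves at most a
  simple pole.\<close>

lemma residue_unit_on_kernel: assumes "G 0 *v v = 0" shows "\<mu> (gg 0) v = v"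
proof -
  define \<gamma> where "\<gamma> = (\<lambda>j::nat. if j = 0 then v else 0)"
  have \<gamma>: "\<gamma> \<in> Lm" unfolding \<gamma>_def by (rule kernel_Lm[OF assms])
  have d: "\<delta> \<gamma> (Suc k) = - of_nat (Suc k) *s \<gamma> k + \<mu> (gg k) v" for k
  proof -
    have "(\<Sum>i\<le>k. \<mu> (gg i) (\<gamma> (k - i))) = (\<Sum>i\<le>k. if i = k then \<mu> (gg k) v else 0)"
      by (rule sum.cong) (auto simp: \<gamma>_def \<mu>_zero)
    then show ?thesis by (simp add: \<delta>_def)
  qed
  have "G 0 *v \<delta> \<gamma> j = 0" for j
  proof (cases j)
    case (Suc k)
    have "G 0 *v \<gamma> k = 0" by (simp add: \<gamma>_def assms)
    then show ?thesis
      using kernel_ideal[OF assms, of "gg k"] Suc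
      by (simp add: d clin_diff[OF clin_matrix] clin_scale[OF clin_matrix] del: of_nat_Suc)
  qed (simp add: \<delta>_def)
  from kernel_valued_Lm[OF Lm_delta[OF \<gamma>] this, of 1]
  have "- of_nat (Suc 0) *s \<gamma> 0 + \<mu> (gg 0) v = 0" using d[of 0] by simp
  then show ?thesis by (simp add: \<gamma>_def)
qed

definition T1 :: "complex^'n \<Rightarrow> complex^'n" where "T1 x = \<mu> (gg 0) x - x"

lemma T1_clin: "clin T1"
  unfolding T1_def by (intro clin_diff_map cbilD(1)[OF bil] clin_ident)

text \<open>The top coefficient lies in the kernel of \<open>G 0\<close>, where \<open>T1\<close>
  vanishes, so each application of \<open>T1\<close> lowers the pole order.\<close>

lemma Lm_unipotent:
  "\<gamma> \<in> Lm \<Longrightarrow> (\<And>j. j \<ge> N \<Longrightarrow> \<gamma> j = 0) \<Longrightarrow> (T1 ^^ N) (\<gamma> j) = 0"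
proof (induction N arbitrary: \<gamma>)
  case 0
  then show ?case by simp
next
  case (Suc m)
  have "(\<lambda>j. T1 (\<gamma> j)) \<in> Lm"
    using Lm_add[OF Lm_mult[OF Suc.prems(1), of "gg 0"] Lm_scale[OF Suc.prems(1), of "-1"]] by (simp add: T1_def)
  moreover have "T1 (\<gamma> j) = 0" if "j \<ge> m" for j
  proof (cases "j = m")
    case True
    then show ?thesis using residue_unit_on_kernel[OF Lm_top[OF Suc.prems]] by (simp add: T1_def)
  next
    case False
    then show ?thesis using Suc.prems(2)[of j] that clin_zero[OF T1_clin] by simp
  qed
  ultimately have "(T1 ^^ m) (T1 (\<gamma> j)) = 0" by (rule Suc.IH)
  then show ?case by (simp add: funpow_swap1)
qed

text \<open>The nilpotent \<open>T1\<close> multiplies this coefficient by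
  \<open>c - 1\<close>.\<close>

lemma Lm_eigenvalue:
  assumes "\<gamma> \<in> Lm" "\<mu> (gg 0) (\<gamma> j) = c *s \<gamma> j" "c \<noteq> 1" shows "\<gamma> j = 0"
proof -
  have "(T1 ^^ k) (\<gamma> j) = (c - 1) ^ k *s \<gamma> j" for k
  proof (induction k)
    case (Suc k)
    have "(T1 ^^ Suc k) (\<gamma> j) = (c - 1) ^ k *s T1 (\<gamma> j)" using Suc by (simp add: clin_scale[OF T1_clin])
    also have "T1 (\<gamma> j) = (c - 1) *s \<gamma> j" using assms(2) by (simp add: T1_def)
    finally show ?case by (simp only: vector_smult_assoc power_Suc mult.commute)
  qed simp
  moreover have "(T1 ^^ pdeg) (\<gamma> j) = 0" by (rule Lm_unipotent[OF assms(1)]) (rule Lm_support[OF assms(1)])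
  ultimately show ?thesis using assms(3) by simp
qed

text \<open>If the coefficients start at index \<open>m\<close>, those of
  \<open>\<delta> \<gamma>\<close> start at \<open>m + 1\<close> with the value
  \<open>\<mu> (gg 0) (\<gamma> m) - (m + 1) \<gamma> m\<close>. By induction from the largest
  possible index downwards this value is 0, and the eigenvalue \<open>m + 1 \<noteq> 1\<close> is
  excluded.\<close>

lemma Lm_zero_residue_step:
  assumes "\<gamma> \<in> Lm" "m \<ge> 1" "\<And>j. j < m \<Longrightarrow> \<gamma> j = 0"
  shows "\<gamma> j = 0"
  using assms
proof (induction "pdeg - m" arbitrary: m \<gamma> j)
  case 0
  then show ?case using Lm_support[of \<gamma> j] by (cases "j < m") auto
next
  case (Suc n)
  have d: "\<delta> \<gamma> (Suc k) = - of_nat (Suc k) *s \<gamma> k + \<mu> (gg 0) (\<gamma> k)" if "k \<le> m" for k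
  proof -
    have "(\<Sum>i\<le>k. \<mu> (gg i) (\<gamma> (k - i))) = (\<Sum>i\<le>k. if i = 0 then \<mu> (gg 0) (\<gamma> k) else 0)"
      using Suc.prems(3) that by (intro sum.cong) (auto simp: \<mu>_zero)
    then show ?thesis by (simp add: \<delta>_def)
  qed
  have z: "\<delta> \<gamma> k = 0" if "k < Suc m" for k
  proof (cases k)
    case (Suc l)
    then show ?thesis using d[of l] Suc.prems(3)[of l] that by (simp add: \<mu>_zero)
  qed (simp add: \<delta>_def)
  have "\<delta> \<gamma> (Suc m) = 0"
  proof (rule Suc.hyps(1)[OF _ Lm_delta[OF Suc.prems(1)] _ z])
    show "n = pdeg - Suc m" "Suc m \<ge> 1" using Suc.hyps(2) by auto
  qed
  then have "\<mu> (gg 0) (\<gamma> m) = of_nat (Suc m) *s \<gamma> m" using d[of m] by (simp add: algebra_simps del: of_nat_Suc)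
  then have "\<gamma> m = 0" by (rule Lm_eigenvalue[OF Suc.prems(1)]) (use Suc.prems(2) in \<open>simp del: of_nat_Suc\<close>)
  then have z': "\<gamma> k = 0" if "k < Suc m" for k using Suc.prems(3)[of k] that by (cases "k = m") auto
  have "n = pdeg - Suc m" "Suc m \<ge> 1" using Suc.hyps(2) by auto
  from Suc.hyps(1)[OF this(1) Suc.prems(1) this(2) z'] show ?case .
qed

lemma Lm_zero_residue: "\<gamma> \<in> Lm \<Longrightarrow> \<gamma> 0 = 0 \<Longrightarrow> \<gamma> j = 0"
  using Lm_zero_residue_step[of \<gamma> 1 j] by simp

text \<open>The residues at the single point \<open>t = 0\<close> of this line. By
  \<open>Lm_zero_residue\<close> they determine the polar combinations.\<close>

definition U :: "(complex^'n) set" where "U = (\<lambda>\<gamma>. \<gamma> 0) ` Lm"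

lemma U_add: "x \<in> U \<Longrightarrow> z \<in> U \<Longrightarrow> x + z \<in> U"
  unfolding U_def using Lm_add by force

lemma U_scale: "x \<in> U \<Longrightarrow> c *s x \<in> U"
  unfolding U_def using Lm_scale by force

lemma U_zero: "0 \<in> U"
proof -
  have "(\<lambda>j. 0) \<in> Lm" by (rule LmI[where N=0]) (simp_all add: pp_def)
  then show ?thesis unfolding U_def by force
qed

lemma U_diff: "x \<in> U \<Longrightarrow> z \<in> U \<Longrightarrow> x - z \<in> U"
  using U_add[of x "-1 *s z"] U_scale[of z "-1"] by simp

lemma U_mult: "x \<in> U \<Longrightarrow> \<mu> w x \<in> U"
  unfolding U_def using Lm_mult by force

text \<open>Repeated multiplication by \<open>t\<close> turns every coefficient into a
  residue.\<close>

lemma Lm_U: "\<gamma> \<in> Lm \<Longrightarrow> \<gamma> j \<in> U"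
proof (induction j arbitrary: \<gamma>)
  case 0
  then show ?case unfolding U_def by blast
next
  case (Suc j)
  then show ?case using Suc.IH[OF Lm_shift[OF Suc.prems]] by simp
qed

lemma gg_U: "gg 0 \<in> U"
  by (rule Lm_U[OF principal_part_Lm[OF gg]])

text \<open>A product of two polar parts starts at \<open>t\<^sup>-\<^sup>2\<close>, so it vanishes if it belongs to \<open>Lm\<close>.\<close>

lemma U_curv: assumes "x \<in> U" "z \<in> U" shows "\<mu> x (\<mu> b z) = \<mu> b (\<mu> x z)"
proof -
  obtain \<alpha> \<beta> where a: "\<alpha> \<in> Lm" "x = \<alpha> 0" and b: "\<beta> \<in> Lm" "z = \<beta> 0" using assms unfolding U_def by blast
  define B where "B x z = \<mu> x (\<mu> b z) - \<mu> b (\<mu> x z)" for x z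
  have B: "cbil B" unfolding B_def cbil_def
    by (auto simp: clin_def \<mu>_add \<mu>_scale algebra_simps)
  define \<gamma> where "\<gamma> = (\<lambda>k. case k of 0 \<Rightarrow> 0 | Suc k \<Rightarrow> \<Sum>i\<le>k. B (\<alpha> i) (\<beta> (k - i)))"
  have B0: "B 0 y = 0" "B x 0 = 0" for x y
    using clin_zero[OF cbilD(1)[OF B]] clin_zero[OF cbilD(2)[OF B]] by auto
  obtain K where K: "\<And>x z t. cmod t < r \<Longrightarrow> norm (G t *v B x z) \<le> K * norm (G t *v x) * norm (G t *v z)"
    using curv[of b] unfolding B_def by blast
  have "\<gamma> \<in> Lm"
  proof (rule LmI)
    show "\<gamma> k = 0" if k: "k \<ge> Suc (pdeg + pdeg)" for k
    proof -
      obtain l where l: "k = Suc l" "pdeg + pdeg \<le> l" using k by (cases k) auto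
      have "B (\<alpha> i) (\<beta> (l - i)) = 0" if "i \<le> l" for i
        using Lm_support[OF a(1), of i] Lm_support[OF b(1), of "l - i"] l that B0 by (cases "i \<ge> pdeg") auto
      then show ?thesis using l by (simp add: \<gamma>_def)
    qed
    have eq: "pp (Suc (pdeg + pdeg)) \<gamma> t = B (pp pdeg \<alpha> t) (pp pdeg \<beta> t)" for t
      unfolding \<gamma>_def by (rule pp_product[OF B, symmetric]) (simp_all add: Lm_support a b)
    have "bdd0 (\<lambda>t. of_real (norm (G t *v pp pdeg \<alpha> t)) *s (G t *v pp pdeg \<beta> t))"
      using Lm_bdd[OF a(1)] by (intro bdd0_smult Lm_bdd[OF b(1)]) (simp add: bdd0_def)
    then show "bdd0 (\<lambda>t. G t *v pp (Suc (pdeg + pdeg)) \<gamma> t)"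
      by (rule bdd0_mono[where K=K]) (use near0 K in \<open>auto elim!: eventually_mono simp: eq norm_smult mult.assoc\<close>)
  qed
  then have "\<gamma> 1 = 0" by (rule Lm_zero_residue) (simp add: \<gamma>_def)
  then show ?thesis using a b by (simp add: \<gamma>_def B_def)
qed

text \<open>On \<open>U\<close> multiplication by \<open>gg 0\<close> is the identity plus the
  nilpotent \<open>T1\<close>, hence onto. The induction on the order of nilpotency replaces the
  geometric series: \<open>T1 v = \<mu> (gg 0) w\<close> means
  \<open>v = \<mu> (gg 0) (v - w)\<close>.\<close>

lemma U_divisible: "v \<in> U \<Longrightarrow> \<exists>w\<in>U. v = \<mu> (gg 0) w"
proof -
  have "\<forall>v\<in>U. (T1 ^^ N) v = 0 \<longrightarrow> (\<exists>w\<in>U. v = \<mu> (gg 0) w)" for N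
  proof (induction N)
    case 0
    then show ?case using U_zero \<mu>_zero by auto
  next
    case (Suc N)
    show ?case
    proof (intro ballI impI)
      fix v assume v: "v \<in> U" "(T1 ^^ Suc N) v = 0"
      have "T1 v \<in> U" unfolding T1_def by (intro U_diff U_mult v)
      moreover have "(T1 ^^ N) (T1 v) = 0" using v(2) by (simp add: funpow_swap1)
      ultimately obtain w where w: "w \<in> U" "T1 v = \<mu> (gg 0) w" using Suc.IH by blast
      then have "v = \<mu> (gg 0) (v - w)" by (simp add: T1_def \<mu>_diff algebra_simps)
      then show "\<exists>w\<in>U. v = \<mu> (gg 0) w" using U_diff[OF v(1) w(1)] by blast
    qed
  qed
  moreover assume "v \<in> U"
  moreover then obtain \<gamma> where \<gamma>: "\<gamma> \<in> Lm" "v = \<gamma> 0" unfolding U_def by blast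
  have "(T1 ^^ pdeg) (\<gamma> 0) = 0" by (rule Lm_unipotent[OF \<gamma>(1)]) (rule Lm_support[OF \<gamma>(1)])
  ultimately show ?thesis using \<gamma> by blast
qed

text \<open>Every element is a product \<open>x y\<close> of two elements of \<open>U\<close>. By
  \<open>U_curv\<close> the outer factors move inside, and both orders of \<open>b\<close> and
  \<open>c\<close> give the product of \<open>b x\<close> and \<open>c y\<close>.\<close>

lemma U_comm_ideal: "comm_ideal \<mu> U"
  unfolding comm_ideal_def
proof (intro conjI ballI allI U_zero U_add U_scale U_mult)
  fix b c v assume "v \<in> U"
  then obtain x y where x: "x \<in> U" and y: "y \<in> U" and v: "v = \<mu> x y" using U_divisible gg_U by blast
  have "\<mu> b (\<mu> c (\<mu> x y)) = \<mu> (\<mu> c y) (\<mu> b x)" for b c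
    using U_curv[OF x y, of c] U_curv[OF U_mult[OF y] x, of c b] sym by metis
  then have "\<mu> b (\<mu> c (\<mu> x y)) = \<mu> (\<mu> c y) (\<mu> b x)" "\<mu> c (\<mu> b (\<mu> x y)) = \<mu> (\<mu> b y) (\<mu> c x)" by blast+
  moreover have "\<mu> c (\<mu> b (\<mu> x y)) = \<mu> (\<mu> b x) (\<mu> c y)"
    using U_curv[OF y x, of b] U_curv[OF U_mult[OF x, of b] y, of c] sym by metis
  ultimately show "\<mu> b (\<mu> c v) = \<mu> c (\<mu> b v)" using sym v by metis
qed

text \<open>All coefficients of the polar part of the inverse lie in a commutative ideal, so
  \<open>T\<close> kills the polar part and sees a bounded function only.\<close>

theorem projection_bounded:
  assumes T: "clin T" and kill: "\<And>J x. comm_ideal \<mu> J \<Longrightarrow> x \<in> J \<Longrightarrow> T x = 0"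
  shows "bdd0 (\<lambda>t. T (matrix_inv (G t) *v X) :: complex^'k)"
proof -
  obtain \<gamma> where \<gamma>: "\<And>j. j \<ge> pdeg \<Longrightarrow> \<gamma> j = 0" "bdd0 (\<lambda>t. matrix_inv (G t) *v X - pp pdeg \<gamma> t)"
    using inverse_principal_part by blast
  have "T (\<gamma> j) = 0" for j by (rule kill[OF U_comm_ideal Lm_U[OF principal_part_Lm[OF \<gamma>]]])
  then have "T (pp pdeg \<gamma> t) = 0" for t by (simp add: pp_clin[OF T]) (simp add: pp_def)
  then have "T (matrix_inv (G t) *v X) = T (matrix_inv (G t) *v X - pp pdeg \<gamma> t)" for t by (simp add: clin_diff[OF T])
  moreover have "bdd0 (\<lambda>t. T (matrix_inv (G t) *v X - pp pdeg \<gamma> t))"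
    by (rule bdd0_mono[OF \<gamma>(2)]) (rule always_eventually, rule allI, rule clin_norm_bound[OF T])
  ultimately show ?thesis by simp
qed

end

section \<open>The sum of all commutative ideals\<close>

text \<open>This makes the union of all commutative ideals closed under addition.\<close>

lemma comm_ideal_sum:
  assumes B: "cbil \<mu>" and I: "comm_ideal \<mu> I" and J: "comm_ideal \<mu> J"
  shows "comm_ideal \<mu> {x + y |x y. x \<in> I \<and> y \<in> J}"
proof -
  note add = clin_add[OF cbilD(1)[OF B]]
  show ?thesis
    unfolding comm_ideal_def
  proof (intro conjI ballI allI)
    have "(0::complex^'a) = 0 + 0" by simp
    then show "0 \<in> {x + y |x y. x \<in> I \<and> y \<in> J}" using I J unfolding comm_ideal_def by blast
  next
    fix u v assume "u \<in> {x + y |x y. x \<in> I \<and> y \<in> J}" "v \<in> {x + y |x y. x \<in> I \<and> y \<in> J}"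
    then obtain x y x' y' where "x \<in> I" "y \<in> J" "x' \<in> I" "y' \<in> J" "u = x + y" "v = x' + y'" by blast
    moreover from this have "u + v = (x + x') + (y + y')" by simp
    ultimately show "u + v \<in> {x + y |x y. x \<in> I \<and> y \<in> J}" using I J unfolding comm_ideal_def by blast
  next
    fix z u assume "u \<in> {x + y |x y. x \<in> I \<and> y \<in> J}"
    then obtain x y where "x \<in> I" "y \<in> J" "u = x + y" by blast
    moreover from this have "z *s u = z *s x + z *s y" by simp
    ultimately show "z *s u \<in> {x + y |x y. x \<in> I \<and> y \<in> J}" using I J unfolding comm_ideal_def by blast
  next
    fix b u assume "u \<in> {x + y |x y. x \<in> I \<and> y \<in> J}"
    then obtain x y where "x \<in> I" "y \<in> J" "u = x + y" by blast
    moreover from this have "\<mu> b u = \<mu> b x + \<mu> b y" by (simp add: add)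
    ultimately show "\<mu> b u \<in> {x + y |x y. x \<in> I \<and> y \<in> J}" using I J unfolding comm_ideal_def by blast
  next
    fix b c u assume "u \<in> {x + y |x y. x \<in> I \<and> y \<in> J}"
    then obtain x y where "x \<in> I" "y \<in> J" "u = x + y" by blast
    then show "\<mu> b (\<mu> c u) = \<mu> c (\<mu> b u)" using I J unfolding comm_ideal_def by (simp add: add)
  qed
qed

text \<open>The values of \<open>1 - T\<close> lie in the sum of the commutative ideals, where
  \<open>1 - T\<close> is the identity and all multiplications commute. So the inner projection does
  nothing, and the outer factors may be exchanged.\<close>

lemma commutative_quotient:
  fixes \<mu> :: "complex^'n \<Rightarrow> complex^'n \<Rightarrow> complex^'n"
  assumes B: "cbil \<mu>"
  obtains T where "clin T" "\<And>J x. comm_ideal \<mu> J \<Longrightarrow> x \<in> J \<Longrightarrow> T x = 0"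
    "\<And>a b v w. \<mu> (a - T a) (\<mu> (v - T v) (w - T w) - T (\<mu> (v - T v) (w - T w)))
       = \<mu> (v - T v) (\<mu> (a - T a) (w - T w) - T (\<mu> (a - T a) (w - T w)))"
proof -
  define U where "U = {x. \<exists>J. comm_ideal \<mu> J \<and> x \<in> J}"
  have UI: "comm_ideal \<mu> U"
    unfolding comm_ideal_def
  proof (intro conjI ballI allI)
    have "comm_ideal \<mu> {0}" using clin_zero[OF cbilD(1)[OF B]] by (auto simp: comm_ideal_def)
    then show "0 \<in> U" unfolding U_def by blast
  next
    fix x y assume "x \<in> U" "y \<in> U"
    then obtain I J where I: "comm_ideal \<mu> I" "x \<in> I" and J: "comm_ideal \<mu> J" "y \<in> J" unfolding U_def by blast
    have "x + y \<in> {x + y |x y. x \<in> I \<and> y \<in> J}" using I J by blast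
    then show "x + y \<in> U" unfolding U_def using comm_ideal_sum[OF B I(1) J(1)] by blast
  qed (unfold U_def comm_ideal_def, blast+)
  have "vec.subspace U" using UI by (auto simp: vec.subspace_def comm_ideal_def)
  moreover have "Vector_Spaces.linear (*s) (*s) (id :: complex^'n \<Rightarrow> complex^'n)" by (rule vec.linear_id)
  \<comment> \<open>A left inverse of the inclusion of \<open>U\<close> with values in
    \<open>U\<close> is a projection onto \<open>U\<close>.\<close>
  ultimately obtain g where g: "range g \<subseteq> U" "Vector_Spaces.linear (*s) (*s) g" "\<forall>v\<in>U. g (id v) = v"
    using vec.linear_exists_left_inverse_on[of id U] by (auto simp: inj_on_def)
  have gl: "clin g"
    using g(2) by (auto simp: clin_def Vector_Spaces.linear_def module_hom_def module_hom_axioms_def)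
  define T where "T v = v - g v" for v
  show thesis
  proof (rule that[of T])
    show "clin T" unfolding T_def by (intro clin_diff_map clin_ident gl)
    show "T x = 0" if "comm_ideal \<mu> J" "x \<in> J" for J x
      using that g(3) unfolding T_def U_def by auto
    fix a b v w
    have P: "x - T x \<in> U" for x using g(1) by (auto simp: T_def)
    have T0: "T x = 0" if "x \<in> U" for x using that g(3) by (simp add: T_def)
    have M: "\<mu> b x \<in> U" "\<mu> b (\<mu> c x) = \<mu> c (\<mu> b x)" if "x \<in> U" for b c x
      using UI that unfolding comm_ideal_def by blast+
    show "\<mu> (a - T a) (\<mu> (v - T v) (w - T w) - T (\<mu> (v - T v) (w - T w)))
       = \<mu> (v - T v) (\<mu> (a - T a) (w - T w) - T (\<mu> (a - T a) (w - T w)))"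
      by (simp add: T0 M(1) P) (rule M(2)[OF P])
  qed
qed

section \<open>Frames with constant connection coefficients\<close>

text \<open>In a chart with image \<open>Q\<close>, the columns of \<open>S x\<close> are the values of commuting vector fields, a frame
  on a dense open set; \<open>\<Gamma>\<close> are the Christoffel symbols of a torsion-free connection
  whose coefficients in the frame are the constants \<open>\<mu>\<close>.\<close>

locale chart_frame =
  fixes S :: "complex^'n \<Rightarrow> complex^'n^'n" and \<Gamma> :: "complex^'n \<Rightarrow> complex^'n \<Rightarrow> complex^'n \<Rightarrow> complex^'n"
    and Q :: "(complex^'n) set" and \<mu> :: "complex^'n \<Rightarrow> complex^'n \<Rightarrow> complex^'n"
  assumes Q: "open Q" and S: "lin_hol (\<lambda>x. (*v) (S x)) Q" and \<Gamma>: "bil_hol \<Gamma> Q"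
    and \<Gamma>sym: "\<And>x v w. x \<in> Q \<Longrightarrow> \<Gamma> x v w = \<Gamma> x w v"
    and bil: "cbil \<mu>" and sym: "\<And>v w. \<mu> v w = \<mu> w v"
    and rel: "\<And>x v w. x \<in> Q \<Longrightarrow> fd (\<lambda>y. S y *v w) x (S x *v v) + \<Gamma> x (S x *v v) (S x *v w) = S x *v \<mu> v w"
    and dense: "\<And>x e. x \<in> Q \<Longrightarrow> e > 0 \<Longrightarrow> \<exists>x'\<in>ball x e \<inter> Q. det (S x') \<noteq> 0"
begin

section \<open>Holomorphic tensors attached to the frame\<close>

definition DS :: "complex^'n \<Rightarrow> complex^'n \<Rightarrow> complex^'n \<Rightarrow> complex^'n" where
  "DS x h v = fd (\<lambda>y. S y *v v) x h"

text \<open>The covariant derivative along \<open>X\<close> of the frame field with constant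
  coefficients \<open>w\<close>. In the frame it is multiplication by \<open>w\<close>, so these
  multiplications are endomorphism fields holomorphic also where the frame degenerates.\<close>

definition L :: "complex^'n \<Rightarrow> complex^'n \<Rightarrow> complex^'n \<Rightarrow> complex^'n" where
  "L x w X = DS x X w + \<Gamma> x X (S x *v w)"

lemma DS: "bil_hol DS Q"
  unfolding DS_def[abs_def] by (rule lin_hol_fd[OF Q S])

lemma S_hol: "vector_holomorphic_on (\<lambda>x. S x *v v) Q"
  using lin_holD(2)[OF S] .

lemma S_lin: "clin ((*v) (S x))"
  by simp

lemmas \<Gamma>_bil = bil_holD(1)[OF \<Gamma>]

lemma rel_DS: "x \<in> Q \<Longrightarrow> DS x (S x *v v) w = S x *v \<mu> v w - \<Gamma> x (S x *v v) (S x *v w)"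
  using rel[of x w v] by (simp add: DS_def algebra_simps)

lemma commute: "x \<in> Q \<Longrightarrow> DS x (S x *v v) w = DS x (S x *v w) v"
  using rel_DS \<Gamma>sym sym by metis

lemma L_frame: "x \<in> Q \<Longrightarrow> L x w (S x *v v) = S x *v \<mu> w v"
  using rel_DS[of x v w] sym by (simp add: L_def)

lemma dense_eq:
  fixes f g :: "complex^'n \<Rightarrow> 'b::real_normed_vector"
  assumes "open W" "W \<subseteq> Q" "continuous_on W f" "continuous_on W g"
    and eq: "\<And>x. x \<in> W \<Longrightarrow> det (S x) \<noteq> 0 \<Longrightarrow> f x = g x" and x: "x \<in> W"
  shows "f x = g x"
proof (rule ccontr)
  assume "f x \<noteq> g x"
  define V where "V = W \<inter> (\<lambda>x. f x - g x) -` (- {0})"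
  have "open V" unfolding V_def
    by (intro continuous_open_preimage continuous_intros assms)
  moreover have "x \<in> V" using x \<open>f x \<noteq> g x\<close> by (simp add: V_def)
  ultimately obtain e where e: "e > 0" "ball x e \<subseteq> V" using open_contains_ball by blast
  then obtain x' where "x' \<in> V" "det (S x') \<noteq> 0" using dense[of x e] x assms(2) by blast
  then show False using eq[of x'] by (simp add: V_def)
qed

lemma frame_surj: "det (S x) \<noteq> 0 \<Longrightarrow> \<exists>v. X = S x *v v"
  using matrix_inv_cancel(1) by metis

text \<open>The covariant derivative of the endomorphism field \<open>L b\<close>. In the frame it
  is a commutator of multiplications, which provides the bound \<open>curv\<close> of
  \<open>line_frame\<close>.\<close>

definition DL :: "complex^'n \<Rightarrow> complex^'n \<Rightarrow> complex^'n \<Rightarrow> complex^'n \<Rightarrow> complex^'n" where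
  "DL b x X Y = fd (\<lambda>y. L y b Y) x X + \<Gamma> x X (L x b Y) - L x b (\<Gamma> x X Y)"

lemma L_lin_hol: "lin_hol (\<lambda>x. L x w) Q"
  unfolding lin_hol_def L_def
  by (auto intro!: clin_add_map cbilD(2)[OF bil_holD(1)[OF DS]] cbilD(2)[OF \<Gamma>_bil]
        vector_hol_add bil_holD(2)[OF DS] bil_hol_apply[OF Q \<Gamma> vector_hol_const S_hol])

lemma L_bil_hol: "bil_hol L Q"
  unfolding bil_hol_def cbil_def
proof (intro conjI allI ballI)
  fix x v w assume x: "x \<in> Q"
  show "clin (L x v)" by (rule lin_holD(1)[OF L_lin_hol x])
  show "clin (\<lambda>v. L x v w)" unfolding L_def
    by (intro clin_add_map cbilD(1)[OF bil_holD(1)[OF DS x]] clin_compose[OF cbilD(1)[OF \<Gamma>_bil[OF x]] S_lin])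
next
  show "vector_holomorphic_on (\<lambda>x. L x v w) Q" for v w by (rule lin_holD(2)[OF L_lin_hol])
qed

lemma DL_bil_hol: "bil_hol (DL b) Q"
proof -
  have 1: "bil_hol (\<lambda>x X Y. fd (\<lambda>y. L y b Y) x X) Q" by (rule lin_hol_fd[OF Q L_lin_hol])
  show ?thesis
    unfolding bil_hol_def cbil_def DL_def
  proof (intro conjI allI ballI)
    fix x X assume x: "x \<in> Q"
    show "clin (\<lambda>Y. fd (\<lambda>y. L y b Y) x X + \<Gamma> x X (L x b Y) - L x b (\<Gamma> x X Y))"
      by (intro clin_diff_map clin_add_map cbilD(1)[OF bil_holD(1)[OF 1 x]] clin_compose[OF cbilD(1)[OF \<Gamma>_bil[OF x]]]
          lin_holD(1)[OF L_lin_hol x] clin_compose[OF lin_holD(1)[OF L_lin_hol x]] cbilD(1)[OF \<Gamma>_bil[OF x]])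
  next
    fix x Y assume x: "x \<in> Q"
    show "clin (\<lambda>X. fd (\<lambda>y. L y b Y) x X + \<Gamma> x X (L x b Y) - L x b (\<Gamma> x X Y))"
      by (intro clin_diff_map clin_add_map cbilD(2)[OF bil_holD(1)[OF 1 x]] cbilD(2)[OF \<Gamma>_bil[OF x]]
          clin_compose[OF lin_holD(1)[OF L_lin_hol x]])
  next
    fix X Y
    show "vector_holomorphic_on (\<lambda>x. fd (\<lambda>y. L y b Y) x X + \<Gamma> x X (L x b Y) - L x b (\<Gamma> x X Y)) Q"
      by (intro vector_hol_diff vector_hol_add bil_holD(2)[OF 1] bil_hol_apply[OF Q \<Gamma> vector_hol_const]
          lin_holD(2)[OF L_lin_hol] lin_hol_apply[OF Q L_lin_hol] bil_holD(2)[OF \<Gamma>])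
  qed
qed

text \<open>Differentiate \<open>L b (S z) = S (\<mu> b z)\<close> along the field of
  \<open>v\<close> and replace derivatives of the frame by means of \<open>rel_DS\<close>.\<close>

lemma DL_frame:
  assumes x: "x \<in> Q"
  shows "DL b x (S x *v v) (S x *v z) = S x *v (\<mu> v (\<mu> b z) - \<mu> b (\<mu> v z))"
proof -
  let ?X = "S x *v v"
  have "fd (\<lambda>y. L y b (S y *v z)) x ?X = fd (\<lambda>y. L y b (S x *v z)) x ?X + L x b (DS x ?X z)"
    unfolding DS_def by (rule fd_lin_hol[OF Q L_lin_hol x S_hol])
  moreover have "fd (\<lambda>y. L y b (S y *v z)) x = fd (\<lambda>y. S y *v \<mu> b z) x"
    by (rule fd_cong_open[OF Q x]) (rule L_frame)
  ultimately have 1: "fd (\<lambda>y. L y b (S x *v z)) x ?X = DS x ?X (\<mu> b z) - L x b (DS x ?X z)" by (simp add: DS_def)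
  have "DL b x ?X (S x *v z) = (DS x ?X (\<mu> b z) + \<Gamma> x ?X (S x *v \<mu> b z)) - L x b (DS x ?X z + \<Gamma> x ?X (S x *v z))"
    unfolding DL_def 1 L_frame[OF x] by (simp add: clin_add[OF lin_holD(1)[OF L_lin_hol x]])
  also have "\<dots> = S x *v \<mu> v (\<mu> b z) - L x b (S x *v \<mu> v z)"
    by (simp add: rel_DS[OF x])
  finally show ?thesis by (simp add: L_frame[OF x] clin_diff[OF clin_matrix])
qed

text \<open>The frame fields are infinitesimal symmetries of the connection.\<close>

lemma killing_frame:
  assumes x: "x \<in> Q"
  defines "s \<equiv> \<lambda>v. S x *v v"
  shows "fd (\<lambda>y. DS y (s w) a) x (s v) + fd (\<lambda>y. \<Gamma> y (s v) (s w)) x (s a) + \<Gamma> x (DS x (s v) a) (s w)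
     + \<Gamma> x (s v) (DS x (s w) a) = DS x (\<Gamma> x (s v) (s w)) a"
proof -
  have DSw: "lin_hol (\<lambda>y X. DS y X w) Q" for w by (rule bil_hol_lin2[OF DS])
  have dDS: "fd (\<lambda>y. DS y (S y *v v) w) x h = fd (\<lambda>y. DS y (s v) w) x h + DS x (DS x h v) w" for v w h
    using fd_lin_hol[OF Q DSw x S_hol, where h=h] unfolding s_def DS_def by blast
  have d\<Gamma>: "fd (\<lambda>y. \<Gamma> y (S y *v v) (S y *v w)) x h = fd (\<lambda>y. \<Gamma> y (s v) (s w)) x h + \<Gamma> x (DS x h v) (s w) + \<Gamma> x (s v) (DS x h w)" for v w h
    using fd_bil_hol[OF Q \<Gamma> x S_hol S_hol, where h=h] unfolding s_def DS_def by blast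
  have D2sym: "fd (\<lambda>y. DS y h w) x k = fd (\<lambda>y. DS y k w) x h" for h k w
    unfolding DS_def by (rule vector_hol_fd(2)[OF S_hol Q x])
  have hDS: "vector_holomorphic_on (\<lambda>y. DS y (S y *v v) w) Q" for v w
    by (rule lin_hol_apply[OF Q DSw S_hol])
  have h\<Gamma>: "vector_holomorphic_on (\<lambda>y. \<Gamma> y (S y *v v) (S y *v w)) Q" for v w
    by (rule bil_hol_apply[OF Q \<Gamma> S_hol S_hol])
  have "fd (\<lambda>y. DS y (S y *v v) w + \<Gamma> y (S y *v v) (S y *v w)) x (s a) = DS x (s a) (\<mu> v w)"
  proof -
    have "fd (\<lambda>y. DS y (S y *v v) w + \<Gamma> y (S y *v v) (S y *v w)) x = fd (\<lambda>y. S y *v \<mu> v w) x"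
      by (rule fd_cong_open[OF Q x]) (simp add: rel_DS)
    then show ?thesis by (simp only: DS_def)
  qed
  moreover have "fd (\<lambda>y. DS y (S y *v v) w + \<Gamma> y (S y *v v) (S y *v w)) x = (\<lambda>h. fd (\<lambda>y. DS y (S y *v v) w) x h + fd (\<lambda>y. \<Gamma> y (S y *v v) (S y *v w)) x h)"
    by (intro frechet_derivative_at' has_derivative_add vector_holD(1)[OF hDS x] vector_holD(1)[OF h\<Gamma> x])
  \<comment> \<open>This is the relation \<open>rel\<close> differentiated along the field of
    \<open>a\<close>.\<close>
  ultimately have 1: "fd (\<lambda>y. DS y (s v) w) x (s a) + DS x (DS x (s a) v) w + (fd (\<lambda>y. \<Gamma> y (s v) (s w)) x (s a) + \<Gamma> x (DS x (s a) v) (s w) + \<Gamma> x (s v) (DS x (s a) w)) = DS x (s a) (\<mu> v w)"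
    by (simp add: dDS d\<Gamma>)
  \<comment> \<open>The commutation of the fields of \<open>a\<close> and \<open>w\<close> is
    differentiated along that of \<open>v\<close>. Symmetry of second derivatives,
    \<open>D2sym\<close>, links the result with the previous identity.\<close>
  have "fd (\<lambda>y. DS y (S y *v a) w) x = fd (\<lambda>y. DS y (S y *v w) a) x"
    by (rule fd_cong_open[OF Q x]) (rule commute)
  from fun_cong[OF this, of "s v"]
  have 2: "fd (\<lambda>y. DS y (s a) w) x (s v) + DS x (DS x (s v) a) w = fd (\<lambda>y. DS y (s w) a) x (s v) + DS x (DS x (s v) w) a"
    by (simp add: dDS)
  have 3: "DS x (\<Gamma> x (s v) (s w)) a = DS x (s (\<mu> v w)) a - DS x (DS x (s v) w) a"
    using rel_DS[OF x, of v w] clin_diff[OF cbilD(2)[OF bil_holD(1)[OF DS x]], of "s (\<mu> v w)" "DS x (s v) w" a]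
    by (simp add: s_def)
  have 4: "DS x (s a) (\<mu> v w) = DS x (s (\<mu> v w)) a" "DS x (s v) a = DS x (s a) v" "DS x (s w) a = DS x (s a) w"
    unfolding s_def by (rule commute[OF x])+
  have 5: "DS x (DS x (s v) w) a = DS x (DS x (s a) v) w + fd (\<lambda>y. DS y (s v) w) x (s a) - fd (\<lambda>y. DS y (s w) a) x (s v)"
    using 2 D2sym[of "s a" w "s v"] unfolding 4 by (simp add: algebra_simps)
  show ?thesis
    unfolding 3 5 4 using 1 unfolding 4(1) by (simp add: algebra_simps)
qed

text \<open>At points where the frame is a basis, \<open>X\<close> and \<open>Y\<close> are values
  of frame fields; the other points follow by continuity.\<close>

lemma killing:
  assumes x: "x \<in> Q"
  shows "fd (\<lambda>y. DS y Y a) x X + fd (\<lambda>y. \<Gamma> y X Y) x (S x *v a) + \<Gamma> x (DS x X a) Y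
     + \<Gamma> x X (DS x Y a) = DS x (\<Gamma> x X Y) a"
proof (rule dense_eq[OF Q order_refl _ _ _ x])
  note c = vector_hol_continuous_on
  show "continuous_on Q (\<lambda>x. fd (\<lambda>y. DS y Y a) x X + fd (\<lambda>y. \<Gamma> y X Y) x (S x *v a) + \<Gamma> x (DS x X a) Y
     + \<Gamma> x X (DS x Y a))"
  proof (intro c vector_hol_add)
    show "vector_holomorphic_on (\<lambda>x. fd (\<lambda>y. DS y Y a) x X) Q" by (rule vector_hol_fd(1)[OF bil_holD(2)[OF DS] Q])
    have "lin_hol (\<lambda>x h. fd (\<lambda>y. \<Gamma> y X Y) x h) Q"
      unfolding lin_hol_def by (auto intro: vector_hol_fd_clin[OF bil_holD(2)[OF \<Gamma>]] vector_hol_fd(1)[OF bil_holD(2)[OF \<Gamma>] Q])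
    then show "vector_holomorphic_on (\<lambda>x. fd (\<lambda>y. \<Gamma> y X Y) x (S x *v a)) Q" by (rule lin_hol_apply[OF Q _ S_hol])
    show "vector_holomorphic_on (\<lambda>x. \<Gamma> x (DS x X a) Y) Q" "vector_holomorphic_on (\<lambda>x. \<Gamma> x X (DS x Y a)) Q"
      by (intro bil_hol_apply[OF Q \<Gamma>] vector_hol_const bil_holD(2)[OF DS])+
  qed
  show "continuous_on Q (\<lambda>x. DS x (\<Gamma> x X Y) a)"
    by (intro c lin_hol_apply[OF Q bil_hol_lin2[OF DS]] bil_holD(2)[OF \<Gamma>])
  fix x assume x: "x \<in> Q" "det (S x) \<noteq> 0"
  obtain v w where "X = S x *v v" "Y = S x *v w" using frame_surj[OF x(2)] by metis
  then show "fd (\<lambda>y. DS y Y a) x X + fd (\<lambda>y. \<Gamma> y X Y) x (S x *v a) + \<Gamma> x (DS x X a) Y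
     + \<Gamma> x X (DS x Y a) = DS x (\<Gamma> x X Y) a"
    using killing_frame[OF x(1), of w a v] by simp
qed

section \<open>Geodesics and good directions\<close>

lemma dGamma_bounded:
  assumes "compact C" "C \<subseteq> Q"
  obtains K where "K \<ge> 0" "\<And>x v w h. x \<in> C \<Longrightarrow> norm (fd (\<lambda>y. \<Gamma> y v w) x h) \<le> K * norm v * norm w * norm h"
proof -
  have "\<exists>k\<ge>0. \<forall>x\<in>C. \<forall>h w. norm (fd (\<lambda>y. \<Gamma> y (axis i 1) w) x h) \<le> k * norm h * norm w" for i
    using bil_hol_bounded[OF lin_hol_fd[OF Q bil_hol_lin1[OF \<Gamma>]] assms] by metis
  then obtain k where k: "\<And>i. k i \<ge> 0" "\<And>i x h w. x \<in> C \<Longrightarrow> norm (fd (\<lambda>y. \<Gamma> y (axis i 1) w) x h) \<le> k i * norm h * norm w" by metis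
  show thesis
  proof (rule that[of "\<Sum>i\<in>UNIV. k i"])
    fix x v w h assume x: "x \<in> C"
    have "norm (fd (\<lambda>y. \<Gamma> y v w) x h) \<le> (\<Sum>i\<in>UNIV. norm (fd (\<lambda>y. \<Gamma> y (axis i 1) w) x h)) * norm v"
      by (rule clin_norm_bound[OF fd_clin_in_parameter[OF Q bil_hol_lin2[OF \<Gamma>]]]) (use x assms(2) in auto)
    also have "\<dots> \<le> (\<Sum>i\<in>UNIV. k i * norm h * norm w) * norm v"
      by (intro mult_right_mono sum_mono k x) auto
    finally show "norm (fd (\<lambda>y. \<Gamma> y v w) x h) \<le> (\<Sum>i\<in>UNIV. k i) * norm v * norm w * norm h"
      by (simp add: sum_distrib_right sum_distrib_left mult_ac)
  qed (simp add: k sum_nonneg)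
qed

text \<open>The geodesic equation as a first order system for position and velocity. Real time is
  enough, since a single later point of the geodesic in the cone around \<open>y\<close> gives the
  contradiction in \<open>good_direction\<close>.\<close>

lemma geodesic_exists:
  assumes p: "p \<in> Q"
  obtains e \<gamma> \<beta> where "e > 0" "\<gamma> 0 = p" "\<beta> 0 = y" "\<And>t. t \<in> {0..e::real} \<Longrightarrow> \<gamma> t \<in> Q"
    "\<And>t. t \<in> {0..e} \<Longrightarrow> (\<gamma> has_vector_derivative \<beta> t) (at t within {0..e})"
    "\<And>t. t \<in> {0..e} \<Longrightarrow> (\<beta> has_vector_derivative - \<Gamma> (\<gamma> t) (\<beta> t) (\<beta> t)) (at t within {0..e})"
proof -
  obtain R where R: "R > 0" "cball p R \<subseteq> Q" using Q p open_contains_cball by blast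
  define F where "F u = (snd u, - \<Gamma> (fst u) (snd u) (snd u))" for u :: "(complex^'n) \<times> (complex^'n)"
  define F' where "F' u k = (snd k, - (fd (\<lambda>y. \<Gamma> y (snd u) (snd u)) (fst u) (fst k) + \<Gamma> (fst u) (snd k) (snd u) + \<Gamma> (fst u) (snd u) (snd k)))" for u k
  let ?B = "cball (p, y) R"
  have inQ: "fst u \<in> cball p R" "norm (snd u) \<le> norm y + R" if "u \<in> ?B" for u
  proof -
    have "dist p (fst u) \<le> dist (p, y) u" using dist_fst_le[of "(p,y)" u] by simp
    then show "fst u \<in> cball p R" using that by simp
    have "dist y (snd u) \<le> dist (p, y) u" using dist_snd_le[of "(p,y)" u] by simp
    then show "norm (snd u) \<le> norm y + R" using that norm_triangle_sub[of "snd u" y] by (simp add: dist_norm norm_minus_commute)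
  qed
  have der: "(F has_derivative F' u) (at u within ?B)" if "u \<in> ?B" for u
    unfolding F_def[abs_def] F'_def[abs_def]
  proof (intro has_derivative_Pair has_derivative_minus)
    show "(snd has_derivative snd) (at u within ?B)"
      by (rule has_derivative_snd[OF has_derivative_ident])
    show "((\<lambda>u. \<Gamma> (fst u) (snd u) (snd u)) has_derivative
      (\<lambda>k. fd (\<lambda>y. \<Gamma> y (snd u) (snd u)) (fst u) (fst k) + \<Gamma> (fst u) (snd k) (snd u) + \<Gamma> (fst u) (snd u) (snd k))) (at u within ?B)"
      by (rule has_derivative_bil_hol[OF Q \<Gamma> has_derivative_fst[OF has_derivative_ident] _ has_derivative_snd[OF has_derivative_ident] has_derivative_snd[OF has_derivative_ident] that])
         (use inQ(1)[OF that] R in auto)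
  qed
  obtain K where K: "K \<ge> 0" "\<And>x v w. x \<in> cball p R \<Longrightarrow> norm (\<Gamma> x v w) \<le> K * norm v * norm w"
    using bil_hol_bounded[OF \<Gamma> compact_cball R(2)] by metis
  obtain K' where K': "K' \<ge> 0" "\<And>x v w h. x \<in> cball p R \<Longrightarrow> norm (fd (\<lambda>y. \<Gamma> y v w) x h) \<le> K' * norm v * norm w * norm h"
    using dGamma_bounded[OF compact_cball R(2)] by metis
  define b where "b = norm y + R"
  have b: "b \<ge> 0" using R by (simp add: b_def)
  define M where "M = 1 + (K' * b * b + K * b + K * b)"
  have M: "norm (F' u k) \<le> M * norm k" if u: "u \<in> ?B" for u k
  proof -
    note u' = inQ[OF u, folded b_def]
    have k1: "norm (fst k) \<le> norm k" "norm (snd k) \<le> norm k" using norm_fst_le[of "fst k" "snd k"] norm_snd_le[of "snd k" "fst k"] by auto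
    have "norm (fd (\<lambda>y. \<Gamma> y (snd u) (snd u)) (fst u) (fst k)) \<le> K' * norm (snd u) * norm (snd u) * norm (fst k)" by (rule K'(2)[OF u'(1)])
    also have "\<dots> \<le> K' * b * b * norm k" by (intro mult_mono u' k1 mult_nonneg_nonneg K' b) auto
    finally have a1: "norm (fd (\<lambda>y. \<Gamma> y (snd u) (snd u)) (fst u) (fst k)) \<le> K' * b * b * norm k" .
    have "norm (\<Gamma> (fst u) (snd k) (snd u)) \<le> K * norm (snd k) * norm (snd u)" by (rule K(2)[OF u'(1)])
    also have "\<dots> \<le> K * norm k * b" by (intro mult_mono u' k1 mult_nonneg_nonneg K b) auto
    finally have a2: "norm (\<Gamma> (fst u) (snd k) (snd u)) \<le> K * norm k * b" .
    have "norm (\<Gamma> (fst u) (snd u) (snd k)) \<le> K * norm (snd u) * norm (snd k)" by (rule K(2)[OF u'(1)])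
    also have "\<dots> \<le> K * b * norm k" by (intro mult_mono u' k1 mult_nonneg_nonneg K b) auto
    finally have a3: "norm (\<Gamma> (fst u) (snd u) (snd k)) \<le> K * b * norm k" .
    have "norm (F' u k) \<le> norm (snd k) + norm (- (fd (\<lambda>y. \<Gamma> y (snd u) (snd u)) (fst u) (fst k) + \<Gamma> (fst u) (snd k) (snd u) + \<Gamma> (fst u) (snd u) (snd k)))"
      unfolding F'_def by (rule norm_Pair_le)
    also have "\<dots> \<le> norm k + (K' * b * b * norm k + K * norm k * b + K * b * norm k)"
      unfolding norm_minus_cancel by (intro add_mono k1 norm_triangle_le a1 a2 a3)
    finally show ?thesis by (simp add: M_def algebra_simps)
  qed
  have "norm (F u - F v) \<le> M * norm (u - v)" if "u \<in> ?B" "v \<in> ?B" for u v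
    by (rule differentiable_bound[OF convex_cball der onorm_le[OF M] that])
  then obtain e u where eu: "e > 0" "u 0 = (p, y)" "\<And>t. t \<in> {0..e} \<Longrightarrow> u t \<in> ?B"
    "\<And>t. t \<in> {0..e} \<Longrightarrow> (u has_vector_derivative F (u t)) (at t within {0..e})"
    using ode_local_existence[OF R(1), of "(p, y)" F M] by blast
  show thesis
  proof (rule that[of e "\<lambda>t. fst (u t)" "\<lambda>t. snd (u t)"])
    fix t assume t: "t \<in> {0..e}"
    show "fst (u t) \<in> Q" using inQ(1)[OF eu(3)[OF t]] R(2) by blast
    have d: "(u has_derivative (\<lambda>h. h *\<^sub>R F (u t))) (at t within {0..e})" using eu(4)[OF t] by (simp add: has_vector_derivative_def)
    show "((\<lambda>t. fst (u t)) has_vector_derivative snd (u t)) (at t within {0..e})"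
      using has_derivative_fst[OF d] by (simp add: has_vector_derivative_def F_def)
    show "((\<lambda>t. snd (u t)) has_vector_derivative - \<Gamma> (fst (u t)) (snd (u t)) (snd (u t))) (at t within {0..e})"
      using has_derivative_snd[OF d] by (simp add: has_vector_derivative_def F_def)
  qed (use eu in auto)
qed

text \<open>By \<open>killing\<close> with \<open>X = Y = \<beta> t\<close>, the value of the field
  along the geodesic and its time derivative solve a linear first order system, the Jacobi equation
  in coordinates, with initial value 0.\<close>

lemma jacobi_unique:
  assumes e: "e > 0" and \<gamma>Q: "\<And>t. t \<in> {0..e::real} \<Longrightarrow> \<gamma> t \<in> Q"
    and d\<gamma>: "\<And>t. t \<in> {0..e} \<Longrightarrow> (\<gamma> has_vector_derivative \<beta> t) (at t within {0..e})"
    and d\<beta>: "\<And>t. t \<in> {0..e} \<Longrightarrow> (\<beta> has_vector_derivative - \<Gamma> (\<gamma> t) (\<beta> t) (\<beta> t)) (at t within {0..e})"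
    and v: "S (\<gamma> 0) *v v = 0" "DS (\<gamma> 0) (\<beta> 0) v = 0" and t: "t \<in> {0..e}"
  shows "S (\<gamma> t) *v v = 0"
proof -
  define z where "z t = S (\<gamma> t) *v v" for t
  define w where "w t = DS (\<gamma> t) (\<beta> t) v" for t
  define w' where "w' t = - (fd (\<lambda>y. \<Gamma> y (\<beta> t) (\<beta> t)) (\<gamma> t) (z t) + \<Gamma> (\<gamma> t) (w t) (\<beta> t) + \<Gamma> (\<gamma> t) (\<beta> t) (w t))" for t
  have dz: "(z has_vector_derivative w t) (at t within {0..e})" if t: "t \<in> {0..e}" for t
  proof -
    have "((\<lambda>t. S (\<gamma> t) *v v) has_derivative (\<lambda>h. fd (\<lambda>y. S y *v v) (\<gamma> t) (h *\<^sub>R \<beta> t) + S (\<gamma> t) *v 0)) (at t within {0..e})"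
      by (rule has_derivative_lin_hol[OF Q S d\<gamma>[OF t, unfolded has_vector_derivative_def] \<gamma>Q[OF t] has_derivative_const t])
    then show ?thesis
      unfolding has_vector_derivative_def z_def w_def DS_def
      using linear_scale[OF clin_linear[OF vector_hol_fd_clin[OF S_hol \<gamma>Q[OF t]]]] by simp
  qed
  have dw: "(w has_vector_derivative w' t) (at t within {0..e})" if t: "t \<in> {0..e}" for t
  proof -
    note gt = \<gamma>Q[OF t]
    have "((\<lambda>t. DS (\<gamma> t) (\<beta> t) v) has_derivative (\<lambda>h. fd (\<lambda>y. DS y (\<beta> t) v) (\<gamma> t) (h *\<^sub>R \<beta> t)
        + DS (\<gamma> t) (h *\<^sub>R - \<Gamma> (\<gamma> t) (\<beta> t) (\<beta> t)) v)) (at t within {0..e})"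
      by (rule has_derivative_lin_hol[OF Q bil_hol_lin2[OF DS] d\<gamma>[OF t, unfolded has_vector_derivative_def] gt d\<beta>[OF t, unfolded has_vector_derivative_def] t])
    moreover have "fd (\<lambda>y. DS y (\<beta> t) v) (\<gamma> t) (h *\<^sub>R \<beta> t) + DS (\<gamma> t) (h *\<^sub>R - \<Gamma> (\<gamma> t) (\<beta> t) (\<beta> t)) v = h *\<^sub>R w' t" for h
    proof -
      have "fd (\<lambda>y. DS y (\<beta> t) v) (\<gamma> t) (h *\<^sub>R \<beta> t) = h *\<^sub>R fd (\<lambda>y. DS y (\<beta> t) v) (\<gamma> t) (\<beta> t)"
        by (rule linear_scale[OF clin_linear[OF vector_hol_fd_clin[OF bil_holD(2)[OF DS] gt]]])
      moreover have "DS (\<gamma> t) (h *\<^sub>R - \<Gamma> (\<gamma> t) (\<beta> t) (\<beta> t)) v = h *\<^sub>R DS (\<gamma> t) (- \<Gamma> (\<gamma> t) (\<beta> t) (\<beta> t)) v"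
        by (rule linear_scale[OF clin_linear[OF cbilD(2)[OF bil_holD(1)[OF DS gt]]]])
      moreover have "DS (\<gamma> t) (- \<Gamma> (\<gamma> t) (\<beta> t) (\<beta> t)) v = - DS (\<gamma> t) (\<Gamma> (\<gamma> t) (\<beta> t) (\<beta> t)) v"
        by (rule clin_minus[OF cbilD(2)[OF bil_holD(1)[OF DS gt]]])
      moreover have "fd (\<lambda>y. DS y (\<beta> t) v) (\<gamma> t) (\<beta> t) + - DS (\<gamma> t) (\<Gamma> (\<gamma> t) (\<beta> t) (\<beta> t)) v = w' t"
        using killing[OF gt, of "\<beta> t" v "\<beta> t"] unfolding w'_def z_def w_def by (simp add: algebra_simps)
      ultimately show ?thesis by (simp only: scaleR_add_right[symmetric])
    qed
    ultimately show ?thesis unfolding has_vector_derivative_def w_def by simp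
  qed
  have c\<gamma>: "continuous_on {0..e} \<gamma>" and c\<beta>: "continuous_on {0..e} \<beta>"
    by (rule continuous_on_vector_derivative, erule d\<gamma>) (rule continuous_on_vector_derivative, erule d\<beta>)
  define C where "C = \<gamma> ` {0..e}"
  have C: "compact C" "C \<subseteq> Q" unfolding C_def using \<gamma>Q by (auto intro!: compact_continuous_image c\<gamma>)
  obtain b where b: "\<And>t. t \<in> {0..e} \<Longrightarrow> norm (\<beta> t) \<le> b"
  proof -
    obtain b where "\<forall>x\<in>\<beta> ` {0..e}. norm x \<le> b"
      using compact_imp_bounded[OF compact_continuous_image[OF c\<beta> compact_Icc]] unfolding bounded_iff by blast
    then show thesis by (intro that) auto
  qed
  have b0: "b \<ge> 0" using order_trans[OF norm_ge_zero b[of 0]] e by simp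
  obtain K where K: "K \<ge> 0" "\<And>x v w. x \<in> C \<Longrightarrow> norm (\<Gamma> x v w) \<le> K * norm v * norm w"
    using bil_hol_bounded[OF \<Gamma> C] by metis
  obtain K' where K': "K' \<ge> 0" "\<And>x v w h. x \<in> C \<Longrightarrow> norm (fd (\<lambda>y. \<Gamma> y v w) x h) \<le> K' * norm v * norm w * norm h"
    using dGamma_bounded[OF C] by metis
  define M where "M = 1 + (K' * b * b + K * b + K * b)"
  have "(z t, w t) = 0"
  proof (rule ode_zero_unique[where e=e and w="\<lambda>t. (z t, w t)" and w'="\<lambda>t. (w t, w' t)" and K=M])
    fix t assume t: "t \<in> {0..e}"
    show "((\<lambda>t. (z t, w t)) has_vector_derivative (w t, w' t)) (at t within {0..e})"
      using has_derivative_Pair[OF dz[OF t, unfolded has_vector_derivative_def] dw[OF t, unfolded has_vector_derivative_def]]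
      by (simp add: has_vector_derivative_def)
    let ?k = "(z t, w t)"
    have tC: "\<gamma> t \<in> C" using t by (simp add: C_def)
    have k1: "norm (z t) \<le> norm ?k" "norm (w t) \<le> norm ?k" using norm_fst_le[of "z t" "w t"] norm_snd_le[of "w t" "z t"] by auto
    have "norm (fd (\<lambda>y. \<Gamma> y (\<beta> t) (\<beta> t)) (\<gamma> t) (z t)) \<le> K' * norm (\<beta> t) * norm (\<beta> t) * norm (z t)" by (rule K'(2)[OF tC])
    also have "\<dots> \<le> K' * b * b * norm ?k" by (intro mult_mono b t k1 mult_nonneg_nonneg K' b0) auto
    finally have a1: "norm (fd (\<lambda>y. \<Gamma> y (\<beta> t) (\<beta> t)) (\<gamma> t) (z t)) \<le> K' * b * b * norm ?k" .
    have "norm (\<Gamma> (\<gamma> t) (w t) (\<beta> t)) \<le> K * norm (w t) * norm (\<beta> t)" by (rule K(2)[OF tC])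
    also have "\<dots> \<le> K * norm ?k * b" by (intro mult_mono b t k1 mult_nonneg_nonneg K b0) auto
    finally have a2: "norm (\<Gamma> (\<gamma> t) (w t) (\<beta> t)) \<le> K * norm ?k * b" .
    have "norm (\<Gamma> (\<gamma> t) (\<beta> t) (w t)) \<le> K * norm (\<beta> t) * norm (w t)" by (rule K(2)[OF tC])
    also have "\<dots> \<le> K * b * norm ?k" by (intro mult_mono b t k1 mult_nonneg_nonneg K b0) auto
    finally have a3: "norm (\<Gamma> (\<gamma> t) (\<beta> t) (w t)) \<le> K * b * norm ?k" .
    have "norm (w t, w' t) \<le> norm (w t) + norm (w' t)" by (rule norm_Pair_le)
    also have "\<dots> \<le> norm ?k + (K' * b * b * norm ?k + K * norm ?k * b + K * b * norm ?k)"
      unfolding w'_def norm_minus_cancel by (intro add_mono k1 norm_triangle_le a1 a2 a3)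
    finally show "norm (w t, w' t) \<le> M * norm ?k" by (simp add: M_def algebra_simps)
  qed (use v t in \<open>auto simp: z_def w_def zero_prod_def\<close>)
  then show ?thesis by (simp add: z_def zero_prod_def)
qed

lemma det_hol: "scalar_holomorphic_on (\<lambda>x. det (S x)) Q"
  by (intro scalar_hol_det lin_hol_matrix_entries S)

text \<open>\<open>y\<close> is taken from a cone without zeros of the determinant. A vector
  \<open>v\<close> killed by both maps gives a field that vanishes along the geodesic with initial
  velocity \<open>y\<close>. This curve enters the cone, where the frame is a basis, so
  \<open>v = 0\<close>.\<close>

lemma good_direction:
  assumes p: "p \<in> Q"
  obtains y r where "r > 0" "\<And>v. S p *v v = 0 \<Longrightarrow> DS p y v = 0 \<Longrightarrow> v = 0"
    "\<And>t. t \<noteq> 0 \<Longrightarrow> cmod t < r \<Longrightarrow> p + t *s y \<in> Q \<and> det (S (p + t *s y)) \<noteq> 0"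
proof -
  obtain R where R: "R > 0" "ball p R \<subseteq> Q" using Q p open_contains_ball by blast
  obtain x where x: "x \<in> ball p R" "det (S x) \<noteq> 0" using dense[OF p R(1)] by blast
  obtain y e r where e: "e > 0" "r > 0" and
    cone: "\<And>z t. norm (z - y) < e \<Longrightarrow> t \<noteq> 0 \<Longrightarrow> cmod t < r \<Longrightarrow> p + t *s z \<in> ball p R \<and> det (S (p + t *s z)) \<noteq> 0"
    using multiplicity_direction[OF scalar_hol_subset[OF det_hol R(2)] R(1) x] by metis
  show thesis
  proof (rule that[of r y])
    show "r > 0" by (rule e)
    show "p + t *s y \<in> Q \<and> det (S (p + t *s y)) \<noteq> 0" if "t \<noteq> 0" "cmod t < r" for t
      using cone[of y t] that e R by auto
    fix v assume v: "S p *v v = 0" "DS p y v = 0"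
    obtain a \<gamma> \<beta> where a: "a > 0" "\<gamma> 0 = p" "\<beta> 0 = y" "\<And>t. t \<in> {0..a::real} \<Longrightarrow> \<gamma> t \<in> Q"
      "\<And>t. t \<in> {0..a} \<Longrightarrow> (\<gamma> has_vector_derivative \<beta> t) (at t within {0..a})"
      "\<And>t. t \<in> {0..a} \<Longrightarrow> (\<beta> has_vector_derivative - \<Gamma> (\<gamma> t) (\<beta> t) (\<beta> t)) (at t within {0..a})"
      using geodesic_exists[OF p, of y] by metis
    have z: "S (\<gamma> t) *v v = 0" if "t \<in> {0..a}" for t
      by (rule jacobi_unique[OF a(1) a(4,5,6) _ _ that]) (use v a in auto)
    have "(\<gamma> has_derivative (\<lambda>h. h *\<^sub>R y)) (at 0 within {0..a})"
      using a(5)[of 0] a(1,3) by (simp add: has_vector_derivative_def)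
    then obtain d where d: "d > 0" "\<And>t. t \<in> {0..a} \<Longrightarrow> norm (t - 0) < d \<Longrightarrow> norm (\<gamma> t - \<gamma> 0 - (t - 0) *\<^sub>R y) \<le> (e/2) * norm (t - 0)"
      unfolding has_derivative_within_alt using half_gt_zero[OF e(1)] by blast
    \<comment> \<open>So small that the chord from \<open>p\<close> to \<open>\<gamma> t\<close>
      points in a direction within \<open>e\<close> of \<open>y\<close>.\<close>
    define t where "t = min (d/2) (min a (r/2))"
    have t: "t > 0" "t \<le> a" "t < d" "t < r" using d a e by (auto simp: t_def)
    define u where "u = (1/t) *\<^sub>R (\<gamma> t - p)"
    have "u - y = (1/t) *\<^sub>R (\<gamma> t - p - t *\<^sub>R y)" using t by (simp add: u_def algebra_simps)
    then have "norm (u - y) = (1/t) * norm (\<gamma> t - p - t *\<^sub>R y)" using t by simp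
    also have "\<dots> \<le> (1/t) * ((e/2) * t)" using d(2)[of t] t a(2) by (intro mult_left_mono) auto
    also have "\<dots> < e" using t e by simp
    finally have "norm (u - y) < e" .
    moreover have "\<gamma> t = p + of_real t *s u" using t by (simp add: u_def scaleR_eq_smult[symmetric])
    ultimately have "det (S (\<gamma> t)) \<noteq> 0" using cone[of u "of_real t"] t by simp
    then show "v = 0" using z[of t] t matrix_inv_cancel(2)[of "S (\<gamma> t)" v] by simp
  qed
qed

end

section \<open>Extension across degenerate points\<close>

lemma matrix_axis_nth: "((A::complex^'n^'m) *v axis j 1) $ i = A $ i $ j"
  by (simp add: matrix_vector_mult_def axis_def if_distrib cong: if_cong)

context chart_frame
begin

text \<open>The condition says that \<open>v \<mapsto> (S x *v v, DS x y v)\<close> is injective,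
  which is open in \<open>x\<close>. So one direction \<open>y\<close> serves all degenerate points
  near \<open>p\<close>.\<close>

lemma good_near:
  assumes p: "p \<in> Q" and good: "\<And>v. S p *v v = 0 \<Longrightarrow> DS p y v = 0 \<Longrightarrow> v = 0"
  obtains d where "d > 0" "ball p d \<subseteq> Q"
    "\<And>x v. x \<in> ball p d \<Longrightarrow> S x *v v = 0 \<Longrightarrow> DS x y v = 0 \<Longrightarrow> v = 0"
proof -
  define f where "f v = (S p *v v, DS p y v)" for v
  have DSl: "clin (DS x y)" if "x \<in> Q" for x using cbilD(1)[OF bil_holD(1)[OF DS that]] .
  have lf: "linear f"
    unfolding f_def
    by (rule linearI) (simp_all add: clin_add[OF DSl[OF p]] clin_add[OF clin_matrix]
        linear_scale[OF clin_linear[OF DSl[OF p]]] linear_scale[OF clin_linear[OF clin_matrix]])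
  moreover have "inj f"
    unfolding linear_injective_0[OF lf] using good by (auto simp: f_def zero_prod_def)
  ultimately obtain c where c: "c > 0" "\<And>v. c * norm v \<le> norm (f v)" using linear_inj_bounded_below_pos by blast
  define m where "m x = (\<Sum>i\<in>UNIV. norm (S p *v axis i 1 - S x *v axis i 1)) + (\<Sum>i\<in>UNIV. norm (DS p y (axis i 1) - DS x y (axis i 1)))" for x
  have "continuous_on Q m" unfolding m_def
    by (intro continuous_intros vector_hol_continuous_on[OF S_hol] vector_hol_continuous_on[OF bil_holD(2)[OF DS]])
  then have "isCont m p" using p Q continuous_on_eq_continuous_at by blast
  then obtain d1 where d1: "d1 > 0" "\<And>x. dist x p < d1 \<Longrightarrow> dist (m x) (m p) < c"
    using c(1) unfolding continuous_at_eps_delta by blast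
  obtain d2 where d2: "d2 > 0" "ball p d2 \<subseteq> Q" using Q p open_contains_ball by blast
  show thesis
  proof (rule that[of "min d1 d2"])
    show "0 < min d1 d2" "ball p (min d1 d2) \<subseteq> Q" using d1 d2 by auto
    fix x v assume x: "x \<in> ball p (min d1 d2)" and v: "S x *v v = 0" "DS x y v = 0"
    have xQ: "x \<in> Q" using x d2 by auto
    have "m p = 0" by (simp add: m_def)
    then have mx: "m x < c" using d1(2)[of x] x by (simp add: dist_commute dist_norm)
    have l1: "clin (\<lambda>v. S p *v v - S x *v v)" by (intro clin_diff_map clin_matrix)
    have l2: "clin (\<lambda>v. DS p y v - DS x y v)" by (intro clin_diff_map DSl xQ p)
    have "norm (f v) \<le> norm (S p *v v) + norm (DS p y v)" unfolding f_def by (rule norm_Pair_le)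
    also have "\<dots> = norm (S p *v v - S x *v v) + norm (DS p y v - DS x y v)" using v by simp
    also have "\<dots> \<le> m x * norm v"
      unfolding m_def distrib_right by (intro add_mono clin_norm_bound[OF l1] clin_norm_bound[OF l2])
    finally have "c * norm v \<le> m x * norm v" using c(2)[of v] by linarith
    then show "v = 0" using mx by (metis mult_le_cancel_right norm_ge_zero norm_le_zero_iff not_less)
  qed
qed

text \<open>The frame on the line is a \<open>line_frame\<close>: \<open>mult\<close> comes from
  \<open>L\<close>, \<open>curv\<close> from \<open>DL\<close> and \<open>cov\<close> from
  \<open>rel\<close>. The constants are bounds of holomorphic tensors on a compact disc of the line,
  hence the radius \<open>r/2\<close>.\<close>

lemma line_bounded:
  fixes T :: "complex^'n \<Rightarrow> complex^'k"
  assumes r: "r > 0" and line: "\<And>t. t \<noteq> 0 \<Longrightarrow> cmod t < r \<Longrightarrow> p + t *s y \<in> Q \<and> det (S (p + t *s y)) \<noteq> 0"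
    and p: "p \<in> Q" and good: "\<And>v. S p *v v = 0 \<Longrightarrow> DS p y v = 0 \<Longrightarrow> v = 0"
    and T: "clin T" "\<And>J x. comm_ideal \<mu> J \<Longrightarrow> x \<in> J \<Longrightarrow> T x = 0"
  shows "bdd0 (\<lambda>t. T (matrix_inv (S (p + t *s y)) *v X))"
proof -
  define C where "C = (\<lambda>t. p + t *s y) ` cball 0 (r/2)"
  have C: "compact C" unfolding C_def
    by (intro compact_continuous_image continuous_intros bounded_linear.continuous_on[OF bounded_linear_smult_left]) auto
  have inQ: "p + t *s y \<in> Q" if "cmod t < r" for t using line[of t] p that by (cases "t = 0") auto
  have CQ: "C \<subseteq> Q" unfolding C_def using r inQ by auto
  have inC: "p + t *s y \<in> C" if "cmod t < r/2" for t unfolding C_def using that by auto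
  define H where "H t = (\<chi> i j. DS (p + t *s y) y (axis j 1) $ i)" for t
  have H: "H t *v v = DS (p + t *s y) y v" if "cmod t < r" for t v
    using clin_expand[OF cbilD(1)[OF bil_holD(1)[OF DS inQ[OF that]]], of y v]
    by (simp add: H_def matrix_vector_mult_def vec_eq_iff mult.commute)
  obtain K1 where K1: "\<And>x v w. x \<in> C \<Longrightarrow> norm (L x v w) \<le> K1 * norm v * norm w" using bil_hol_bounded[OF L_bil_hol C CQ] by metis
  obtain K2 where K2: "\<And>x v w. x \<in> C \<Longrightarrow> norm (\<Gamma> x v w) \<le> K2 * norm v * norm w" using bil_hol_bounded[OF \<Gamma> C CQ] by metis
  interpret line_frame "\<lambda>t. S (p + t *s y)" H "r/2" y \<mu>
  proof
    show "r/2 > 0" using r by simp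
    fix t :: complex and i j assume t: "cmod t < r/2"
    then have t': "p + t *s y \<in> Q" using inQ r by simp
    have e: "scalar_holomorphic_on (\<lambda>x. S x $ i $ j) Q" by (rule lin_hol_matrix_entries[OF S])
    have "fd (\<lambda>x. S x $ i $ j) (p + t *s y) y = H t $ i $ j"
      using vector_holD(3)[OF S_hol t', of "axis j 1" y i] unfolding matrix_axis_nth by (simp add: H_def DS_def)
    then show "((\<lambda>t. S (p + t *s y) $ i $ j) has_field_derivative H t $ i $ j) (at t)"
      using line_field_derivative[OF e t'] by simp
  next
    show "det (S (p + t *s y)) \<noteq> 0" if "t \<noteq> 0" "cmod t < r/2" for t using line[of t] that r by auto
    show "cbil \<mu>" "\<mu> v w = \<mu> w v" for v w by (rule bil, rule sym)
    show "\<exists>K. \<forall>v t. cmod t < r/2 \<longrightarrow> norm (S (p + t *s y) *v \<mu> w v) \<le> K * norm (S (p + t *s y) *v v)" for w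
    proof (intro exI allI impI)
      fix v t assume "cmod t < r/2"
      from K1[OF inC[OF this], of w "S (p + t *s y) *v v"] L_frame[of "p + t *s y" w v] inC[OF this] CQ
      show "norm (S (p + t *s y) *v \<mu> w v) \<le> (K1 * norm w) * norm (S (p + t *s y) *v v)" by auto
    qed
    show "\<exists>K. \<forall>x z t. cmod t < r/2 \<longrightarrow> norm (S (p + t *s y) *v (\<mu> x (\<mu> b z) - \<mu> b (\<mu> x z)))
        \<le> K * norm (S (p + t *s y) *v x) * norm (S (p + t *s y) *v z)" for b
    proof -
      obtain K where K: "\<And>x v w. x \<in> C \<Longrightarrow> norm (DL b x v w) \<le> K * norm v * norm w" using bil_hol_bounded[OF DL_bil_hol C CQ] by metis
      then show ?thesis using DL_frame inC CQ by (metis subsetD)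
    qed
    show "\<exists>K. \<forall>v t. t \<noteq> 0 \<and> cmod t < r/2 \<longrightarrow>
        norm (H t *v v - S (p + t *s y) *v \<mu> (matrix_inv (S (p + t *s y)) *v y) v) \<le> K * norm (S (p + t *s y) *v v)"
    proof (intro exI allI impI)
      fix v t assume t: "t \<noteq> 0 \<and> cmod t < r/2"
      let ?x = "p + t *s y"
      have x: "?x \<in> Q" "det (S ?x) \<noteq> 0" using line[of t] t r by auto
      have "H t *v v - S ?x *v \<mu> (matrix_inv (S ?x) *v y) v = - \<Gamma> ?x y (S ?x *v v)"
        using rel_DS[OF x(1), of "matrix_inv (S ?x) *v y" v] H[of t v] t r by (simp add: matrix_inv_cancel(1)[OF x(2)])
      then show "norm (H t *v v - S ?x *v \<mu> (matrix_inv (S ?x) *v y) v) \<le> (K2 * norm y) * norm (S ?x *v v)"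
        using K2[OF inC, of t y "S ?x *v v"] t by simp
    qed
    fix v assume "S (p + 0 *s y) *v v = 0" "H 0 *v v = 0"
    then show "v = 0" using good[of v] H[of 0 v] r by simp
  qed
  show ?thesis by (rule projection_bounded[OF T])
qed

text \<open>Off the zeros of \<open>det S\<close> the function \<open>x \<mapsto> T ((S x)\<^sup>-\<^sup>1 X)\<close> is holomorphic, and it is bounded
  along the lines in a good direction. So it equals its mean over small circles in
  these lines, which avoid the zeros and depend holomorphically on the centre.\<close>

lemma extension_local:
  fixes T :: "complex^'n \<Rightarrow> complex^'k"
  assumes p: "p \<in> Q" and T: "clin T" "\<And>J x. comm_ideal \<mu> J \<Longrightarrow> x \<in> J \<Longrightarrow> T x = 0"
  obtains d \<Psi> where "d > 0" "ball p d \<subseteq> Q" "lin_hol \<Psi> (ball p d)"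
    "\<And>x X. x \<in> ball p d \<Longrightarrow> det (S x) \<noteq> 0 \<Longrightarrow> \<Psi> x X = T (matrix_inv (S x) *v X)"
proof -
  obtain y r where r: "r > 0" and good: "\<And>v. S p *v v = 0 \<Longrightarrow> DS p y v = 0 \<Longrightarrow> v = 0"
    and line: "\<And>t. t \<noteq> 0 \<Longrightarrow> cmod t < r \<Longrightarrow> p + t *s y \<in> Q \<and> det (S (p + t *s y)) \<noteq> 0"
    using good_direction[OF p] by metis
  obtain d2 where d2: "d2 > 0" "ball p d2 \<subseteq> Q" and
    good2: "\<And>x v. x \<in> ball p d2 \<Longrightarrow> S x *v v = 0 \<Longrightarrow> DS x y v = 0 \<Longrightarrow> v = 0"
    using good_near[OF p good] by metis
  \<comment> \<open>Below \<open>r\<close>, so that the circle around \<open>p\<close> avoids the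
    zeros, and so small that discs of radius \<open>2 * \<rho>\<close> in the line around all
    centres near \<open>p\<close> stay where \<open>y\<close> is a good direction.\<close>
  define \<rho> where "\<rho> = min (r/2) (d2 / (4 * (norm y + 1)))"
  have ny: "norm y + 1 > 0" using norm_ge_zero[of y] by linarith
  have \<rho>: "\<rho> > 0" "\<rho> < r" using r d2 ny by (auto simp: \<rho>_def)
  have \<rho>y: "2 * \<rho> * norm y \<le> d2/2"
  proof -
    have "2 * \<rho> * norm y \<le> 2 * (d2 / (4 * (norm y + 1))) * norm y" by (intro mult_right_mono mult_left_mono) (auto simp: \<rho>_def)
    also have "\<dots> = (d2/2) * (norm y / (norm y + 1))" using ny by (simp add: field_simps)
    also have "\<dots> \<le> (d2/2) * 1" using d2 ny by (intro mult_left_mono) (auto simp: field_simps)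
    finally show ?thesis by simp
  qed
  define N where "N = {x \<in> Q. det (S x) \<noteq> 0}"
  have oN: "open N" unfolding N_def by (rule open_det_nonzero[OF Q S])
  define f where "f i j x = T (matrix_inv (S x) *v axis j 1) $ i" for i j x
  have fN: "scalar_holomorphic_on (f i j) N" for i j
  proof -
    have l: "lin_hol (\<lambda>x. (*v) (matrix_inv (S x))) N"
      by (rule lin_hol_matrix_inv[OF lin_hol_subset[OF S] oN]) (auto simp: N_def)
    have "lin_hol (\<lambda>x::complex^'n. T) N" using T(1) by (simp add: lin_hol_def)
    from lin_hol_apply[OF oN this lin_holD(2)[OF l, of "axis j 1"]]
    show ?thesis unfolding f_def vector_holomorphic_on_def by blast
  qed
  have cK: "continuous_on {0..1} (\<lambda>t. circ \<rho> t *s y)"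
    by (intro bounded_linear.continuous_on[OF bounded_linear_smult_left] continuous_intros)
  define I where "I i j x = integral {0..1} (\<lambda>t. 1 * f i j (x + circ \<rho> t *s y))" for i j x
  have "\<exists>d>0. (\<forall>x\<in>ball p d. \<forall>t\<in>{0..1}. x + circ \<rho> t *s y \<in> N) \<and> scalar_holomorphic_on (I i j) (ball p d)" for i j
  proof -
    have "p + circ \<rho> t *s y \<in> N" for t
      using line[of "circ \<rho> t"] norm_circ[OF \<rho>(1), of t] circ_nonzero[OF \<rho>(1), of t] \<rho>(2) by (simp add: N_def)
    then show ?thesis unfolding I_def
      using hol_param_integral[OF fN oN cK continuous_on_const[of _ 1], of p i j] by metis
  qed
  then obtain D where D: "\<And>i j. D i j > 0" "\<And>i j x t. x \<in> ball p (D i j) \<Longrightarrow> t \<in> {0..1} \<Longrightarrow> x + circ \<rho> t *s y \<in> N"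
    "\<And>i j. scalar_holomorphic_on (I i j) (ball p (D i j))" by metis
  define d where "d = Min (insert (d2/2) (range (\<lambda>(i,j). D i j)))"
  have d: "d > 0" "d \<le> d2/2" "d \<le> D i j" for i j
  proof -
    show "d > 0" unfolding d_def using D(1) d2 by (subst Min_gr_iff) auto
    show "d \<le> d2/2" unfolding d_def by (rule Min_le) auto
    have "D i j \<in> range (\<lambda>(i,j). D i j)" by (rule range_eqI[of _ _ "(i,j)"]) simp
    then show "d \<le> D i j" unfolding d_def by (intro Min_le) auto
  qed
  have inball: "x + t *s y \<in> ball p d2" if "x \<in> ball p d" "cmod t < 2 * \<rho>" for x t
  proof -
    have "norm (t *s y) \<le> 2 * \<rho> * norm y" unfolding norm_smult using that by (intro mult_right_mono) auto
    then have "dist p (x + t *s y) < d + d2/2"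
      using \<rho>y that(1) norm_triangle_ineq[of "p - x" "- (t *s y)"] by (simp add: dist_norm algebra_simps)
    then show ?thesis using d(2) by simp
  qed
  have key: "I i j x = f i j x" if x: "x \<in> ball p d" and nz: "det (S x) \<noteq> 0" for i j x
  proof -
    have circN: "x + circ \<rho> t *s y \<in> N" if "t \<in> {0..1}" for t using D(2)[of x i j t] x d(3)[of i j] that by simp
    define \<phi> where "\<phi> t = det (S (x + t *s y))" for t
    have xQ: "x + t *s y \<in> Q" if "cmod t < 2 * \<rho>" for t using inball[OF x that] d2 by blast
    have \<phi>: "\<phi> holomorphic_on ball 0 (2 * \<rho>)" unfolding \<phi>_def
      by (rule line_holomorphic[OF det_hol]) (use xQ in auto)
    \<comment> \<open>Between \<open>\<rho>\<close> and \<open>2 * \<rho>\<close>: the closed disc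
      of radius \<open>R\<close> is compact in the domain of \<open>\<phi>\<close>, so it contains
      finitely many zeros.\<close>
    define R where "R = 3 * \<rho> / 2"
    have R: "\<rho> < R" "R < 2 * \<rho>" using \<rho> by (auto simp: R_def)
    define Z where "Z = {t \<in> cball 0 R. \<phi> t = 0}"
    have Z: "finite Z"
    proof (cases "\<phi> constant_on ball 0 (2 * \<rho>)")
      case True
      then obtain c where c: "\<And>t. t \<in> ball 0 (2*\<rho>) \<Longrightarrow> \<phi> t = c" unfolding constant_on_def by blast
      have "\<phi> 0 \<noteq> 0" using nz by (simp add: \<phi>_def)
      then have "c \<noteq> 0" using c[of 0] \<rho> by simp
      then have "Z = {}" unfolding Z_def using c R by auto
      then show ?thesis by simp
    next
      case False
      show ?thesis unfolding Z_def
        by (rule holomorphic_compact_finite_zeros[OF \<phi> open_ball connected_ball compact_cball _ False]) (use R in auto)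
    qed
    define Z' where "Z' = Z \<inter> ball 0 R"
    define F where "F t = f i j (x + t *s y)" for t
    have "\<exists>g. g holomorphic_on ball 0 R \<and> (\<forall>z\<in>ball 0 R - Z'. g z = F z)"
    proof (rule removable_singularities)
      show "finite Z'" unfolding Z'_def using Z by simp
      show "Z' \<subseteq> interior (ball 0 R)" by (simp add: Z'_def interior_open)
      show "F holomorphic_on ball 0 R - Z'" unfolding F_def
        by (rule line_holomorphic[OF fN]) (use xQ R in \<open>auto simp: N_def Z'_def Z_def \<phi>_def\<close>)
      \<comment> \<open>At each zero the same direction \<open>y\<close> is good and the other zeros
        keep a distance, so \<open>line_bounded\<close> applies there too and the singularity is
        removable.\<close>
      fix z assume z: "z \<in> Z'"
      let ?p = "x + z *s y"
      have zR: "cmod z < R" using z by (simp add: Z'_def)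
      obtain e where e: "e > 0" "\<And>w. w \<in> Z \<Longrightarrow> w \<noteq> z \<Longrightarrow> e \<le> dist w z"
        using finite_set_avoid[OF Z, of z] by (metis dist_commute)
      define r' where "r' = min e (R - cmod z)"
      have "bdd0 (\<lambda>t. T (matrix_inv (S (?p + t *s y)) *v axis j 1))"
      proof (rule line_bounded[OF _ _ _ _ T, where r=r'])
        show "r' > 0" using e zR by (simp add: r'_def)
        have zr: "cmod z < 2 * \<rho>" using zR R by simp
        show "?p \<in> Q" by (rule xQ[OF zr])
        show "v = 0" if "S ?p *v v = 0" "DS ?p y v = 0" for v by (rule good2[OF inball[OF x zr] that])
        fix t assume t: "t \<noteq> 0" "cmod t < r'"
        have tz: "cmod (z + t) < R" using t norm_triangle_ineq[of z t] by (simp add: r'_def)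
        have eq: "?p + t *s y = x + (z + t) *s y" by (simp add: vec_eq_iff algebra_simps)
        have "z + t \<notin> Z" using e(2)[of "z + t"] t by (auto simp: r'_def dist_norm)
        then have "\<phi> (z + t) \<noteq> 0" using tz by (simp add: Z_def)
        then show "?p + t *s y \<in> Q \<and> det (S (?p + t *s y)) \<noteq> 0"
          unfolding eq \<phi>_def using xQ[of "z + t"] tz R by simp
      qed
      from bdd0_component[OF this, of i] obtain K where "\<forall>\<^sub>F t in at 0. norm (T (matrix_inv (S (?p + t *s y)) *v axis j 1) $ i) \<le> K"
        unfolding bdd0_def by blast
      moreover have "?p + t *s y = x + (t + z) *s y" for t by (simp add: vec_eq_iff algebra_simps)
      ultimately have "\<forall>\<^sub>F t in at 0. norm (F (t + z)) \<le> K" by (simp add: F_def f_def)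
      then have "\<forall>\<^sub>F t in at z. norm (F t) \<le> K" by (subst eventually_at_to_0)
      then show "F \<in> O[at z](\<lambda>_. 1)" by (intro bigoI[where c=K]) simp
    qed
    then obtain g where g: "g holomorphic_on ball 0 R" "\<And>z. z \<in> ball 0 R - Z' \<Longrightarrow> g z = F z" by blast
    \<comment> \<open>The mean value property holds for the extension \<open>g\<close>. It agrees
      with \<open>F\<close> on the circle, which contains no zeros, and at the centre, since
      \<open>det (S x) \<noteq> 0\<close>.\<close>
    have "g 0 = integral {0..1} (\<lambda>t. g (circ \<rho> t))" by (rule cauchy_mean_value(1)[OF g(1) \<rho>(1) R(1)])
    also have "\<dots> = integral {0..1} (\<lambda>t. F (circ \<rho> t))"
    proof (rule integral_cong)
      fix t :: real assume "t \<in> {0..1}"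
      then have "circ \<rho> t \<notin> Z" using circN[of t] by (simp add: Z_def N_def \<phi>_def)
      then show "g (circ \<rho> t) = F (circ \<rho> t)" using g(2) norm_circ[OF \<rho>(1), of t] R by (simp add: Z'_def)
    qed
    also have "\<dots> = I i j x" by (simp add: I_def F_def)
    finally have "I i j x = g 0" by simp
    also have "\<dots> = F 0" using g(2)[of 0] nz \<rho> R by (simp add: Z'_def Z_def \<phi>_def)
    finally show ?thesis by (simp add: F_def)
  qed
  show thesis
  proof (rule that[OF d(1), of "\<lambda>x X. \<Sum>j\<in>UNIV. X $ j *s (\<chi> i. I i j x)"])
    show "ball p d \<subseteq> Q" using d d2 by auto
    have "vector_holomorphic_on (\<lambda>x. \<chi> i. I i j x) (ball p d)" for j
      unfolding vector_holomorphic_on_def using scalar_hol_subset[OF D(3)] d(3) by (simp add: subset_ball)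
    then show "lin_hol (\<lambda>x X. \<Sum>j\<in>UNIV. X $ j *s (\<chi> i. I i j x)) (ball p d)"
      unfolding lin_hol_def
      by (auto intro!: vector_hol_sum vector_hol_smult clinI simp: sum.distrib vec.scale_sum_right)
    fix x X assume x: "x \<in> ball p d" "det (S x) \<noteq> 0"
    have "(\<chi> i. I i j x) = T (matrix_inv (S x) *v axis j 1)" for j
      by (simp add: key[OF x] f_def)
    then show "(\<Sum>j\<in>UNIV. X $ j *s (\<chi> i. I i j x)) = T (matrix_inv (S x) *v X)"
      using clin_expand[OF clin_compose[OF T(1) clin_matrix], of "matrix_inv (S x)" X] by simp
  qed
qed

text \<open>Local extensions agree where the frame is a basis, hence by density on the overlap of
  their balls.\<close>

lemma extension:
  fixes T :: "complex^'n \<Rightarrow> complex^'k"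
  assumes T: "clin T" "\<And>J x. comm_ideal \<mu> J \<Longrightarrow> x \<in> J \<Longrightarrow> T x = 0"
  obtains \<Psi> where "lin_hol \<Psi> Q" "\<And>x v. x \<in> Q \<Longrightarrow> \<Psi> x (S x *v v) = T v"
proof -
  have "\<exists>d \<Psi>. d > 0 \<and> ball p d \<subseteq> Q \<and> lin_hol \<Psi> (ball p d) \<and>
    (\<forall>x\<in>ball p d. det (S x) \<noteq> 0 \<longrightarrow> (\<forall>X. \<Psi> x X = T (matrix_inv (S x) *v X)))" if "p \<in> Q" for p
    by (rule extension_local[OF that T]) (assumption, assumption, blast)
  then obtain d \<psi> where d: "\<And>p. p \<in> Q \<Longrightarrow> d p > 0" "\<And>p. p \<in> Q \<Longrightarrow> ball p (d p) \<subseteq> Q"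
    "\<And>p. p \<in> Q \<Longrightarrow> lin_hol (\<psi> p) (ball p (d p))"
    and eq: "\<And>p x X. p \<in> Q \<Longrightarrow> x \<in> ball p (d p) \<Longrightarrow> det (S x) \<noteq> 0 \<Longrightarrow> \<psi> p x X = T (matrix_inv (S x) *v X)"
    by metis
  \<comment> \<open>Each point uses the extension chosen for itself; by \<open>agree\<close> a
    single one may be used on a whole ball.\<close>
  define \<Psi> where "\<Psi> x = \<psi> x x" for x
  have agree: "\<Psi> x X = \<psi> p x X" if p: "p \<in> Q" and x: "x \<in> ball p (d p)" for p x X
  proof -
    have xQ: "x \<in> Q" using d(2) p x by blast
    show ?thesis unfolding \<Psi>_def
    proof (rule dense_eq[where W="ball x (d x) \<inter> ball p (d p)" and f="\<lambda>y. \<psi> x y X" and g="\<lambda>y. \<psi> p y X"])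
      show "continuous_on (ball x (d x) \<inter> ball p (d p)) (\<lambda>y. \<psi> x y X)" "continuous_on (ball x (d x) \<inter> ball p (d p)) (\<lambda>y. \<psi> p y X)"
        using vector_hol_continuous_on[OF lin_holD(2)[OF d(3)[OF xQ]]] vector_hol_continuous_on[OF lin_holD(2)[OF d(3)[OF p]]]
        by (auto intro: continuous_on_subset)
    qed (use d(1,2)[OF xQ] x eq p xQ in auto)
  qed
  have lin: "lin_hol \<Psi> Q"
    unfolding lin_hol_def
  proof (intro conjI ballI allI)
    fix x assume x: "x \<in> Q"
    have "\<Psi> x = \<psi> x x" by (simp add: \<Psi>_def)
    then show "clin (\<Psi> x)" using lin_holD(1)[OF d(3)[OF x]] d(1)[OF x] by simp
  next
    fix X
    show "vector_holomorphic_on (\<lambda>x. \<Psi> x X) Q"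
    proof (rule vector_hol_local)
      fix p assume p: "p \<in> Q"
      have "vector_holomorphic_on (\<lambda>x. \<Psi> x X) (ball p (d p))"
        by (rule vector_hol_cong[OF open_ball _ lin_holD(2)[OF d(3)[OF p]]]) (simp add: agree[OF p])
      then show "\<exists>T. p \<in> T \<and> vector_holomorphic_on (\<lambda>x. \<Psi> x X) T" using d(1)[OF p] by (intro exI[where x="ball p (d p)"]) simp
    qed
  qed
  show thesis
  proof (rule that[OF lin])
    fix x v assume x: "x \<in> Q"
    show "\<Psi> x (S x *v v) = T v"
    proof (rule dense_eq[OF Q order_refl _ continuous_on_const _ x, where f="\<lambda>x. \<Psi> x (S x *v v)"])
      show "continuous_on Q (\<lambda>x. \<Psi> x (S x *v v))"
        by (rule vector_hol_continuous_on[OF lin_hol_apply[OF Q lin S_hol]])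
      fix x assume x: "x \<in> Q" "det (S x) \<noteq> 0"
      then show "\<Psi> x (S x *v v) = T v"
        using eq[OF x(1) _ x(2)] d(1)[OF x(1)] by (simp add: \<Psi>_def matrix_inv_cancel(2))
    qed
  qed
qed

theorem projected_christoffel:
  assumes T: "clin T" "\<And>J x. comm_ideal \<mu> J \<Longrightarrow> x \<in> J \<Longrightarrow> T x = 0"
  obtains \<Gamma>' where "bil_hol \<Gamma>' Q" "\<And>x v w. x \<in> Q \<Longrightarrow> \<Gamma>' x v w = \<Gamma>' x w v"
    "\<And>x v w. x \<in> Q \<Longrightarrow> fd (\<lambda>y. S y *v w) x (S x *v v) + \<Gamma>' x (S x *v v) (S x *v w) = S x *v \<mu> (v - T v) (w - T w)"
proof -
  obtain \<Psi> where \<Psi>: "lin_hol \<Psi> Q" "\<And>x v. x \<in> Q \<Longrightarrow> \<Psi> x (S x *v v) = T v"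
    by (rule extension[OF T]) (assumption, assumption, rule that)
  \<comment> \<open>In the frame \<open>\<Psi>\<close> becomes \<open>T\<close>, and the formula is
    the expansion of \<open>\<mu> (v - T v) (w - T w)\<close> into four terms, each written with
    tensors that are holomorphic on all of \<open>Q\<close>.\<close>
  define \<Gamma>' where "\<Gamma>' x X Y = \<Gamma> x X Y - L x (\<Psi> x Y) X - L x (\<Psi> x X) Y + S x *v \<mu> (\<Psi> x X) (\<Psi> x Y)" for x X Y
  have ml: "lin_hol (\<lambda>x. \<mu> v) Q" for v using cbilD(1)[OF bil] by (simp add: lin_hol_def)
  have mb: "bil_hol (\<lambda>x. \<mu>) Q" using bil by (simp add: bil_hol_def)
  note \<Psi>l = lin_holD(1)[OF \<Psi>(1)] and \<Psi>h = lin_holD(2)[OF \<Psi>(1)]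
  note Lb = bil_holD(1)[OF L_bil_hol]
  have b: "bil_hol \<Gamma>' Q"
    unfolding bil_hol_def cbil_def \<Gamma>'_def
  proof (intro conjI allI ballI)
    fix x X assume x: "x \<in> Q"
    show "clin (\<lambda>Y. \<Gamma> x X Y - L x (\<Psi> x Y) X - L x (\<Psi> x X) Y + S x *v \<mu> (\<Psi> x X) (\<Psi> x Y))"
      by (intro clin_add_map clin_diff_map cbilD(1)[OF \<Gamma>_bil[OF x]] clin_compose[OF cbilD(2)[OF Lb[OF x]] \<Psi>l[OF x]]
          cbilD(1)[OF Lb[OF x]] clin_compose[OF clin_matrix] clin_compose[OF cbilD(1)[OF bil] \<Psi>l[OF x]])
  next
    fix x Y assume x: "x \<in> Q"
    show "clin (\<lambda>X. \<Gamma> x X Y - L x (\<Psi> x Y) X - L x (\<Psi> x X) Y + S x *v \<mu> (\<Psi> x X) (\<Psi> x Y))"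
      by (intro clin_add_map clin_diff_map cbilD(2)[OF \<Gamma>_bil[OF x]] clin_compose[OF cbilD(2)[OF Lb[OF x]] \<Psi>l[OF x]]
          cbilD(1)[OF Lb[OF x]] clin_compose[OF clin_matrix] clin_compose[OF cbilD(2)[OF bil] \<Psi>l[OF x]])
  next
    fix X Y
    show "vector_holomorphic_on (\<lambda>x. \<Gamma> x X Y - L x (\<Psi> x Y) X - L x (\<Psi> x X) Y + S x *v \<mu> (\<Psi> x X) (\<Psi> x Y)) Q"
      by (intro vector_hol_add vector_hol_diff bil_holD(2)[OF \<Gamma>] bil_hol_apply[OF Q L_bil_hol] \<Psi>h vector_hol_const
          lin_hol_apply[OF Q S] bil_hol_apply[OF Q mb])
  qed
  show thesis
  proof (rule that[OF b])
    fix x v w assume x: "x \<in> Q"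
    show "\<Gamma>' x v w = \<Gamma>' x w v"
      using \<Gamma>sym[OF x, of v w] sym[of "\<Psi> x v" "\<Psi> x w"] by (simp add: \<Gamma>'_def algebra_simps)
    show "fd (\<lambda>y. S y *v w) x (S x *v v) + \<Gamma>' x (S x *v v) (S x *v w) = S x *v \<mu> (v - T v) (w - T w)"
      using rel[OF x, of w v] sym[of "T w" v]
      by (simp add: \<Gamma>'_def \<Psi>(2)[OF x] L_frame[OF x] clin_diff[OF cbilD(1)[OF bil]] clin_diff[OF cbilD(2)[OF bil]]
          clin_diff[OF clin_matrix] algebra_simps)
  qed
qed

end

section \<open>Covariant derivatives in a frame\<close>

context chart_frame
begin

text \<open>With \<open>Y = S c\<close> the derivative splits into that of the coefficients and that
  of the frame, and \<open>rel\<close> turns the latter together with \<open>\<Gamma>\<close> into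
  \<open>\<mu>\<close>.\<close>

lemma covariant_derivative_frame:
  assumes V: "open V" "V \<subseteq> Q" and x: "x \<in> V" and nz: "\<And>y. y \<in> V \<Longrightarrow> det (S y) \<noteq> 0"
    and Y: "vector_holomorphic_on Y V"
  shows "fd Y x X + \<Gamma> x X (Y x) =
    S x *v (fd (\<lambda>y. matrix_inv (S y) *v Y y) x X + \<mu> (matrix_inv (S x) *v X) (matrix_inv (S x) *v Y x))"
proof -
  define c where "c y = matrix_inv (S y) *v Y y" for y
  have SV: "lin_hol (\<lambda>x. (*v) (S x)) V" by (rule lin_hol_subset[OF S V(2)])
  have inv: "lin_hol (\<lambda>x. (*v) (matrix_inv (S x))) V" by (rule lin_hol_matrix_inv[OF SV V(1) nz])
  have c: "vector_holomorphic_on c V" unfolding c_def by (rule lin_hol_apply[OF V(1) inv Y])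
  have Yc: "Y y = S y *v c y" if "y \<in> V" for y using matrix_inv_cancel(1)[OF nz[OF that]] by (simp add: c_def)
  have xQ: "x \<in> Q" using x V by blast
  have "fd Y x X = fd (\<lambda>y. S y *v c y) x X" using fd_cong_open[OF V(1) x Yc] by simp
  also have "\<dots> = DS x X (c x) + S x *v fd c x X" unfolding DS_def by (rule fd_lin_hol[OF V(1) SV x c])
  finally have 1: "fd Y x X = DS x X (c x) + S x *v fd c x X" .
  have "DS x X (c x) = S x *v \<mu> (matrix_inv (S x) *v X) (c x) - \<Gamma> x X (S x *v c x)"
    using rel_DS[OF xQ, of "matrix_inv (S x) *v X" "c x"] by (simp add: matrix_inv_cancel(1)[OF nz[OF x]])
  then show ?thesis unfolding 1 Yc[OF x, symmetric] c_def[symmetric] using Yc[OF x]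
    by (simp add: clin_add[OF clin_matrix])
qed

text \<open>Where the frame is a basis, the operator acts on coefficients as differentiation plus a
  constant product. Second derivatives cancel by symmetry, and the commutator of the multiplications
  vanishes by \<open>assoc\<close>. The remaining points follow by density.\<close>

lemma curvature_zero:
  assumes assoc: "\<And>a b c. \<mu> a (\<mu> b c) = \<mu> b (\<mu> a c)"
    and W: "open W" "W \<subseteq> Q" and x: "x \<in> W"
    and X: "vector_holomorphic_on X W" and Y: "vector_holomorphic_on Y W" and Z: "vector_holomorphic_on Z W"
  defines "D \<equiv> \<lambda>A B x. fd B x (A x) + \<Gamma> x (A x) (B x)"
  shows "D X (D Y Z) x - D Y (D X Z) x - D (\<lambda>x. fd Y x (X x) - fd X x (Y x)) Z x = 0"
proof -
  have hfd: "vector_holomorphic_on (\<lambda>x. fd B x (A x)) U"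
    if "open U" "vector_holomorphic_on A U" "vector_holomorphic_on B U"
    for A B :: "complex^'n \<Rightarrow> complex^'n" and U
  proof -
    have "lin_hol (fd B) U" unfolding lin_hol_def using vector_hol_fd_clin[OF that(3)] vector_hol_fd(1)[OF that(3,1)] by auto
    then show ?thesis by (rule lin_hol_apply[OF that(1) _ that(2)])
  qed
  have hD: "vector_holomorphic_on (D A B) W" if "vector_holomorphic_on A W" "vector_holomorphic_on B W" for A B
    unfolding D_def by (intro vector_hol_add hfd W that bil_hol_apply[OF W(1) bil_hol_subset[OF \<Gamma> W(2)]])
  show ?thesis
  proof (rule dense_eq[OF W(1,2) _ continuous_on_const _ x, where f="\<lambda>x. D X (D Y Z) x - D Y (D X Z) x - D (\<lambda>x. fd Y x (X x) - fd X x (Y x)) Z x"])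
    show "continuous_on W (\<lambda>x. D X (D Y Z) x - D Y (D X Z) x - D (\<lambda>x. fd Y x (X x) - fd X x (Y x)) Z x)"
      by (intro vector_hol_continuous_on vector_hol_diff hD hfd X Y Z W)
    fix x assume x: "x \<in> W" "det (S x) \<noteq> 0"
    define V where "V = {y \<in> W. det (S y) \<noteq> 0}"
    have oV: "open V" unfolding V_def by (rule open_det_nonzero[OF W(1) lin_hol_subset[OF S W(2)]])
    have VQ: "V \<subseteq> Q" and VW: "V \<subseteq> W" and nz: "\<And>y. y \<in> V \<Longrightarrow> det (S y) \<noteq> 0" and xV: "x \<in> V"
      using W x by (auto simp: V_def)
    note sub = vector_hol_subset[OF _ VW]
    have inv: "lin_hol (\<lambda>x. (*v) (matrix_inv (S x))) V"
      by (rule lin_hol_matrix_inv[OF lin_hol_subset[OF S VQ] oV nz])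
    define c where "c A y = matrix_inv (S y) *v A y" for A y
    have hc: "vector_holomorphic_on (c A) V" if "vector_holomorphic_on A W" for A
      unfolding c_def by (rule lin_hol_apply[OF oV inv sub[OF that]])
    have F: "D A B y = S y *v (fd (c B) y (A y) + \<mu> (c A y) (c B y))"
      if "y \<in> V" "vector_holomorphic_on B W" for A B y
      using covariant_derivative_frame[OF oV VQ that(1) nz sub[OF that(2)]] unfolding D_def c_def .
    have cD: "c (D A B) y = fd (c B) y (A y) + \<mu> (c A y) (c B y)" if "y \<in> V" "vector_holomorphic_on B W" for A B y
      using F[OF that] matrix_inv_cancel(2)[OF nz[OF that(1)]] by (simp add: c_def)
    have mb: "bil_hol (\<lambda>x. \<mu>) V" using bil by (simp add: bil_hol_def)
    have m0: "fd (\<lambda>y. \<mu> a b) x h = 0" for a b h by (simp add: frechet_derivative_const)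
    have dcD: "fd (c (D A B)) x h = fd (\<lambda>y. fd (c B) y (A x)) x h + fd (c B) x (fd A x h) + \<mu> (fd (c A) x h) (c B x) + \<mu> (c A x) (fd (c B) x h)"
      if A: "vector_holomorphic_on A W" and B: "vector_holomorphic_on B W" for A B h
    proof -
      have lB: "lin_hol (fd (c B)) V" unfolding lin_hol_def
        using vector_hol_fd_clin[OF hc[OF B]] vector_hol_fd(1)[OF hc[OF B] oV] by auto
      have h1: "vector_holomorphic_on (\<lambda>y. fd (c B) y (A y)) V" by (rule hfd[OF oV sub[OF A] hc[OF B]])
      have h2: "vector_holomorphic_on (\<lambda>y. \<mu> (c A y) (c B y)) V" by (rule bil_hol_apply[OF oV mb hc[OF A] hc[OF B]])
      have "fd (c (D A B)) x = fd (\<lambda>y. fd (c B) y (A y) + \<mu> (c A y) (c B y)) x"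
        by (rule fd_cong_open[OF oV xV]) (rule cD[OF _ B])
      also have "\<dots> = (\<lambda>h. fd (\<lambda>y. fd (c B) y (A y)) x h + fd (\<lambda>y. \<mu> (c A y) (c B y)) x h)"
        by (intro frechet_derivative_at' has_derivative_add vector_holD(1)[OF h1 xV] vector_holD(1)[OF h2 xV])
      finally show ?thesis
        using fd_lin_hol[OF oV lB xV sub[OF A], of h] fd_bil_hol[OF oV mb xV hc[OF A] hc[OF B], of h]
        by (simp add: m0)
    qed
    have sym2: "fd (\<lambda>y. fd (c Z) y h) x k = fd (\<lambda>y. fd (c Z) y k) x h" for h k
      by (rule vector_hol_fd(2)[OF hc[OF Z] oV xV])
    define b where "b = fd Y x (X x) - fd X x (Y x)"
    \<comment> \<open>The coefficients of the Lie bracket: the terms with \<open>\<mu>\<close> and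
      with \<open>\<Gamma>\<close> cancel because both are symmetric.\<close>
    have "S x *v (fd (c Y) x (X x) - fd (c X) x (Y x)) = D X Y x - D Y X x"
      using F[OF xV X, of Y] F[OF xV Y, of X] sym[of "c X x" "c Y x"] by (simp add: clin_diff[OF clin_matrix] clin_add[OF clin_matrix])
    also have "\<dots> = b" using \<Gamma>sym[of x "X x" "Y x"] VQ xV by (auto simp: D_def b_def)
    finally have cb: "matrix_inv (S x) *v b = fd (c Y) x (X x) - fd (c X) x (Y x)"
      using matrix_inv_cancel(2)[OF nz[OF xV]] by metis
    have fdZ: "clin (fd (c Z) x)" by (rule vector_hol_fd_clin[OF hc[OF Z] xV])
    note md = clin_diff[OF cbilD(1)[OF bil]] clin_diff[OF cbilD(2)[OF bil]] clin_add[OF cbilD(1)[OF bil]] clin_add[OF cbilD(2)[OF bil]]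
    have 1: "D X (D Y Z) x = S x *v (fd (c (D Y Z)) x (X x) + \<mu> (c X x) (c (D Y Z) x))" by (rule F[OF xV hD[OF Y Z]])
    have 2: "D Y (D X Z) x = S x *v (fd (c (D X Z)) x (Y x) + \<mu> (c Y x) (c (D X Z) x))" by (rule F[OF xV hD[OF X Z]])
    have 3: "D (\<lambda>x. fd Y x (X x) - fd X x (Y x)) Z x = S x *v (fd (c Z) x b + \<mu> (matrix_inv (S x) *v b) (c Z x))"
      using F[OF xV Z, of "\<lambda>x. fd Y x (X x) - fd X x (Y x)"] by (simp add: c_def b_def)
    have fb: "fd (c Z) x b = fd (c Z) x (fd Y x (X x)) - fd (c Z) x (fd X x (Y x))" by (simp add: b_def clin_diff[OF fdZ])
    show "D X (D Y Z) x - D Y (D X Z) x - D (\<lambda>x. fd Y x (X x) - fd X x (Y x)) Z x = 0"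
      unfolding 1 2 3 cb fb dcD[OF Y Z] dcD[OF X Z] cD[OF xV Z] md
      using sym2[of "X x" "Y x"] assoc[of "c X x" "c Y x" "c Z x"]
      by (simp add: clin_diff[OF clin_matrix, symmetric])
  qed
qed

end

section \<open>Flows of a commuting frame\<close>

lemma bounded_bilinear_smult: "bounded_bilinear (\<lambda>z (x::complex^'n). z *s x)"
  by (rule bounded_bilinear.intro)
     (auto simp: scaleR_eq_smult mult_ac norm_smult scaleR_conv_of_real intro!: exI[where x=1])

lemma continuous_on_lin_hol:
  assumes T: "lin_hol T S" and g: "continuous_on X g" "g ` X \<subseteq> S" and v: "continuous_on X v"
  shows "continuous_on X (\<lambda>z. T (g z) (v z))"
proof -
  have "continuous_on X (\<lambda>z. \<Sum>i\<in>UNIV. v z $ i *s T (g z) (axis i 1))"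
    by (intro continuous_on_sum bounded_bilinear.continuous_on[OF bounded_bilinear_smult] continuous_on_component v
        continuous_on_compose2[OF vector_hol_continuous_on[OF lin_holD(2)[OF T]] g(1) g(2)])
  then show ?thesis
  proof (rule continuous_on_eq)
    show "(\<Sum>i\<in>UNIV. v z $ i *s T (g z) (axis i 1)) = T (g z) (v z)" if "z \<in> X" for z
      using clin_expand[OF lin_holD(1)[OF T], of "g z" "v z"] g(2) that by auto
  qed
qed

lemma continuous_on_bil_hol:
  assumes B: "bil_hol B S" and g: "continuous_on X g" "g ` X \<subseteq> S" and v: "continuous_on X v" and w: "continuous_on X w"
  shows "continuous_on X (\<lambda>z. B (g z) (v z) (w z))"
proof -
  have "continuous_on X (\<lambda>z. \<Sum>i\<in>UNIV. v z $ i *s B (g z) (axis i 1) (w z))"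
    by (intro continuous_on_sum bounded_bilinear.continuous_on[OF bounded_bilinear_smult] continuous_on_component v
        continuous_on_lin_hol[OF bil_hol_lin1[OF B] g w])
  then show ?thesis
  proof (rule continuous_on_eq)
    show "(\<Sum>i\<in>UNIV. v z $ i *s B (g z) (axis i 1) (w z)) = B (g z) (v z) (w z)" if "z \<in> X" for z
      using clin_expand[OF cbilD(2)[OF bil_holD(1)[OF B]], of "g z" "v z" "w z"] g(2) that by auto
  qed
qed

lemma clin_bounded_linear: "clin T \<Longrightarrow> bounded_linear T"
  using clin_linear linear_conv_bounded_linear by blast

text \<open>The Poincare lemma: \<open>F x\<close> is the integral of \<open>\<theta>\<close> over
  the segment from \<open>x0\<close> to \<open>x\<close>. Closedness makes the derivative of the
  integrand along \<open>h\<close> equal to the \<open>t\<close>-derivative of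
  \<open>t *\<^sub>R \<theta> (P x t) h\<close>.\<close>

lemma closed_form_exact:
  fixes \<theta> :: "complex^'n \<Rightarrow> complex^'n \<Rightarrow> complex^'m"
  assumes \<theta>: "lin_hol \<theta> (ball x0 R)"
    and closed: "\<And>x h k. x \<in> ball x0 R \<Longrightarrow> fd (\<lambda>y. \<theta> y h) x k = fd (\<lambda>y. \<theta> y k) x h"
  obtains F where "\<And>x. x \<in> ball x0 R \<Longrightarrow> (F has_derivative \<theta> x) (at x)"
proof -
  let ?B = "ball x0 R"
  define P where "P x t = x0 + t *\<^sub>R (x - x0)" for x and t :: real
  have P: "P x t \<in> ?B" if "x \<in> ?B" "t \<in> {0..1}" for x t
  proof -
    have "t * norm (x - x0) \<le> 1 * norm (x - x0)" using that by (intro mult_right_mono) auto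
    then show ?thesis using that by (simp add: P_def dist_norm norm_minus_commute)
  qed
  define f where "f x t = \<theta> (P x t) (x - x0)" for x t
  define f' where "f' x t h = fd (\<lambda>y. \<theta> y (x - x0)) (P x t) (t *\<^sub>R h) + \<theta> (P x t) h" for x t h
  have d\<theta>: "bil_hol (\<lambda>x h v. fd (\<lambda>y. \<theta> y v) x h) ?B" by (rule lin_hol_fd[OF open_ball \<theta>])
  have der: "((\<lambda>x. f x t) has_derivative f' x t) (at x within ?B)" if "x \<in> ?B" "t \<in> {0..1}" for x t
  proof -
    have 1: "((\<lambda>x. P x t) has_derivative (\<lambda>h. t *\<^sub>R h)) (at x within ?B)" unfolding P_def
      by (auto intro!: derivative_eq_intros)
    have 2: "((\<lambda>x. x - x0) has_derivative (\<lambda>h. h)) (at x within ?B)" by (auto intro!: derivative_eq_intros)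
    show ?thesis unfolding f_def f'_def
      by (rule has_derivative_lin_hol[OF open_ball \<theta> 1 P[OF that] 2 that(1)])
  qed
  have bl: "bounded_linear (f' x t)" if "x \<in> ?B" "t \<in> {0..1}" for x t
    using der[OF that] by (rule has_derivative_bounded_linear)
  have cont': "continuous_on (?B \<times> {0..1}) (\<lambda>(x, t). f' x t h)" for h
    unfolding f'_def split_beta
  proof (intro continuous_on_add)
    have cP: "continuous_on (?B \<times> {0..1}) (\<lambda>z. P (fst z) (snd z))" unfolding P_def by (intro continuous_intros)
    have iP: "(\<lambda>z. P (fst z) (snd z)) ` (?B \<times> {0..1}) \<subseteq> ?B" using P by auto
    show "continuous_on (?B \<times> {0..1}) (\<lambda>z. fd (\<lambda>y. \<theta> y (fst z - x0)) (P (fst z) (snd z)) (snd z *\<^sub>R h))"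
      by (rule continuous_on_bil_hol[OF d\<theta> cP iP]) (intro continuous_intros)+
    show "continuous_on (?B \<times> {0..1}) (\<lambda>z. \<theta> (P (fst z) (snd z)) h)"
      by (rule continuous_on_lin_hol[OF \<theta> cP iP]) (intro continuous_intros)
  qed
  have cf: "continuous_on {0..1} (f x)" if x: "x \<in> ?B" for x unfolding f_def
    by (rule continuous_on_lin_hol[OF \<theta>]) (use P[OF x] in \<open>auto simp: P_def intro!: continuous_intros\<close>)
  define F where "F x = integral (cbox 0 1) (f x)" for x
  show thesis
  proof (rule that[of F])
    fix x assume x: "x \<in> ?B"
    have "(F has_derivative integral (cbox 0 1) (\<lambda>t. Blinfun (f' x t))) (at x within ?B)"
      unfolding F_def
    proof (rule leibniz_rule[where fx="\<lambda>x t. Blinfun (f' x t)"])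
      show "((\<lambda>x. f x t) has_derivative blinfun_apply (Blinfun (f' x t))) (at x within ?B)" if "x \<in> ?B" "t \<in> cbox 0 1" for x t
        using der[OF that(1)] that bl[OF that(1)] by (simp add: bounded_linear_Blinfun_apply)
      show "f x integrable_on cbox 0 1" if "x \<in> ?B" for x
        using integrable_continuous_real[OF cf[OF that]] by simp
      have "continuous_on (?B \<times> cbox 0 1) (\<lambda>z. Blinfun (f' (fst z) (snd z)))"
      proof (rule continuous_on_blinfun_componentwise)
        fix i :: "complex^'n"
        show "continuous_on (?B \<times> cbox 0 1) (\<lambda>z. blinfun_apply (Blinfun (f' (fst z) (snd z))) i)"
        proof (rule continuous_on_eq)
          show "continuous_on (?B \<times> cbox 0 1) (\<lambda>(x, t). f' x t i)" using cont'[of i] by simp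
        qed (auto simp: bounded_linear_Blinfun_apply bl)
      qed
      then show "continuous_on (?B \<times> cbox 0 1) (\<lambda>(x, t). Blinfun (f' x t))" by (simp add: split_beta)
    qed (use x in auto)
    moreover have "blinfun_apply (integral (cbox 0 1) (\<lambda>t. Blinfun (f' x t))) = \<theta> x"
    proof
      fix h
      have cB: "continuous_on {0..1} (\<lambda>t. Blinfun (f' x t))"
      proof (rule continuous_on_blinfun_componentwise)
        fix i :: "complex^'n"
        have "continuous_on {0..1} (\<lambda>t::real. (x, t))" by (rule continuous_on_Pair[OF continuous_on_const continuous_on_id])
        from continuous_on_compose2[OF cont'[of i] this]
        have "continuous_on {0..1} (\<lambda>t. f' x t i)" using x by (auto simp: image_subset_iff)
        then show "continuous_on {0..1} (\<lambda>t. blinfun_apply (Blinfun (f' x t)) i)"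
          by (rule continuous_on_eq) (use bl[OF x] in \<open>simp add: bounded_linear_Blinfun_apply\<close>)
      qed
      have "blinfun_apply (integral {0..1} (\<lambda>t. Blinfun (f' x t))) h = integral {0..1} (\<lambda>t. blinfun_apply (Blinfun (f' x t)) h)"
        by (rule blinfun_apply_integral[OF integrable_continuous_real[OF cB]])
      also have "\<dots> = integral {0..1} (\<lambda>t. f' x t h)"
        by (rule integral_cong) (use bl[OF x] in \<open>simp add: bounded_linear_Blinfun_apply\<close>)
      also have "\<dots> = 1 *\<^sub>R \<theta> (P x 1) h - 0 *\<^sub>R \<theta> (P x 0) h"
      proof (rule integral_unique, rule fundamental_theorem_of_calculus)
        fix t :: real assume t: "t \<in> {0..1}"
        have "((\<lambda>t. \<theta> (P x t) (t *\<^sub>R h)) has_derivative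
            (\<lambda>s. fd (\<lambda>y. \<theta> y (t *\<^sub>R h)) (P x t) (s *\<^sub>R (x - x0)) + \<theta> (P x t) (s *\<^sub>R h))) (at t within {0..1})"
        proof -
          have 1: "(P x has_derivative (\<lambda>s. s *\<^sub>R (x - x0))) (at t within {0..1})" unfolding P_def
            by (auto intro!: derivative_eq_intros)
          have 2: "((\<lambda>t. t *\<^sub>R h) has_derivative (\<lambda>s. s *\<^sub>R h)) (at t within {0..1})"
            by (auto intro!: derivative_eq_intros)
          show ?thesis by (rule has_derivative_lin_hol[OF open_ball \<theta> 1 P[OF x t] 2 t])
        qed
        moreover have "fd (\<lambda>y. \<theta> y (t *\<^sub>R h)) (P x t) (s *\<^sub>R (x - x0)) + \<theta> (P x t) (s *\<^sub>R h) = s *\<^sub>R f' x t h" for s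
        proof -
          have l: "linear (fd (\<lambda>y. \<theta> y v) (P x t))" for v
            by (rule clin_linear[OF vector_hol_fd_clin[OF lin_holD(2)[OF \<theta>] P[OF x t]]])
          \<comment> \<open>Closedness exchanges the direction of differentiation and the argument
            of the form.\<close>
          have "fd (\<lambda>y. \<theta> y (t *\<^sub>R h)) (P x t) (s *\<^sub>R (x - x0)) = s *\<^sub>R fd (\<lambda>y. \<theta> y (x - x0)) (P x t) (t *\<^sub>R h)"
            by (simp add: linear_scale[OF l] closed[OF P[OF x t], of "t *\<^sub>R h" "x - x0"])
          then show ?thesis
            using linear_scale[OF clin_linear[OF lin_holD(1)[OF \<theta> P[OF x t]]]] by (simp add: f'_def scaleR_add_right)
        qed
        ultimately have "((\<lambda>t. \<theta> (P x t) (t *\<^sub>R h)) has_vector_derivative f' x t h) (at t within {0..1})"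
          by (simp add: has_vector_derivative_def)
        then show "((\<lambda>t. t *\<^sub>R \<theta> (P x t) h) has_vector_derivative f' x t h) (at t within {0..1})"
          by (rule has_vector_derivative_transform[OF t, rotated])
             (use linear_scale[OF clin_linear[OF lin_holD(1)[OF \<theta> P[OF x]]]] in simp)
      qed simp
      finally show "blinfun_apply (integral (cbox 0 1) (\<lambda>t. Blinfun (f' x t))) h = \<theta> x h" by (simp add: P_def)
    qed
    ultimately show "(F has_derivative \<theta> x) (at x)"
      using at_within_open[OF x open_ball] by simp
  qed
qed

text \<open>The inverse matrix of a commuting frame is a closed form. A primitive \<open>F\<close>
  straightens all frame fields at once, that of \<open>v\<close> becoming the constant
  \<open>v\<close>, so the flow is translation by \<open>t v\<close> in the coordinates
  \<open>F\<close>. Its Jacobian \<open>S (H t x) ** matrix_inv (S x)\<close> carries the frame to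
  the frame.\<close>

lemma frame_flow:
  fixes S :: "complex^'n \<Rightarrow> complex^'n^'n"
  assumes Q: "open Q" and S: "lin_hol (\<lambda>x. (*v) (S x)) Q"
    and commute: "\<And>x v w. x \<in> Q \<Longrightarrow> fd (\<lambda>y. S y *v w) x (S x *v v) = fd (\<lambda>y. S y *v v) x (S x *v w)"
    and x0: "x0 \<in> Q" "det (S x0) \<noteq> 0"
  obtains \<epsilon> W H where "\<epsilon> > 0" "open W" "x0 \<in> W" "W \<subseteq> Q" "\<And>x. x \<in> W \<Longrightarrow> det (S x) \<noteq> 0" "\<And>x. x \<in> W \<Longrightarrow> H 0 x = x"
    "\<And>t x. t \<in> ball 0 \<epsilon> \<Longrightarrow> x \<in> W \<Longrightarrow> H t x \<in> Q \<and>
       ((\<lambda>(s, x). H s x) has_derivative (\<lambda>(s, h). s *s (S (H t x) *v v) + (S (H t x) ** matrix_inv (S x)) *v h)) (at (t, x))"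
proof -
  define N where "N = {x \<in> Q. det (S x) \<noteq> 0}"
  have oN: "open N" unfolding N_def by (rule open_det_nonzero[OF Q S])
  obtain R where R: "R > 0" "ball x0 R \<subseteq> N" using oN x0 open_contains_ball[of N] by (auto simp: N_def)
  let ?B = "ball x0 R"
  have BQ: "?B \<subseteq> Q" and nz: "\<And>x. x \<in> ?B \<Longrightarrow> det (S x) \<noteq> 0" using R by (auto simp: N_def)
  note SB = lin_hol_subset[OF S BQ]
  define \<theta> where "\<theta> x = (*v) (matrix_inv (S x))" for x
  have \<theta>: "lin_hol \<theta> ?B" unfolding \<theta>_def by (rule lin_hol_matrix_inv[OF SB open_ball nz])
  \<comment> \<open>The derivative of the inverse matrix, by differentiating
    \<open>\<theta> y (S y *v u) = u\<close> with the fixed vector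
    \<open>u = \<theta> x k\<close>.\<close>
  have dinv: "fd (\<lambda>y. \<theta> y k) x h = - (\<theta> x (fd (\<lambda>y. S y *v \<theta> x k) x h))" if x: "x \<in> ?B" for x h k
  proof -
    have "fd (\<lambda>y. \<theta> y (S y *v \<theta> x k)) x h = fd (\<lambda>y. \<theta> y (S x *v \<theta> x k)) x h + \<theta> x (fd (\<lambda>y. S y *v \<theta> x k) x h)"
      by (rule fd_lin_hol[OF open_ball \<theta> x lin_holD(2)[OF SB]])
    moreover have "fd (\<lambda>y. \<theta> y (S y *v \<theta> x k)) x = fd (\<lambda>y. \<theta> x k) x"
      by (rule fd_cong_open[OF open_ball x]) (simp add: \<theta>_def matrix_inv_cancel(2) nz)
    ultimately show ?thesis
      using matrix_inv_cancel(1)[OF nz[OF x], of k] by (simp add: \<theta>_def frechet_derivative_const eq_neg_iff_add_eq_0)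
  qed
  obtain F where F: "\<And>x. x \<in> ?B \<Longrightarrow> (F has_derivative \<theta> x) (at x)"
  proof (rule closed_form_exact[OF \<theta>])
    fix x h k assume x: "x \<in> ?B"
    have "S x *v \<theta> x h = h" "S x *v \<theta> x k = k" unfolding \<theta>_def by (rule matrix_inv_cancel(1)[OF nz[OF x]])+
    then show "fd (\<lambda>y. \<theta> y h) x k = fd (\<lambda>y. \<theta> y k) x h"
      using commute[of x "\<theta> x h" "\<theta> x k"] BQ x unfolding dinv[OF x] by auto
  qed (rule that)
  have bl: "bounded_linear (\<theta> x)" for x unfolding \<theta>_def by (rule clin_bounded_linear[OF clin_matrix])
  have blS: "bounded_linear ((*v) (S x))" for x by (rule clin_bounded_linear[OF clin_matrix])
  have "continuous_on ?B (\<lambda>x. Blinfun (\<theta> x))"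
    by (rule continuous_on_blinfun_componentwise)
       (simp add: bounded_linear_Blinfun_apply[OF bl] vector_hol_continuous_on[OF lin_holD(2)[OF \<theta>]])
  moreover have "Blinfun ((*v) (S x0)) o\<^sub>L Blinfun (\<theta> x0) = id_blinfun"
    by (rule blinfun_eqI) (simp add: bounded_linear_Blinfun_apply[OF bl] bounded_linear_Blinfun_apply[OF blS], simp add: \<theta>_def matrix_inv_cancel(1) x0)
  moreover have "(F has_derivative blinfun_apply (Blinfun (\<theta> x))) (at x)" if "x \<in> ?B" for x
    using F[OF that] by (simp add: bounded_linear_Blinfun_apply[OF bl])
  ultimately obtain U V g g' where U: "open U" "U \<subseteq> ?B" "x0 \<in> U" "open V" "F x0 \<in> V" "homeomorphism U V F g"
    and g: "\<And>y. y \<in> V \<Longrightarrow> (g has_derivative (g' y)) (at y)"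
    "\<And>y. y \<in> V \<Longrightarrow> g' y = inv (blinfun_apply (Blinfun (\<theta> (g y))))"
    using inverse_function_theorem[of ?B F "\<lambda>x. Blinfun (\<theta> x)" x0 "Blinfun ((*v) (S x0))"] R by (metis centre_in_ball open_ball)
  have gU: "g y \<in> U" if "y \<in> V" for y using U(6) that unfolding homeomorphism_def by blast
  have g': "g' y = (*v) (S (g y))" if "y \<in> V" for y
  proof -
    have n: "det (S (g y)) \<noteq> 0" using nz gU[OF that] U(2) by blast
    show ?thesis unfolding g(2)[OF that] bounded_linear_Blinfun_apply[OF bl]
      by (rule inv_equality) (simp_all add: \<theta>_def matrix_inv_cancel[OF n])
  qed
  \<comment> \<open>One \<open>\<eta>\<close> is for the initial point and one for the displacement
    \<open>t *s v\<close>.\<close>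
  obtain \<eta> where \<eta>: "\<eta> > 0" "ball (F x0) (2 * \<eta>) \<subseteq> V"
  proof -
    obtain e where "e > 0" "ball (F x0) e \<subseteq> V" using U(4,5) open_contains_ball by blast
    then show thesis by (intro that[of "e/2"]) auto
  qed
  define W where "W = U \<inter> F -` ball (F x0) \<eta>"
  have cF: "continuous_on U F" using F U(2) has_derivative_continuous continuous_at_imp_continuous_on by (metis subsetD)
  have oW: "open W" unfolding W_def by (rule continuous_open_preimage[OF cF U(1) open_ball])
  define \<epsilon> where "\<epsilon> = \<eta> / (norm v + 1)"
  have nv: "norm v + 1 > 0" using norm_ge_zero[of v] by linarith
  define H where "H t x = g (F x + t *s v)" for t x
  have inV: "F x + t *s v \<in> V" if "t \<in> ball 0 \<epsilon>" "x \<in> W" for t x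
  proof -
    have "norm (t *s v) \<le> \<epsilon> * norm v" unfolding norm_smult using that by (intro mult_right_mono) auto
    also have "\<dots> \<le> \<eta>" using \<eta> nv by (simp add: \<epsilon>_def field_simps)
    finally have "dist (F x0) (F x + t *s v) < 2 * \<eta>"
      using that(2) norm_triangle_ineq[of "F x0 - F x" "- (t *s v)"] by (simp add: W_def dist_norm algebra_simps)
    then show ?thesis using \<eta>(2) by auto
  qed
  show thesis
  proof (rule that[of \<epsilon> W H])
    show "\<epsilon> > 0" using \<eta> nv by (simp add: \<epsilon>_def)
    show "open W" by (rule oW)
    show "x0 \<in> W" using U \<eta> by (simp add: W_def)
    show "W \<subseteq> Q" using U BQ by (auto simp: W_def)
    show "det (S x) \<noteq> 0" if "x \<in> W" for x using that U(2) nz by (auto simp: W_def)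
    show "H 0 x = x" if "x \<in> W" for x using that U(6) by (simp add: H_def W_def homeomorphism_def)
    fix t :: complex and x assume tx: "t \<in> ball 0 \<epsilon>" "x \<in> W"
    note y = inV[OF tx]
    have xB: "x \<in> ?B" using tx(2) U(2) by (auto simp: W_def)
    have F': "(F has_derivative \<theta> x) (at (snd (t, x)))" using F[OF xB] by simp
    have "((\<lambda>z. F (snd z) + fst z *s v) has_derivative (\<lambda>k. \<theta> x (snd k) + fst k *s v)) (at (t, x))"
      by (intro has_derivative_add has_derivative_compose[OF has_derivative_snd[OF has_derivative_ident] F']
          bounded_linear.has_derivative[OF bounded_linear_smult_left] has_derivative_fst[OF has_derivative_ident])
    from has_derivative_compose[OF this, of g "(*v) (S (H t x))"]
    have "((\<lambda>z. H (fst z) (snd z)) has_derivative (\<lambda>k. S (H t x) *v (\<theta> x (snd k) + fst k *s v))) (at (t, x))"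
      using g(1)[OF y] g'[OF y] by (simp add: H_def)
    moreover have "(\<lambda>k. S (H t x) *v (\<theta> x (snd k) + fst k *s v)) =
       (\<lambda>(s, h). s *s (S (H t x) *v v) + (S (H t x) ** matrix_inv (S x)) *v h)"
      by (auto simp: fun_eq_iff \<theta>_def clin_add[OF clin_matrix] clin_scale[OF clin_matrix] matrix_vector_mul_assoc)
    ultimately show "H t x \<in> Q \<and> ((\<lambda>(s, x). H s x) has_derivative (\<lambda>(s, h). s *s (S (H t x) *v v) + (S (H t x) ** matrix_inv (S x)) *v h)) (at (t, x))"
      using gU[OF y] U(2) BQ by (auto simp: H_def case_prod_beta')
  qed
qed

section \<open>Charts, tangent vectors and vector fields\<close>

locale cmanifold =
  fixes M :: "'a topology" and A :: "('a, 'n::finite) chart set"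
  assumes mfd: "complex_manifold M A"
begin

abbreviation img :: "('a, 'n) chart \<Rightarrow> 'a set \<Rightarrow> (complex^'n) set" where
  "img c U \<equiv> coord c ` (U \<inter> chart_dom c)"

abbreviation HV :: "'a set \<Rightarrow> ('a, 'n) vfield set" where
  "HV \<equiv> holomorphic_vfields A"

lemma chart_is: "c \<in> A \<Longrightarrow> is_chart M c"
  using mfd by (simp add: complex_manifold_def)

lemma dom_open: "c \<in> A \<Longrightarrow> openin M (chart_dom c)"
  using chart_is by (simp add: is_chart_def)

lemma dom_subset: "c \<in> A \<Longrightarrow> chart_dom c \<subseteq> topspace M"
  by (rule openin_subset[OF dom_open])

lemma chart_cover: "p \<in> topspace M \<Longrightarrow> \<exists>c\<in>A. p \<in> chart_dom c"
  using mfd by (auto simp: complex_manifold_def)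

lemma chart_homeo: "c \<in> A \<Longrightarrow> homeomorphic_map (subtopology M (chart_dom c)) (top_of_set (coord c ` chart_dom c)) (coord c)"
  using chart_is by (simp add: is_chart_def)

lemma coord_inj: "c \<in> A \<Longrightarrow> inj_on (coord c) (chart_dom c)"
  using homeomorphic_imp_injective_map[OF chart_homeo] dom_subset by (simp add: topspace_subtopology Int_absorb1)

lemma chart_inv_coord [simp]: "c \<in> A \<Longrightarrow> p \<in> chart_dom c \<Longrightarrow> chart_inv c (coord c p) = p"
  by (simp add: chart_inv_def inv_into_f_f coord_inj)

lemma coord_chart_inv: "x \<in> coord c ` chart_dom c \<Longrightarrow> coord c (chart_inv c x) = x"
  by (simp add: chart_inv_def f_inv_into_f)

lemma chart_inv_dom: "x \<in> coord c ` chart_dom c \<Longrightarrow> chart_inv c x \<in> chart_dom c"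
  by (simp add: chart_inv_def inv_into_into)

lemma img_iff: "c \<in> A \<Longrightarrow> x \<in> img c U \<longleftrightarrow> x \<in> coord c ` chart_dom c \<and> chart_inv c x \<in> U"
  using coord_chart_inv chart_inv_dom by fastforce

lemma img_open:
  assumes "c \<in> A" "openin M U" shows "open (img c U)"
proof -
  have o: "open (coord c ` chart_dom c)" using chart_is[OF assms(1)] by (simp add: is_chart_def)
  have "openin (subtopology M (chart_dom c)) (U \<inter> chart_dom c)"
    using assms(2) by (auto simp: openin_subtopology)
  then have "openin (top_of_set (coord c ` chart_dom c)) (img c U)"
    using homeomorphic_imp_open_map[OF chart_homeo[OF assms(1)]] by (simp add: open_map_def)
  then show ?thesis using o openin_open_eq by blast
qed

lemma chart_image_open: "c \<in> A \<Longrightarrow> open (coord c ` chart_dom c)"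
  using img_open[OF _ dom_open, of c c] by simp

lemma chart_inv_image_open:
  assumes "c \<in> A" "open W" "W \<subseteq> coord c ` chart_dom c" shows "openin M (chart_inv c ` W)"
proof -
  have "openin (top_of_set (coord c ` chart_dom c)) W" using assms(2,3) by (simp add: openin_open_eq chart_image_open assms(1))
  then have "openin (subtopology M (chart_dom c)) {p \<in> topspace (subtopology M (chart_dom c)). coord c p \<in> W}"
    by (rule openin_continuous_map_preimage[OF homeomorphic_imp_continuous_map[OF chart_homeo[OF assms(1)]]])
  moreover have "{p \<in> topspace (subtopology M (chart_dom c)). coord c p \<in> W} = chart_inv c ` W"
  proof
    show "{p \<in> topspace (subtopology M (chart_dom c)). coord c p \<in> W} \<subseteq> chart_inv c ` W"
      using chart_inv_coord[OF assms(1)] by (force simp: image_iff)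
    show "chart_inv c ` W \<subseteq> {p \<in> topspace (subtopology M (chart_dom c)). coord c p \<in> W}"
      using assms(3) coord_chart_inv[of _ c] chart_inv_dom[of _ c] dom_subset[OF assms(1)] by (auto simp: subset_iff)
  qed
  ultimately show ?thesis using openin_open_subtopology[OF dom_open[OF assms(1)]] by simp
qed

lemma chart_inv_continuous:
  assumes "c \<in> A" shows "continuous_map (top_of_set (coord c ` chart_dom c)) M (chart_inv c)"
  unfolding continuous_map_def
proof (intro conjI allI impI)
  show "chart_inv c \<in> topspace (top_of_set (coord c ` chart_dom c)) \<rightarrow> topspace M"
    using chart_inv_coord[OF assms] dom_subset[OF assms] by auto
  fix U assume U: "openin M U"
  have "{x \<in> topspace (top_of_set (coord c ` chart_dom c)). chart_inv c x \<in> U} = img c U"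
    using img_iff[OF assms] by auto
  then show "openin (top_of_set (coord c ` chart_dom c)) {x \<in> topspace (top_of_set (coord c ` chart_dom c)). chart_inv c x \<in> U}"
    using img_open[OF assms U] by (auto simp: openin_open_eq chart_image_open assms)
qed

section \<open>Transition maps and tangent vectors\<close>

lemma transition_hol:
  assumes "c \<in> A" "d \<in> A" shows "vector_holomorphic_on (transition c d) (img c (chart_dom d))"
  using mfd assms by (simp add: complex_manifold_def Int_commute)

lemma transition_coord: "c \<in> A \<Longrightarrow> p \<in> chart_dom c \<Longrightarrow> transition c d (coord c p) = coord d p"
  by (simp add: transition_def)

lemma transition_chain:
  assumes "c \<in> A" "d \<in> A" "e \<in> A" and p: "p \<in> chart_dom c" "p \<in> chart_dom d" "p \<in> chart_dom e"
  shows "fd (transition d e) (coord d p) (fd (transition c d) (coord c p) h) = fd (transition c e) (coord c p) h"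
proof -
  let ?W = "img c (chart_dom d \<inter> chart_dom e)"
  have W: "open ?W" by (rule img_open[OF assms(1) openin_Int[OF dom_open dom_open]]) fact+
  have x: "coord c p \<in> ?W" using p by blast
  have D1: "(transition c d has_derivative fd (transition c d) (coord c p)) (at (coord c p))"
    using vector_holD(1)[OF transition_hol[OF assms(1,2)]] p by blast
  have D2: "(transition d e has_derivative fd (transition d e) (coord d p)) (at (transition c d (coord c p)))"
    using vector_holD(1)[OF transition_hol[OF assms(2,3)], of "coord d p"] p by (simp add: transition_coord assms)
  have "((\<lambda>x. transition d e (transition c d x)) has_derivative (\<lambda>h. fd (transition d e) (coord d p) (fd (transition c d) (coord c p) h))) (at (coord c p))"
    by (rule has_derivative_compose[OF D1 D2])
  then have "fd (\<lambda>x. transition d e (transition c d x)) (coord c p) = (\<lambda>h. fd (transition d e) (coord d p) (fd (transition c d) (coord c p) h))"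
    by (rule frechet_derivative_at')
  moreover have "fd (\<lambda>x. transition d e (transition c d x)) (coord c p) = fd (transition c e) (coord c p)"
    by (rule fd_cong_open[OF W x]) (use assms in \<open>auto simp: transition_coord\<close>)
  ultimately show ?thesis by simp
qed

lemma transition_self:
  assumes "c \<in> A" "p \<in> chart_dom c" shows "fd (transition c c) (coord c p) h = h"
proof -
  have "fd (transition c c) (coord c p) = fd (\<lambda>x. x) (coord c p)"
    by (rule fd_cong_open[OF chart_image_open[OF assms(1)]]) (use assms in \<open>auto simp: transition_coord\<close>)
  also have "\<dots> = (\<lambda>h. h)" by (rule frechet_derivative_at'[OF has_derivative_ident])
  finally show ?thesis by simp
qed

lemma transition_clin:
  assumes "c \<in> A" "d \<in> A" "p \<in> chart_dom c" "p \<in> chart_dom d" shows "clin (fd (transition c d) (coord c p))"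
  by (rule vector_hol_fd_clin[OF transition_hol[OF assms(1,2)]]) (use assms in blast)

lemma tangentD:
  "v \<in> tangent_space A p \<Longrightarrow> c \<in> A \<Longrightarrow> d \<in> A \<Longrightarrow> p \<in> chart_dom c \<Longrightarrow> p \<in> chart_dom d \<Longrightarrow>
   v d = fd (transition c d) (coord c p) (v c)"
  unfolding tangent_space_def mem_Collect_eq by blast

lemma tangent_outside:
  assumes "v \<in> tangent_space A p" "\<not> (c \<in> A \<and> p \<in> chart_dom c)" shows "v c = 0"
proof -
  have "\<forall>c. \<not> (c \<in> A \<and> p \<in> chart_dom c) \<longrightarrow> v c = 0"
    using assms(1) unfolding tangent_space_def mem_Collect_eq by (rule conjunct1)
  from spec[OF this, of c] assms(2) show ?thesis by (rule mp)
qed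

lemma tangent_spaceI:
  assumes "\<And>c. \<not> (c \<in> A \<and> p \<in> chart_dom c) \<Longrightarrow> v c = 0"
    and "\<And>c d. c \<in> A \<Longrightarrow> d \<in> A \<Longrightarrow> p \<in> chart_dom c \<Longrightarrow> p \<in> chart_dom d \<Longrightarrow> v d = fd (transition c d) (coord c p) (v c)"
  shows "v \<in> tangent_space A p"
  unfolding tangent_space_def mem_Collect_eq
  by (intro conjI allI ballI impI, erule assms(1), rule assms(2)) simp_all

lemma tangent_eqI:
  assumes "v \<in> tangent_space A p" "w \<in> tangent_space A p" "c \<in> A" "p \<in> chart_dom c" "v c = w c"
  shows "v = w"
proof
  fix d
  show "v d = w d"
    using tangentD[OF assms(1,3), of d] tangentD[OF assms(2,3), of d] tangent_outside[OF assms(1), of d]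
      tangent_outside[OF assms(2), of d] assms(4,5) by metis
qed

text \<open>A tangent vector prescribed in one chart; the chain rule \<open>transition_chain\<close>
  makes its transforms compatible.\<close>

lemma tangentI:
  assumes c: "c \<in> A" "p \<in> chart_dom c"
    and v: "\<And>d. v d = (if d \<in> A \<and> p \<in> chart_dom d then fd (transition c d) (coord c p) w else 0)"
  shows "v \<in> tangent_space A p"
  unfolding tangent_space_def
proof (intro CollectI conjI allI ballI impI)
  show "v d = 0" if "\<not> (d \<in> A \<and> p \<in> chart_dom d)" for d
    by (subst v, rule if_not_P[OF that])
  fix d e assume "d \<in> A" "e \<in> A" "p \<in> chart_dom d \<inter> chart_dom e"
  then show "v e = fd (transition d e) (coord d p) (v d)"
    using transition_chain[OF c(1) _ _ c(2), of d e w] by (simp add: v)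
qed

section \<open>Spaces of holomorphic vector fields\<close>

lemma HV_tangent: "X \<in> HV U \<Longrightarrow> p \<in> U \<Longrightarrow> X p \<in> tangent_space A p"
  and HV_outside: "X \<in> HV U \<Longrightarrow> p \<notin> U \<Longrightarrow> X p = 0"
  and HV_hol: "X \<in> HV U \<Longrightarrow> c \<in> A \<Longrightarrow> vector_holomorphic_on (local_rep c X) (img c U)"
  by (simp_all add: holomorphic_vfields_def)

lemma local_rep_coord [simp]: "c \<in> A \<Longrightarrow> p \<in> chart_dom c \<Longrightarrow> local_rep c X (coord c p) = X p c"
  by (simp add: local_rep_def)

lemma HV_I:
  "(\<And>p. p \<in> U \<Longrightarrow> X p \<in> tangent_space A p) \<Longrightarrow> (\<And>p. p \<notin> U \<Longrightarrow> X p = 0) \<Longrightarrow>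
   (\<And>c. c \<in> A \<Longrightarrow> vector_holomorphic_on (local_rep c X) (img c U)) \<Longrightarrow> X \<in> HV U"
  by (simp add: holomorphic_vfields_def)

lemma tangent_add:
  assumes "v \<in> tangent_space A p" "w \<in> tangent_space A p" shows "v + w \<in> tangent_space A p"
proof (rule tangent_spaceI)
  show "(v + w) c = 0" if "\<not> (c \<in> A \<and> p \<in> chart_dom c)" for c
    using tangent_outside[OF assms(1) that] tangent_outside[OF assms(2) that] by simp
  fix c d assume c: "c \<in> A" "d \<in> A" "p \<in> chart_dom c" "p \<in> chart_dom d"
  show "(v + w) d = fd (transition c d) (coord c p) ((v + w) c)"
    using tangentD[OF assms(1) c] tangentD[OF assms(2) c] clin_add[OF transition_clin[OF c]] by simp
qed

lemma tangent_scale_mem: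
  assumes "v \<in> tangent_space A p" shows "tangent_scale z v \<in> tangent_space A p"
proof (rule tangent_spaceI)
  show "tangent_scale z v c = 0" if "\<not> (c \<in> A \<and> p \<in> chart_dom c)" for c
    using tangent_outside[OF assms(1) that] by (simp add: tangent_scale_def)
  fix c d assume c: "c \<in> A" "d \<in> A" "p \<in> chart_dom c" "p \<in> chart_dom d"
  show "tangent_scale z v d = fd (transition c d) (coord c p) (tangent_scale z v c)"
    using tangentD[OF assms(1) c] clin_scale[OF transition_clin[OF c]] by (simp add: tangent_scale_def)
qed

lemma tangent_zero: "0 \<in> tangent_space A p"
  by (rule tangent_spaceI) (simp_all add: clin_zero[OF transition_clin])

lemma HV_add: "X \<in> HV U \<Longrightarrow> Y \<in> HV U \<Longrightarrow> X + Y \<in> HV U"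
  by (rule HV_I) (auto simp: HV_tangent HV_outside tangent_add local_rep_def[abs_def]
      intro: vector_hol_add[OF HV_hol[unfolded local_rep_def] HV_hol[unfolded local_rep_def]])

lemma HV_zero: "0 \<in> HV U"
  by (rule HV_I) (simp_all add: tangent_zero local_rep_def)

lemma HV_scale:
  assumes "X \<in> HV U" "holomorphic_function_on A U f" shows "fun_scale f X \<in> HV U"
proof (rule HV_I)
  show "fun_scale f X p \<in> tangent_space A p" if "p \<in> U" for p
    using HV_tangent[OF assms(1) that] by (simp add: fun_scale_def tangent_scale_mem)
  show "fun_scale f X p = 0" if "p \<notin> U" for p
    using HV_outside[OF assms(1) that] by (simp add: fun_scale_def tangent_scale_def fun_eq_iff)
  fix c assume c: "c \<in> A"
  have "local_rep c (fun_scale f X) = (\<lambda>x. (f \<circ> chart_inv c) x *s local_rep c X x)"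
    by (simp add: local_rep_def fun_scale_def tangent_scale_def fun_eq_iff)
  then show "vector_holomorphic_on (local_rep c (fun_scale f X)) (img c U)"
    using vector_hol_smult[OF bspec[OF assms(2)[unfolded holomorphic_function_on_def] c] HV_hol[OF assms(1) c]] by simp
qed

lemma HV_sum: "(\<And>i. i \<in> I \<Longrightarrow> X i \<in> HV U) \<Longrightarrow> (\<Sum>i\<in>I. X i) \<in> HV U"
  by (induction I rule: infinite_finite_induct) (simp_all add: HV_zero HV_add)

lemma HV_restrict:
  assumes "X \<in> HV U" "V \<subseteq> U" "openin M V" shows "restrict_vfield V X \<in> HV V"
proof (rule HV_I)
  show "restrict_vfield V X p \<in> tangent_space A p" if "p \<in> V" for p
    using HV_tangent[OF assms(1)] that assms(2) by (auto simp: restrict_vfield_def)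
  show "restrict_vfield V X p = 0" if "p \<notin> V" for p using that by (simp add: restrict_vfield_def)
  fix c assume c: "c \<in> A"
  show "vector_holomorphic_on (local_rep c (restrict_vfield V X)) (img c V)"
  proof (rule vector_hol_cong[OF img_open[OF c assms(3)]])
    show "vector_holomorphic_on (local_rep c X) (img c V)"
      by (rule vector_hol_subset[OF HV_hol[OF assms(1) c]]) (use assms(2) in auto)
    show "local_rep c X x = local_rep c (restrict_vfield V X) x" if "x \<in> img c V" for x
      using that c by (auto simp: restrict_vfield_def local_rep_def)
  qed
qed

lemma HV_fd_cong:
  assumes "c \<in> A" "openin M V" "p \<in> V" "p \<in> chart_dom c" "\<And>q. q \<in> V \<Longrightarrow> X q c = Y q c"
  shows "fd (local_rep c X) (coord c p) = fd (local_rep c Y) (coord c p)"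
  by (rule fd_cong_open[OF img_open[OF assms(1,2)]]) (use assms in auto)

section \<open>Identity principle and connected components\<close>

abbreviation comp :: "'a \<Rightarrow> 'a set" where
  "comp p \<equiv> connected_component_of_set M p"

lemma chart_ball:
  assumes "c \<in> A" "p \<in> chart_dom c" "openin M U" "p \<in> U"
  obtains r where "r > 0" "ball (coord c p) r \<subseteq> img c U" "openin M (chart_inv c ` ball (coord c p) r)"
    "chart_inv c ` ball (coord c p) r \<subseteq> U \<inter> chart_dom c" "p \<in> chart_inv c ` ball (coord c p) r"
    "chart_inv c ` ball (coord c p) r \<subseteq> comp p"
proof -
  obtain r where r: "r > 0" "ball (coord c p) r \<subseteq> img c U"
    using img_open[OF assms(1,3)] assms(2,4) open_contains_ball by blast
  let ?V = "chart_inv c ` ball (coord c p) r"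
  have sub: "ball (coord c p) r \<subseteq> coord c ` chart_dom c" using r(2) by blast
  have pV: "p \<in> ?V" using r(1) assms(1,2) by (intro image_eqI[of _ _ "coord c p"]) auto
  have "connectedin (top_of_set (coord c ` chart_dom c)) (ball (coord c p) r)"
    using sub by (simp add: connectedin_subtopology)
  then have "connectedin M ?V" by (rule connectedin_continuous_map_image[OF chart_inv_continuous[OF assms(1)]])
  then have "?V \<subseteq> comp p" using pV by (rule connected_component_of_maximal)
  moreover have "?V \<subseteq> U \<inter> chart_dom c" using r(2) assms(1) by auto
  ultimately show thesis using r pV chart_inv_image_open[OF assms(1) open_ball sub] by (intro that)
qed

lemma comp_eq: assumes "q \<in> comp p" shows "comp q = comp p"
proof -
  have "connected_component_of M p q" using assms by simp
  then have "connected_component_of M p = connected_component_of M q"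
    by (rule connected_component_of_equiv[THEN iffD1, THEN conjunct2, THEN conjunct2])
  then show ?thesis by simp
qed

lemma comp_open: "openin M (comp p)"
proof (subst openin_subopen, intro ballI)
  fix q assume q: "q \<in> comp p"
  then have "q \<in> topspace M" using connected_component_of_subset_topspace by fastforce
  then obtain c where c: "c \<in> A" "q \<in> chart_dom c" using chart_cover by blast
  obtain r where "openin M (chart_inv c ` ball (coord c q) r)" "q \<in> chart_inv c ` ball (coord c q) r"
    "chart_inv c ` ball (coord c q) r \<subseteq> comp q"
    using chart_ball[OF c dom_open[OF c(1)] c(2)] by metis
  moreover have "comp q = comp p" by (rule comp_eq[OF q])
  ultimately show "\<exists>T. openin M T \<and> q \<in> T \<and> T \<subseteq> comp p" by blast
qed

lemma comp_refl: "p \<in> topspace M \<Longrightarrow> p \<in> comp p"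
  by (simp add: connected_component_of_refl)

lemma comp_topspace: "comp p \<subseteq> topspace M"
  by (rule connected_component_of_subset_topspace)

text \<open>The interior of the set where \<open>Z\<close> holds is also closed, by the identity
  theorem on coordinate balls. The functions \<open>F c\<close> need not be local forms of a global
  object: only their vanishing is independent of the chart, which admits determinants as well as
  vector fields.\<close>

lemma identity_principle:
  fixes Z :: "'a \<Rightarrow> bool" and F :: "('a, 'n) chart \<Rightarrow> complex^'n \<Rightarrow> complex^'m"
  assumes F: "\<And>c. c \<in> A \<Longrightarrow> vector_holomorphic_on (F c) (coord c ` chart_dom c)"
    and Z: "\<And>c p. c \<in> A \<Longrightarrow> p \<in> chart_dom c \<Longrightarrow> Z p \<longleftrightarrow> F c (coord c p) = 0"
    and W: "openin M W" "p \<in> W" "\<And>q. q \<in> W \<Longrightarrow> Z q" and q: "q \<in> comp p"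
  shows "Z q"
proof -
  define T where "T = {p \<in> topspace M. \<exists>V. openin M V \<and> p \<in> V \<and> (\<forall>q\<in>V. Z q)}"
  have oT: "openin M T"
  proof (subst openin_subopen, intro ballI)
    fix x assume "x \<in> T"
    then obtain V where V: "openin M V" "x \<in> V" "\<forall>q\<in>V. Z q" unfolding T_def by blast
    then have "V \<subseteq> T" using openin_subset[OF V(1)] unfolding T_def by blast
    then show "\<exists>V. openin M V \<and> x \<in> V \<and> V \<subseteq> T" using V by blast
  qed
  have "openin M (topspace M - T)"
  proof (subst openin_subopen, intro ballI)
    fix p assume p: "p \<in> topspace M - T"
    then obtain c where c: "c \<in> A" "p \<in> chart_dom c" using chart_cover by blast
    obtain r where r: "r > 0" "ball (coord c p) r \<subseteq> img c (chart_dom c)" and V: "openin M (chart_inv c ` ball (coord c p) r)"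
      "p \<in> chart_inv c ` ball (coord c p) r" "chart_inv c ` ball (coord c p) r \<subseteq> chart_dom c"
      using chart_ball[OF c dom_open[OF c(1)] c(2)] by (metis Int_absorb)
    let ?V = "chart_inv c ` ball (coord c p) r"
    have "?V \<inter> T = {}"
    proof (rule ccontr)
      assume "?V \<inter> T \<noteq> {}"
      then obtain q V' where q: "q \<in> ?V" "openin M V'" "q \<in> V'" "\<forall>q\<in>V'. Z q" unfolding T_def by blast
      have qd: "q \<in> chart_dom c" using q(1) V(3) by blast
      have qb: "coord c q \<in> ball (coord c p) r" using q(1) r(2) c(1) by (auto simp: coord_chart_inv subset_iff)
      have "openin M (V' \<inter> ?V)" by (intro openin_Int q V)
      then obtain s where s: "s > 0" "ball (coord c q) s \<subseteq> img c (V' \<inter> ?V)"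
        using chart_ball[OF c(1) qd, of "V' \<inter> ?V"] q by (metis IntI)
      have zero: "F c z $ i = 0" if "z \<in> ball (coord c p) r" for z i
      proof (rule scalar_hol_identity[OF _ qb s(1) _ that])
        show "scalar_holomorphic_on (\<lambda>z. F c z $ i) (ball (coord c p) r)"
          using F[OF c(1)] r(2) scalar_hol_subset unfolding vector_holomorphic_on_def by blast
        fix z assume "z \<in> ball (coord c q) s"
        then obtain q' where "q' \<in> V'" "q' \<in> chart_dom c" "z = coord c q'" using s(2) by blast
        then show "F c z $ i = 0" using Z[OF c(1), of q'] q(4) by simp
      qed
      have "\<forall>q\<in>?V. Z q"
      proof
        fix q' assume "q' \<in> ?V"
        then obtain z where z: "z \<in> ball (coord c p) r" "q' = chart_inv c z" by blast
        then have q': "coord c q' = z" "q' \<in> chart_dom c" using r(2) coord_chart_inv[of z c] chart_inv_dom[of z c] by auto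
        have "F c z = 0" using zero[OF z(1)] by (simp add: vec_eq_iff)
        then show "Z q'" using Z[OF c(1) q'(2)] q'(1) by simp
      qed
      then have "p \<in> T" unfolding T_def using V(1,2) p by blast
      then show False using p by blast
    qed
    then show "\<exists>T'. openin M T' \<and> p \<in> T' \<and> T' \<subseteq> topspace M - T"
      using V(1,2) openin_subset[OF V(1)] by blast
  qed
  then have cT: "closedin M T" using oT openin_subset by (simp add: closedin_def)
  have pT: "p \<in> T" unfolding T_def using W openin_subset[OF W(1)] by blast
  have "connectedin M (comp p)" by (rule connectedin_connected_component_of)
  then have "comp p \<subseteq> T \<or> disjnt (comp p) T" by (rule connectedin_clopen_cases[OF _ cT oT])
  moreover have "p \<in> comp p" using comp_refl pT by (simp add: T_def)
  ultimately have "q \<in> T" using q pT by (auto simp: disjnt_def)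
  then show ?thesis unfolding T_def by blast
qed

section \<open>Christoffel symbols\<close>

lemma frame_field_exists:
  assumes c: "c \<in> A"
  obtains E where "\<And>i. E i \<in> HV (chart_dom c)" "\<And>i p. p \<in> chart_dom c \<Longrightarrow> E i p c = axis i 1"
proof -
  define E where "E i p d = (if p \<in> chart_dom c \<and> d \<in> A \<and> p \<in> chart_dom d then fd (transition c d) (coord c p) (axis i 1) else 0)" for i p d
  show thesis
  proof (rule that[of E])
    fix i
    show "E i \<in> HV (chart_dom c)"
    proof (rule HV_I)
      show "E i p \<in> tangent_space A p" if "p \<in> chart_dom c" for p
        by (rule tangentI[OF c that, where w="axis i 1"]) (simp add: E_def that)
      show "E i p = 0" if "p \<notin> chart_dom c" for p using that by (simp add: E_def fun_eq_iff)
      fix d assume d: "d \<in> A"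
      have 1: "vector_holomorphic_on (\<lambda>x. fd (transition c d) x (axis i 1)) (img c (chart_dom d))"
        by (rule vector_hol_fd(1)[OF transition_hol[OF c d] img_open[OF c dom_open[OF d]]])
      have 2: "vector_holomorphic_on (\<lambda>x. fd (transition c d) (transition d c x) (axis i 1)) (img d (chart_dom c))"
        by (rule vector_hol_compose[OF 1 transition_hol[OF d c]]) (use d in \<open>auto simp: transition_coord\<close>)
      show "vector_holomorphic_on (local_rep d (E i)) (img d (chart_dom c))"
        by (rule vector_hol_cong[OF img_open[OF d dom_open[OF c]] _ 2])
           (use d c in \<open>auto simp: transition_coord E_def\<close>)
    qed
    show "E i p c = axis i 1" if "p \<in> chart_dom c" for p using that c by (simp add: E_def transition_self)
  qed
qed

lemma sum_vfield_apply: "(\<Sum>i\<in>I. f i) p c = (\<Sum>i\<in>I. f i p c)"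
  for f :: "'i \<Rightarrow> 'a \<Rightarrow> 'b \<Rightarrow> complex^'n"
  by (induction I rule: infinite_finite_induct) simp_all

lemma HV_expand:
  fixes X :: "('a, 'n) vfield"
  assumes c: "c \<in> A" and E: "\<And>i. E i \<in> HV (chart_dom c)" "\<And>i p. p \<in> chart_dom c \<Longrightarrow> E i p c = axis i 1"
    and X: "X \<in> HV (chart_dom c)"
  shows "holomorphic_function_on A (chart_dom c) (\<lambda>p. X p c $ i)"
    and "X = (\<Sum>i\<in>UNIV. fun_scale (\<lambda>p. X p c $ i) (E i))"
proof -
  show hf: "holomorphic_function_on A (chart_dom c) (\<lambda>p. X p c $ i)" for i
    unfolding holomorphic_function_on_def
  proof
    fix d assume d: "d \<in> A"
    have 1: "scalar_holomorphic_on (\<lambda>x. local_rep c X (transition d c x) $ i) (img d (chart_dom c))"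
    proof (rule scalar_hol_compose[OF _ transition_hol[OF d c]])
      show "scalar_holomorphic_on (\<lambda>x. local_rep c X x $ i) (img c (chart_dom c))"
        using HV_hol[OF X c] by (simp add: vector_holomorphic_on_def)
    qed (use d in \<open>auto simp: transition_coord\<close>)
    show "scalar_holomorphic_on ((\<lambda>p. X p c $ i) \<circ> chart_inv d) (img d (chart_dom c))"
      by (rule scalar_hol_cong[OF img_open[OF d dom_open[OF c]] _ 1])
         (use d c in \<open>auto simp: transition_coord\<close>)
  qed
  have S: "(\<Sum>i\<in>UNIV. fun_scale (\<lambda>p. X p c $ i) (E i)) \<in> HV (chart_dom c)"
    by (intro HV_sum HV_scale hf E)
  show "X = (\<Sum>i\<in>UNIV. fun_scale (\<lambda>p. X p c $ i) (E i))"
  proof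
    fix p
    show "X p = (\<Sum>i\<in>UNIV. fun_scale (\<lambda>p. X p c $ i) (E i)) p"
    proof (cases "p \<in> chart_dom c")
      case True
      have "(\<Sum>i\<in>UNIV. fun_scale (\<lambda>p. X p c $ i) (E i)) p c = (\<Sum>i\<in>UNIV. X p c $ i *s E i p c)"
        by (simp add: fun_scale_def tangent_scale_def sum_vfield_apply)
      also have "\<dots> = X p c" using True by (simp add: E(2) basis_expansion)
      finally show ?thesis by (intro tangent_eqI[OF HV_tangent[OF X True] HV_tangent[OF S True] c True]) simp
    next
      case False
      then show ?thesis using HV_outside[OF X] HV_outside[OF S] by simp
    qed
  qed
qed

end

lemma cbil_expand:
  assumes "cbil B" shows "B v w = (\<Sum>i\<in>UNIV. \<Sum>j\<in>UNIV. v $ i *s (w $ j *s B (axis i 1) (axis j 1)))"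
  by (subst clin_expand[OF cbilD(2)[OF assms]], subst clin_expand[OF cbilD(1)[OF assms]])
     (simp add: vec.scale_sum_right)

lemma cbil_eqI:
  assumes "cbil B" "cbil C" "\<And>i j. B (axis i 1) (axis j 1) = C (axis i 1) (axis j 1)"
  shows "B v w = C v w"
  by (simp only: cbil_expand[OF assms(1), of v w] cbil_expand[OF assms(2), of v w] assms(3))

lemma clin_matrix_ex: "clin T \<Longrightarrow> \<exists>J. \<forall>h. T h = J *v h" for T :: "complex^'n \<Rightarrow> complex^'m"
proof (intro exI allI)
  fix h assume T: "clin T"
  show "T h = (\<chi> i j. T (axis j 1) $ i) *v h"
    by (subst clin_expand[OF T]) (simp add: vec_eq_iff matrix_vector_mult_def sum_component mult.commute)
qed

lemma matrix_vector_axis_sum: "(A :: complex^'n^'m) *v v = (\<Sum>j\<in>UNIV. v $ j *s (A *v axis j 1))"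
  by (rule clin_expand[OF clin_matrix])

lemma det_nonzero_iff: "det (B :: complex^'k^'k) \<noteq> 0 \<longleftrightarrow> (\<forall>v. B *v v = 0 \<longrightarrow> v = 0)"
  by (metis invertible_det_nz invertible_left_inverse matrix_left_invertible_ker)

context cmanifold
begin

section \<open>Local form of a connection\<close>

lemma connection_facts:
  assumes N: "holomorphic_connection M A N" and U: "openin M U"
  shows "X \<in> HV U \<Longrightarrow> Y \<in> HV U \<Longrightarrow> N U X Y \<in> HV U"
    and "X \<in> HV U \<Longrightarrow> X' \<in> HV U \<Longrightarrow> Y \<in> HV U \<Longrightarrow> N U (X + X') Y = N U X Y + N U X' Y"
    and "X \<in> HV U \<Longrightarrow> Y \<in> HV U \<Longrightarrow> Y' \<in> HV U \<Longrightarrow> N U X (Y + Y') = N U X Y + N U X Y'"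
    and "holomorphic_function_on A U f \<Longrightarrow> X \<in> HV U \<Longrightarrow> Y \<in> HV U \<Longrightarrow> N U (fun_scale f X) Y = fun_scale f (N U X Y)"
    and "holomorphic_function_on A U f \<Longrightarrow> X \<in> HV U \<Longrightarrow> Y \<in> HV U \<Longrightarrow> c \<in> A \<Longrightarrow> p \<in> U \<Longrightarrow> p \<in> chart_dom c \<Longrightarrow>
      N U X (fun_scale f Y) p c = f p *s N U X Y p c + fd (f \<circ> chart_inv c) (coord c p) (X p c) *s Y p c"
    and "openin M V \<Longrightarrow> V \<subseteq> U \<Longrightarrow> X \<in> HV U \<Longrightarrow> Y \<in> HV U \<Longrightarrow>
      N V (restrict_vfield V X) (restrict_vfield V Y) = restrict_vfield V (N U X Y)"
proof -
  note F = N[unfolded holomorphic_connection_def, THEN spec, THEN mp, OF U]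
  note F1 = F[THEN conjunct1] and F2 = F[THEN conjunct2, THEN conjunct1] and F3 = F[THEN conjunct2, THEN conjunct2, THEN conjunct1]
    and F4 = F[THEN conjunct2, THEN conjunct2, THEN conjunct2, THEN conjunct1]
    and F5 = F[THEN conjunct2, THEN conjunct2, THEN conjunct2, THEN conjunct2]
  show "X \<in> HV U \<Longrightarrow> Y \<in> HV U \<Longrightarrow> N U X Y \<in> HV U" by (rule F1[rule_format])
  show "X \<in> HV U \<Longrightarrow> X' \<in> HV U \<Longrightarrow> Y \<in> HV U \<Longrightarrow> N U (X + X') Y = N U X Y + N U X' Y" by (rule F2[rule_format])
  show "X \<in> HV U \<Longrightarrow> Y \<in> HV U \<Longrightarrow> Y' \<in> HV U \<Longrightarrow> N U X (Y + Y') = N U X Y + N U X Y'" by (rule F3[rule_format])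
  show "holomorphic_function_on A U f \<Longrightarrow> X \<in> HV U \<Longrightarrow> Y \<in> HV U \<Longrightarrow> N U (fun_scale f X) Y = fun_scale f (N U X Y)"
    by (rule F4[rule_format, THEN conjunct1])
  show "N U X (fun_scale f Y) p c = f p *s N U X Y p c + fd (f \<circ> chart_inv c) (coord c p) (X p c) *s Y p c"
    if "holomorphic_function_on A U f" "X \<in> HV U" "Y \<in> HV U" "c \<in> A" "p \<in> U" "p \<in> chart_dom c"
    using F4[rule_format, THEN conjunct2, OF that(1-3)] that(4-6) by blast
  show "openin M V \<Longrightarrow> V \<subseteq> U \<Longrightarrow> X \<in> HV U \<Longrightarrow> Y \<in> HV U \<Longrightarrow>
    N V (restrict_vfield V X) (restrict_vfield V Y) = restrict_vfield V (N U X Y)" by (rule F5[rule_format, OF conjI])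
qed

lemma connection_sum:
  assumes N: "holomorphic_connection M A N" and U: "openin M U"
  shows "(\<And>i. i \<in> I \<Longrightarrow> X i \<in> HV U) \<Longrightarrow> Y \<in> HV U \<Longrightarrow> N U (\<Sum>i\<in>I. X i) Y = (\<Sum>i\<in>I. N U (X i) Y)"
    and "(\<And>i. i \<in> I \<Longrightarrow> X i \<in> HV U) \<Longrightarrow> Y \<in> HV U \<Longrightarrow> N U Y (\<Sum>i\<in>I. X i) = (\<Sum>i\<in>I. N U Y (X i))"
proof -
  note f = connection_facts[OF N U]
  have z: "N U 0 Y = 0" "N U Y 0 = 0" if "Y \<in> HV U" for Y
    using f(2)[OF HV_zero HV_zero that] f(3)[OF that HV_zero HV_zero] by simp_all
  show "(\<And>i. i \<in> I \<Longrightarrow> X i \<in> HV U) \<Longrightarrow> Y \<in> HV U \<Longrightarrow> N U (\<Sum>i\<in>I. X i) Y = (\<Sum>i\<in>I. N U (X i) Y)"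
    by (induction I rule: infinite_finite_induct) (simp_all add: z f(2) HV_sum)
  show "(\<And>i. i \<in> I \<Longrightarrow> X i \<in> HV U) \<Longrightarrow> Y \<in> HV U \<Longrightarrow> N U Y (\<Sum>i\<in>I. X i) = (\<Sum>i\<in>I. N U Y (X i))"
    by (induction I rule: infinite_finite_induct) (simp_all add: z f(3) HV_sum)
qed

text \<open>Both fields are expanded in the coordinate fields of the chart. These exist over its
  domain only, so compatibility with restriction is used to pass from \<open>topspace M\<close> to
  this domain.\<close>

lemma christoffel:
  assumes N: "holomorphic_connection M A N" and c: "c \<in> A"
  obtains \<Gamma> where "bil_hol \<Gamma> (coord c ` chart_dom c)"
    "\<And>X Y p. X \<in> HV (topspace M) \<Longrightarrow> Y \<in> HV (topspace M) \<Longrightarrow> p \<in> chart_dom c \<Longrightarrow>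
       N (topspace M) X Y p c = fd (local_rep c Y) (coord c p) (X p c) + \<Gamma> (coord c p) (X p c) (Y p c)"
proof -
  let ?U = "chart_dom c"
  note U = dom_open[OF c]
  note f = connection_facts[OF N U]
  obtain E where E: "\<And>i. E i \<in> HV ?U" and Ec: "\<And>i p. p \<in> ?U \<Longrightarrow> E i p c = axis i 1"
    using frame_field_exists[OF c] by metis
  define G where "G i j = local_rep c (N ?U (E i) (E j))" for i j
  define \<Gamma> where "\<Gamma> x v w = (\<Sum>i\<in>UNIV. \<Sum>j\<in>UNIV. v $ i *s (w $ j *s G i j x))" for x v w
  have hG: "vector_holomorphic_on (G i j) (coord c ` ?U)" for i j
    using HV_hol[OF f(1)[OF E E] c, of i j] by (simp add: G_def)
  have "bil_hol \<Gamma> (coord c ` ?U)"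
    unfolding bil_hol_def cbil_def \<Gamma>_def
    by (auto intro!: clinI vector_hol_sum vector_hol_smult hG simp: sum.distrib vec.scale_sum_right algebra_simps)
  moreover have "N (topspace M) X Y p c = fd (local_rep c Y) (coord c p) (X p c) + \<Gamma> (coord c p) (X p c) (Y p c)"
    if X: "X \<in> HV (topspace M)" and Y: "Y \<in> HV (topspace M)" and p: "p \<in> ?U" for X Y p
  proof -
    define X' where "X' = restrict_vfield ?U X"
    define Y' where "Y' = restrict_vfield ?U Y"
    have X': "X' \<in> HV ?U" and Y': "Y' \<in> HV ?U"
      unfolding X'_def Y'_def by (intro HV_restrict[OF X dom_subset[OF c] U] HV_restrict[OF Y dom_subset[OF c] U])+
    note eX = HV_expand[OF c E Ec X'] and eY = HV_expand[OF c E Ec Y']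
    have val: "X' p c = X p c" "Y' p c = Y p c" using p by (simp_all add: X'_def Y'_def restrict_vfield_def)
    have EY: "N ?U (E i) Y' p c = (\<Sum>j\<in>UNIV. Y p c $ j *s G i j (coord c p)) + fd (local_rep c Y') (coord c p) (axis i 1)" for i
    proof -
      have "N ?U (E i) Y' = (\<Sum>j\<in>UNIV. N ?U (E i) (fun_scale (\<lambda>p. Y' p c $ j) (E j)))"
        by (rule trans[OF arg_cong[OF eY(2), where f="N ?U (E i)"] connection_sum(2)[OF N U]]) (assumption | intro HV_scale E eY(1))+
      then have "N ?U (E i) Y' p c = (\<Sum>j\<in>UNIV. N ?U (E i) (fun_scale (\<lambda>p. Y' p c $ j) (E j)) p c)"
        by (simp only: sum_vfield_apply)
      also have "\<dots> = (\<Sum>j\<in>UNIV. Y' p c $ j *s N ?U (E i) (E j) p c + fd ((\<lambda>p. Y' p c $ j) \<circ> chart_inv c) (coord c p) (E i p c) *s E j p c)"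
        by (intro sum.cong refl f(5) eY(1) E c p)
      also have "\<dots> = (\<Sum>j\<in>UNIV. Y p c $ j *s G i j (coord c p)) + (\<Sum>j\<in>UNIV. fd (local_rep c Y') (coord c p) (axis i 1) $ j *s axis j 1)"
      proof -
        have "(\<lambda>p. Y' p c $ j) \<circ> chart_inv c = (\<lambda>x. local_rep c Y' x $ j)" for j by (simp add: fun_eq_iff local_rep_def)
        moreover have "fd (\<lambda>x. local_rep c Y' x $ j) (coord c p) (axis i 1) = fd (local_rep c Y') (coord c p) (axis i 1) $ j" for j
          using vector_holD(3)[OF HV_hol[OF Y' c], of "coord c p" "axis i 1" j] p by auto
        ultimately show ?thesis using p c by (simp add: sum.distrib Ec val G_def)
      qed
      finally show ?thesis by (simp only: basis_expansion)
    qed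
    have "N ?U X' Y' = (\<Sum>i\<in>UNIV. N ?U (fun_scale (\<lambda>p. X' p c $ i) (E i)) Y')"
      by (rule trans[OF arg_cong[OF eX(2), where f="\<lambda>Z. N ?U Z Y'"] connection_sum(1)[OF N U]]) (assumption | intro HV_scale E eX(1) Y')+
    also have "\<dots> = (\<Sum>i\<in>UNIV. fun_scale (\<lambda>p. X' p c $ i) (N ?U (E i) Y'))"
      by (intro sum.cong refl f(4) eX(1) E Y')
    finally have "N ?U X' Y' p c = (\<Sum>i\<in>UNIV. X p c $ i *s N ?U (E i) Y' p c)"
      by (simp add: sum_vfield_apply fun_scale_def tangent_scale_def val)
    also have "\<dots> = \<Gamma> (coord c p) (X p c) (Y p c) + (\<Sum>i\<in>UNIV. X p c $ i *s fd (local_rep c Y') (coord c p) (axis i 1))"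
      by (simp add: EY sum.distrib vec.scale_sum_right \<Gamma>_def)
    also have "(\<Sum>i\<in>UNIV. X p c $ i *s fd (local_rep c Y') (coord c p) (axis i 1)) = fd (local_rep c Y') (coord c p) (X p c)"
    proof (rule clin_expand[symmetric])
      show "clin (fd (local_rep c Y') (coord c p))" by (rule vector_hol_fd_clin[OF HV_hol[OF Y' c]]) (use p in auto)
    qed
    also have "fd (local_rep c Y') (coord c p) = fd (local_rep c Y) (coord c p)"
      by (rule HV_fd_cong[OF c U p p]) (simp add: Y'_def restrict_vfield_def)
    finally have "N ?U X' Y' p c = \<Gamma> (coord c p) (X p c) (Y p c) + fd (local_rep c Y) (coord c p) (X p c)" .
    moreover have "N ?U X' Y' = restrict_vfield ?U (N (topspace M) X Y)"
      unfolding X'_def Y'_def by (rule connection_facts(6)[OF N openin_topspace U dom_subset[OF c] X Y])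
    ultimately show ?thesis using p by (simp add: restrict_vfield_def)
  qed
  ultimately show thesis by (rule that)
qed

section \<open>Frames of global vector fields\<close>

definition frame :: "('n \<Rightarrow> ('a, 'n) vfield) \<Rightarrow> ('a, 'n) chart \<Rightarrow> complex^'n \<Rightarrow> complex^'n^'n" where
  "frame X c x = (\<chi> i j. local_rep c (X j) x $ i)"

lemma frame_axis: "frame X c x *v axis j 1 = local_rep c (X j) x"
  by (simp add: vec_eq_iff matrix_axis_nth frame_def)

lemma frame_apply: "frame X c x *v v = (\<Sum>j\<in>UNIV. v $ j *s local_rep c (X j) x)"
  by (subst matrix_vector_axis_sum) (simp add: frame_axis)

lemma frame_lin_hol:
  assumes "\<And>j. X j \<in> HV (topspace M)" "c \<in> A"
  shows "lin_hol (\<lambda>x. (*v) (frame X c x)) (coord c ` chart_dom c)"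
proof -
  have "topspace M \<inter> chart_dom c = chart_dom c" using dom_subset[OF assms(2)] by blast
  then have "vector_holomorphic_on (local_rep c (X j)) (coord c ` chart_dom c)" for j using HV_hol[OF assms(1,2)] by metis
  then have "vector_holomorphic_on (\<lambda>x. frame X c x *v v) (coord c ` chart_dom c)" for v
    unfolding frame_apply by (intro vector_hol_sum vector_hol_smult scalar_hol_const)
  then show ?thesis unfolding lin_hol_def using clin_matrix by blast
qed

lemma frame_transition:
  assumes "\<And>j. X j \<in> HV (topspace M)" "c \<in> A" "d \<in> A" "p \<in> chart_dom c" "p \<in> chart_dom d"
  shows "frame X d (coord d p) *v v = fd (transition c d) (coord c p) (frame X c (coord c p) *v v)"
proof -
  have p: "p \<in> topspace M" using dom_subset assms by blast
  have "fd (transition c d) (coord c p) (frame X c (coord c p) *v v) = (\<Sum>j\<in>UNIV. v $ j *s fd (transition c d) (coord c p) (X j p c))"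
    using assms by (simp add: frame_apply clin_sum[OF transition_clin] clin_scale[OF transition_clin])
  also have "\<dots> = (\<Sum>j\<in>UNIV. v $ j *s X j p d)"
    using tangentD[OF HV_tangent[OF assms(1) p] assms(2-5)] by simp
  finally show ?thesis using assms by (simp add: frame_apply)
qed

text \<open>The derivatives of the two transition maps carry the frame matrices into each other, so
  these have the same kernel.\<close>

lemma frame_det_transition:
  assumes "\<And>j. X j \<in> HV (topspace M)" "c \<in> A" "d \<in> A" "p \<in> chart_dom c" "p \<in> chart_dom d"
  shows "det (frame X c (coord c p)) \<noteq> 0 \<longleftrightarrow> det (frame X d (coord d p)) \<noteq> 0"
proof -
  have z: "fd (transition c d) (coord c p) 0 = 0" "fd (transition d c) (coord d p) 0 = 0"
    by (rule clin_zero[OF transition_clin], fact+)+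
  have "frame X c (coord c p) *v v = 0 \<longleftrightarrow> frame X d (coord d p) *v v = 0" for v
    using frame_transition[of X c d p v, OF assms] frame_transition[of X d c p v, OF assms(1,3,2,5,4)] z by auto
  then show ?thesis unfolding det_nonzero_iff by simp
qed

end

section \<open>The connection is constant in an invariant frame\<close>

locale commuting_fields = cmanifold M A
  for M :: "'a topology" and A :: "('a, 'n::finite) chart set" +
  fixes X :: "'n \<Rightarrow> ('a, 'n) vfield"
  assumes X: "\<And>j. X j \<in> HV (topspace M)" and comm: "\<And>i j. lie_bracket A (topspace M) (X i) (X j) = 0"
begin

abbreviation S where "S \<equiv> frame X"

lemma S_lin: "c \<in> A \<Longrightarrow> lin_hol (\<lambda>x. (*v) (S c x)) (coord c ` chart_dom c)"
  by (rule frame_lin_hol[OF X])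

lemma S_fd_axis: "fd (\<lambda>y. S c y *v axis j 1) x h = fd (local_rep c (X j)) x h"
  by (simp add: frame_axis[abs_def])

text \<open>The vanishing brackets of the fields \<open>X i\<close> extend to constant combinations
  by bilinearity.\<close>

lemma S_commute:
  assumes c: "c \<in> A" and x: "x \<in> coord c ` chart_dom c"
  shows "fd (\<lambda>y. S c y *v w) x (S c x *v v) = fd (\<lambda>y. S c y *v v) x (S c x *v w)"
proof (rule cbil_eqI[where B="\<lambda>v w. fd (\<lambda>y. S c y *v w) x (S c x *v v)" and C="\<lambda>v w. fd (\<lambda>y. S c y *v v) x (S c x *v w)"])
  note B = bil_holD(1)[OF lin_hol_fd[OF chart_image_open[OF c] S_lin[OF c]] x]
  show "cbil (\<lambda>v w. fd (\<lambda>y. S c y *v w) x (S c x *v v))" "cbil (\<lambda>v w. fd (\<lambda>y. S c y *v v) x (S c x *v w))"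
    unfolding cbil_def
    by (intro conjI allI cbilD(1)[OF B] clin_compose[OF cbilD(2)[OF B] clin_matrix]
        clin_compose[OF vector_hol_fd_clin[OF lin_holD(2)[OF S_lin[OF c]] x] clin_matrix])+
  fix i j
  obtain p where p: "p \<in> chart_dom c" "x = coord c p" using x by blast
  have "p \<in> topspace M" using p dom_subset[OF c] by blast
  have "lie_bracket A (topspace M) (X i) (X j) p c = 0" by (simp add: comm)
  then show "fd (\<lambda>y. S c y *v axis j 1) x (S c x *v axis i 1) = fd (\<lambda>y. S c y *v axis i 1) x (S c x *v axis j 1)"
    using c p \<open>p \<in> topspace M\<close> by (simp add: S_fd_axis frame_axis lie_bracket_def)
qed

text \<open>The flow of \<open>frame_flow\<close>, moved to the manifold. Since
  \<open>local_flow\<close> asks for derivatives in all pairs of charts, transition maps are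
  composed on both sides; \<open>H\<close> is kept for computations in the chart
  \<open>c\<close>.\<close>

lemma frame_local_flow:
  assumes c: "c \<in> A" and p0: "p0 \<in> chart_dom c" "det (S c (coord c p0)) \<noteq> 0"
  obtains \<epsilon> W \<Phi> H where "\<epsilon> > 0" "local_flow M A (X j) \<epsilon> W \<Phi>" "p0 \<in> W" "W \<subseteq> chart_dom c"
    "\<And>t p. \<Phi> t p = chart_inv c (H t (coord c p))"
    "\<And>p. p \<in> W \<Longrightarrow> det (S c (coord c p)) \<noteq> 0" "\<And>p. p \<in> W \<Longrightarrow> H 0 (coord c p) = coord c p"
    "\<And>t p. t \<in> ball 0 \<epsilon> \<Longrightarrow> p \<in> W \<Longrightarrow> H t (coord c p) \<in> coord c ` chart_dom c \<and>
      ((\<lambda>(s, x). H s x) has_derivative (\<lambda>(s, h). s *s (S c (H t (coord c p)) *v axis j 1) +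
        (S c (H t (coord c p)) ** matrix_inv (S c (coord c p))) *v h)) (at (t, coord c p))"
proof -
  let ?Q = "coord c ` chart_dom c"
  obtain \<epsilon> W0 H where \<epsilon>: "\<epsilon> > 0" and W0: "open W0" "coord c p0 \<in> W0" "W0 \<subseteq> ?Q"
    and nz: "\<And>x. x \<in> W0 \<Longrightarrow> det (S c x) \<noteq> 0" and H0: "\<And>x. x \<in> W0 \<Longrightarrow> H 0 x = x"
    and H: "\<And>t x. t \<in> ball 0 \<epsilon> \<Longrightarrow> x \<in> W0 \<Longrightarrow> H t x \<in> ?Q \<and>
       ((\<lambda>(s, x). H s x) has_derivative (\<lambda>(s, h). s *s (S c (H t x) *v axis j 1) + (S c (H t x) ** matrix_inv (S c x)) *v h)) (at (t, x))"
    by (rule frame_flow[OF chart_image_open[OF c] S_lin[OF c] S_commute[OF c] _ p0(2), of "axis j 1"])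
       (assumption, use p0 in blast, rule that)
  define W where "W = chart_inv c ` W0"
  define \<Phi> where "\<Phi> t p = chart_inv c (H t (coord c p))" for t p
  have Wd: "W \<subseteq> chart_dom c" unfolding W_def by (auto intro!: chart_inv_dom subsetD[OF W0(3)])
  have WW0: "coord c p \<in> W0" if "p \<in> W" for p using that W0(3) coord_chart_inv[of _ c] unfolding W_def by auto
  have oW: "openin M W" unfolding W_def by (rule chart_inv_image_open[OF c W0(1,3)])
  have flow: "local_flow M A (X j) \<epsilon> W \<Phi>"
    unfolding local_flow_def
  proof (intro conjI ballI impI \<epsilon> oW)
    show "\<Phi> 0 p = p" if "p \<in> W" for p using H0[OF WW0[OF that]] c Wd that by (auto simp: \<Phi>_def)
    have cH: "continuous_on (ball 0 \<epsilon> \<times> W0) (\<lambda>(s, x). H s x)"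
      by (intro continuous_at_imp_continuous_on ballI) (use H has_derivative_continuous in blast)
    have "continuous_map (prod_topology (top_of_set (ball 0 \<epsilon>)) (subtopology M W)) (top_of_set (ball 0 \<epsilon> \<times> W0)) (\<lambda>(t, p). (t, coord c p))"
    proof -
      have "continuous_map (subtopology M W) (top_of_set ?Q) (coord c)"
        using homeomorphic_imp_continuous_map[OF chart_homeo[OF c]] continuous_map_from_subtopology_mono[OF _ Wd] by blast
      then have "continuous_map (subtopology M W) (top_of_set W0) (coord c)"
        using WW0 by (auto simp: continuous_map_in_subtopology)
      then have "continuous_map (prod_topology (top_of_set (ball 0 \<epsilon>)) (subtopology M W)) (prod_topology (top_of_set (ball 0 \<epsilon>)) (top_of_set W0)) (\<lambda>(t, p). (t, coord c p))"
        by (subst continuous_map_prod_top) auto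
      then show ?thesis by (simp add: subtopology_Times euclidean_product_topology)
    qed
    moreover have "continuous_map (top_of_set (ball 0 \<epsilon> \<times> W0)) (top_of_set ?Q) (\<lambda>(s, x). H s x)"
      using cH H by (auto simp: continuous_map_in_subtopology)
    ultimately have "continuous_map (prod_topology (top_of_set (ball 0 \<epsilon>)) (subtopology M W)) M
       (chart_inv c \<circ> ((\<lambda>(s, x). H s x) \<circ> (\<lambda>(t, p). (t, coord c p))))"
      by (intro continuous_map_compose[OF _ chart_inv_continuous[OF c]] continuous_map_compose)
    then show "continuous_map (prod_topology (top_of_set (ball 0 \<epsilon>)) (subtopology M W)) M (\<lambda>(t, p). \<Phi> t p)"
      by (simp add: \<Phi>_def comp_def case_prod_unfold)
    fix t p c1 d1 assume t: "t \<in> ball (0::complex) \<epsilon>" and p: "p \<in> W" and c1: "c1 \<in> A" and d1: "d1 \<in> A"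
      and dom: "p \<in> chart_dom c1 \<and> \<Phi> t p \<in> chart_dom d1"
    have pc: "p \<in> chart_dom c" using Wd p by blast
    note Ht = H[OF t WW0[OF p]]
    define q where "q = \<Phi> t p"
    have qc: "q \<in> chart_dom c" unfolding q_def \<Phi>_def by (rule chart_inv_dom[OF conjunct1[OF Ht]])
    have Hq: "H t (coord c p) = coord c q" unfolding q_def \<Phi>_def by (rule coord_chart_inv[OF conjunct1[OF Ht], symmetric])
    have qd: "q \<in> chart_dom d1" using dom q_def by simp
    have T1: "(transition c1 c has_derivative fd (transition c1 c) (coord c1 p)) (at (coord c1 p))"
      using vector_holD(1)[OF transition_hol[OF c1 c]] dom pc by blast
    have T2: "(transition c d1 has_derivative fd (transition c d1) (coord c q)) (at (coord c q))"
      using vector_holD(1)[OF transition_hol[OF c d1]] qc qd by blast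
    have t1: "transition c1 c (coord c1 p) = coord c p" by (rule transition_coord) (use c1 dom in auto)
    have DH: "((\<lambda>z. H (fst z) (snd z)) has_derivative (\<lambda>k. fst k *s (S c (coord c q) *v axis j 1) +
       (S c (coord c q) ** matrix_inv (S c (coord c p))) *v snd k)) (at (t, coord c p))"
      using conjunct2[OF Ht] unfolding Hq by (simp add: case_prod_beta')
    have P: "((\<lambda>z. (fst z, transition c1 c (snd z))) has_derivative (\<lambda>k. (fst k, fd (transition c1 c) (coord c1 p) (snd k)))) (at (t, coord c1 p))"
      by (intro has_derivative_Pair has_derivative_fst[OF has_derivative_ident]
          has_derivative_compose[OF has_derivative_snd[OF has_derivative_ident]]) (use T1 in simp)
    from has_derivative_compose[OF P, of "\<lambda>z. H (fst z) (snd z)", unfolded prod.sel t1, OF DH]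
    have "((\<lambda>z. H (fst z) (transition c1 c (snd z))) has_derivative (\<lambda>k. fst k *s (S c (coord c q) *v axis j 1) +
       (S c (coord c q) ** matrix_inv (S c (coord c p))) *v fd (transition c1 c) (coord c1 p) (snd k))) (at (t, coord c1 p))"
      by simp
    from has_derivative_compose[OF this, of "transition c d1"] T2
    have D: "((\<lambda>z. transition c d1 (H (fst z) (transition c1 c (snd z)))) has_derivative (\<lambda>k. fd (transition c d1) (coord c q)
       (fst k *s (S c (coord c q) *v axis j 1) + (S c (coord c q) ** matrix_inv (S c (coord c p))) *v fd (transition c1 c) (coord c1 p) (snd k)))) (at (t, coord c1 p))"
      by (simp add: t1 Hq)
    have l2: "clin (fd (transition c d1) (coord c q))" by (rule transition_clin[OF c d1 qc qd])
    have l1: "clin (fd (transition c1 c) (coord c1 p))" by (rule transition_clin[OF c1 c]) (use dom pc in auto)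
    obtain J where J: "\<And>h. fd (transition c d1) (coord c q) ((S c (coord c q) ** matrix_inv (S c (coord c p))) *v fd (transition c1 c) (coord c1 p) h) = J *v h"
      using clin_matrix_ex[OF clin_compose[OF l2 clin_compose[OF clin_matrix l1]]] by metis
    have Xq: "fd (transition c d1) (coord c q) (S c (coord c q) *v axis j 1) = X j q d1"
      using tangentD[OF HV_tangent[OF X] c d1 qc qd] dom_subset[OF c] qc c by (auto simp: frame_axis)
    show "\<exists>J::complex^'n^'n. ((\<lambda>(s, x). coord d1 (\<Phi> s (chart_inv c1 x))) has_derivative (\<lambda>(s, h). s *s X j (\<Phi> t p) d1 + J *v h)) (at (t, coord c1 p))"
      using D unfolding clin_add[OF l2] clin_scale[OF l2] Xq J
      by (intro exI[where x=J]) (simp add: transition_def \<Phi>_def q_def case_prod_beta' comp_def)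
  qed
  show thesis
  proof (rule that[OF \<epsilon> flow _ Wd \<Phi>_def])
    show "p0 \<in> W" unfolding W_def using W0(2) p0 c by (intro image_eqI[of _ _ "coord c p0"]) auto
    show "det (S c (coord c p)) \<noteq> 0" "H 0 (coord c p) = coord c p" if "p \<in> W" for p
      using nz[OF WW0[OF that]] H0[OF WW0[OF that]] by auto
  qed (use H WW0 in blast)
qed

text \<open>The flow of each \<open>X j\<close> preserves all frame fields and \<open>N\<close>,
  hence also \<open>N\<close> applied to two frame fields. So the coefficients \<open>g\<close> of
  the latter are constant along the flow lines, and the frame fields span all directions.\<close>

lemma connection_constant:
  assumes N: "holomorphic_connection M A N"
    and pres: "preserves_connection M A X N"
    and c: "c \<in> A" and p0: "p0 \<in> chart_dom c" "det (S c (coord c p0)) \<noteq> 0"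
  shows "fd (\<lambda>x. matrix_inv (S c x) *v local_rep c (N (topspace M) (X k) (X l)) x) (coord c p0) h = 0"
proof -
  let ?Q = "coord c ` chart_dom c" and ?x0 = "coord c p0"
  define G where "G = N (topspace M) (X k) (X l)"
  have G: "G \<in> HV (topspace M)" unfolding G_def by (rule connection_facts(1)[OF N openin_topspace X X])
  define g where "g x = matrix_inv (S c x) *v local_rep c G x" for x
  define D where "D = {x \<in> ?Q. det (S c x) \<noteq> 0}"
  have oD: "open D" unfolding D_def by (rule open_det_nonzero[OF chart_image_open[OF c] S_lin[OF c]])
  have DQ: "D \<subseteq> ?Q" and x0: "?x0 \<in> D" using p0 by (auto simp: D_def)
  have hG: "vector_holomorphic_on (local_rep c G) D"
    by (rule vector_hol_subset[OF HV_hol[OF G c]]) (use DQ dom_subset[OF c] in auto)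
  have hg: "vector_holomorphic_on g D"
    unfolding g_def by (rule lin_hol_apply[OF oD lin_hol_matrix_inv[OF lin_hol_subset[OF S_lin[OF c] DQ] oD] hG]) (simp add: D_def)
  have zero: "fd g ?x0 (S c ?x0 *v axis j 1) = 0" for j
  proof -
    obtain \<epsilon> W \<Phi> H where \<epsilon>: "\<epsilon> > 0" and flow: "local_flow M A (X j) \<epsilon> W \<Phi>" and W: "p0 \<in> W" "W \<subseteq> chart_dom c"
      and \<Phi>: "\<And>t p. \<Phi> t p = chart_inv c (H t (coord c p))"
      and nz: "\<And>p. p \<in> W \<Longrightarrow> det (S c (coord c p)) \<noteq> 0" and H0: "\<And>p. p \<in> W \<Longrightarrow> H 0 (coord c p) = coord c p"
      and H: "\<And>t p. t \<in> ball 0 \<epsilon> \<Longrightarrow> p \<in> W \<Longrightarrow> H t (coord c p) \<in> ?Q \<and>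
        ((\<lambda>(s, x). H s x) has_derivative (\<lambda>(s, h). s *s (S c (H t (coord c p)) *v axis j 1) +
        (S c (H t (coord c p)) ** matrix_inv (S c (coord c p))) *v h)) (at (t, coord c p))"
      by (rule frame_local_flow[OF c p0, of j]) (rule that)
    have oW: "openin M W" using flow by (simp add: local_flow_def)
    have Wt: "W \<subseteq> topspace M" using W dom_subset[OF c] by blast
    have inv: "g (H t ?x0) = g ?x0" if t: "t \<in> ball 0 \<epsilon>" for t
    proof -
      have aut: "local_automorphism M A N W (\<Phi> t)" by (rule pres[unfolded preserves_connection_def, rule_format, OF flow t])
      then have ofW: "openin M (\<Phi> t ` W)" by (simp add: local_automorphism_def biholomorphism_on_def)
      have fWt: "\<Phi> t ` W \<subseteq> topspace M" by (rule openin_subset[OF ofW])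
      \<comment> \<open>In arbitrary charts the Jacobian from \<open>frame_flow\<close> stands
        between the derivatives of two transition maps.\<close>
      have der: "fd (coord d1 \<circ> \<Phi> t \<circ> chart_inv c1) (coord c1 p) h =
         fd (transition c d1) (H t (coord c p)) ((S c (H t (coord c p)) ** matrix_inv (S c (coord c p))) *v fd (transition c1 c) (coord c1 p) h)"
        if p: "p \<in> W" "p \<in> chart_dom c1" "\<Phi> t p \<in> chart_dom d1" and A: "c1 \<in> A" "d1 \<in> A" for p c1 d1 h
      proof -
        note Ht = H[OF t p(1)]
        have pc: "p \<in> chart_dom c" using W p by blast
        have qc: "\<Phi> t p \<in> chart_dom c" unfolding \<Phi> by (rule chart_inv_dom[OF conjunct1[OF Ht]])
        have Hq: "H t (coord c p) = coord c (\<Phi> t p)" unfolding \<Phi> by (rule coord_chart_inv[OF conjunct1[OF Ht], symmetric])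
        have T1: "(transition c1 c has_derivative fd (transition c1 c) (coord c1 p)) (at (coord c1 p))"
          using vector_holD(1)[OF transition_hol[OF A(1) c]] p pc by blast
        have T2: "(transition c d1 has_derivative fd (transition c d1) (H t (coord c p))) (at (H t (coord c p)))"
          unfolding Hq using vector_holD(1)[OF transition_hol[OF c A(2)]] qc p by blast
        have t1: "transition c1 c (coord c1 p) = coord c p" by (rule transition_coord) (use A p in auto)
        have "((\<lambda>x. (t, x)) has_derivative (\<lambda>h. (0, h))) (at (coord c p))" by (auto intro!: derivative_eq_intros)
        from has_derivative_compose[OF this conjunct2[OF Ht]]
        have "((\<lambda>x. H t x) has_derivative (\<lambda>h. (S c (H t (coord c p)) ** matrix_inv (S c (coord c p))) *v h)) (at (transition c1 c (coord c1 p)))"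
          by (simp add: t1)
        from has_derivative_compose[OF has_derivative_compose[OF T1 this], of "transition c d1"] T2
        have "((\<lambda>x. transition c d1 (H t (transition c1 c x))) has_derivative (\<lambda>h. fd (transition c d1) (H t (coord c p)) ((S c (H t (coord c p)) ** matrix_inv (S c (coord c p))) *v fd (transition c1 c) (coord c1 p) h))) (at (coord c1 p))"
          by (simp add: t1)
        moreover have "(\<lambda>x. transition c d1 (H t (transition c1 c x))) = coord d1 \<circ> \<Phi> t \<circ> chart_inv c1"
          by (simp add: fun_eq_iff transition_def \<Phi>)
        ultimately show ?thesis using frechet_derivative_at' by metis
      qed
      \<comment> \<open>The Jacobian sends each column of the frame matrix to the same column at the
        image point.\<close>
      have rel: "related_on A (\<Phi> t) W (restrict_vfield W (X i)) (restrict_vfield (\<Phi> t ` W) (X i))" for i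
        unfolding related_on_def
      proof (intro ballI impI)
        fix p c1 d1 assume p: "p \<in> W" and A: "c1 \<in> A" "d1 \<in> A" and dom: "p \<in> chart_dom c1 \<and> \<Phi> t p \<in> chart_dom d1"
        note Ht = H[OF t p]
        have pc: "p \<in> chart_dom c" using W p by blast
        have qc: "\<Phi> t p \<in> chart_dom c" unfolding \<Phi> by (rule chart_inv_dom[OF conjunct1[OF Ht]])
        have Hq: "H t (coord c p) = coord c (\<Phi> t p)" unfolding \<Phi> by (rule coord_chart_inv[OF conjunct1[OF Ht], symmetric])
        have "fd (transition c1 c) (coord c1 p) (X i p c1) = X i p c"
          using tangentD[OF HV_tangent[OF X] A(1) c] dom pc Wt p by auto
        also have "\<dots> = S c (coord c p) *v axis i 1" using c pc by (simp add: frame_axis)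
        finally have 1: "fd (transition c1 c) (coord c1 p) (X i p c1) = S c (coord c p) *v axis i 1" .
        have "fd (coord d1 \<circ> \<Phi> t \<circ> chart_inv c1) (coord c1 p) (X i p c1) = fd (transition c d1) (coord c (\<Phi> t p)) (S c (coord c (\<Phi> t p)) *v axis i 1)"
          using der[OF p _ _ A] dom by (simp add: 1 matrix_vector_mul_assoc[symmetric] matrix_inv_cancel(2)[OF nz[OF p]] Hq)
        also have "\<dots> = X i (\<Phi> t p) d1"
          using tangentD[OF HV_tangent[OF X] c A(2) qc] dom fWt p c qc by (auto simp: frame_axis)
        finally show "restrict_vfield (\<Phi> t ` W) (X i) (\<Phi> t p) d1 = fd (coord d1 \<circ> \<Phi> t \<circ> chart_inv c1) (coord c1 p) (restrict_vfield W (X i) p c1)"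
          using p by (simp add: restrict_vfield_def)
      qed
      have R: "restrict_vfield W (X i) \<in> HV W" "restrict_vfield (\<Phi> t ` W) (X i) \<in> HV (\<Phi> t ` W)" for i
        by (rule HV_restrict[OF X Wt oW], rule HV_restrict[OF X fWt ofW])
      have "related_on A (\<Phi> t) W (N W (restrict_vfield W (X k)) (restrict_vfield W (X l)))
        (N (\<Phi> t ` W) (restrict_vfield (\<Phi> t ` W) (X k)) (restrict_vfield (\<Phi> t ` W) (X l)))"
        by (rule aut[unfolded local_automorphism_def, THEN conjunct2, THEN spec, THEN mp, OF conjI[OF oW subset_refl], rule_format, OF R(1) R(1) R(2) R(2)])
          (intro conjI rel)
      moreover have "N W (restrict_vfield W (X k)) (restrict_vfield W (X l)) = restrict_vfield W G"
        unfolding G_def by (rule connection_facts(6)[OF N openin_topspace oW Wt X X])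
      moreover have "N (\<Phi> t ` W) (restrict_vfield (\<Phi> t ` W) (X k)) (restrict_vfield (\<Phi> t ` W) (X l)) = restrict_vfield (\<Phi> t ` W) G"
        unfolding G_def by (rule connection_facts(6)[OF N openin_topspace ofW fWt X X])
      ultimately have rG: "related_on A (\<Phi> t) W (restrict_vfield W G) (restrict_vfield (\<Phi> t ` W) G)" by simp
      note Ht = H[OF t W(1)]
      have qc: "\<Phi> t p0 \<in> chart_dom c" unfolding \<Phi> by (rule chart_inv_dom[OF conjunct1[OF Ht]])
      have Hq: "H t ?x0 = coord c (\<Phi> t p0)" unfolding \<Phi> by (rule coord_chart_inv[OF conjunct1[OF Ht], symmetric])
      have "G (\<Phi> t p0) c = fd (coord c \<circ> \<Phi> t \<circ> chart_inv c) ?x0 (G p0 c)"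
        using rG[unfolded related_on_def, rule_format, OF W(1) c c] p0(1) qc W(1) by (simp add: restrict_vfield_def)
      also have "\<dots> = fd (transition c c) (H t ?x0) ((S c (H t ?x0) ** matrix_inv (S c ?x0)) *v fd (transition c c) ?x0 (G p0 c))"
        by (rule der[OF W(1) p0(1) qc c c])
      also have "\<dots> = S c (H t ?x0) *v g ?x0"
        unfolding Hq transition_self[OF c qc] transition_self[OF c p0(1)] g_def using p0(1) c by (simp add: matrix_vector_mul_assoc)
      finally have GS: "G (\<Phi> t p0) c = S c (H t ?x0) *v g ?x0" .
      \<comment> \<open>The frame is still a basis at the moved point: the flow map is
        biholomorphic, being a local automorphism, so its derivative, which is \<open>S c\<close> at
        the new point times an inverse matrix, is injective.\<close>
      have nzH: "det (S c (H t ?x0)) \<noteq> 0"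
        unfolding det_nonzero_iff
      proof (intro allI impI)
        fix v assume v: "S c (H t ?x0) *v v = 0"
        have "biholomorphism_on M A W (\<Phi> t)" using aut by (simp add: local_automorphism_def)
        then have inj: "inj_on (\<Phi> t) W" and hi: "holomorphic_map_on M A (\<Phi> t ` W) (inv_into W (\<Phi> t))"
          by (simp_all add: biholomorphism_on_def)
        let ?k = "coord c \<circ> inv_into W (\<Phi> t) \<circ> chart_inv c" and ?f = "coord c \<circ> \<Phi> t \<circ> chart_inv c"
        have "vector_holomorphic_on ?k (coord c ` {p \<in> \<Phi> t ` W \<inter> chart_dom c. inv_into W (\<Phi> t) p \<in> chart_dom c})"
          using hi c unfolding holomorphic_map_on_def by blast
        moreover have "coord c (\<Phi> t p0) \<in> coord c ` {p \<in> \<Phi> t ` W \<inter> chart_dom c. inv_into W (\<Phi> t) p \<in> chart_dom c}"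
          using W(1) qc p0(1) inj by (auto simp: inv_into_f_f)
        ultimately have Dk: "(?k has_derivative fd ?k (coord c (\<Phi> t p0))) (at (coord c (\<Phi> t p0)))"
          by (rule vector_holD(1))
        have "((\<lambda>x. (t, x)) has_derivative (\<lambda>h. (0, h))) (at ?x0)" by (auto intro!: derivative_eq_intros)
        from has_derivative_compose[OF this conjunct2[OF Ht]]
        have DHt: "((\<lambda>x. H t x) has_derivative (\<lambda>h. (S c (H t ?x0) ** matrix_inv (S c ?x0)) *v h)) (at ?x0)" by simp
        have "((\<lambda>x. ?k (H t x)) has_derivative (\<lambda>h. fd ?k (coord c (\<Phi> t p0)) ((S c (H t ?x0) ** matrix_inv (S c ?x0)) *v h))) (at ?x0)"
          by (rule has_derivative_compose[OF DHt]) (use Dk in \<open>simp only: Hq\<close>)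
        then have Dc: "fd (\<lambda>x. ?k (H t x)) ?x0 = (\<lambda>h. fd ?k (coord c (\<Phi> t p0)) ((S c (H t ?x0) ** matrix_inv (S c ?x0)) *v h))"
          by (rule frechet_derivative_at')
        have Di: "fd (\<lambda>x. ?k (H t x)) ?x0 = fd (\<lambda>x. x) ?x0"
        proof (rule fd_cong_open[OF img_open[OF c oW]])
          show "?x0 \<in> img c W" using W(1) p0(1) by blast
          fix x assume "x \<in> img c W"
          then obtain p where p: "p \<in> W" "p \<in> chart_dom c" "x = coord c p" by blast
          have "chart_inv c (H t x) = \<Phi> t p" by (simp add: \<Phi> p(3))
          then show "?k (H t x) = x" using inj p by (simp add: inv_into_f_f)
        qed
        have "fd ?k (coord c (\<Phi> t p0)) ((S c (H t ?x0) ** matrix_inv (S c ?x0)) *v h) = h" for h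
          using fun_cong[OF trans[OF Dc[symmetric] trans[OF Di frechet_derivative_at'[OF has_derivative_ident]]], of h] .
        from this[of "S c ?x0 *v v"] have "fd ?k (coord c (\<Phi> t p0)) 0 = S c ?x0 *v v"
          using v by (simp add: matrix_vector_mul_assoc[symmetric] matrix_inv_cancel(2)[OF p0(2)])
        moreover have "fd ?k (coord c (\<Phi> t p0)) 0 = 0" using linear_0[OF has_derivative_linear[OF Dk]] .
        ultimately have "S c ?x0 *v v = 0" by simp
        then show "v = 0" using p0(2) unfolding det_nonzero_iff by blast
      qed
      show ?thesis
        unfolding g_def[of "H t ?x0"] using GS matrix_inv_cancel(2)[OF nzH] by (simp add: Hq qc c)
    qed
    \<comment> \<open>The time derivative at 0 of the constant function \<open>g (H t ?x0)\<close>
      is the derivative of \<open>g\<close> along \<open>X j\<close>.\<close>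
    have "((\<lambda>t. (t, ?x0)) has_derivative (\<lambda>s. (s, 0))) (at (0::complex))" by (auto intro!: derivative_eq_intros)
    from has_derivative_compose[OF this conjunct2[OF H[of 0 p0]]]
    have "((\<lambda>t. H t ?x0) has_derivative (\<lambda>s. s *s (S c ?x0 *v axis j 1))) (at 0)"
      using \<epsilon> W(1) by (simp add: H0)
    from has_derivative_compose[OF this, of g] vector_holD(1)[OF hg x0]
    have d1: "((\<lambda>t. g (H t ?x0)) has_derivative (\<lambda>s. fd g ?x0 (s *s (S c ?x0 *v axis j 1)))) (at 0)"
      by (simp add: H0 W(1))
    have "((\<lambda>t. g (H t ?x0)) has_derivative (\<lambda>s. 0)) (at 0)"
      by (rule has_derivative_transform_within_open[OF has_derivative_const[of "g ?x0"] open_ball[of 0 \<epsilon>]])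
         (use \<epsilon> inv in auto)
    with d1 have "(\<lambda>s. fd g ?x0 (s *s (S c ?x0 *v axis j 1))) = (\<lambda>s. 0)" by (rule has_derivative_unique)
    from fun_cong[OF this, of 1] show ?thesis by simp
  qed
  have cl: "clin (\<lambda>v. fd g ?x0 (S c ?x0 *v v))"
    by (rule clin_compose[OF vector_hol_fd_clin[OF hg x0] clin_matrix])
  have "fd g ?x0 (S c ?x0 *v v) = 0" for v using clin_expand[OF cl, of v] by (simp add: zero)
  from this[of "matrix_inv (S c ?x0) *v h"] show ?thesis
    by (simp add: matrix_inv_cancel(1)[OF p0(2)] g_def[abs_def] G_def)
qed

end

lemma cbil_arith:
  assumes "cbil B"
  shows "B (x + y) v = B x v + B y v" "B x (v + w) = B x v + B x w" "B (z *s x) v = z *s B x v" "B x (z *s v) = z *s B x v"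
  using clin_add[OF cbilD(1)[OF assms]] clin_add[OF cbilD(2)[OF assms]] clin_scale[OF cbilD(1)[OF assms]] clin_scale[OF cbilD(2)[OF assms]]
  by auto

lemma cbil_symmetrize: "cbil B \<Longrightarrow> cbil (\<lambda>v w. z *s (B v w + B w v))"
  unfolding cbil_def[of "\<lambda>v w. z *s (B v w + B w v)"] by (auto intro!: clinI simp: cbil_arith algebra_simps)

lemma cbil_sum: "cbil B \<Longrightarrow> cbil C \<Longrightarrow> cbil (\<lambda>v w. B v w + C v w)"
  unfolding cbil_def[of "\<lambda>v w. B v w + C v w"] by (auto intro!: clinI simp: cbil_arith algebra_simps)

section \<open>Structure constants on a component\<close>

context commuting_fields
begin

text \<open>A determinant that vanishes on an open set would vanish on the whole component, in
  particular at \<open>p0\<close>.\<close>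

lemma det_dense:
  assumes c0: "c0 \<in> A" and p0: "p0 \<in> chart_dom c0" "det (S c0 (coord c0 p0)) \<noteq> 0"
    and c: "c \<in> A" and x: "x \<in> img c (comp p0)" and e: "e > 0"
  shows "\<exists>x'\<in>ball x e \<inter> img c (comp p0). det (S c x') \<noteq> 0"
proof (rule ccontr)
  assume neg: "\<not> (\<exists>x'\<in>ball x e \<inter> img c (comp p0). det (S c x') \<noteq> 0)"
  let ?B = "ball x e \<inter> img c (comp p0)"
  define Z where "Z p \<longleftrightarrow> (\<forall>d\<in>A. p \<in> chart_dom d \<longrightarrow> det (S d (coord d p)) = 0)" for p
  have oB: "open ?B" by (intro open_Int open_ball img_open[OF c comp_open])
  have BQ: "?B \<subseteq> coord c ` chart_dom c" by blast
  obtain q where q: "q \<in> comp p0" "q \<in> chart_dom c" "x = coord c q" using x by blast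
  \<comment> \<open>\<open>identity_principle\<close> takes vector-valued functions, and
    \<open>vec\<close> makes the determinant one.\<close>
  have Zi: "Z p \<longleftrightarrow> (vec (det (S d (coord d p))) :: complex^'n) = 0" if d: "d \<in> A" and p: "p \<in> chart_dom d" for d p
  proof -
    have "det (S d (coord d p)) = 0 \<longleftrightarrow> det (S d' (coord d' p)) = 0" if "d' \<in> A" "p \<in> chart_dom d'" for d'
      using frame_det_transition[of X, OF X d that(1) p that(2)] by blast
    then have "Z p \<longleftrightarrow> det (S d (coord d p)) = 0" unfolding Z_def using d p by blast
    then show ?thesis by (simp add: vec_eq_iff)
  qed
  have "Z p0"
  proof (rule identity_principle[where F="\<lambda>d x. vec (det (S d x)) :: complex^'n" and W="chart_inv c ` ?B" and p=q])
    show "vector_holomorphic_on (\<lambda>x. vec (det (S d x)) :: complex^'n) (coord d ` chart_dom d)" if "d \<in> A" for d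
      unfolding vector_holomorphic_on_def using scalar_hol_det[OF lin_hol_matrix_entries[OF S_lin[OF that]]] by simp
    show "openin M (chart_inv c ` ?B)" by (rule chart_inv_image_open[OF c oB BQ])
    show "q \<in> chart_inv c ` ?B" using q e c x by (intro image_eqI[of _ _ x]) auto
    show "p0 \<in> comp q" using comp_eq[OF q(1)] comp_refl dom_subset[OF c0] p0(1) by blast
    fix r assume "r \<in> chart_inv c ` ?B"
    then obtain y where y: "y \<in> ?B" "r = chart_inv c y" by blast
    then have yQ: "y \<in> coord c ` chart_dom c" by blast
    have "r \<in> chart_dom c" "coord c r = y" unfolding y(2) by (rule chart_inv_dom[OF yQ], rule coord_chart_inv[OF yQ])
    moreover have "det (S c y) = 0" using neg y(1) by blast
    ultimately show "Z r" using Zi[OF c, of r] by (metis vec_0)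
  qed (rule Zi)
  then show False using c0 p0 unfolding Z_def by blast
qed

text \<open>By \<open>connection_constant\<close> the coefficients are constant on a ball. The
  combination \<open>K\<close> of the fields with these constants then coincides with the covariant
  derivative on the whole component, including the points where the frame degenerates.\<close>

lemma structure_constants:
  assumes N: "holomorphic_connection M A N"
    and pres: "preserves_connection M A X N"
    and c0: "c0 \<in> A" and p0: "p0 \<in> chart_dom c0" "det (S c0 (coord c0 p0)) \<noteq> 0"
  obtains v where "\<And>c p. c \<in> A \<Longrightarrow> p \<in> chart_dom c \<Longrightarrow> p \<in> comp p0 \<Longrightarrow>
    N (topspace M) (X k) (X l) p c = S c (coord c p) *v v"
proof -
  let ?Q = "coord c0 ` chart_dom c0" and ?x0 = "coord c0 p0"
  define G where "G = N (topspace M) (X k) (X l)"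
  have G: "G \<in> HV (topspace M)" unfolding G_def by (rule connection_facts(1)[OF N openin_topspace X X])
  have TS: "topspace M \<inter> chart_dom d = chart_dom d" if "d \<in> A" for d using dom_subset[OF that] by blast
  have Gh: "vector_holomorphic_on (local_rep d G) (coord d ` chart_dom d)" if "d \<in> A" for d
    using HV_hol[OF G that] by (simp only: TS[OF that])
  define g where "g x = matrix_inv (S c0 x) *v local_rep c0 G x" for x
  define D where "D = {x \<in> ?Q. det (S c0 x) \<noteq> 0}"
  have oD: "open D" unfolding D_def by (rule open_det_nonzero[OF chart_image_open[OF c0] S_lin[OF c0]])
  have DQ: "D \<subseteq> ?Q" and x0: "?x0 \<in> D" using p0 by (auto simp: D_def)
  have hg: "vector_holomorphic_on g D"
    unfolding g_def by (rule lin_hol_apply[OF oD lin_hol_matrix_inv[OF lin_hol_subset[OF S_lin[OF c0] DQ] oD] vector_hol_subset[OF Gh[OF c0] DQ]]) (simp add: D_def)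
  obtain r where r: "r > 0" "ball ?x0 r \<subseteq> D" using oD x0 open_contains_ball by blast
  have "(g has_derivative (\<lambda>h. 0)) (at x)" if x: "x \<in> D" for x
  proof -
    obtain p where p: "p \<in> chart_dom c0" "x = coord c0 p" using x DQ by blast
    then have nz: "det (S c0 (coord c0 p)) \<noteq> 0" using x by (simp add: D_def)
    have "fd g x h = 0" for h
      using connection_constant[OF N pres c0 p(1) nz, of k l h] unfolding p(2) g_def[abs_def] G_def .
    then have "fd g x = (\<lambda>h. 0)" by (rule ext)
    then show ?thesis using vector_holD(1)[OF hg x] by simp
  qed
  then have const: "g x = g ?x0" if "x \<in> ball ?x0 r" for x
    using has_derivative_zero_unique[of "ball ?x0 r" g, OF convex_ball _ that] r has_derivative_at_withinI
    by (meson centre_in_ball subsetD)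
  define K where "K = (\<Sum>j\<in>UNIV. fun_scale (\<lambda>_. g ?x0 $ j) (X j))"
  have hc: "holomorphic_function_on A U (\<lambda>_. z)" for U z
    by (simp add: holomorphic_function_on_def comp_def scalar_hol_const)
  have K: "K \<in> HV (topspace M)" unfolding K_def by (intro HV_sum HV_scale X hc)
  have Kc: "K p c = S c (coord c p) *v g ?x0" if "c \<in> A" "p \<in> chart_dom c" for c p
    using that by (simp add: K_def sum_vfield_apply fun_scale_def tangent_scale_def frame_apply)
  have Zi: "G p = K p \<longleftrightarrow> local_rep d G (coord d p) - S d (coord d p) *v g ?x0 = 0" if d: "d \<in> A" and p: "p \<in> chart_dom d" for d p
  proof
    show "G p = K p \<Longrightarrow> local_rep d G (coord d p) - S d (coord d p) *v g ?x0 = 0" using Kc[OF d p] d p by simp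
    have pt: "p \<in> topspace M" using dom_subset d p by blast
    assume "local_rep d G (coord d p) - S d (coord d p) *v g ?x0 = 0"
    then have "G p d = K p d" using Kc[OF d p] d p by simp
    then show "G p = K p" by (rule tangent_eqI[OF HV_tangent[OF G pt] HV_tangent[OF K pt] d p])
  qed
  have eq: "G p = K p" if "p \<in> comp p0" for p
  proof (rule identity_principle[where F="\<lambda>d x. local_rep d G x - S d x *v g ?x0" and W="chart_inv c0 ` ball ?x0 r" and p=p0 and q=p])
    show "vector_holomorphic_on (\<lambda>x. local_rep d G x - S d x *v g ?x0) (coord d ` chart_dom d)" if "d \<in> A" for d
      by (intro vector_hol_diff Gh lin_holD(2)[OF S_lin] that)
    show "openin M (chart_inv c0 ` ball ?x0 r)" by (rule chart_inv_image_open[OF c0 open_ball]) (use r DQ in blast)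
    show "p0 \<in> chart_inv c0 ` ball ?x0 r" using c0 p0 r(1) by (intro image_eqI[of _ _ ?x0]) auto
    fix s assume "s \<in> chart_inv c0 ` ball ?x0 r"
    then obtain y where y: "y \<in> ball ?x0 r" "s = chart_inv c0 y" by blast
    then have yD: "y \<in> D" using r(2) by blast
    have s: "s \<in> chart_dom c0" "coord c0 s = y" using y yD DQ chart_inv_dom[of y c0] coord_chart_inv[of y c0] by auto
    have "S c0 y *v g ?x0 = local_rep c0 G y"
      unfolding const[OF y(1), symmetric] using yD by (simp add: g_def matrix_inv_cancel(1) D_def)
    then show "G s = K s" using Zi[OF c0 s(1)] s(2) by simp
  qed (use Zi that in auto)
  show thesis by (rule that[of "g ?x0"]) (use eq Kc in \<open>simp add: G_def\<close>)
qed

text \<open>The products \<open>\<mu>0\<close>, \<open>\<mu>1\<close> and \<open>\<mu>\<close>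
  belong to \<open>N\<close>, to its symmetrization and to the projection of the latter; only
  \<open>\<mu>\<close> is associative.\<close>

lemma component_structure:
  assumes N: "holomorphic_connection M A N"
    and pres: "preserves_connection M A X N"
    and c0: "c0 \<in> A" and p0: "p0 \<in> chart_dom c0" "det (S c0 (coord c0 p0)) \<noteq> 0"
  obtains \<mu> \<Gamma> where "\<And>c. c \<in> A \<Longrightarrow> chart_frame (S c) (\<Gamma> c) (img c (comp p0)) \<mu>"
    "\<And>a b v. \<mu> a (\<mu> b v) = \<mu> b (\<mu> a v)"
proof -
  have "\<exists>v. \<forall>c p. c \<in> A \<longrightarrow> p \<in> chart_dom c \<longrightarrow> p \<in> comp p0 \<longrightarrow> N (topspace M) (X k) (X l) p c = S c (coord c p) *v v" for k l
    by (rule structure_constants[OF N pres c0 p0, of k l]) (rule exI, intro allI impI)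
  then obtain \<kappa> where \<kappa>: "\<And>k l c p. c \<in> A \<Longrightarrow> p \<in> chart_dom c \<Longrightarrow> p \<in> comp p0 \<Longrightarrow>
      N (topspace M) (X k) (X l) p c = S c (coord c p) *v \<kappa> k l"
    by metis
  define \<mu>0 where "\<mu>0 v w = (\<Sum>i\<in>UNIV. \<Sum>j\<in>UNIV. v $ i *s (w $ j *s \<kappa> i j))" for v w
  have b0: "cbil \<mu>0" unfolding cbil_def \<mu>0_def
    by (auto intro!: clinI simp: sum.distrib vec.scale_sum_right algebra_simps)
  have \<mu>0a: "\<mu>0 (axis i 1) (axis j 1) = \<kappa> i j" for i j
  proof -
    have d: "(axis i 1 :: complex^'n) $ k *s v = (if k = i then v else 0)" for i k and v :: "complex^'n" by (simp add: axis_def)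
    show ?thesis unfolding \<mu>0_def vec.scale_sum_right[symmetric] by (simp add: d)
  qed
  \<comment> \<open>Averaging over both orders of the arguments removes the torsion. The relation to
    the frame survives because the fields commute.\<close>
  define \<mu>1 where "\<mu>1 v w = (1/2::complex) *s (\<mu>0 v w + \<mu>0 w v)" for v w
  have b1: "cbil \<mu>1" unfolding \<mu>1_def by (rule cbil_symmetrize[OF b0])
  have "\<exists>G. bil_hol G (coord c ` chart_dom c) \<and> (\<forall>X Y p. X \<in> HV (topspace M) \<longrightarrow> Y \<in> HV (topspace M) \<longrightarrow> p \<in> chart_dom c \<longrightarrow>
      N (topspace M) X Y p c = fd (local_rep c Y) (coord c p) (X p c) + G (coord c p) (X p c) (Y p c))" if "c \<in> A" for c
    by (rule christoffel[OF N that]) blast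
  then obtain \<Gamma>0 where \<Gamma>0: "\<And>c. c \<in> A \<Longrightarrow> bil_hol (\<Gamma>0 c) (coord c ` chart_dom c)"
    "\<And>c X Y p. c \<in> A \<Longrightarrow> X \<in> HV (topspace M) \<Longrightarrow> Y \<in> HV (topspace M) \<Longrightarrow> p \<in> chart_dom c \<Longrightarrow>
       N (topspace M) X Y p c = fd (local_rep c Y) (coord c p) (X p c) + \<Gamma>0 c (coord c p) (X p c) (Y p c)"
    by metis
  define \<Gamma>1 where "\<Gamma>1 c x v w = (1/2::complex) *s (\<Gamma>0 c x v w + \<Gamma>0 c x w v)" for c x v w
  have cf: "chart_frame (S c) (\<Gamma>1 c) (img c (comp p0)) \<mu>1" if c: "c \<in> A" for c
  proof
    have sub: "img c (comp p0) \<subseteq> coord c ` chart_dom c" by blast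
    note G0 = bil_hol_subset[OF \<Gamma>0(1)[OF c] sub]
    show "open (img c (comp p0))" by (rule img_open[OF c comp_open])
    show "lin_hol (\<lambda>x. (*v) (S c x)) (img c (comp p0))" by (rule lin_hol_subset[OF S_lin[OF c] sub])
    show "bil_hol (\<Gamma>1 c) (img c (comp p0))" unfolding bil_hol_def \<Gamma>1_def
    proof (intro conjI ballI allI)
      fix x assume "x \<in> img c (comp p0)"
      from bil_holD(1)[OF G0 this] show "cbil (\<lambda>v w. (1/2::complex) *s (\<Gamma>0 c x v w + \<Gamma>0 c x w v))"
        by (rule cbil_symmetrize)
    qed (intro vector_hol_smult scalar_hol_const vector_hol_add bil_holD(2)[OF G0])
    show "\<Gamma>1 c x v w = \<Gamma>1 c x w v" for x v w by (simp add: \<Gamma>1_def add.commute)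
    show "cbil \<mu>1" by (rule b1)
    show "\<mu>1 v w = \<mu>1 w v" for v w by (simp add: \<mu>1_def add.commute)
    show "\<exists>x'\<in>ball x e \<inter> img c (comp p0). det (S c x') \<noteq> 0" if "x \<in> img c (comp p0)" "e > 0" for x e
      by (rule det_dense[OF c0 p0 c that])
    fix x v w assume x: "x \<in> img c (comp p0)"
    then have xQ: "x \<in> coord c ` chart_dom c" by blast
    obtain p where p: "p \<in> comp p0" "p \<in> chart_dom c" "x = coord c p" using x by blast
    have r0: "fd (\<lambda>y. S c y *v w) x (S c x *v v) + \<Gamma>0 c x (S c x *v v) (S c x *v w) = S c x *v \<mu>0 v w" for v w
    proof (rule cbil_eqI[where B="\<lambda>v w. fd (\<lambda>y. S c y *v w) x (S c x *v v) + \<Gamma>0 c x (S c x *v v) (S c x *v w)" and C="\<lambda>v w. S c x *v \<mu>0 v w"])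
      note B = bil_holD(1)[OF lin_hol_fd[OF chart_image_open[OF c] S_lin[OF c]] xQ] and B0 = bil_holD(1)[OF G0 x]
      have 1: "clin (\<lambda>w. fd (\<lambda>y. S c y *v w) x (S c x *v v))" "clin (\<lambda>v. fd (\<lambda>y. S c y *v w) x (S c x *v v))" for v w
        by (intro cbilD(1)[OF B] clin_compose[OF cbilD(2)[OF B] clin_matrix]
           clin_compose[OF vector_hol_fd_clin[OF lin_holD(2)[OF S_lin[OF c]] xQ] clin_matrix])+
      have 2: "clin (\<lambda>w. \<Gamma>0 c x (S c x *v v) (S c x *v w))" "clin (\<lambda>v. \<Gamma>0 c x (S c x *v v) (S c x *v w))" for v w
        by (rule clin_compose[OF cbilD(1)[OF B0] clin_matrix], rule clin_compose[OF cbilD(2)[OF B0] clin_matrix])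
      show "cbil (\<lambda>v w. fd (\<lambda>y. S c y *v w) x (S c x *v v) + \<Gamma>0 c x (S c x *v v) (S c x *v w))"
        by (rule cbil_sum; unfold cbil_def; intro conjI allI 1 2)
      show "cbil (\<lambda>v w. S c x *v \<mu>0 v w)"
        unfolding cbil_def by (intro conjI allI clin_compose[OF clin_matrix cbilD(1)[OF b0]] clin_compose[OF clin_matrix cbilD(2)[OF b0]])
      fix i j
      show "fd (\<lambda>y. S c y *v axis j 1) x (S c x *v axis i 1) + \<Gamma>0 c x (S c x *v axis i 1) (S c x *v axis j 1) = S c x *v \<mu>0 (axis i 1) (axis j 1)"
        using \<Gamma>0(2)[OF c X X p(2), of i j] \<kappa>[OF c p(2,1), of i j] c p
        by (simp add: \<mu>0a S_fd_axis frame_axis)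
    qed
    have "S c x *v \<mu>1 v w = (1/2::complex) *s (S c x *v \<mu>0 v w + S c x *v \<mu>0 w v)"
      by (simp add: \<mu>1_def vector_scalar_commute matrix_vector_right_distrib)
    also have "\<dots> = (1/2::complex) *s (fd (\<lambda>y. S c y *v w) x (S c x *v v) + fd (\<lambda>y. S c y *v w) x (S c x *v v)) + \<Gamma>1 c x (S c x *v v) (S c x *v w)"
      unfolding r0[symmetric] \<Gamma>1_def S_commute[OF c xQ, of v w] by (simp add: algebra_simps)
    also have "(1/2::complex) *s (fd (\<lambda>y. S c y *v w) x (S c x *v v) + fd (\<lambda>y. S c y *v w) x (S c x *v v)) = fd (\<lambda>y. S c y *v w) x (S c x *v v)"
      by (simp add: vec_eq_iff)
    finally show "fd (\<lambda>y. S c y *v w) x (S c x *v v) + \<Gamma>1 c x (S c x *v v) (S c x *v w) = S c x *v \<mu>1 v w" ..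
  qed
  obtain T where T: "clin T" "\<And>J x. comm_ideal \<mu>1 J \<Longrightarrow> x \<in> J \<Longrightarrow> T x = 0"
    and comm: "\<And>a b v w. \<mu>1 (a - T a) (\<mu>1 (v - T v) (w - T w) - T (\<mu>1 (v - T v) (w - T w)))
       = \<mu>1 (v - T v) (\<mu>1 (a - T a) (w - T w) - T (\<mu>1 (a - T a) (w - T w)))"
    by (rule commutative_quotient[OF b1]) (rule that)
  define \<mu> where "\<mu> v w = \<mu>1 (v - T v) (w - T w)" for v w
  define P where "P c G \<longleftrightarrow> bil_hol G (img c (comp p0)) \<and> (\<forall>x\<in>img c (comp p0). \<forall>v w. G x v w = G x w v) \<and>
     (\<forall>x\<in>img c (comp p0). \<forall>v w. fd (\<lambda>y. S c y *v w) x (S c x *v v) + G x (S c x *v v) (S c x *v w) = S c x *v \<mu> v w)" for c G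
  have ex: "\<exists>G. P c G" if c: "c \<in> A" for c
    by (rule chart_frame.projected_christoffel[OF cf[OF c] T]) (assumption, assumption, unfold P_def \<mu>_def, blast)
  define \<Gamma> where "\<Gamma> c = (SOME G. P c G)" for c
  have PG: "P c (\<Gamma> c)" if "c \<in> A" for c unfolding \<Gamma>_def by (rule someI_ex[OF ex[OF that]])
  have \<Gamma>: "bil_hol (\<Gamma> c) (img c (comp p0))" "x \<in> img c (comp p0) \<Longrightarrow> \<Gamma> c x v w = \<Gamma> c x w v"
     "x \<in> img c (comp p0) \<Longrightarrow> fd (\<lambda>y. S c y *v w) x (S c x *v v) + \<Gamma> c x (S c x *v v) (S c x *v w) = S c x *v \<mu> v w"
    if "c \<in> A" for c x v w
    using PG[OF that] unfolding P_def by blast+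
  show thesis
  proof (rule that[of \<Gamma> \<mu>])
    have l: "clin (\<lambda>v. v - T v)" by (rule clinI) (simp_all add: clin_add[OF T(1)] clin_scale[OF T(1)] vec.scale_right_diff_distrib)
    show "chart_frame (S c) (\<Gamma> c) (img c (comp p0)) \<mu>" if c: "c \<in> A" for c
    proof -
      interpret cf: chart_frame "S c" "\<Gamma>1 c" "img c (comp p0)" \<mu>1 by (rule cf[OF c])
      show ?thesis
      proof
        show "cbil \<mu>" unfolding cbil_def \<mu>_def
          by (intro conjI allI clin_compose[OF cbilD(1)[OF b1] l] clin_compose[OF cbilD(2)[OF b1] l])
        show "\<mu> v w = \<mu> w v" for v w unfolding \<mu>_def by (rule cf.sym)
      qed (use \<Gamma> c cf.Q cf.S cf.dense in blast)+
    qed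
    show "\<mu> a (\<mu> b v) = \<mu> b (\<mu> a v)" for a b v
      unfolding \<mu>_def by (rule comm)
  qed
qed

end

context cmanifold
begin

text \<open>The values \<open>\<rho> a q\<close> already form a subspace, so at a point of the open orbit the frame can be
  chosen to be the coordinate frame.\<close>

lemma orbit_structure:
  fixes \<rho> :: "'g::ab_group_add \<Rightarrow> ('a, 'n) vfield"
  assumes alg: "abelian_complex_lie_algebra smul bracket" and act: "holomorphic_action M A smul bracket \<rho>"
    and dense: "dense_open_orbit M A \<rho>" and N: "holomorphic_connection M A N" and pres: "preserves_connection M A \<rho> N"
    and p: "p \<in> topspace M"
  obtains X \<mu> \<Gamma> where "\<And>j. X j \<in> HV (topspace M)" "\<And>a j. lie_bracket A (topspace M) (\<rho> a) (X j) = 0"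
    "\<And>c. c \<in> A \<Longrightarrow> chart_frame (frame X c) (\<Gamma> c) (img c (comp p)) \<mu>" "\<And>a b v. \<mu> a (\<mu> b v) = \<mu> b (\<mu> a v)"
proof -
  interpret abelian_complex_lie_algebra smul bracket by (rule alg)
  have \<rho>: "\<rho> a \<in> HV (topspace M)" "\<rho> (a + b) = \<rho> a + \<rho> b" "\<rho> (smul z a) = fun_scale (\<lambda>_. z) (\<rho> a)"
    "\<rho> (bracket a b) = lie_bracket A (topspace M) (\<rho> a) (\<rho> b)" for a b z
    using act by (simp_all add: holomorphic_action_def)
  have \<rho>0: "\<rho> 0 = 0" using \<rho>(2)[of 0 0] by simp
  have bracket0: "lie_bracket A (topspace M) (\<rho> a) (\<rho> b) = 0" for a b
    using \<rho>(4)[of a b] \<rho>0 by (simp add: abelian)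
  let ?O = "{m \<in> topspace M. module.span tangent_scale (range (\<lambda>a. \<rho> a m)) = tangent_space A m}"
  have "p \<in> M closure_of ?O" using dense p by (simp add: dense_open_orbit_def)
  \<comment> \<open>The component is an open neighbourhood of \<open>p\<close>, so it contains a
    point of the dense orbit set, possibly different from \<open>p\<close>.\<close>
  then obtain q where q: "q \<in> ?O" "q \<in> comp p" using comp_open comp_refl[OF p] unfolding in_closure_of by blast
  then obtain c where c: "c \<in> A" "q \<in> chart_dom c" using chart_cover by blast
  interpret T: module "tangent_scale :: complex \<Rightarrow> ('a, 'n) tangent \<Rightarrow> ('a, 'n) tangent"
    by unfold_locales (simp_all add: tangent_scale_def fun_eq_iff vec.scale_right_distrib vec.scale_left_distrib)
  have "T.span (range (\<lambda>a. \<rho> a q)) \<subseteq> range (\<lambda>a. \<rho> a q)"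
  proof (rule T.span_minimal[OF subset_refl], rule T.subspaceI)
    show "0 \<in> range (\<lambda>a. \<rho> a q)" by (rule range_eqI[of _ _ 0]) (simp add: \<rho>0)
    fix v w z assume "v \<in> range (\<lambda>a. \<rho> a q)"
    then obtain a where a: "v = \<rho> a q" by blast
    show "tangent_scale z v \<in> range (\<lambda>a. \<rho> a q)"
      by (rule range_eqI[of _ _ "smul z a"]) (simp add: a \<rho>(3) fun_scale_def)
    assume "w \<in> range (\<lambda>a. \<rho> a q)"
    then obtain b where b: "w = \<rho> b q" by blast
    show "v + w \<in> range (\<lambda>a. \<rho> a q)" by (rule range_eqI[of _ _ "a + b"]) (simp add: a b \<rho>(2))
  qed
  then have onto: "tangent_space A q \<subseteq> range (\<lambda>a. \<rho> a q)" using q(1) by simp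
  have "\<exists>a. \<rho> a q c = axis j 1" for j
  proof -
    define v :: "('a, 'n) tangent" where "v d = (if d \<in> A \<and> q \<in> chart_dom d then fd (transition c d) (coord c q) (axis j 1) else 0)" for d
    have "v \<in> tangent_space A q" by (rule tangentI[OF c v_def])
    then obtain a where "v = \<rho> a q" using onto by blast
    moreover have "v c = axis j 1" using c by (simp add: v_def transition_self)
    ultimately show ?thesis by metis
  qed
  then obtain e where e: "\<And>j. \<rho> (e j) q c = axis j 1" by metis
  define X where "X j = \<rho> (e j)" for j
  interpret commuting_fields M A X
    by unfold_locales (simp_all add: X_def \<rho>(1) bracket0)
  have "frame X c (coord c q) = mat 1"
    using c by (simp add: frame_def X_def e mat_def axis_def vec_eq_iff)
  then have nz: "det (frame X c (coord c q)) \<noteq> 0" by simp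
  have "preserves_connection M A X N" using pres unfolding preserves_connection_def X_def by blast
  then obtain \<mu> \<Gamma> where cq: "\<And>c. c \<in> A \<Longrightarrow> chart_frame (frame X c) (\<Gamma> c) (img c (comp q)) \<mu>" and assoc: "\<And>a b v. \<mu> a (\<mu> b v) = \<mu> b (\<mu> a v)"
    by (rule component_structure[OF N _ c nz]) (rule that)
  have cf: "chart_frame (frame X c) (\<Gamma> c) (img c (comp p)) \<mu>" if "c \<in> A" for c
    using cq[OF that] unfolding comp_eq[OF q(2)] .
  show thesis by (rule that[OF X _ cf assoc]) (unfold X_def, rule bracket0, assumption)
qed

end

text \<open>Both operators have the same constant product in their frames, and \<open>F\<close>
  carries one frame to the other. So related fields have equal coefficients at \<open>x\<close> and
  \<open>F x\<close>, which settles the points where the frame is a basis; the others follow by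
  density.\<close>

lemma related_derivative:
  assumes cf: "chart_frame S \<Gamma> Q \<mu>" and cf': "chart_frame S' \<Gamma>' Q' \<mu>"
    and W: "open W" "W \<subseteq> Q" and W': "open W'" "W' \<subseteq> Q'"
    and F: "vector_holomorphic_on F W" "\<And>x. x \<in> W \<Longrightarrow> F x \<in> W'" "\<And>x v. x \<in> W \<Longrightarrow> fd F x v = 0 \<Longrightarrow> v = 0"
    and SF: "\<And>x v. x \<in> W \<Longrightarrow> S' (F x) *v v = fd F x (S x *v v)"
    and Y: "vector_holomorphic_on Y W" "vector_holomorphic_on Y' W'" "\<And>x. x \<in> W \<Longrightarrow> Y' (F x) = fd F x (Y x)"
    and Z: "vector_holomorphic_on Z W" "vector_holomorphic_on Z' W'" "\<And>x. x \<in> W \<Longrightarrow> Z' (F x) = fd F x (Z x)"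
    and x: "x \<in> W"
  shows "fd Z' (F x) (Y' (F x)) + \<Gamma>' (F x) (Y' (F x)) (Z' (F x)) = fd F x (fd Z x (Y x) + \<Gamma> x (Y x) (Z x))"
proof -
  interpret a: chart_frame S \<Gamma> Q \<mu> by (rule cf)
  interpret b: chart_frame S' \<Gamma>' Q' \<mu> by (rule cf')
  have hD: "vector_holomorphic_on (\<lambda>x. fd Z x (Y x) + G x (Y x) (Z x)) V"
    if "open V" "vector_holomorphic_on Y V" "vector_holomorphic_on Z V" "bil_hol G V" for Y Z V and G :: "complex^'m \<Rightarrow> complex^'m \<Rightarrow> complex^'m \<Rightarrow> complex^'m"
  proof (rule vector_hol_add)
    have "lin_hol (fd Z) V" by (simp add: lin_hol_def vector_hol_fd_clin[OF that(3)] vector_hol_fd(1)[OF that(3,1)])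
    then show "vector_holomorphic_on (\<lambda>x. fd Z x (Y x)) V" by (rule lin_hol_apply[OF that(1) _ that(2)])
    show "vector_holomorphic_on (\<lambda>x. G x (Y x) (Z x)) V" by (rule bil_hol_apply[OF that(1,4,2,3)])
  qed
  have hl: "vector_holomorphic_on (\<lambda>x. fd Z' (F x) (Y' (F x)) + \<Gamma>' (F x) (Y' (F x)) (Z' (F x))) W"
    by (rule vector_hol_compose[OF hD[OF W'(1) Y(2) Z(2) bil_hol_subset[OF b.\<Gamma> W'(2)]] F(1,2)])
  have hF: "lin_hol (fd F) W"
    by (simp add: lin_hol_def vector_hol_fd_clin[OF F(1)] vector_hol_fd(1)[OF F(1) W(1)])
  have hr: "vector_holomorphic_on (\<lambda>x. fd F x (fd Z x (Y x) + \<Gamma> x (Y x) (Z x))) W"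
    by (rule lin_hol_apply[OF W(1) hF hD[OF W(1) Y(1) Z(1) bil_hol_subset[OF a.\<Gamma> W(2)]]])
  show ?thesis
  proof (rule a.dense_eq[OF W vector_hol_continuous_on[OF hl] vector_hol_continuous_on[OF hr] _ x])
    fix x assume x: "x \<in> W" and nz: "det (S x) \<noteq> 0"
    define V where "V = {x \<in> W. det (S x) \<noteq> 0}"
    define V' where "V' = {x \<in> W'. det (S' x) \<noteq> 0}"
    have V: "open V" "V \<subseteq> Q" "V \<subseteq> W" and xV: "x \<in> V" and nzV: "\<And>x. x \<in> V \<Longrightarrow> det (S x) \<noteq> 0"
      unfolding V_def using open_det_nonzero[OF W(1) lin_hol_subset[OF a.S W(2)]] W x nz by auto
    have V': "open V'" "V' \<subseteq> Q'" "V' \<subseteq> W'" and nzV': "\<And>x. x \<in> V' \<Longrightarrow> det (S' x) \<noteq> 0"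
      unfolding V'_def using open_det_nonzero[OF W'(1) lin_hol_subset[OF b.S W'(2)]] W' by auto
    \<comment> \<open>As the derivative of \<open>F\<close> is injective, nondegenerate points go to
      nondegenerate points.\<close>
    have FV: "F y \<in> V'" if y: "y \<in> V" for y
    proof -
      have yW: "y \<in> W" using y V by blast
      have "det (S' (F y)) \<noteq> 0" unfolding det_nonzero_iff
      proof (intro allI impI)
        fix v assume "S' (F y) *v v = 0"
        then have "S y *v v = 0" using F(3)[OF yW] SF[OF yW] by simp
        then show "v = 0" using nzV[OF y] unfolding det_nonzero_iff by blast
      qed
      then show ?thesis unfolding V'_def using F(2)[OF yW] by blast
    qed
    have coef: "matrix_inv (S' (F y)) *v fd F y u = matrix_inv (S y) *v u" if y: "y \<in> V" for y u
    proof -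
      have "fd F y u = S' (F y) *v (matrix_inv (S y) *v u)"
        using SF[of y] y V matrix_inv_cancel(1)[OF nzV[OF y]] by auto
      then show ?thesis by (simp add: matrix_inv_cancel(2)[OF nzV'[OF FV[OF y]]])
    qed
    define \<eta> where "\<eta> y = matrix_inv (S y) *v Z y" for y
    define \<eta>' where "\<eta>' y = matrix_inv (S' y) *v Z' y" for y
    have h\<eta>': "vector_holomorphic_on \<eta>' V'" unfolding \<eta>'_def
      by (rule lin_hol_apply[OF V'(1) lin_hol_matrix_inv[OF lin_hol_subset[OF b.S V'(2)] V'(1) nzV'] vector_hol_subset[OF Z(2) V'(3)]])
    have "\<eta> y = \<eta>' (F y)" if "y \<in> V" for y
      using coef[OF that, of "Z y"] Z(3)[of y] that V(3) by (auto simp: \<eta>_def \<eta>'_def)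
    then have "fd \<eta> x = fd (\<lambda>y. \<eta>' (F y)) x" by (rule fd_cong_open[OF V(1) xV])
    also have "\<dots> = (\<lambda>h. fd \<eta>' (F x) (fd F x h))"
      by (rule frechet_derivative_at'[OF has_derivative_compose[OF vector_holD(1)[OF F(1) x] vector_holD(1)[OF h\<eta>' FV[OF xV]]]])
    finally have chain: "fd \<eta> x h = fd \<eta>' (F x) (fd F x h)" for h by (rule fun_cong)
    have "fd Z' (F x) (Y' (F x)) + \<Gamma>' (F x) (Y' (F x)) (Z' (F x)) =
      S' (F x) *v (fd \<eta>' (F x) (Y' (F x)) + \<mu> (matrix_inv (S' (F x)) *v Y' (F x)) (matrix_inv (S' (F x)) *v Z' (F x)))"
      unfolding \<eta>'_def by (rule b.covariant_derivative_frame[OF V'(1,2) FV[OF xV] nzV' vector_hol_subset[OF Z(2) V'(3)]])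
    also have "\<dots> = S' (F x) *v (fd \<eta> x (Y x) + \<mu> (matrix_inv (S x) *v Y x) (matrix_inv (S x) *v Z x))"
      by (simp add: chain Y(3)[OF x] Z(3)[OF x] coef[OF xV])
    also have "\<dots> = fd F x (S x *v (fd \<eta> x (Y x) + \<mu> (matrix_inv (S x) *v Y x) (matrix_inv (S x) *v Z x)))"
      by (rule SF[OF x])
    also have "S x *v (fd \<eta> x (Y x) + \<mu> (matrix_inv (S x) *v Y x) (matrix_inv (S x) *v Z x)) = fd Z x (Y x) + \<Gamma> x (Y x) (Z x)"
      unfolding \<eta>_def by (rule a.covariant_derivative_frame[OF V(1,2) xV nzV vector_hol_subset[OF Z(1) V(3)], symmetric])
    finally show "fd Z' (F x) (Y' (F x)) + \<Gamma>' (F x) (Y' (F x)) (Z' (F x)) = fd F x (fd Z x (Y x) + \<Gamma> x (Y x) (Z x))" .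
  qed
qed

text \<open>The second variable of \<open>f\<close> parametrizes a curve of initial points, so \<open>fd f y (axis 2 1)\<close> is the
  push-forward of its velocity along the flow; both it and \<open>Z\<close> solve the linearized flow equation.\<close>

lemma flow_pushforward:
  fixes f :: "complex^2 \<Rightarrow> complex^'n" and B Z :: "complex^'n \<Rightarrow> complex^'n"
  assumes D: "open D" and f: "vector_holomorphic_on f D" and Q: "open Q" "\<And>y. y \<in> D \<Longrightarrow> f y \<in> Q"
    and B: "vector_holomorphic_on B Q" and Z: "vector_holomorphic_on Z Q"
    and flow: "\<And>y. y \<in> D \<Longrightarrow> fd f y (axis 1 1) = B (f y)"
    and comm: "\<And>x. x \<in> Q \<Longrightarrow> fd Z x (B x) = fd B x (Z x)"
    and seg: "\<And>r. r \<in> {0..1} \<Longrightarrow> y + (of_real r * t) *s axis 1 1 \<in> D"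
    and init: "fd f y (axis 2 1) = Z (f y)"
  shows "fd f (y + t *s axis 1 1) (axis 2 1) = Z (f (y + t *s axis 1 1))"
proof -
  define g where "g r = y + (of_real r * t) *s axis 1 1" for r :: real
  define h where "h x = fd f x (axis 2 1) - Z (f x)" for x
  have gD: "g r \<in> D" if "r \<in> {0..1}" for r using seg[OF that] by (simp add: g_def)
  have dg: "(g has_derivative (\<lambda>s. (of_real s * t) *s axis 1 1)) (at r within {0..1})" for r
  proof -
    have "((\<lambda>r. (of_real r * t) *s (axis 1 1 :: complex^2)) has_derivative (\<lambda>s. (of_real s * t) *s axis 1 1)) (at r within {0..1})"
      by (rule bounded_linear.has_derivative[OF bounded_linear_smult_left]) (auto intro!: derivative_eq_intros)
    then show ?thesis unfolding g_def using has_derivative_add[OF has_derivative_const[of y]] by fastforce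
  qed
  have hf2: "vector_holomorphic_on (\<lambda>x. fd f x (axis 2 1)) D" by (rule vector_hol_fd(1)[OF f D])
  have hZ: "vector_holomorphic_on (\<lambda>x. Z (f x)) D" by (rule vector_hol_compose[OF Z f Q(2)])
  have hh: "vector_holomorphic_on h D" unfolding h_def by (rule vector_hol_diff[OF hf2 hZ])
  \<comment> \<open>The defect \<open>h\<close> solves a linear equation along flow lines: mixed
    derivatives of \<open>f\<close> agree, and \<open>comm\<close> rewrites the term with
    \<open>Z\<close>. It starts at 0.\<close>
  have dh: "fd h x (axis 1 1) = fd B (f x) (h x)" if x: "x \<in> D" for x
  proof -
    have cf: "fd (\<lambda>x. P (f x)) x k = fd P (f x) (fd f x k)" if "vector_holomorphic_on P Q" for P :: "complex^'n \<Rightarrow> complex^'n" and k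
      by (rule fun_cong[OF frechet_derivative_at'[OF has_derivative_compose[OF vector_holD(1)[OF f x] vector_holD(1)[OF that Q(2)[OF x]]]]])
    have "fd (\<lambda>x. fd f x (axis 2 1)) x (axis 1 1) = fd (\<lambda>x. fd f x (axis 1 1)) x (axis 2 1)"
      by (rule vector_hol_fd(2)[OF f D x])
    also have "\<dots> = fd (\<lambda>x. B (f x)) x (axis 2 1)" using fd_cong_open[OF D x flow] by simp
    also have "\<dots> = fd B (f x) (fd f x (axis 2 1))" by (rule cf[OF B])
    finally have 1: "fd (\<lambda>x. fd f x (axis 2 1)) x (axis 1 1) = fd B (f x) (fd f x (axis 2 1))" .
    have 2: "fd (\<lambda>x. Z (f x)) x (axis 1 1) = fd B (f x) (Z (f x))"
      using cf[OF Z, of "axis 1 1"] flow[OF x] comm[OF Q(2)[OF x]] by simp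
    have "fd h x = (\<lambda>k. fd (\<lambda>x. fd f x (axis 2 1)) x k - fd (\<lambda>x. Z (f x)) x k)"
      unfolding h_def by (intro frechet_derivative_at' has_derivative_diff vector_holD(1)[OF hf2 x] vector_holD(1)[OF hZ x])
    then show ?thesis by (simp add: 1 2 h_def clin_diff[OF vector_hol_fd_clin[OF B Q(2)[OF x]]])
  qed
  define w where "w r = h (g r)" for r
  define w' where "w' r = t *s fd B (f (g r)) (w r)" for r
  have dw: "(w has_vector_derivative w' r) (at r within {0..1})" if r: "r \<in> {0..1}" for r
  proof -
    note H = vector_holD[OF hh gD[OF r]]
    have "(w has_derivative (\<lambda>s. fd h (g r) ((of_real s * t) *s axis 1 1))) (at r within {0..1})"
      unfolding w_def by (rule has_derivative_compose[OF dg H(1)])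
    moreover have "fd h (g r) ((of_real s * t) *s axis 1 1) = s *\<^sub>R w' r" for s
      by (simp add: H(2) dh[OF gD[OF r]] w'_def w_def scaleR_eq_smult)
    ultimately show ?thesis by (simp add: has_vector_derivative_def)
  qed
  have cg: "continuous_on {0..1} g" by (rule has_derivative_continuous_on[OF dg])
  obtain K where K: "\<And>r v. r \<in> {0..1} \<Longrightarrow> norm (fd B (f (g r)) v) \<le> K * norm v"
  proof (rule lin_hol_bounded[of "fd B" Q "(\<lambda>r. f (g r)) ` {0..1}"])
    show "lin_hol (fd B) Q" by (simp add: lin_hol_def vector_hol_fd_clin[OF B] vector_hol_fd(1)[OF B Q(1)])
    show "compact ((\<lambda>r. f (g r)) ` {0..1})"
      by (intro compact_continuous_image continuous_on_compose2[OF vector_hol_continuous_on[OF f] cg]) (use gD in auto)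
    show "(\<lambda>r. f (g r)) ` {0..1} \<subseteq> Q" using gD Q(2) by blast
  qed (use that in blast)
  have "w 1 = 0"
  proof (rule ode_zero_unique[OF dw])
    show "norm (w' r) \<le> norm t * K * norm (w r)" if "r \<in> {0..1}" for r
      using mult_left_mono[OF K[OF that, of "w r"], of "norm t"] by (simp add: w'_def norm_smult mult.assoc)
    show "w 0 = 0" using init by (simp add: w_def g_def h_def)
  qed simp_all
  then show ?thesis by (simp add: w_def g_def h_def)
qed

section \<open>The flat connection\<close>

text \<open>The data are indexed by the component as a set, so they are the same for all of its
  points.\<close>

locale component_frames = cmanifold M A
  for M :: "'a topology" and A :: "('a, 'n::finite) chart set" +
  fixes X :: "'a set \<Rightarrow> 'n \<Rightarrow> ('a, 'n) vfield"
    and \<mu> :: "'a set \<Rightarrow> complex^'n \<Rightarrow> complex^'n \<Rightarrow> complex^'n"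
    and \<Gamma> :: "'a set \<Rightarrow> ('a, 'n) chart \<Rightarrow> complex^'n \<Rightarrow> complex^'n \<Rightarrow> complex^'n \<Rightarrow> complex^'n"
  assumes X: "\<And>p j. p \<in> topspace M \<Longrightarrow> X (comp p) j \<in> HV (topspace M)"
    and cf: "\<And>p c. p \<in> topspace M \<Longrightarrow> c \<in> A \<Longrightarrow> chart_frame (frame (X (comp p)) c) (\<Gamma> (comp p) c) (img c (comp p)) (\<mu> (comp p))"
    and assoc: "\<And>p a b v. p \<in> topspace M \<Longrightarrow> \<mu> (comp p) a (\<mu> (comp p) b v) = \<mu> (comp p) b (\<mu> (comp p) a v)"
begin

text \<open>The Christoffel symbols are those of the component of the point, so one formula covers
  all components. Entries at other charts are 0, as for tangent vectors.\<close>

definition conn :: "('a, 'n) connection" where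
  "conn U Y Z = (\<lambda>p c. if c \<in> A \<and> p \<in> U \<inter> chart_dom c then
     fd (local_rep c Z) (coord c p) (Y p c) + \<Gamma> (comp p) c (coord c p) (Y p c) (Z p c) else 0)"

lemma conn_at: "c \<in> A \<Longrightarrow> p \<in> U \<Longrightarrow> p \<in> chart_dom c \<Longrightarrow>
   conn U Y Z p c = fd (local_rep c Z) (coord c p) (Y p c) + \<Gamma> (comp p) c (coord c p) (Y p c) (Z p c)"
  by (simp add: conn_def)

lemma conn_outside: "\<not> (c \<in> A \<and> p \<in> U \<and> p \<in> chart_dom c) \<Longrightarrow> conn U Y Z p c = 0"
  by (auto simp: conn_def)

lemma \<Gamma>_bil: "p \<in> topspace M \<Longrightarrow> c \<in> A \<Longrightarrow> bil_hol (\<Gamma> (comp p) c) (img c (comp p))"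
  using chart_frame.\<Gamma>[OF cf] .

lemma \<Gamma>_cbil: "c \<in> A \<Longrightarrow> p \<in> chart_dom c \<Longrightarrow> cbil (\<Gamma> (comp p) c (coord c p))"
  by (rule bil_holD(1)[OF \<Gamma>_bil]) (use dom_subset comp_refl in blast)+

lemma \<Gamma>_sym: "c \<in> A \<Longrightarrow> p \<in> chart_dom c \<Longrightarrow> \<Gamma> (comp p) c (coord c p) v w = \<Gamma> (comp p) c (coord c p) w v"
  by (rule chart_frame.\<Gamma>sym[OF cf]) (use dom_subset comp_refl in blast)+

lemma local_rep_conn:
  assumes "c \<in> A" "x \<in> img c (U \<inter> comp p)"
  shows "local_rep c (conn U Y Z) x = fd (local_rep c Z) x (local_rep c Y x) + \<Gamma> (comp p) c x (local_rep c Y x) (local_rep c Z x)"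
proof -
  obtain q where q: "q \<in> U" "q \<in> comp p" "q \<in> chart_dom c" "x = coord c q" using assms(2) by blast
  show ?thesis using conn_at[OF assms(1) q(1,3), of Y Z] assms(1) q(3) by (simp only: q(4) local_rep_coord comp_eq[OF q(2)])
qed

lemma HV_hol_sub:
  assumes "Y \<in> HV U" "c \<in> A" shows "vector_holomorphic_on (local_rep c Y) (img c (U \<inter> V))"
  by (rule vector_hol_subset[OF HV_hol[OF assms]]) blast

text \<open>One naturality statement with two uses: for the identity map it gives independence of
  the chart, for the flow maps it gives invariance. Points have to stay in their component because
  each component has its own frame.\<close>

lemma conn_related:
  assumes F: "openin M V" "V \<subseteq> topspace M" "openin M V'" "p \<in> V" and c: "c \<in> A" "p \<in> chart_dom c" and d: "d \<in> A" "f p \<in> chart_dom d"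
    and f: "\<And>q. q \<in> V \<Longrightarrow> f q \<in> V'" "\<And>q. q \<in> V \<Longrightarrow> f q \<in> comp q" "continuous_map (subtopology M V) M f"
    and hol: "vector_holomorphic_on (coord d \<circ> f \<circ> chart_inv c) (coord c ` {q \<in> V \<inter> chart_dom c. f q \<in> chart_dom d})"
    and inj: "\<And>q v. q \<in> V \<Longrightarrow> q \<in> chart_dom c \<Longrightarrow> f q \<in> chart_dom d \<Longrightarrow> fd (coord d \<circ> f \<circ> chart_inv c) (coord c q) v = 0 \<Longrightarrow> v = 0"
    and XF: "\<And>q j. q \<in> V \<Longrightarrow> q \<in> chart_dom c \<Longrightarrow> f q \<in> chart_dom d \<Longrightarrow>
      X (comp q) j (f q) d = fd (coord d \<circ> f \<circ> chart_inv c) (coord c q) (X (comp q) j q c)"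
    and Y: "Y \<in> HV V" "Y' \<in> HV V'" "\<And>q. q \<in> V \<Longrightarrow> q \<in> chart_dom c \<Longrightarrow> f q \<in> chart_dom d \<Longrightarrow> Y' (f q) d = fd (coord d \<circ> f \<circ> chart_inv c) (coord c q) (Y q c)"
    and Z: "Z \<in> HV V" "Z' \<in> HV V'" "\<And>q. q \<in> V \<Longrightarrow> q \<in> chart_dom c \<Longrightarrow> f q \<in> chart_dom d \<Longrightarrow> Z' (f q) d = fd (coord d \<circ> f \<circ> chart_inv c) (coord c q) (Z q c)"
  shows "conn V' Y' Z' (f p) d = fd (coord d \<circ> f \<circ> chart_inv c) (coord c p) (conn V Y Z p c)"
proof -
  define F where "F = coord d \<circ> f \<circ> chart_inv c"
  define C where "C = comp p"
  have pt: "p \<in> topspace M" using F by blast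
  have pC: "p \<in> C" unfolding C_def by (rule comp_refl[OF pt])
  have compC: "comp q = C" if "q \<in> C" for q using comp_eq that unfolding C_def by blast
  have oC: "openin M C" unfolding C_def by (rule comp_open)
  \<comment> \<open>On this open set one frame and one chart at each end suffice.\<close>
  define V1 where "V1 = {q \<in> V. f q \<in> chart_dom d} \<inter> C"
  have oV1: "openin M V1"
  proof -
    have "openin (subtopology M V) {q \<in> topspace (subtopology M V). f q \<in> chart_dom d}"
      by (rule openin_continuous_map_preimage[OF f(3) dom_open[OF d(1)]])
    moreover have "{q \<in> topspace (subtopology M V). f q \<in> chart_dom d} = {q \<in> V. f q \<in> chart_dom d}"
      using F(2) by auto
    ultimately show ?thesis unfolding V1_def using F(1) oC openin_open_subtopology by (metis openin_Int)
  qed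
  define W where "W = img c V1"
  define W' where "W' = img d (V' \<inter> C)"
  have Wx: "\<exists>q. q \<in> V \<and> f q \<in> chart_dom d \<and> q \<in> C \<and> q \<in> chart_dom c \<and> x = coord c q" if "x \<in> W" for x
    using that unfolding W_def V1_def by blast
  have Fq: "F (coord c q) = coord d (f q)" if "q \<in> chart_dom c" for q using c that by (simp add: F_def)
  have "fd (local_rep d Z') (F (coord c p)) (local_rep d Y' (F (coord c p))) + \<Gamma> C d (F (coord c p)) (local_rep d Y' (F (coord c p))) (local_rep d Z' (F (coord c p))) =
      fd F (coord c p) (fd (local_rep c Z) (coord c p) (local_rep c Y (coord c p)) + \<Gamma> C c (coord c p) (local_rep c Y (coord c p)) (local_rep c Z (coord c p)))"
  proof (rule related_derivative[where W=W and W'=W'])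
    show "chart_frame (frame (X C) c) (\<Gamma> C c) (img c C) (\<mu> C)" "chart_frame (frame (X C) d) (\<Gamma> C d) (img d C) (\<mu> C)"
      unfolding C_def by (rule cf[OF pt c(1)], rule cf[OF pt d(1)])
    show "open W" unfolding W_def by (rule img_open[OF c(1) oV1])
    show "W \<subseteq> img c C" unfolding W_def V1_def by blast
    show "open W'" unfolding W'_def by (rule img_open[OF d(1) openin_Int[OF F(3) oC]])
    show "W' \<subseteq> img d C" unfolding W'_def by blast
    show "vector_holomorphic_on F W" unfolding F_def by (rule vector_hol_subset[OF hol]) (auto simp: W_def V1_def)
    show "vector_holomorphic_on (local_rep c Y) W" "vector_holomorphic_on (local_rep c Z) W"
      by (rule vector_hol_subset[OF HV_hol[OF Y(1) c(1)]], force simp: W_def V1_def, rule vector_hol_subset[OF HV_hol[OF Z(1) c(1)]], force simp: W_def V1_def)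
    show "vector_holomorphic_on (local_rep d Y') W'" "vector_holomorphic_on (local_rep d Z') W'"
      unfolding W'_def by (rule HV_hol_sub[OF Y(2) d(1)], rule HV_hol_sub[OF Z(2) d(1)])
    show "coord c p \<in> W" unfolding W_def V1_def using F pC d c by blast
    fix x assume "x \<in> W"
    from Wx[OF this] obtain q where q: "q \<in> V" "f q \<in> chart_dom d" "q \<in> C" "q \<in> chart_dom c" "x = coord c q" by blast
    have fqC: "f q \<in> C" using f(2)[OF q(1)] compC[OF q(3)] by simp
    show "F x \<in> W'" unfolding W'_def q(5) Fq[OF q(4)] using f(1)[OF q(1)] fqC q(2) by blast
    show "v = 0" if "fd F x v = 0" for v using inj[OF q(1,4,2)] that unfolding F_def q(5) by blast
    show "local_rep d Y' (F x) = fd F x (local_rep c Y x)" "local_rep d Z' (F x) = fd F x (local_rep c Z x)"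
      using Y(3)[OF q(1,4,2)] Z(3)[OF q(1,4,2)] c(1) d(1) q(2,4) by (simp_all add: q(5) Fq F_def[symmetric])
    have lF: "clin (fd F x)" unfolding F_def by (rule vector_hol_fd_clin[OF hol]) (use q in blast)
    show "frame (X C) d (F x) *v v = fd F x (frame (X C) c x *v v)" for v
      using XF[OF q(1,4,2)] c(1) d(1) q(2,4) unfolding compC[OF q(3)] F_def[symmetric]
      by (simp add: frame_apply clin_sum[OF lF] clin_scale[OF lF]) (simp add: q(5) Fq)
  qed
  moreover have "comp (f p) = C" using f(2)[OF F(4)] compC unfolding C_def by blast
  ultimately show ?thesis
    using conn_at[OF c(1) F(4) c(2), of Y Z] conn_at[OF d(1) f(1)[OF F(4)] d(2), of Y' Z'] c d Fq[OF c(2)]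
    by (simp add: F_def[symmetric] C_def[symmetric])
qed

lemma conn_HV:
  assumes U: "openin M U" and Y: "Y \<in> HV U" and Z: "Z \<in> HV U"
  shows "conn U Y Z \<in> HV U"
proof (rule HV_I)
  have Ut: "U \<subseteq> topspace M" by (rule openin_subset[OF U])
  show "conn U Y Z p = 0" if "p \<notin> U" for p using that by (simp add: conn_def fun_eq_iff)
  fix p assume p: "p \<in> U"
  show "conn U Y Z p \<in> tangent_space A p"
  proof (rule tangent_spaceI)
    show "conn U Y Z p c = 0" if "\<not> (c \<in> A \<and> p \<in> chart_dom c)" for c using that by (intro conn_outside) blast
    fix c d assume A: "c \<in> A" "d \<in> A" and pc: "p \<in> chart_dom c" "p \<in> chart_dom d"
    have idt: "coord d \<circ> (\<lambda>q. q) \<circ> chart_inv c = transition c d" by (simp add: transition_def comp_def)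
    \<comment> \<open>The identity map in the charts \<open>c\<close> and \<open>d\<close> is the
      transition map.\<close>
    have "conn U Y Z ((\<lambda>q. q) p) d = fd (coord d \<circ> (\<lambda>q. q) \<circ> chart_inv c) (coord c p) (conn U Y Z p c)"
    proof (rule conn_related[where f="\<lambda>q. q", OF U Ut U p A(1) pc(1) A(2) pc(2)])
      show "continuous_map (subtopology M U) M (\<lambda>q. q)" by (rule continuous_map_from_subtopology) simp
      show "q \<in> comp q" if "q \<in> U" for q using comp_refl Ut that by blast
      show "vector_holomorphic_on (coord d \<circ> (\<lambda>q. q) \<circ> chart_inv c) (coord c ` {q \<in> U \<inter> chart_dom c. q \<in> chart_dom d})"
        unfolding idt by (rule vector_hol_subset[OF transition_hol[OF A]]) blast
      fix q assume q: "q \<in> U" "q \<in> chart_dom c" "q \<in> chart_dom d"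
      have qt: "q \<in> topspace M" using q Ut by blast
      show "X (comp q) j q d = fd (coord d \<circ> (\<lambda>q. q) \<circ> chart_inv c) (coord c q) (X (comp q) j q c)" for j
        unfolding idt by (rule tangentD[OF HV_tangent[OF X[OF qt] qt] A q(2,3)])
      show "Y q d = fd (coord d \<circ> (\<lambda>q. q) \<circ> chart_inv c) (coord c q) (Y q c)" "Z q d = fd (coord d \<circ> (\<lambda>q. q) \<circ> chart_inv c) (coord c q) (Z q c)"
        unfolding idt by (rule tangentD[OF HV_tangent[OF Y q(1)] A q(2,3)], rule tangentD[OF HV_tangent[OF Z q(1)] A q(2,3)])
      show "v = 0" if v: "fd (coord d \<circ> (\<lambda>q. q) \<circ> chart_inv c) (coord c q) v = 0" for v
      proof -
        have "v = fd (transition d c) (coord d q) 0"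
          using transition_chain[OF A A(1) q(2,3,2), of v] v unfolding idt transition_self[OF A(1) q(2)] by simp
        then show ?thesis using clin_zero[OF transition_clin[OF A(2,1) q(3,2)]] by simp
      qed
    qed (use Y Z in auto)
    then show "conn U Y Z p d = fd (transition c d) (coord c p) (conn U Y Z p c)" unfolding idt .
  qed
next
  fix c assume c: "c \<in> A"
  show "vector_holomorphic_on (local_rep c (conn U Y Z)) (img c U)"
  proof (rule vector_hol_local)
    fix x assume "x \<in> img c U"
    then obtain p where p: "p \<in> U" "p \<in> chart_dom c" "x = coord c p" by blast
    have pt: "p \<in> topspace M" using p openin_subset[OF U] by blast
    let ?W = "img c (U \<inter> comp p)"
    have o: "open ?W" by (rule img_open[OF c openin_Int[OF U comp_open]])
    have gW: "?W \<subseteq> img c (comp p)" by blast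
    have hY: "vector_holomorphic_on (local_rep c Y) ?W" and hZ: "vector_holomorphic_on (local_rep c Z) ?W"
      by (rule HV_hol_sub[OF Y c], rule HV_hol_sub[OF Z c])
    have "lin_hol (fd (local_rep c Z)) ?W" by (simp add: lin_hol_def vector_hol_fd_clin[OF hZ] vector_hol_fd(1)[OF hZ o])
    from lin_hol_apply[OF o this hY]
    have "vector_holomorphic_on (\<lambda>x. fd (local_rep c Z) x (local_rep c Y x) + \<Gamma> (comp p) c x (local_rep c Y x) (local_rep c Z x)) ?W"
      by (rule vector_hol_add[OF _ bil_hol_apply[OF o bil_hol_subset[OF \<Gamma>_bil[OF pt c] gW] hY hZ]])
    from vector_hol_cong[OF o local_rep_conn[OF c, symmetric] this]
    have "vector_holomorphic_on (local_rep c (conn U Y Z)) ?W" .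
    moreover have "x \<in> ?W" using p comp_refl[OF pt] by blast
    ultimately show "\<exists>T. x \<in> T \<and> vector_holomorphic_on (local_rep c (conn U Y Z)) T" by (intro exI conjI)
  qed
qed

lemma HV_has_derivative:
  assumes "Y \<in> HV U" "c \<in> A" "p \<in> U" "p \<in> chart_dom c"
  shows "(local_rep c Y has_derivative fd (local_rep c Y) (coord c p)) (at (coord c p))" "clin (fd (local_rep c Y) (coord c p))"
  by (rule vector_holD(1)[OF HV_hol[OF assms(1,2)]], use assms in blast, rule vector_hol_fd_clin[OF HV_hol[OF assms(1,2)]], use assms in blast)

lemma conn_eqI:
  assumes "\<And>c p. c \<in> A \<Longrightarrow> p \<in> U \<Longrightarrow> p \<in> chart_dom c \<Longrightarrow> P p c = R p c"
    and "\<And>c p. \<not> (c \<in> A \<and> p \<in> U \<and> p \<in> chart_dom c) \<Longrightarrow> P p c = R p c"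
  shows "P = R"
  by (rule ext, rule ext) (use assms in blast)

lemma conn_hol: "holomorphic_connection M A conn"
  unfolding holomorphic_connection_def
proof (intro conjI allI impI ballI)
  fix U assume U: "openin M U"
  show "conn U Y Z \<in> HV U" if "Y \<in> HV U" "Z \<in> HV U" for Y Z by (rule conn_HV[OF U that])
  fix Y assume Y: "Y \<in> HV U"
  show "conn U (Y + Y') Z = conn U Y Z + conn U Y' Z" if "Y' \<in> HV U" "Z \<in> HV U" for Y' Z
  proof (rule conn_eqI[of U])
    fix c p assume c: "c \<in> A" "p \<in> U" "p \<in> chart_dom c"
    show "conn U (Y + Y') Z p c = (conn U Y Z + conn U Y' Z) p c"
      using conn_at[OF c] by (simp add: clin_add[OF HV_has_derivative(2)[OF that(2) c]] cbil_arith[OF \<Gamma>_cbil[OF c(1,3)]])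
  qed (simp add: conn_outside)
  fix Z assume Z: "Z \<in> HV U"
  show "conn U Y (Z + Z') = conn U Y Z + conn U Y Z'" if Z': "Z' \<in> HV U" for Z'
  proof (rule conn_eqI[of U])
    fix c p assume c: "c \<in> A" "p \<in> U" "p \<in> chart_dom c"
    have "local_rep c (Z + Z') = (\<lambda>x. local_rep c Z x + local_rep c Z' x)" by (simp add: local_rep_def fun_eq_iff)
    then have "fd (local_rep c (Z + Z')) (coord c p) = (\<lambda>h. fd (local_rep c Z) (coord c p) h + fd (local_rep c Z') (coord c p) h)"
      using frechet_derivative_at'[OF has_derivative_add[OF HV_has_derivative(1)[OF Z c] HV_has_derivative(1)[OF Z' c]]] by simp
    then show "conn U Y (Z + Z') p c = (conn U Y Z + conn U Y Z') p c"
      using conn_at[OF c] by (simp add: cbil_arith[OF \<Gamma>_cbil[OF c(1,3)]])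
  qed (simp add: conn_outside)
  fix f assume f: "holomorphic_function_on A U f"
  show "conn U (fun_scale f Y) Z = fun_scale f (conn U Y Z)"
  proof (rule conn_eqI[of U])
    fix c p assume c: "c \<in> A" "p \<in> U" "p \<in> chart_dom c"
    show "conn U (fun_scale f Y) Z p c = fun_scale f (conn U Y Z) p c"
      using conn_at[OF c] by (simp add: fun_scale_def tangent_scale_def clin_scale[OF HV_has_derivative(2)[OF Z c]]
        cbil_arith[OF \<Gamma>_cbil[OF c(1,3)]] vec.scale_right_distrib)
  qed (simp add: conn_outside fun_scale_def tangent_scale_def)
  fix c p assume A: "c \<in> A" and "p \<in> U \<inter> chart_dom c"
  then have c: "c \<in> A" "p \<in> U" "p \<in> chart_dom c" by blast+
  have df: "((f \<circ> chart_inv c) has_derivative fd (f \<circ> chart_inv c) (coord c p)) (at (coord c p))"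
    by (rule scalar_holD(1)) (use f c in \<open>auto simp: holomorphic_function_on_def\<close>)
  have "local_rep c (fun_scale f Z) = (\<lambda>x. (f \<circ> chart_inv c) x *s local_rep c Z x)"
    by (simp add: local_rep_def fun_eq_iff fun_scale_def tangent_scale_def)
  then have "fd (local_rep c (fun_scale f Z)) (coord c p) = (\<lambda>h. f p *s fd (local_rep c Z) (coord c p) h + fd (f \<circ> chart_inv c) (coord c p) h *s Z p c)"
    using frechet_derivative_at'[OF bounded_bilinear.FDERIV[OF bounded_bilinear_smult df HV_has_derivative(1)[OF Z c]]] c by simp
  then show "conn U Y (fun_scale f Z) p c = f p *s conn U Y Z p c + fd (f \<circ> chart_inv c) (coord c p) (Y p c) *s Z p c"
    using conn_at[OF c] by (simp add: fun_scale_def tangent_scale_def cbil_arith[OF \<Gamma>_cbil[OF c(1,3)]] vec.scale_right_distrib)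
next
  fix U V Y Z assume U: "openin M U" and V: "openin M V \<and> V \<subseteq> U" and Y: "Y \<in> HV U" and Z: "Z \<in> HV U"
  show "conn V (restrict_vfield V Y) (restrict_vfield V Z) = restrict_vfield V (conn U Y Z)"
  proof (rule conn_eqI[of V])
    fix c p assume c: "c \<in> A" "p \<in> V" "p \<in> chart_dom c"
    have pU: "p \<in> U" using V c by blast
    have "fd (local_rep c (restrict_vfield V Z)) (coord c p) = fd (local_rep c Z) (coord c p)"
      by (rule HV_fd_cong[OF c(1) conjunct1[OF V] c(2,3)]) (simp add: restrict_vfield_def)
    then show "conn V (restrict_vfield V Y) (restrict_vfield V Z) p c = restrict_vfield V (conn U Y Z) p c"
      using conn_at[OF c] conn_at[OF c(1) pU c(3)] c(2) by (simp add: restrict_vfield_def)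
  next
    fix c p assume "\<not> (c \<in> A \<and> p \<in> V \<and> p \<in> chart_dom c)"
    then show "conn V (restrict_vfield V Y) (restrict_vfield V Z) p c = restrict_vfield V (conn U Y Z) p c"
      by (auto simp: conn_def restrict_vfield_def)
  qed
qed

lemma lie_at: "c \<in> A \<Longrightarrow> p \<in> U \<Longrightarrow> p \<in> chart_dom c \<Longrightarrow>
   lie_bracket A U Y Z p c = fd (local_rep c Z) (coord c p) (Y p c) - fd (local_rep c Y) (coord c p) (Z p c)"
  by (simp add: lie_bracket_def)

lemma conn_torsion_free: "torsion_free M A conn"
  unfolding torsion_free_def
proof (intro allI impI ballI)
  fix U Y Z assume U: "openin M U" and Y: "Y \<in> HV U" and Z: "Z \<in> HV U"
  show "torsion A conn U Y Z = 0"
  proof (rule conn_eqI[of U])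
    fix c p assume c: "c \<in> A" "p \<in> U" "p \<in> chart_dom c"
    show "torsion A conn U Y Z p c = 0 p c"
      unfolding torsion_def using \<Gamma>_sym[OF c(1,3), of "Y p c" "Z p c"] by (simp add: conn_at[OF c] lie_at[OF c])
  next
    fix c p assume n: "\<not> (c \<in> A \<and> p \<in> U \<and> p \<in> chart_dom c)"
    then have "lie_bracket A U Y Z p c = 0" by (auto simp: lie_bracket_def)
    then show "torsion A conn U Y Z p c = 0 p c" using conn_outside[OF n] by (simp add: torsion_def)
  qed
qed

lemma conn_flat: "flat_connection M A conn"
  unfolding flat_connection_def
proof (intro allI impI ballI)
  fix U Y Z B assume U: "openin M U" and Y: "Y \<in> HV U" and Z: "Z \<in> HV U" and B: "B \<in> HV U"
  show "curvature A conn U Y Z B = 0"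
  proof (rule conn_eqI[of U])
    fix c p assume c: "c \<in> A" "p \<in> U" "p \<in> chart_dom c"
    have pt: "p \<in> topspace M" using openin_subset[OF U] c by blast
    let ?W = "img c (U \<inter> comp p)" and ?x = "coord c p"
    define D where "D P R x = fd R x (P x) + \<Gamma> (comp p) c x (P x) (R x)" for P R :: "complex^'n \<Rightarrow> complex^'n" and x
    have o: "open ?W" by (rule img_open[OF c(1) openin_Int[OF U comp_open]])
    have x: "?x \<in> ?W" using c comp_refl[OF pt] by blast
    \<comment> \<open>The coordinate form is needed on a neighbourhood, because the inner covariant
      derivative is differentiated once more.\<close>
    have rep: "local_rep c (conn U P R) x = D (local_rep c P) (local_rep c R) x" if "x \<in> ?W" for P R x
      unfolding D_def by (rule local_rep_conn[OF c(1) that])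
    have val: "conn U P R p c = D (local_rep c P) (local_rep c R) ?x" for P R
      using rep[OF x] c by simp
    have "conn U P (conn U R B) p c = D (local_rep c P) (D (local_rep c R) (local_rep c B)) ?x" for P R
      unfolding val[of P] D_def[of _ "local_rep c (conn U R B)"] D_def[of _ "D (local_rep c R) (local_rep c B)"]
      using fd_cong_open[OF o x rep] rep[OF x] by simp
    moreover have "conn U (lie_bracket A U Y Z) B p c =
       D (\<lambda>x. fd (local_rep c Z) x (local_rep c Y x) - fd (local_rep c Y) x (local_rep c Z x)) (local_rep c B) ?x"
      unfolding val[of "lie_bracket A U Y Z"] D_def using lie_at[OF c, of Y Z] c by simp
    moreover have "D (local_rep c Y) (D (local_rep c Z) (local_rep c B)) ?x - D (local_rep c Z) (D (local_rep c Y) (local_rep c B)) ?x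
        - D (\<lambda>x. fd (local_rep c Z) x (local_rep c Y x) - fd (local_rep c Y) x (local_rep c Z x)) (local_rep c B) ?x = 0"
      unfolding D_def
    proof (rule chart_frame.curvature_zero[OF cf[OF pt c(1)] assoc[OF pt] o _ x])
      show "?W \<subseteq> img c (comp p)" by blast
    qed (rule HV_hol_sub[OF Y c(1)] HV_hol_sub[OF Z c(1)] HV_hol_sub[OF B c(1)])+
    ultimately show "curvature A conn U Y Z B p c = 0 p c" by (simp add: curvature_def)
  qed (simp add: curvature_def conn_outside)
qed

end

section \<open>Local flows preserve the flat connection\<close>

context cmanifold
begin

lemma biholomorphism_image_open:
  assumes f: "biholomorphism_on M A W f" and V: "openin M V" "V \<subseteq> W"
  shows "openin M (f ` V)"
proof -
  have oW: "openin M (f ` W)" and inj: "inj_on f W" and "continuous_map (subtopology M (f ` W)) M (inv_into W f)"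
    using f by (simp_all add: biholomorphism_on_def holomorphic_map_on_def)
  from openin_continuous_map_preimage[OF this(3) V(1)]
  have "openin M {r \<in> topspace (subtopology M (f ` W)). inv_into W f r \<in> V}" using oW openin_open_subtopology by blast
  moreover have "{r \<in> topspace (subtopology M (f ` W)). inv_into W f r \<in> V} = f ` V"
  proof
    show "{r \<in> topspace (subtopology M (f ` W)). inv_into W f r \<in> V} \<subseteq> f ` V"
    proof
      fix r assume "r \<in> {r \<in> topspace (subtopology M (f ` W)). inv_into W f r \<in> V}"
      then have "r \<in> f ` W" "inv_into W f r \<in> V" by auto
      then show "r \<in> f ` V" using f_inv_into_f by (metis image_eqI)
    qed
    show "f ` V \<subseteq> {r \<in> topspace (subtopology M (f ` W)). inv_into W f r \<in> V}"
      using V(2) inj openin_subset[OF oW] by (auto simp: inv_into_f_f subset_iff)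
  qed
  ultimately show ?thesis by simp
qed

text \<open>By the chain rule, the derivative of the inverse map is a left inverse.\<close>

lemma biholomorphism_fd_inj:
  assumes f: "biholomorphism_on M A W f" and c: "c \<in> A" "q \<in> chart_dom c" and d: "d \<in> A" "f q \<in> chart_dom d" and q: "q \<in> W"
    and v: "fd (coord d \<circ> f \<circ> chart_inv c) (coord c q) v = 0"
  shows "v = 0"
proof -
  have oW: "openin M W" and inj: "inj_on f W" and hf: "holomorphic_map_on M A W f" and hi: "holomorphic_map_on M A (f ` W) (inv_into W f)"
    using f by (simp_all add: biholomorphism_on_def)
  let ?k = "coord c \<circ> inv_into W f \<circ> chart_inv d" and ?F = "coord d \<circ> f \<circ> chart_inv c"
  have hF: "vector_holomorphic_on ?F (coord c ` {p \<in> W \<inter> chart_dom c. f p \<in> chart_dom d})"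
    using hf c d unfolding holomorphic_map_on_def by blast
  have DF: "(?F has_derivative fd ?F (coord c q)) (at (coord c q))"
    by (rule vector_holD(1)[OF hF]) (use q c d in blast)
  have Fq: "?F (coord c q) = coord d (f q)" using c by simp
  have hk: "vector_holomorphic_on ?k (coord d ` {p \<in> f ` W \<inter> chart_dom d. inv_into W f p \<in> chart_dom c})"
    using hi c d unfolding holomorphic_map_on_def by blast
  have Dk: "(?k has_derivative fd ?k (coord d (f q))) (at (?F (coord c q)))"
    unfolding Fq
    by (rule vector_holD(1)[OF hk], intro imageI CollectI conjI IntI) (simp_all add: q c d inj inv_into_f_f)
  have o: "open (coord c ` {p \<in> W \<inter> chart_dom c. f p \<in> chart_dom d})"
  proof -
    have "continuous_map (subtopology M W) M f" using hf by (simp add: holomorphic_map_on_def)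
    from openin_continuous_map_preimage[OF this dom_open[OF d(1)]]
    have "openin M {p \<in> topspace (subtopology M W). f p \<in> chart_dom d}" using oW openin_open_subtopology by blast
    from img_open[OF c(1) this]
    have "open (img c {p \<in> topspace (subtopology M W). f p \<in> chart_dom d})" .
    moreover have "{p \<in> W \<inter> chart_dom c. f p \<in> chart_dom d} = {p \<in> topspace (subtopology M W). f p \<in> chart_dom d} \<inter> chart_dom c"
      using openin_subset[OF oW] by auto
    ultimately show ?thesis by (simp only:)
  qed
  have "fd (\<lambda>x. ?k (?F x)) (coord c q) = fd (\<lambda>x. x) (coord c q)"
  proof (rule fd_cong_open[OF o])
    show "coord c q \<in> coord c ` {p \<in> W \<inter> chart_dom c. f p \<in> chart_dom d}" using q c d by blast
    fix x assume "x \<in> coord c ` {p \<in> W \<inter> chart_dom c. f p \<in> chart_dom d}"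
    then obtain p where "p \<in> W" "p \<in> chart_dom c" "f p \<in> chart_dom d" "x = coord c p" by blast
    then show "?k (?F x) = x" using c(1) d(1) inj by (simp add: inv_into_f_f)
  qed
  then have "(\<lambda>h. fd ?k (coord d (f q)) (fd ?F (coord c q) h)) = (\<lambda>h. h)"
    using frechet_derivative_at'[OF has_derivative_compose[OF DF Dk]] frechet_derivative_at'[OF has_derivative_ident] by (simp only:)
  from fun_cong[OF this, of v] v show ?thesis using linear_0[OF has_derivative_linear[OF Dk]] by simp
qed

text \<open>The orbit of \<open>p\<close> is the continuous image of a disc of times and contains
  \<open>p\<close>.\<close>

lemma flow_stays:
  assumes flow: "local_flow M A B \<epsilon> W \<Phi>" and t: "t \<in> ball 0 \<epsilon>" and p: "p \<in> W"
  shows "\<Phi> t p \<in> comp p"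
proof -
  have \<epsilon>: "\<epsilon> > 0" and W: "openin M W" and \<Phi>0: "\<Phi> 0 p = p"
    and cont: "continuous_map (prod_topology (top_of_set (ball 0 \<epsilon>)) (subtopology M W)) M (\<lambda>(t, p). \<Phi> t p)"
    using flow p by (simp_all add: local_flow_def)
  have "continuous_map (top_of_set (ball (0::complex) \<epsilon>)) (prod_topology (top_of_set (ball 0 \<epsilon>)) (subtopology M W)) (\<lambda>s. (s, p))"
    using p openin_subset[OF W] by (intro continuous_map_pairedI) (auto simp: continuous_map_const)
  from continuous_map_compose[OF this cont]
  have "continuous_map (top_of_set (ball (0::complex) \<epsilon>)) M (\<lambda>s. \<Phi> s p)" by (simp add: comp_def)
  then have "connectedin M ((\<lambda>s. \<Phi> s p) ` ball 0 \<epsilon>)"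
    by (rule connectedin_continuous_map_image) (simp add: connectedin_subtopology)
  moreover have "p \<in> (\<lambda>s. \<Phi> s p) ` ball 0 \<epsilon>" using \<Phi>0 \<epsilon> by (intro image_eqI[of _ _ 0]) auto
  ultimately have "connected_component_of M p (\<Phi> t p)" using t unfolding connected_component_of_def by blast
  then show ?thesis by simp
qed

text \<open>\<open>flow_pushforward\<close> works in one chart around the image points, but the
  orbit may pass through several. The statement \<open>P s\<close> speaks of all charts and is
  propagated from \<open>s = 0\<close> over the connected disc of times.\<close>

lemma flow_preserves_field:
  assumes B: "B \<in> HV (topspace M)" and Y: "Y \<in> HV (topspace M)" and comm: "lie_bracket A (topspace M) B Y = 0"
    and flow: "local_flow M A B \<epsilon> W \<Phi>" and p: "p \<in> W" and c: "c \<in> A" "p \<in> chart_dom c"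
    and t: "t \<in> ball 0 \<epsilon>" and d: "d \<in> A" "\<Phi> t p \<in> chart_dom d"
  shows "Y (\<Phi> t p) d = fd (coord d \<circ> \<Phi> t \<circ> chart_inv c) (coord c p) (Y p c)"
proof -
  have \<epsilon>: "\<epsilon> > 0" and W: "openin M W" and \<Phi>0: "\<And>p. p \<in> W \<Longrightarrow> \<Phi> 0 p = p"
    and cont: "continuous_map (prod_topology (top_of_set (ball 0 \<epsilon>)) (subtopology M W)) M (\<lambda>(t, p). \<Phi> t p)"
    and der: "\<And>t p c d. t \<in> ball 0 \<epsilon> \<Longrightarrow> p \<in> W \<Longrightarrow> c \<in> A \<Longrightarrow> d \<in> A \<Longrightarrow> p \<in> chart_dom c \<Longrightarrow> \<Phi> t p \<in> chart_dom d \<Longrightarrow>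
        \<exists>J::complex^'n^'n. ((\<lambda>(s, x). coord d (\<Phi> s (chart_inv c x))) has_derivative (\<lambda>(s, h). s *s B (\<Phi> t p) d + J *v h)) (at (t, coord c p))"
    using flow unfolding local_flow_def by blast+
  define x0 where "x0 = coord c p"
  define v where "v = Y p c"
  have stay: "\<Phi> s p \<in> topspace M" if "s \<in> ball 0 \<epsilon>" for s using flow_stays[OF flow that p] comp_topspace by blast
  have slice: "((\<lambda>x. coord d (\<Phi> s (chart_inv c x))) has_derivative fd (coord d \<circ> \<Phi> s \<circ> chart_inv c) x0) (at x0)"
    if sd: "s \<in> ball 0 \<epsilon>" "d \<in> A" "\<Phi> s p \<in> chart_dom d" for s d
  proof -
    obtain J :: "complex^'n^'n" where J: "((\<lambda>(s, x). coord d (\<Phi> s (chart_inv c x))) has_derivative (\<lambda>(u, h). u *s B (\<Phi> s p) d + J *v h)) (at (s, x0))"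
      using der[OF sd(1) p c(1) sd(2) c(2) sd(3), folded x0_def] by (rule exE) (rule that)
    have "((\<lambda>x. (s, x)) has_derivative (\<lambda>h. (0, h))) (at x0)" by (auto intro!: derivative_eq_intros)
    from has_derivative_compose[OF this J]
    have H: "((\<lambda>x. coord d (\<Phi> s (chart_inv c x))) has_derivative (\<lambda>h. J *v h)) (at x0)" by simp
    have "coord d \<circ> \<Phi> s \<circ> chart_inv c = (\<lambda>x. coord d (\<Phi> s (chart_inv c x)))" by (simp add: fun_eq_iff)
    then show ?thesis using H frechet_derivative_at'[OF H] by simp
  qed
  define P where "P s \<longleftrightarrow> (\<forall>d\<in>A. \<Phi> s p \<in> chart_dom d \<longrightarrow> Y (\<Phi> s p) d = fd (coord d \<circ> \<Phi> s \<circ> chart_inv c) x0 v)" for s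
  \<comment> \<open>One chart around the image point suffices, since both sides transform by the
    derivative of the transition map.\<close>
  have change: "P s" if s: "s \<in> ball 0 \<epsilon>" and d: "d \<in> A" "\<Phi> s p \<in> chart_dom d" and eq: "Y (\<Phi> s p) d = fd (coord d \<circ> \<Phi> s \<circ> chart_inv c) x0 v" for s d
    unfolding P_def
  proof (intro ballI impI)
    fix e assume e: "e \<in> A" "\<Phi> s p \<in> chart_dom e"
    have x0: "chart_inv c x0 = p" unfolding x0_def using c by simp
    have "(transition d e has_derivative fd (transition d e) (coord d (\<Phi> s p))) (at (coord d (\<Phi> s (chart_inv c x0))))"
      unfolding x0 by (rule vector_holD(1)[OF transition_hol[OF d(1) e(1)]]) (use d e in blast)
    from has_derivative_compose[OF slice[OF s d] this]
    have 1: "fd (\<lambda>x. transition d e (coord d (\<Phi> s (chart_inv c x)))) x0 = (\<lambda>h. fd (transition d e) (coord d (\<Phi> s p)) (fd (coord d \<circ> \<Phi> s \<circ> chart_inv c) x0 h))"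
      by (rule frechet_derivative_at')
    have 2: "fd (coord e \<circ> \<Phi> s \<circ> chart_inv c) x0 = fd (\<lambda>x. transition d e (coord d (\<Phi> s (chart_inv c x)))) x0"
    proof -
      have "continuous_map (subtopology M W) (prod_topology (top_of_set (ball 0 \<epsilon>)) (subtopology M W)) (\<lambda>p. (s, p))"
        using s by (intro continuous_map_pairedI) (auto simp: continuous_map_const)
      from continuous_map_compose[OF this cont]
      have "continuous_map (subtopology M W) M (\<Phi> s)" by (simp add: comp_def)
      from openin_continuous_map_preimage[OF this dom_open[OF d(1)]]
      have o: "openin M {q \<in> topspace (subtopology M W). \<Phi> s q \<in> chart_dom d}" using W openin_open_subtopology by blast
      show ?thesis
      proof (rule fd_cong_open[OF img_open[OF c(1) o]])
        show "x0 \<in> img c {q \<in> topspace (subtopology M W). \<Phi> s q \<in> chart_dom d}"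
          using p c d openin_subset[OF W] unfolding x0_def by auto
        fix x assume "x \<in> img c {q \<in> topspace (subtopology M W). \<Phi> s q \<in> chart_dom d}"
        then obtain q where "\<Phi> s q \<in> chart_dom d" "q \<in> chart_dom c" "x = coord c q" by blast
        then show "(coord e \<circ> \<Phi> s \<circ> chart_inv c) x = transition d e (coord d (\<Phi> s (chart_inv c x)))"
          using c(1) d(1) by (simp add: transition_coord)
      qed
    qed
    have "Y (\<Phi> s p) e = fd (transition d e) (coord d (\<Phi> s p)) (Y (\<Phi> s p) d)"
      by (rule tangentD[OF HV_tangent[OF Y stay[OF s]] d(1) e(1) d(2) e(2)])
    then show "Y (\<Phi> s p) e = fd (coord e \<circ> \<Phi> s \<circ> chart_inv c) x0 v" by (simp add: 2 1 eq)
  qed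
  have "P t"
  proof (rule connected_induction_simple[where S="ball (0::complex) \<epsilon>" and P=P and a=0 and b=t])
    show "P 0"
    proof (rule change[OF _ c(1)])
      have "fd (coord c \<circ> \<Phi> 0 \<circ> chart_inv c) x0 = fd (transition c c) x0"
        by (rule fd_cong_open[OF img_open[OF c(1) W]]) (use p c \<Phi>0 in \<open>auto simp: x0_def transition_def\<close>)
      then show "Y (\<Phi> 0 p) c = fd (coord c \<circ> \<Phi> 0 \<circ> chart_inv c) x0 v"
        unfolding x0_def v_def by (simp add: transition_self[OF c] \<Phi>0[OF p])
    qed (use \<epsilon> c \<Phi>0[OF p] in auto)
    fix s0 :: complex assume s0: "s0 \<in> ball 0 \<epsilon>"
    obtain d where d: "d \<in> A" "\<Phi> s0 p \<in> chart_dom d" using chart_cover[OF stay[OF s0]] by blast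
    \<comment> \<open>A complex line of initial points through \<open>p\<close> with velocity
      \<open>v\<close>; with the time as first variable it makes \<open>f\<close> a function of two
      complex variables.\<close>
    define k where "k y = x0 + y $ 2 *s v" for y :: "complex^2"
    define D0 where "D0 = {y. y $ 1 \<in> ball 0 \<epsilon> \<and> k y \<in> img c W}"
    define D where "D = {y \<in> D0. \<Phi> (y $ 1) (chart_inv c (k y)) \<in> chart_dom d}"
    define f where "f y = coord d (\<Phi> (y $ 1) (chart_inv c (k y)))" for y
    have dk: "(k has_derivative (\<lambda>h. h $ 2 *s v)) (at y)" for y
    proof -
      have "((\<lambda>y. y $ 2 *s v) has_derivative (\<lambda>h. h $ 2 *s v)) (at y)"
        by (rule bounded_linear.has_derivative[OF bounded_linear_smult_left bounded_linear.has_derivative[OF bounded_linear_vec_nth has_derivative_ident]])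
      then show ?thesis unfolding k_def using has_derivative_add[OF has_derivative_const[of x0]] by fastforce
    qed
    have ck: "continuous_on UNIV k" by (rule has_derivative_continuous_on[OF has_derivative_at_withinI[OF dk]])
    have oD0: "open D0"
    proof -
      have "D0 = (\<lambda>y. y $ 1) -` ball 0 \<epsilon> \<inter> k -` img c W" unfolding D0_def by auto
      then show ?thesis
        using open_vimage[OF open_ball continuous_on_component[OF continuous_on_id]] open_vimage[OF img_open[OF c(1) W] ck] by (auto intro: open_Int)
    qed
    have cD0: "continuous_map (top_of_set D0) M (\<lambda>y. \<Phi> (y $ 1) (chart_inv c (k y)))"
    proof -
      have "continuous_map (top_of_set D0) (top_of_set (coord c ` chart_dom c)) k"
        using continuous_on_subset[OF ck] unfolding D0_def by (auto simp: continuous_map_in_subtopology)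
      from continuous_map_compose[OF this chart_inv_continuous[OF c(1)]]
      have "continuous_map (top_of_set D0) M (\<lambda>y. chart_inv c (k y))" by (simp add: comp_def)
      moreover have "chart_inv c (k y) \<in> W" if "y \<in> D0" for y
        using that img_iff[OF c(1), of "k y" W] unfolding D0_def by blast
      ultimately have "continuous_map (top_of_set D0) (subtopology M W) (\<lambda>y. chart_inv c (k y))"
        by (auto simp: continuous_map_in_subtopology)
      moreover have "continuous_map (top_of_set D0) (top_of_set (ball 0 \<epsilon>)) (\<lambda>y. y $ 1)"
        unfolding D0_def by (auto simp: continuous_map_in_subtopology intro!: continuous_on_component continuous_on_id)
      ultimately have "continuous_map (top_of_set D0) (prod_topology (top_of_set (ball 0 \<epsilon>)) (subtopology M W)) (\<lambda>y. (y $ 1, chart_inv c (k y)))"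
        by (intro continuous_map_pairedI)
      from continuous_map_compose[OF this cont] show ?thesis by (simp add: comp_def)
    qed
    have oD: "open D"
    proof -
      have "openin (top_of_set D0) {y \<in> topspace (top_of_set D0). \<Phi> (y $ 1) (chart_inv c (k y)) \<in> chart_dom d}"
        by (rule openin_continuous_map_preimage[OF cD0 dom_open[OF d(1)]])
      moreover have "{y \<in> topspace (top_of_set D0). \<Phi> (y $ 1) (chart_inv c (k y)) \<in> chart_dom d} = D" unfolding D_def by simp
      ultimately show ?thesis using openin_open_eq[OF oD0] by simp
    qed
    \<comment> \<open>\<open>local_flow\<close> provides at each point a derivative with some
      Jacobian \<open>J\<close>. Its complex linearity makes \<open>f\<close> holomorphic; the
      second partial derivative is needed only on the orbit of \<open>p\<close>, where
      \<open>k y = x0\<close>.\<close>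
    have fder: "(f has_derivative fd f y) (at y) \<and> clin (fd f y) \<and> fd f y (axis 1 1) = B (\<Phi> (y $ 1) (chart_inv c (k y))) d \<and>
       (k y = x0 \<longrightarrow> fd f y (axis 2 1) = fd (coord d \<circ> \<Phi> (y $ 1) \<circ> chart_inv c) x0 v)" if y: "y \<in> D" for y
    proof -
      define q where "q = chart_inv c (k y)"
      have q: "q \<in> W" "q \<in> chart_dom c" "coord c q = k y" and y1: "y $ 1 \<in> ball 0 \<epsilon>" and qd: "\<Phi> (y $ 1) q \<in> chart_dom d"
        using y img_iff[OF c(1), of "k y" W] chart_inv_dom[of "k y" c] coord_chart_inv[of "k y" c] unfolding D_def D0_def q_def by blast+
      obtain J :: "complex^'n^'n" where J: "((\<lambda>(s, x). coord d (\<Phi> s (chart_inv c x))) has_derivative (\<lambda>(s, h). s *s B (\<Phi> (y $ 1) q) d + J *v h)) (at (y $ 1, k y))"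
        using der[OF y1 q(1) c(1) d(1) q(2) qd, unfolded q(3)] by (rule exE) (rule that)
      have "((\<lambda>y. (y $ 1, k y)) has_derivative (\<lambda>h. (h $ 1, h $ 2 *s v))) (at y)"
        by (intro has_derivative_Pair dk bounded_linear.has_derivative[OF bounded_linear_vec_nth has_derivative_ident])
      from has_derivative_compose[OF this J]
      have H: "(f has_derivative (\<lambda>h. h $ 1 *s B (\<Phi> (y $ 1) q) d + J *v (h $ 2 *s v))) (at y)" unfolding f_def by simp
      note E = frechet_derivative_at'[OF H]
      have "fd (coord d \<circ> \<Phi> (y $ 1) \<circ> chart_inv c) x0 v = J *v v" if k0: "k y = x0"
      proof -
        have "((\<lambda>x. (y $ 1, x)) has_derivative (\<lambda>h. (0, h))) (at x0)" by (auto intro!: derivative_eq_intros)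
        from has_derivative_compose[OF this J[unfolded k0]]
        have "((\<lambda>x. coord d (\<Phi> (y $ 1) (chart_inv c x))) has_derivative (\<lambda>h. J *v h)) (at x0)" by simp
        from frechet_derivative_at'[OF this] show ?thesis by (simp add: comp_def)
      qed
      moreover have "clin (\<lambda>h. h $ 1 *s B (\<Phi> (y $ 1) q) d + J *v (h $ 2 *s v))"
        by (rule clinI) (simp_all add: matrix_vector_right_distrib vector_scalar_commute algebra_simps vec.scale_right_distrib)
      ultimately show ?thesis using H unfolding E by (simp add: axis_def q_def)
    qed
    have fh: "vector_holomorphic_on f D"
      by (rule vector_holI) (use fder clin_scale in blast)
    define Q where "Q = coord d ` chart_dom d"
    have TS: "topspace M \<inter> chart_dom d = chart_dom d" using dom_subset[OF d(1)] by blast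
    have fQ: "f y \<in> Q" if "y \<in> D" for y using that unfolding f_def D_def Q_def by blast
    have flowB: "fd f y (axis 1 1) = local_rep d B (f y)" if "y \<in> D" for y
      using fder[OF that] that d(1) unfolding f_def[of y] D_def by simp
    have commQ: "fd (local_rep d Y) x (local_rep d B x) = fd (local_rep d B) x (local_rep d Y x)" if x: "x \<in> Q" for x
    proof -
      obtain q where q: "q \<in> chart_dom d" "x = coord d q" using x unfolding Q_def by blast
      have "q \<in> topspace M" using q dom_subset[OF d(1)] by blast
      moreover have "lie_bracket A (topspace M) B Y q d = 0" by (simp add: comm)
      ultimately show ?thesis using q d(1) by (simp add: lie_bracket_def)
    qed
    have kx: "k (s *s axis 1 1) = x0" and k1: "(s *s axis 1 1 :: complex^2) $ 1 = s" for s by (simp_all add: k_def axis_def)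
    have x0: "chart_inv c x0 = p" "x0 \<in> img c W" unfolding x0_def using c p by auto
    have "open ((\<lambda>s. s *s (axis 1 1 :: complex^2)) -` D)"
      by (rule open_vimage[OF oD]) (rule linear_continuous_on[OF bounded_linear_smult_left])
    moreover have "s0 *s axis 1 1 \<in> D" using s0 d x0 unfolding D_def D0_def mem_Collect_eq kx k1 by simp
    ultimately obtain r where r: "r > 0" "ball s0 r \<subseteq> (\<lambda>s. s *s (axis 1 1 :: complex^2)) -` D"
      using open_contains_ball by (metis vimageI)
    have rD: "s *s axis 1 1 \<in> D" if "s \<in> ball s0 r" for s using r(2) that by blast
    have val: "f (s *s axis 1 1) = coord d (\<Phi> s p)" for s unfolding f_def kx k1 x0 ..
    have in\<epsilon>: "s \<in> ball 0 \<epsilon>" "\<Phi> s p \<in> chart_dom d" if "s \<in> ball s0 r" for s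
      using rD[OF that] unfolding D_def D0_def mem_Collect_eq kx k1 x0 by blast+
    have push: "fd f (s *s axis 1 1) (axis 2 1) = fd (coord d \<circ> \<Phi> s \<circ> chart_inv c) x0 v" if "s \<in> ball s0 r" for s
      using fder[OF rD[OF that]] unfolding kx k1 by blast
    have step: "P s2" if s1: "s1 \<in> ball s0 r" and s2: "s2 \<in> ball s0 r" and P1: "P s1" for s1 s2
    proof -
      have "fd f (s1 *s axis 1 1 + (s2 - s1) *s axis 1 1) (axis 2 1) = local_rep d Y (f (s1 *s axis 1 1 + (s2 - s1) *s axis 1 1))"
      proof (rule flow_pushforward[OF oD fh _ fQ _ _ flowB commQ])
        show "open Q" unfolding Q_def by (rule chart_image_open[OF d(1)])
        show "vector_holomorphic_on (local_rep d B) Q" "vector_holomorphic_on (local_rep d Y) Q"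
          unfolding Q_def using HV_hol[OF B d(1)] HV_hol[OF Y d(1)] by (simp_all only: TS)
        show "s1 *s axis 1 1 + (of_real u * (s2 - s1)) *s axis 1 1 \<in> D" if u: "u \<in> {0..1}" for u
        proof -
          have "(1 - u) *\<^sub>R s1 + u *\<^sub>R s2 \<in> ball s0 r"
            using convexD_alt[OF convex_ball s1 s2, of u] u by simp
          moreover have "(1 - u) *\<^sub>R s1 + u *\<^sub>R s2 = s1 + of_real u * (s2 - s1)" by (simp add: scaleR_conv_of_real algebra_simps)
          ultimately have "(s1 + of_real u * (s2 - s1)) *s axis 1 1 \<in> D" using rD by metis
          then show ?thesis by (simp only: vec.scale_left_distrib)
        qed
        show "fd f (s1 *s axis 1 1) (axis 2 1) = local_rep d Y (f (s1 *s axis 1 1))"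
          using P1 in\<epsilon>[OF s1] d(1) unfolding push[OF s1] val P_def by simp
      qed
      then have "fd f (s2 *s axis 1 1) (axis 2 1) = local_rep d Y (f (s2 *s axis 1 1))"
        by (simp only: vec.scale_left_distrib[symmetric] add_diff_cancel_left' diff_add_cancel add.commute[of s1])
      then have "Y (\<Phi> s2 p) d = fd (coord d \<circ> \<Phi> s2 \<circ> chart_inv c) x0 v"
        unfolding push[OF s2] val using in\<epsilon>[OF s2] d(1) by simp
      then show "P s2" by (rule change[OF in\<epsilon>(1)[OF s2] d(1) in\<epsilon>(2)[OF s2]])
    qed
    have o: "openin (top_of_set (ball 0 \<epsilon>)) (ball s0 r)" using in\<epsilon>(1) by (intro open_subset open_ball) blast
    show "\<exists>T. openin (top_of_set (ball 0 \<epsilon>)) T \<and> s0 \<in> T \<and> (\<forall>x\<in>T. \<forall>y\<in>T. P x \<longrightarrow> P y)"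
    proof (intro exI conjI ballI impI)
      show "s0 \<in> ball s0 r" using r(1) by simp
    qed (rule o, rule step)
  qed (use \<epsilon> t in auto)
  then show ?thesis using d unfolding P_def x0_def v_def by blast
qed

end

context component_frames
begin

text \<open>The flow map preserves the frame of each component by
  \<open>flow_preserves_field\<close> and moves no point out of its component by
  \<open>flow_stays\<close>, so \<open>conn_related\<close> applies.\<close>

lemma conn_preserved:
  assumes B: "B \<in> HV (topspace M)" and comm: "\<And>p j. p \<in> topspace M \<Longrightarrow> lie_bracket A (topspace M) B (X (comp p) j) = 0"
    and flow: "local_flow M A B \<epsilon> W \<Phi>" and t: "t \<in> ball 0 \<epsilon>" and bih: "biholomorphism_on M A W (\<Phi> t)"
  shows "local_automorphism M A conn W (\<Phi> t)"
  unfolding local_automorphism_def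
proof (intro conjI allI impI ballI bih)
  fix V Y Z Y' Z' assume V: "openin M V \<and> V \<subseteq> W" and Y: "Y \<in> HV V" and Z: "Z \<in> HV V" and Y': "Y' \<in> HV (\<Phi> t ` V)" and Z': "Z' \<in> HV (\<Phi> t ` V)"
    and rel: "related_on A (\<Phi> t) V Y Y' \<and> related_on A (\<Phi> t) V Z Z'"
  have oV: "openin M V" and VW: "V \<subseteq> W" using V by auto
  have ht: "holomorphic_map_on M A W (\<Phi> t)" using bih by (simp add: biholomorphism_on_def)
  have Wt: "W \<subseteq> topspace M" using flow openin_subset by (auto simp: local_flow_def)
  show "related_on A (\<Phi> t) V (conn V Y Z) (conn (\<Phi> t ` V) Y' Z')"
    unfolding related_on_def
  proof (intro ballI impI)
    fix p c d assume p: "p \<in> V" and A: "c \<in> A" "d \<in> A" and dom: "p \<in> chart_dom c \<and> \<Phi> t p \<in> chart_dom d"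
    show "conn (\<Phi> t ` V) Y' Z' (\<Phi> t p) d = fd (coord d \<circ> \<Phi> t \<circ> chart_inv c) (coord c p) (conn V Y Z p c)"
    proof (rule conn_related[where f="\<Phi> t", OF oV openin_subset[OF oV] biholomorphism_image_open[OF bih oV VW] p A(1) conjunct1[OF dom] A(2) conjunct2[OF dom]])
      show "\<Phi> t q \<in> \<Phi> t ` V" "\<Phi> t q \<in> comp q" if "q \<in> V" for q
        using that flow_stays[OF flow t, of q] VW by blast+
      show "continuous_map (subtopology M V) M (\<Phi> t)"
        using ht continuous_map_from_subtopology_mono[OF _ VW] by (auto simp: holomorphic_map_on_def)
      have "vector_holomorphic_on (coord d \<circ> \<Phi> t \<circ> chart_inv c) (coord c ` {q \<in> W \<inter> chart_dom c. \<Phi> t q \<in> chart_dom d})"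
        using ht A unfolding holomorphic_map_on_def by blast
      then show "vector_holomorphic_on (coord d \<circ> \<Phi> t \<circ> chart_inv c) (coord c ` {q \<in> V \<inter> chart_dom c. \<Phi> t q \<in> chart_dom d})"
        by (rule vector_hol_subset) (use VW in blast)
      fix q assume q: "q \<in> V" "q \<in> chart_dom c" "\<Phi> t q \<in> chart_dom d"
      have qW: "q \<in> W" using q VW by blast
      have qt: "q \<in> topspace M" using qW Wt by blast
      show "v = 0" if "fd (coord d \<circ> \<Phi> t \<circ> chart_inv c) (coord c q) v = 0" for v
        by (rule biholomorphism_fd_inj[OF bih A(1) q(2) A(2) q(3) qW that])
      show "X (comp q) j (\<Phi> t q) d = fd (coord d \<circ> \<Phi> t \<circ> chart_inv c) (coord c q) (X (comp q) j q c)" for j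
        by (rule flow_preserves_field[OF B X[OF qt] comm[OF qt] flow qW A(1) q(2) t A(2) q(3)])
      show "Y' (\<Phi> t q) d = fd (coord d \<circ> \<Phi> t \<circ> chart_inv c) (coord c q) (Y q c)"
        "Z' (\<Phi> t q) d = fd (coord d \<circ> \<Phi> t \<circ> chart_inv c) (coord c q) (Z q c)"
        using rel q A unfolding related_on_def by blast+
    qed (fact Y Y' Z Z')+
  qed
qed

end

theorem theorem2:
  fixes M :: "'a topology"
    and A :: "('a, 'n::finite) chart set"
    and smul :: "complex \<Rightarrow> 'g::ab_group_add \<Rightarrow> 'g"
    and bracket :: "'g \<Rightarrow> 'g \<Rightarrow> 'g"
    and \<rho> :: "'g \<Rightarrow> ('a, 'n) vfield"
    and N :: "('a, 'n) connection"
  assumes "complex_manifold M A"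
    and "abelian_complex_lie_algebra smul bracket"
    and "holomorphic_action M A smul bracket \<rho>"
    and "dense_open_orbit M A \<rho>"
    and "holomorphic_connection M A N"
    and "preserves_connection M A \<rho> N"
  shows "\<exists>N'. holomorphic_connection M A N' \<and> flat_connection M A N' \<and> torsion_free M A N' \<and>
              preserves_connection M A \<rho> N'"
proof -
  interpret cmanifold M A by unfold_locales (rule assms(1))
  define P where "P C X \<mu> \<Gamma> \<longleftrightarrow> (\<forall>j. X j \<in> HV (topspace M)) \<and> (\<forall>a j. lie_bracket A (topspace M) (\<rho> a) (X j) = 0) \<and>
    (\<forall>c\<in>A. chart_frame (frame X c) (\<Gamma> c) (img c C) \<mu>) \<and> (\<forall>a b v. \<mu> a (\<mu> b v) = \<mu> b (\<mu> a v))"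
    for C and X :: "'n \<Rightarrow> ('a, 'n) vfield" and \<mu> :: "complex^'n \<Rightarrow> complex^'n \<Rightarrow> complex^'n" and \<Gamma>
  \<comment> \<open>The choice depends on the component only, not on a point in it, as
    \<open>component_frames\<close> requires.\<close>
  define D where "D C = (SOME D. P C (fst D) (fst (snd D)) (snd (snd D)))" for C
  have PD: "P (comp p) (fst (D (comp p))) (fst (snd (D (comp p)))) (snd (snd (D (comp p))))" if p: "p \<in> topspace M" for p
    unfolding D_def
  proof (rule someI_ex[where P="\<lambda>D. P (comp p) (fst D) (fst (snd D)) (snd (snd D))"])
    obtain X \<mu> \<Gamma> where 1: "\<And>j. X j \<in> HV (topspace M)" and 2: "\<And>a j. lie_bracket A (topspace M) (\<rho> a) (X j) = 0"
      and 3: "\<And>c. c \<in> A \<Longrightarrow> chart_frame (frame X c) (\<Gamma> c) (img c (comp p)) \<mu>" and 4: "\<And>a b v. \<mu> a (\<mu> b v) = \<mu> b (\<mu> a v)"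
      by (rule orbit_structure[OF assms(2-6) p]) (rule that)
    have "P (comp p) X \<mu> \<Gamma>" unfolding P_def by (intro conjI allI ballI 1 2 3 4)
    then show "\<exists>D. P (comp p) (fst D) (fst (snd D)) (snd (snd D))" by (intro exI[of _ "(X, \<mu>, \<Gamma>)"]) simp
  qed
  interpret component_frames M A "\<lambda>C. fst (D C)" "\<lambda>C. fst (snd (D C))" "\<lambda>C. snd (snd (D C))"
  proof (rule component_frames.intro[OF cmanifold_axioms component_frames_axioms.intro])
    fix p assume p: "p \<in> topspace M"
    note F = PD[OF p, unfolded P_def]
    show "fst (D (comp p)) j \<in> HV (topspace M)" for j using F by blast
    show "chart_frame (frame (fst (D (comp p))) c) (snd (snd (D (comp p))) c) (img c (comp p)) (fst (snd (D (comp p))))" if "c \<in> A" for c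
      by (rule F[THEN conjunct2, THEN conjunct2, THEN conjunct1, rule_format, OF that])
    show "fst (snd (D (comp p))) a (fst (snd (D (comp p))) b v) = fst (snd (D (comp p))) b (fst (snd (D (comp p))) a v)" for a b v
      by (rule F[THEN conjunct2, THEN conjunct2, THEN conjunct2, rule_format])
  qed
  have "preserves_connection M A \<rho> conn"
    unfolding preserves_connection_def
  proof (intro allI impI ballI)
    fix a \<epsilon> W \<Phi> t assume flow: "local_flow M A (\<rho> a) \<epsilon> W \<Phi>" and t: "t \<in> ball (0::complex) \<epsilon>"
    show "local_automorphism M A conn W (\<Phi> t)"
    proof (rule conn_preserved[OF _ _ flow t])
      show "\<rho> a \<in> HV (topspace M)" using assms(3) by (simp add: holomorphic_action_def)
      show "lie_bracket A (topspace M) (\<rho> a) (fst (D (comp p)) j) = 0" if "p \<in> topspace M" for p j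
        by (rule PD[OF that, unfolded P_def, THEN conjunct2, THEN conjunct1, rule_format])
      \<comment> \<open>The invariance of \<open>N\<close> includes that the flow maps are
        biholomorphic onto open images.\<close>
      have "local_automorphism M A N W (\<Phi> t)"
        by (rule assms(6)[unfolded preserves_connection_def, rule_format, OF flow t])
      then show "biholomorphism_on M A W (\<Phi> t)" by (simp add: local_automorphism_def)
    qed
  qed
  then show ?thesis using conn_hol conn_flat conn_torsion_free by (intro exI conjI)
qed

end
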